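(* Let $\lambda\in\mathbb R$, $s>d/2+4$, and consider for $\varepsilon>0$ the Klein-Gordon Cauchy problem $$\varepsilon^2\partial_{tt}u-\Delta u+\frac1{\varepsilon^2}u=\lambda u^2,\quad t\ge0,\ x\in\mathbb R^d,\qquad u(0)=u_{0,\varepsilon},\quad(\partial_tu)(0)=\frac1{\varepsilon^2}u_{1,\varepsilon}.$$ Assume that the real initial datum has the form $u_{0,\varepsilon}=\varphi_0+\varepsilon\varphi_\varepsilon$, $u_{1,\varepsilon}=\psi_0+\varepsilon\psi_\varepsilon$, where $(\varphi_0,\psi_0)\in(H^s)^2$ is independent of $\varepsilon$ and $\{(\varphi_\varepsilon,\psi_\varepsilon,\varepsilon\nabla\varphi_\varepsilon)\}_{0<\varepsilon<1}$ is uniformly bounded in $(H^{s-4})^{d+2}$. Then there exists $\varepsilon_0>0$ such that for any $0<\varepsilon<\varepsilon_0$ this Cauchy problem admits a unique solution $u\in L^\infty(0,\frac T\varepsilon;H^{s-4})$ for some $T>0$ independent of $\varepsilon$. Moreover, there exists a constant $C$ independent of $\varepsilon$ such that $$\Big\|u-\big(e^{-it/\varepsilon^2}v+e^{it/\varepsilon^2}\bar v\big)\Big\|_{L^\infty(0,\frac T\varepsilon;H^{s-4})}\le C\varepsilon,$$ where $v\in C_b(0,\infty;H^s)\cap C_b^1(0,\infty;H^{s-2})$ is the solution of the linear Schr\"odinger Cauchy problem $$2i\,v_t+\Delta v=0,\qquad v(0)=\frac{\varphi_0+i\psi_0}{2}.$$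
   Context: $H^s=H^s(\mathbb R^d)$ is the usual Sobolev space. The unknown $u=u(t,x)$ is real-valued, and $\bar v$ is the complex conjugate of $v$. $C_b$ and $C_b^1$ denote bounded continuous functions of time, respectively $C^1$ functions of time bounded together with their first time derivative. *)

theory Defs
  imports "HOL-Analysis.Analysis"
begin

text \<open>Functions on space are representatives of almost-everywhere classes with respect to
  \<^const>\<open>lborel\<close>; each class of Lebesgue measurable functions has a Borel representative.\<close>

definition partial :: "'a::euclidean_space \<Rightarrow> ('a \<Rightarrow> real) \<Rightarrow> 'a \<Rightarrow> real" where
  "partial b f = (\<lambda>x. frechet_derivative f (at x) b)"

primrec C_k :: "nat \<Rightarrow> ('a::euclidean_space \<Rightarrow> real) \<Rightarrow> bool" where
  "C_k 0 f \<longleftrightarrow> continuous_on UNIV f"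
| "C_k (Suc k) f \<longleftrightarrow> (\<forall>x. f differentiable (at x)) \<and> (\<forall>b\<in>Basis. C_k k (partial b f))"

definition test_functions :: "'a::euclidean_space set \<Rightarrow> ('a \<Rightarrow> real) set" where
  "test_functions \<Omega> =
     {\<eta>. (\<forall>k. C_k k \<eta>) \<and> compact (closure {x. \<eta> x \<noteq> 0}) \<and> closure {x. \<eta> x \<noteq> 0} \<subseteq> \<Omega>}"

definition laplacian :: "('a::euclidean_space \<Rightarrow> real) \<Rightarrow> 'a \<Rightarrow> real" where
  "laplacian \<eta> x = (\<Sum>b\<in>Basis. partial b (partial b \<eta>) x)"

definition locally_integrable ::
    "('a::euclidean_space \<Rightarrow> 'b::{banach, second_countable_topology}) \<Rightarrow> bool" where
  "locally_integrable f \<longleftrightarrow>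
     f \<in> borel_measurable lborel \<and> (\<forall>K. compact K \<longrightarrow> set_integrable lborel K f)"

definition weak_partial :: "'a::euclidean_space
    \<Rightarrow> ('a \<Rightarrow> 'b::{banach, second_countable_topology}) \<Rightarrow> ('a \<Rightarrow> 'b) \<Rightarrow> bool" where
  "weak_partial b f g \<longleftrightarrow> locally_integrable f \<and> locally_integrable g \<and>
     (\<forall>\<eta>\<in>test_functions UNIV.
        (LINT x|lborel. partial b \<eta> x *\<^sub>R f x) = - (LINT x|lborel. \<eta> x *\<^sub>R g x))"

definition weak_laplacian ::
    "('a::euclidean_space \<Rightarrow> 'b::{banach, second_countable_topology}) \<Rightarrow> ('a \<Rightarrow> 'b) \<Rightarrow> bool" where
  "weak_laplacian f g \<longleftrightarrow> locally_integrable f \<and> locally_integrable g \<and>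
     (\<forall>\<eta>\<in>test_functions UNIV.
        (LINT x|lborel. laplacian \<eta> x *\<^sub>R f x) = (LINT x|lborel. \<eta> x *\<^sub>R g x))"

definition L2 :: "('a::euclidean_space \<Rightarrow> complex) set" where
  "L2 = {f \<in> borel_measurable lborel. integrable lborel (\<lambda>x. (norm (f x))\<^sup>2)}"

definition fourier_integral :: "('a::euclidean_space \<Rightarrow> complex) \<Rightarrow> 'a \<Rightarrow> complex" where
  "fourier_integral f \<xi> =
     ((2 * pi) powr (- real DIM('a) / 2)) *\<^sub>R (LINT x|lborel. cis (- (x \<bullet> \<xi>)) * f x)"

text \<open>The Fourier--Plancherel transform of a square integrable \<open>f\<close>: the \<open>L\<^sup>2\<close> limit of the
  Fourier integrals of the truncations of \<open>f\<close>, which are integrable.\<close>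

definition is_fourier_transform ::
    "('a::euclidean_space \<Rightarrow> complex) \<Rightarrow> ('a \<Rightarrow> complex) \<Rightarrow> bool" where
  "is_fourier_transform f g \<longleftrightarrow> f \<in> L2 \<and> g \<in> L2 \<and>
     ((\<lambda>R::real. \<integral>\<^sup>+\<xi>. ennreal
        ((norm (g \<xi> - fourier_integral (\<lambda>x. indicator (cball 0 R) x *\<^sub>R f x) \<xi>))\<^sup>2) \<partial>lborel)
      \<longlongrightarrow> 0) at_top"

text \<open>For \<open>\<sigma> \<ge> 0\<close> this is \<open>H\<^sup>\<sigma>\<close>. For \<open>\<sigma> < 0\<close> it is not, as only square integrable
  functions are considered.\<close>

definition sobolev :: "real \<Rightarrow> ('a::euclidean_space \<Rightarrow> complex) set" where
  "sobolev \<sigma> = {f. \<exists>g. is_fourier_transform f g \<and>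
     integrable lborel (\<lambda>\<xi>. (1 + (norm \<xi>)\<^sup>2) powr \<sigma> * (norm (g \<xi>))\<^sup>2)}"

text \<open>The transform is unique up to null sets, so the choice of representative is immaterial;
  the value is meaningful only for elements of \<^term>\<open>sobolev \<sigma>\<close>.\<close>

definition sobolev_norm :: "real \<Rightarrow> ('a::euclidean_space \<Rightarrow> complex) \<Rightarrow> real" where
  "sobolev_norm \<sigma> f =
     sqrt (LINT \<xi>|lborel. (1 + (norm \<xi>)\<^sup>2) powr \<sigma> * (norm ((SOME g. is_fourier_transform f g) \<xi>))\<^sup>2)"

definition sobolev_le :: "real \<Rightarrow> ('a::euclidean_space \<Rightarrow> complex) \<Rightarrow> real \<Rightarrow> bool" where
  "sobolev_le \<sigma> f B \<longleftrightarrow> f \<in> sobolev \<sigma> \<and> sobolev_norm \<sigma> f \<le> B"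

text \<open>\<open>w\<close> belongs to \<open>L\<^sup>\<infinity>(0, T; H\<^sup>\<sigma>)\<close> and its norm there is at most \<open>B\<close>. As \<open>H\<^sup>\<sigma>\<close> is separable,
  joint measurability yields strong measurability of \<open>t \<mapsto> w(t)\<close>, and conversely every strongly
  measurable map has a jointly measurable representative.\<close>

definition Linf_sobolev_le ::
    "real \<Rightarrow> real \<Rightarrow> (real \<Rightarrow> 'a::euclidean_space \<Rightarrow> complex) \<Rightarrow> real \<Rightarrow> bool" where
  "Linf_sobolev_le T \<sigma> w B \<longleftrightarrow>
     set_borel_measurable lborel ({0<..<T} \<times> UNIV) (\<lambda>(t, x). w t x) \<and>
     (AE t in lborel. t \<in> {0<..<T} \<longrightarrow> sobolev_le \<sigma> (w t) B)"

definition Linf_sobolev ::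
    "real \<Rightarrow> real \<Rightarrow> (real \<Rightarrow> 'a::euclidean_space \<Rightarrow> complex) set" where
  "Linf_sobolev T \<sigma> = {w. \<exists>B. Linf_sobolev_le T \<sigma> w B}"

definition Cb_sobolev :: "real \<Rightarrow> (real \<Rightarrow> 'a::euclidean_space \<Rightarrow> complex) set" where
  "Cb_sobolev \<sigma> = {v. (\<exists>B. \<forall>t\<ge>0. sobolev_le \<sigma> (v t) B) \<and>
     (\<forall>t\<ge>0. ((\<lambda>\<tau>. sobolev_norm \<sigma> (\<lambda>x. v \<tau> x - v t x)) \<longlongrightarrow> 0) (at t within {0..}))}"

definition sobolev_time_derivative :: "real \<Rightarrow> (real \<Rightarrow> 'a::euclidean_space \<Rightarrow> complex)
    \<Rightarrow> (real \<Rightarrow> 'a \<Rightarrow> complex) \<Rightarrow> bool" where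
  "sobolev_time_derivative \<sigma> v w \<longleftrightarrow> (\<forall>t\<ge>0.
     ((\<lambda>\<tau>. sobolev_norm \<sigma> (\<lambda>x. (v \<tau> x - v t x) /\<^sub>R (\<tau> - t) - w t x)) \<longlongrightarrow> 0) (at t within {0..}))"

text \<open>Weak solutions on \<open>[0, T)\<close> of \<open>\<epsilon>\<^sup>2 u\<^sub>t\<^sub>t - \<Delta>u + u / \<epsilon>\<^sup>2 = \<lambda> u\<^sup>2\<close> with \<open>u(0) = a\<close> and
  \<open>u\<^sub>t(0) = b\<close>. The test functions need not vanish at \<open>t = 0\<close>; two integrations by parts in
  time produce the terms carrying the initial data.\<close>

definition klein_gordon_solution :: "real \<Rightarrow> real \<Rightarrow> real
    \<Rightarrow> ('a::euclidean_space \<Rightarrow> real) \<Rightarrow> ('a \<Rightarrow> real) \<Rightarrow> (real \<Rightarrow> 'a \<Rightarrow> real) \<Rightarrow> bool" where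
  "klein_gordon_solution lam \<epsilon> T a b u \<longleftrightarrow>
     (\<forall>\<Phi>\<in>test_functions ({..<T} \<times> (UNIV :: 'a set)).
        (LINT p:{0<..<T} \<times> UNIV|lborel.
            u (fst p) (snd p) *
              (\<epsilon>\<^sup>2 * partial (1, 0) (partial (1, 0) \<Phi>) p
               - laplacian (\<lambda>x. \<Phi> (fst p, x)) (snd p) + \<Phi> p / \<epsilon>\<^sup>2))
        + \<epsilon>\<^sup>2 * (LINT x|lborel. a x * partial (1, 0) \<Phi> (0, x))
        - \<epsilon>\<^sup>2 * (LINT x|lborel. b x * \<Phi> (0, x))
        = (LINT p:{0<..<T} \<times> UNIV|lborel. lam * (u (fst p) (snd p))\<^sup>2 * \<Phi> p))"

text \<open>\<open>v \<in> C\<^sub>b([0, \<infinity>); H\<^sup>s) \<inter> C\<^sub>b\<^sup>1([0, \<infinity>); H\<^sup>s\<^sup>-\<^sup>2)\<close> solves \<open>2 i v\<^sub>t + \<Delta>v = 0\<close> with \<open>v(0) = a\<close>.\<close>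

definition schroedinger_solution :: "real
    \<Rightarrow> ('a::euclidean_space \<Rightarrow> complex) \<Rightarrow> (real \<Rightarrow> 'a \<Rightarrow> complex) \<Rightarrow> bool" where
  "schroedinger_solution s a v \<longleftrightarrow> v \<in> Cb_sobolev s \<and> v \<in> Cb_sobolev (s - 2) \<and>
     (\<exists>w\<in>Cb_sobolev (s - 2). sobolev_time_derivative (s - 2) v w \<and>
        (\<forall>t\<ge>0. \<exists>L. weak_laplacian (v t) L \<and> (AE x in lborel. 2 * \<i> * w t x + L x = 0))) \<and>
     (AE x in lborel. v 0 x = a x)"

end

theory Submission
 imports Defs "HOL-Probability.Probability"
begin

text \<open>On the Fourier side the equation is the Duhamel formula
 \<open>U(t) = cos(\<Omega>t) P + sin(\<Omega>t)/\<omega> Q + \<mu> \<integral> sin(\<Omega>(t - \<tau>))/\<omega> (U * U)(\<tau>) d\<tau>\<close> with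
 \<open>\<omega> = (1 + \<epsilon>\<^sup>2|\<xi>|\<^sup>2)\<^sup>1\<^sup>/\<^sup>2\<close>, \<open>\<Omega> = \<omega>/\<epsilon>\<^sup>2\<close>, and the approximation has the phase \<open>1/\<epsilon>\<^sup>2 + |\<xi>|\<^sup>2/2\<close>.
 A quadratic interaction of phases close to \<open>\<plusminus>1/\<epsilon>\<^sup>2\<close> produces \<open>0\<close> or \<open>\<plusminus>2/\<epsilon>\<^sup>2\<close> and is never resonant, so
 each time integral gains \<open>\<epsilon>\<^sup>2\<close> and the first two Picard iterates of the approximation are \<open>O(\<epsilon>)\<close> on
 times \<open>O(1/\<epsilon>)\<close>. A contraction argument for the remainder, controlling also its interaction with the
 approximation, gives the solution and the error bound together. For uniqueness, testing the difference
 of a weak solution and its Duhamel formula with products of bumps shows that for almost every \<open>\<xi>\<close> it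
 solves the oscillator equation \<open>y'' + \<Omega>\<^sup>2 y = 0\<close> with zero data, hence vanishes; Gronwall's
 inequality concludes.\<close>

text \<open>Write the solution as \<open>app + r\<close>. The obstacle is the linear term
  \<open>2*mu*Bq ep app r\<close>: on times of order \<open>1/ep\<close> the plain estimate costs a
  factor \<open>T/ep\<close>, and \<open>r\<close> has no known phases, so nothing is gained from it
  directly. Hence \<open>Bq ep app r\<close> is carried as a second unknown. Inserting the equation
  of \<open>r\<close> into it produces double Duhamel integrals
  \<open>Bq ep app (Bq ep x y)\<close>; exchanging the two time integrals leaves, for arbitrary
  \<open>x\<close> and \<open>y\<close>, a kernel with the phases \<open>Om\<close>,
  \<open>th\<close>, \<open>Om\<close>, whose integral gains \<open>ep^2\<close>, so the total
  factor is \<open>T*ep\<close>. Beyond frequency \<open>1/ep\<close> the gain is bought with the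
  weight \<open>wgt 2\<close>, that is with four derivatives. They are always charged to
  \<open>app\<close>, which has order \<open>s\<close>; this is why \<open>r\<close> lives in order
  \<open>s - 4\<close>. Since \<open>s - 4 > d/2\<close>, transforms are absolutely integrable and
  the weighted \<open>L2\<close> space is a convolution algebra; the estimates stay on the Fourier
  side, and physical space enters through the weak formulation.\<close>

abbreviation nn_lborel (binder "NN " 60) where "nn_lborel f \<equiv> nn_integral lborel f"
abbreviation lint_lborel (binder "LL " 60) where "lint_lborel f \<equiv> integral\<^sup>L lborel f"
abbreviation ae_lborel (binder "AEL " 10) where "ae_lborel P \<equiv> almost_everywhere lborel P"
abbreviation "LI \<equiv> integrable lborel"
abbreviation "BM \<equiv> borel_measurable borel"
abbreviation "BM2 \<equiv> borel_measurable (borel \<Otimes>\<^sub>M borel)"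
abbreviation "cx \<equiv> complex_of_real"
abbreviation "ind \<equiv> indicator"
abbreviation "enm z \<equiv> ennreal (norm z)"
abbreviation "FI \<equiv> fourier_integral"
abbreviation "IFT \<equiv> is_fourier_transform"
abbreviation "dt \<equiv> partial (1, 0)"
abbreviation limseq (infixr "--->" 60) where "X ---> L \<equiv> filterlim X (nhds L) sequentially"
notation scaleR (infixr "*R" 75)
lemmas BI_int_add = Bochner_Integration.integrable_add
lemmas BI_int_bound = Bochner_Integration.integrable_bound
lemmas BI_int_diff = Bochner_Integration.integrable_diff
lemmas BI_int_sum = Bochner_Integration.integrable_sum
lemmas BI_LINT_add = Bochner_Integration.integral_add
lemmas BI_LINT_cnj = Bochner_Integration.integral_cnj
lemmas BI_LINT_cong = Bochner_Integration.integral_cong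
lemmas BI_LINT_diff = Bochner_Integration.integral_diff
lemmas BI_LINT_nonneg = Bochner_Integration.integral_nonneg
lemmas BI_LINT_sum = Bochner_Integration.integral_sum

section \<open>Translations, reflections and iterated integrals for Lebesgue measure\<close>

lemma distr_lborel_affine1:
 fixes a :: "'a::euclidean_space"
 assumes "c = 1 \<or> c = -1"
 shows "distr lborel borel (%x. a + c *R x) = lborel"
proof -
 have c: "c ~= 0" "\<bar>c\<bar> = 1" using assms by auto
 have "lborel = density (distr lborel borel (%x. a + c *R x)) (%_. ennreal (\<bar>c\<bar> ^ DIM('a)))"
  using lborel_affine[OF c(1), of a] .
 also have "... = distr lborel borel (%x. a + c *R x)"
  using c(2) by (simp add: density_1)
 finally show ?thesis by simp
qed

lemma nn_integral_lborel_shift: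
 fixes f :: "'a::euclidean_space => ennreal"
 assumes [measurable]: "f \<in> BM"
 shows "(NN x. f (x + a)) = (NN x. f x)"
proof -
 have "(NN x. f x) = (\<integral>\<^sup>+x. f x \<partial>distr lborel borel (%x. a + 1 *R x))"
  by (simp add: distr_lborel_affine1 del: scaleR_one)
 also have "... = (NN x. f (a + 1 *R x))"
  by (rule nn_integral_distr) simp_all
 finally show ?thesis by (simp add: add.commute)
qed

lemma nn_integral_lborel_reflect:
 fixes f :: "'a::euclidean_space => ennreal"
 assumes [measurable]: "f \<in> BM"
 shows "(NN x. f (a - x)) = (NN x. f x)"
proof -
 have "(NN x. f x) = (\<integral>\<^sup>+x. f x \<partial>distr lborel borel (%x. a + (-1) *R x))"
  by (subst distr_lborel_affine1) simp_all
 also have "... = (NN x. f (a + (-1) *R x))"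
  by (rule nn_integral_distr) simp_all
 finally show ?thesis by simp
qed

lemma lborel_shift:
 fixes f :: "'a::euclidean_space => 'b::{banach, second_countable_topology}"
 assumes [measurable]: "f \<in> BM"
 shows "(LL x. f (x + a)) = (LL x. f x)"
  and "LI (%x. f (x + a)) \<longleftrightarrow> LI f"
proof -
 have d: "distr lborel borel (%x. x + a) = lborel"
  using distr_lborel_affine1[of 1 a] by (simp add: add.commute)
 show "(LL x. f (x + a)) = (LL x. f x)"
  using integral_distr[of "%x. x + a" lborel borel f] by (simp add: d)
 show "LI (%x. f (x + a)) \<longleftrightarrow> LI f"
  using integrable_distr_eq[of "%x. x + a" lborel borel f] by (simp add: d)
qed

lemma lborel_reflect:
 fixes f :: "'a::euclidean_space => 'b::{banach, second_countable_topology}"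
 assumes [measurable]: "f \<in> BM"
 shows "(LL x. f (a - x)) = (LL x. f x)"
  and "LI (%x. f (a - x)) \<longleftrightarrow> LI f"
proof -
 have d: "distr lborel borel (%x. a - x) = lborel"
  using distr_lborel_affine1[of "-1" a] by simp
 show "(LL x. f (a - x)) = (LL x. f x)"
  using integral_distr[of "%x. a - x" lborel borel f] by (simp add: d)
 show "LI (%x. f (a - x)) \<longleftrightarrow> LI f"
  using integrable_distr_eq[of "%x. a - x" lborel borel f] by (simp add: d)
qed

lemma lborel_scale:
 fixes f :: "'a::euclidean_space => 'b::{banach, second_countable_topology}"
 assumes [measurable]: "f \<in> BM" and c: "c > 0"
 shows "(LL x. f x) = c ^ DIM('a) *R (LL x. f (c *R x))"
proof -
 have l: "lborel = density (distr lborel borel (%x::'a. 0 + c *R x)) (%_. ennreal (\<bar>c\<bar> ^ DIM('a)))"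
  using c by (intro lborel_affine) auto
 have "(LL x. f x) = (LINT x|density (distr lborel borel (%x::'a. 0 + c *R x)) (%_. ennreal (\<bar>c\<bar> ^ DIM('a))). f x)"
  using l by simp
 also have "... = (LINT x|distr lborel borel (%x::'a. 0 + c *R x). (\<bar>c\<bar> ^ DIM('a)) *R f x)"
  by (rule integral_density) auto
 also have "... = (LL x. (\<bar>c\<bar> ^ DIM('a)) *R f (0 + c *R x))"
  by (rule integral_distr) auto
 finally show ?thesis using c by simp
qed

lemma norm_integral_le_nn:
 fixes f :: "'a => 'b::{banach, second_countable_topology}"
 shows "enm (LINT x|M. f x) <= (\<integral>\<^sup>+x. enm (f x) \<partial>M)"
proof (cases "integrable M f")
 case True then show ?thesis by (rule integral_norm_bound_ennreal)
next
 case False then show ?thesis by (simp add: not_integrable_integral_eq)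
qed

text \<open>A single Tonelli bound on the iterated integral of norms yields all forms of Fubini's
  theorem at once, so exchanging vector-valued integrals later reduces to one finite
  \<open>NN x. NN y\<close> estimate.\<close>

lemma fubini_lborel:
 fixes f :: "'a::euclidean_space => 'b::euclidean_space => 'c::{banach, second_countable_topology}"
 assumes [measurable]: "(%(x,y). f x y) \<in> BM2"
  and fin: "(NN x. NN y. enm (f x y)) < \<infinity>"
 shows "integrable (lborel \<Otimes>\<^sub>M lborel) (%(x,y). f x y)"
  and "(LL x. LL y. f x y) = (LL y. LL x. f x y)"
  and "LI (%x. LL y. f x y)"
  and "LI (%y. LL x. f x y)"
  and "AEL x. LI (f x)"
  and "AEL y. LI (%x. f x y)"
  and "(LL z. f (fst z) (snd z)) = (LL x. LL y. f x y)"
proof -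
 have *: "(\<integral>\<^sup>+z. enm (case z of (x,y) => f x y) \<partial>(lborel \<Otimes>\<^sub>M lborel)) < \<infinity>"
  using fin by (subst lborel.nn_integral_fst[symmetric]) auto
 show I: "integrable (lborel \<Otimes>\<^sub>M lborel) (%(x,y). f x y)"
  using * by (intro integrableI_bounded) auto
 show "(LL x. LL y. f x y) = (LL y. LL x. f x y)"
  using lborel_pair.Fubini_integral[OF I] by simp
 show "LI (%x. LL y. f x y)" by (rule lborel_pair.integrable_fst[OF I])
 show "LI (%y. LL x. f x y)" by (rule lborel_pair.integrable_snd[OF I])
 show "AEL x. LI (f x)"
  using lborel_pair.AE_integrable_fst[OF I] by simp
 show "AEL y. LI (%x. f x y)"
  using lborel_pair.AE_integrable_snd[OF I] by simp
 show "(LL z. f (fst z) (snd z)) = (LL x. LL y. f x y)"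
  using lborel_pair.integral_fst[OF I] by (simp add: lborel_prod case_prod_unfold)
qed

lemma Fubini_lborel_nn:
 fixes f :: "'a::euclidean_space => 'b::euclidean_space => ennreal"
 assumes [measurable]: "(%(x,y). f x y) \<in> BM2"
 shows "(NN x. NN y. f x y) = (NN y. NN x. f x y)"
 using lborel_pair.Fubini[of "%(x,y). f x y"] by simp

section \<open>Continuity of translations in \<open>L1\<close>\<close>

text \<open>Openness only gives pointwise convergence of the positive part of
  \<open>u x - u (x + z n)\<close>. That is enough: \<open>u\<close> and its translate have the same
  integral, so their \<open>L1\<close> distance is twice the integral of this positive part.\<close>

lemma tendsto_L1_shift_open:
 fixes U :: "'a::euclidean_space set" and z :: "nat => 'a"
 assumes U: "open U" "emeasure lborel U < \<infinity>" and z: "z ---> 0"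
 shows "(%n. NN x. ennreal (\<bar>indicator U (x + z n) - ind U x\<bar>)) ---> 0"
proof -
 have [measurable]: "U \<in> sets borel" using U by simp
 define u where "u = (ind U :: 'a => real)"
 have [measurable]: "u \<in> BM" by (simp add: u_def)
 have iu: "LI u" using U unfolding u_def by (simp add: integrable_indicator_iff)
 have ius: "LI (%x. u (x + z n))" for n by (subst lborel_shift) (auto intro: iu)
 have lim: "(%n. LL x. 2*max 0 (u x - u (x + z n))) ---> (LINT x|(lborel::'a measure). 0)"
 proof (rule integral_dominated_convergence[where w="%x. 2*u x"])
  show "AEL x. (%n. 2*max 0 (u x - u (x + z n))) ---> 0"
  proof (rule AE_I2)
   fix x :: 'a
   show "(%n. 2*max 0 (u x - u (x + z n))) ---> 0"
   proof (cases "x \<in> U")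
    case True
    have "(%n. x + z n) ---> x + 0" by (intro tendsto_intros z)
    then have "eventually (%n. x + z n \<in> U) sequentially"
     using topological_tendstoD[of "%n. x + z n" x sequentially U] U True by simp
    then have "eventually (%n. 2*max 0 (u x - u (x + z n)) = 0) sequentially"
     by eventually_elim (simp add: u_def True)
    then show ?thesis by (rule tendsto_eventually)
   next
    case False
    then have "max 0 (u x - u (x + z n)) = 0" for n by (simp add: u_def)
    then show ?thesis by simp
   qed
  qed
  show "LI (%x. 2*u x)" using iu by simp
 qed (auto simp: u_def indicator_def max_def)
 have eq: "(LL x. \<bar>u (x + z n) - u x\<bar>) = (LL x. 2*max 0 (u x - u (x + z n)))" for n
 proof -
  have i1: "LI (%x. 2*max 0 (u x - u (x + z n)))"
  proof (rule BI_int_bound[of _ "%x. 2*u x"])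
   show "LI (%x. 2*u x)" using iu by simp
  qed (auto simp: u_def indicator_def)
  have "(LL x. \<bar>u (x + z n) - u x\<bar>)
   = (LL x. 2*max 0 (u x - u (x + z n)) + (u (x + z n) - u x))"
   by (intro BI_LINT_cong) (auto simp: max_def)
  also have "... = (LL x. 2*max 0 (u x - u (x + z n))) + ((LL x. u (x + z n)) - (LL x. u x))"
   using i1 iu ius by simp
  finally show ?thesis by (simp add: lborel_shift(1))
 qed
 have "(%n. ennreal (LL x. \<bar>u (x + z n) - u x\<bar>)) ---> ennreal 0"
  using lim by (intro tendsto_ennrealI) (simp add: eq)
 moreover have "(NN x. ennreal (\<bar>u (x + z n) - u x\<bar>)) = ennreal (LL x. \<bar>u (x + z n) - u x\<bar>)" for n
  by (intro nn_integral_eq_integral) (auto intro!: iu ius)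
 ultimately show ?thesis unfolding u_def[symmetric] by simp
qed

lemma ennreal_limsup_zeroI:
 fixes T :: "nat => ennreal"
 assumes "!!e. e > 0 ==> \<exists>S. S ---> 0 & (\<forall>n. T n <= S n + ennreal e)"
 shows "T ---> 0"
proof (rule order_tendstoI)
 fix a :: ennreal assume "0 < a"
 then obtain b where b: "0 < b" "b < a" using dense by blast
 then obtain e where "b = ennreal e" "0 <= e" by (cases b) auto
 with b have e: "0 < e" "ennreal e < a" by (auto simp: less_le)
 obtain S where S: "S ---> 0" "!!n. T n <= S n + ennreal e" using assms[OF e(1)] by blast
 have "(%n. S n + ennreal e) ---> 0 + ennreal e" by (intro tendsto_intros S)
 then have "eventually (%n. S n + ennreal e < a) sequentially" using e by (intro order_tendstoD) auto
 then show "eventually (%n. T n < a) sequentially" by eventually_elim (use S in \<open>auto intro: le_less_trans\<close>)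
qed simp

text \<open>Induction over integrable functions. A measurable set is replaced by an open superset of
  nearly the same measure, where the previous lemma applies; the error of an approximation is
  translation invariant and therefore uniform in the shift.\<close>

lemma tendsto_L1_shift:
 fixes f :: "'a::euclidean_space => 'b::{banach, second_countable_topology}" and z :: "nat => 'a"
 assumes "LI f" and z: "z ---> 0"
 shows "(%n. NN x. enm (f (x + z n) - f x)) ---> 0"
 using assms(1)
proof (induction rule: integrable_induct)
 case (base A c)
 have [measurable]: "A \<in> sets borel" using base by simp
 show ?case
 proof (rule ennreal_limsup_zeroI)
  fix e :: real assume e: "e > 0"
  \<comment> \<open>The excess \<open>U - A\<close> is counted twice, at \<open>x\<close> and at
    \<open>x + z n\<close>, hence the 2; the \<open>+ 1\<close> keeps the quotient meaningful for
    \<open>c = 0\<close>.\<close>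
  define e' where "e' = e/(2*(norm c + 1))"
  have e': "e' > 0" using e by (auto simp: e'_def intro!: divide_pos_pos add_nonneg_pos)
  obtain U where U: "open U" "A \<subseteq> U" "emeasure lborel (U - A) < e'"
   using outer_regular_lborel[OF _ e', of A] by auto
  have [measurable]: "U \<in> sets borel" using U by simp
  have "emeasure lborel U <= emeasure lborel (U - A) + emeasure lborel A"
   using emeasure_subadditive[of "U - A" lborel A] U by (simp add: Un_absorb2)
  also have "... < \<infinity>" using U(3) base by (auto simp: top.not_eq_extremum[symmetric])
  finally have fU: "emeasure lborel U < \<infinity>" .
  let ?S = "%n. ennreal (norm c)*(NN x. ennreal (\<bar>indicator U (x + z n) - ind U x\<bar>))"
  have "?S ---> ennreal (norm c)*0"
   by (intro ennreal_tendsto_cmult tendsto_L1_shift_open U fU z) simp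
  moreover have "(NN x. enm (ind A (x + z n) *R c - ind A x *R c)) <= ?S n + ennreal e" for n
  proof -
   have "(NN x. enm (ind A (x + z n) *R c - ind A x *R c))
    <= (NN x. ennreal (norm c)*(ennreal (\<bar>indicator U (x + z n) - ind U x\<bar>)
      + ind (U - A) (x + z n) + ind (U - A) x))"
    using U(2)
    by (intro nn_integral_mono)
     (auto simp: indicator_def scaleR_diff_left[symmetric] simp flip: ennreal_1 ennreal_plus ennreal_mult)
   also have "... = ennreal (norm c)*((NN x. ennreal (\<bar>indicator U (x + z n) - ind U x\<bar>))
     + (NN x. ind (U - A) (x + z n)) + (NN x. ind (U - A) x))"
    by (simp add: nn_integral_cmult nn_integral_add)
   also have "(NN x. ind (U - A) (x + z n)) = (\<integral>\<^sup>+x. ind (U - A) x \<partial>(lborel :: 'a measure))"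
    by (rule nn_integral_lborel_shift) simp
   also have "(NN x. ind (U - A) x) = emeasure lborel (U - A)" by simp
   also have "ennreal (norm c)*((NN x. ennreal (\<bar>indicator U (x + z n) - ind U x\<bar>))
      + emeasure lborel (U - A) + emeasure lborel (U - A))
    <= ennreal (norm c)*((NN x. ennreal (\<bar>indicator U (x + z n) - ind U x\<bar>)) + (ennreal e' + ennreal e'))"
    using U(3) by (auto intro!: mult_left_mono add_mono simp: add.assoc)
   also have "... = ?S n + ennreal (norm c*(e' + e'))"
   proof -
    have "ennreal (norm c*(e' + e')) = ennreal (norm c)*(ennreal e' + ennreal e')"
     using e' by (simp add: ennreal_mult flip: ennreal_plus)
    then show ?thesis by (simp only: distrib_left)
   qed
   also have "... <= ?S n + ennreal e"
   proof -
    have "e/(2*N) + e/(2*N) = e/N" for N by (cases "N = 0") (auto simp: field_simps)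
    then have "e' + e' = e/(norm c + 1)" unfolding e'_def .
    then have "norm c*(e' + e') = e*(norm c/(norm c + 1))" by simp
    also have "... <= e*1"
     using e by (intro mult_left_mono) (smt (verit) divide_le_eq_1 norm_ge_zero, simp)
    finally show ?thesis by (intro add_left_mono ennreal_leI) simp
   qed
   finally show ?thesis .
  qed
  ultimately show "\<exists>S. S ---> 0 &
      (\<forall>n. (NN  x. enm (ind A (x + z n) *R c - ind A x *R c)) <= S n + ennreal e)"
   by (intro exI[of _ ?S]) auto
 qed
next
 case (add f g)
 have [measurable]: "f \<in> BM" "g \<in> BM" using add by auto
 have "(%n. (NN x. enm (f (x + z n) - f x)) + (NN x. enm (g (x + z n) - g x))) ---> 0 + 0"
  by (intro tendsto_intros add)
 then have L: "(%n. (NN x. enm (f (x + z n) - f x)) + (NN x. enm (g (x + z n) - g x))) ---> 0"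
  by simp
 show ?case
 proof (rule tendsto_sandwich[OF _ _ tendsto_const L])
  show "\<forall>\<^sub>F n in sequentially. (NN x. enm (f (x + z n) + g (x + z n) - (f x + g x)))
   <= (NN x. enm (f (x + z n) - f x)) + (NN x. enm (g (x + z n) - g x))"
   by (intro always_eventually allI, subst nn_integral_add[symmetric])
    (auto intro!: nn_integral_mono ennreal_leI norm_triangle_le simp flip: ennreal_plus simp: add_diff_add norm_triangle_ineq)
 qed auto
next
 case (lim f s)
 have [measurable]: "f \<in> BM" "!!i. s i \<in> BM" using lim by auto
 have "(%i. NN x. enm (s i x - f x)) ---> (\<integral>\<^sup>+x. 0 \<partial>(lborel::'a measure))"
 proof (rule nn_integral_dominated_convergence[where w="%x. ennreal (3*norm (f x))"])
  show "(NN  x. ennreal (3*norm (f x))) < \<infinity>"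
  proof -
   have "(NN  x. enm (f x)) < \<infinity>" using lim.hyps(4) by (simp add: integrable_iff_bounded)
   then show ?thesis by (simp add: ennreal_mult nn_integral_cmult ennreal_mult_less_top)
  qed
  show "AEL x. enm (s i x - f x) <= ennreal (3*norm (f x))" for i
  proof (intro AE_I2 ennreal_leI)
   fix x
   have "norm (s i x - f x) <= norm (s i x) + norm (f x)" by (rule norm_triangle_ineq4)
   then show "norm (s i x - f x) <= 3*norm (f x)" using lim.hyps(3)[of x i] by simp
  qed
  show "AEL x. (%i. enm (s i x - f x)) ---> 0"
   using lim.hyps(2) by (intro AE_I2 tendsto_ennrealI[where x=0, simplified] tendsto_norm_zero LIM_zero) auto
 qed auto
 then have c0: "(%i. NN x. enm (s i x - f x)) ---> 0" by simp
 show ?case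
 proof (rule ennreal_limsup_zeroI)
  fix e :: real assume e: "e > 0"
  have "eventually (%i. (NN x. enm (s i x - f x)) < ennreal (e/2)) sequentially"
   using e by (intro order_tendstoD[OF c0]) simp
  then obtain i where i: "(NN x. enm (s i x - f x)) < ennreal (e/2)"
   by (auto simp: eventually_sequentially)
  have "(NN x. enm (f (x + z n) - f x)) <= (NN x. enm (s i (x + z n) - s i x)) + ennreal e" for n
  proof -
   have "(NN x. enm (f (x + z n) - f x))
    <= (NN x. enm (s i (x + z n) - s i x) + (enm (s i (x + z n) - f (x + z n)) + enm (s i x - f x)))"
   proof (intro nn_integral_mono)
    fix x
    have "f (x + z n) - f x = (s i (x + z n) - s i x) - (s i (x + z n) - f (x + z n)) + (s i x - f x)" by simp
    then have "norm (f (x + z n) - f x) <= norm (s i (x + z n) - s i x) + (norm (s i (x + z n) - f (x + z n)) + norm (s i x - f x))"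
     by (smt (verit) norm_triangle_ineq norm_triangle_ineq4)
    then show "enm (f (x + z n) - f x) <= enm (s i (x + z n) - s i x) + (enm (s i (x + z n) - f (x + z n)) + enm (s i x - f x))"
     by (simp flip: ennreal_plus)
   qed
   also have "... = (NN x. enm (s i (x + z n) - s i x))
    + ((NN x. enm (s i (x + z n) - f (x + z n))) + (NN x. enm (s i x - f x)))"
    by (simp add: nn_integral_add)
   also have "(NN x. enm (s i (x + z n) - f (x + z n))) = (NN x. enm (s i x - f x))"
    by (rule nn_integral_lborel_shift) simp
   also have "(NN x. enm (s i x - f x)) + (NN x. enm (s i x - f x)) <= ennreal (e/2) + ennreal (e/2)"
    using i by (intro add_mono) auto
   also have "... = ennreal e" using e by (simp flip: ennreal_plus)
   finally show ?thesis by (simp add: add_left_mono)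
  qed
  then show "\<exists>S. S ---> 0 & (\<forall>n. (NN x. enm (f (x + z n) - f x)) <= S n + ennreal e)"
   using lim.IH[of i] by blast
 qed
qed

subsection \<open>Fourier integrals\<close>

definition fconst :: "'a::euclidean_space itself => real" where
 "fconst _ = (2*pi) powr (- real DIM('a)/2)"

lemma fconst_pos: "fconst TYPE('a::euclidean_space) > 0"
 by (simp add: fconst_def)

lemma fourier_integral_eq:
 "FI f xi = fconst TYPE('a) *R (LL x. cis (- (x \<bullet> xi))*f (x::'a::euclidean_space))"
 by (simp add: fourier_integral_def fconst_def)

lemma borel_measurable_cis [measurable (raw)]:
 assumes [measurable]: "f \<in> borel_measurable M"
 shows "(%x. cis (f x)) \<in> borel_measurable M"
proof -
 have "(%x. exp (\<i>*cx x)) \<in> BM"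
  by (intro borel_measurable_continuous_onI continuous_intros)
 from measurable_compose[OF assms this] show ?thesis by (simp add: cis_conv_exp)
qed

lemma borel_measurable_fourier_integral [measurable (raw)]:
 fixes f :: "'b => 'a::euclidean_space => complex"
 assumes [measurable]: "(%(w, x). f w x) \<in> borel_measurable (M \<Otimes>\<^sub>M borel)" "h \<in> borel_measurable M"
 shows "(%w. FI (f w) (h w)) \<in> borel_measurable M"
proof -
 have "(%(w, x). cis (- (x \<bullet> h w))*f w x) \<in> borel_measurable (M \<Otimes>\<^sub>M lborel)" by measurable
 from sigma_finite_measure.borel_measurable_lebesgue_integral[OF sigma_finite_lborel this]
 show ?thesis unfolding fourier_integral_eq by measurable
qed

lemma integrable_cis_mult:
 fixes f :: "'a::euclidean_space => complex"
 assumes "LI f" and [measurable]: "g \<in> BM"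
 shows "LI (%x. cis (g x)*f x)"
proof (rule BI_int_bound[OF assms(1)])
 have [measurable]: "f \<in> BM" using assms by auto
 show "(%x. cis (g x)*f x) \<in> borel_measurable lborel" by measurable
qed (simp add: norm_mult)

lemma fourier_integral_add:
 assumes "LI f" "LI g"
 shows "FI (%x. f x + g x) xi = FI f xi + FI g xi"
 unfolding fourier_integral_eq using assms by (simp add: integrable_cis_mult distrib_left scaleR_add_right)

lemma fourier_integral_diff:
 assumes "LI f" "LI g"
 shows "FI (%x. f x - g x) xi = FI f xi - FI g xi"
 unfolding fourier_integral_eq using assms
 by (simp add: integrable_cis_mult right_diff_distrib scaleR_diff_right)

lemma fourier_integral_cmult:
 "FI (%x. c*f x) xi = c*FI f (xi::'a::euclidean_space)"
proof -
 have "(LL x. cis (- (x \<bullet> xi))*(c*f x)) = (LL x. c*(cis (- (x \<bullet> xi))*f x))"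
  by (simp add: mult_ac)
 then show ?thesis unfolding fourier_integral_eq by simp
qed

lemma fourier_integral_cong_AE:
 assumes "AEL x. f x = g x" "f \<in> BM" "g \<in> BM"
 shows "FI f xi = FI g (xi::'a::euclidean_space)"
proof -
 note [measurable] = assms(2,3)
 have "(LL x. cis (- (x \<bullet> xi))*f x) = (LL x. cis (- (x \<bullet> xi))*g x)"
  using assms(1) by (intro integral_cong_AE) auto
 then show ?thesis by (simp add: fourier_integral_eq)
qed

lemma norm_fourier_integral_le:
 assumes "LI f"
 shows "norm (FI f xi) <= fconst TYPE('a)*(LL x. norm (f (x::'a::euclidean_space)))"
proof -
 have "norm (LL x. cis (- (x \<bullet> xi))*f x) <= (LL x. norm (cis (- (x \<bullet> xi))*f x))"
  by (rule integral_norm_bound)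
 then show ?thesis unfolding fourier_integral_eq
  using fconst_pos[where 'a='a] by (simp add: norm_mult)
qed

lemma cnj_fourier_integral:
 "cnj (FI f xi) = FI (%x. cnj (f x)) (- xi)"
proof -
 have "cnj (LL x. cis (- (x \<bullet> xi))*f x) = (LL x. cnj (cis (- (x \<bullet> xi))*f x))"
  by (rule BI_LINT_cnj[symmetric])
 also have "... = (LL x. cis (- (x \<bullet> - xi))*cnj (f x))"
  by (intro BI_LINT_cong) (simp_all add: cis_cnj)
 finally show ?thesis unfolding fourier_integral_eq by (simp del: integral_cnj)
qed

lemma fourier_integral_reflect:
 fixes f :: "'a::euclidean_space => complex"
 assumes [measurable]: "f \<in> BM"
 shows "FI (%x. f (- x)) xi = FI f (- xi)"
proof -
 have "(LL x. cis (- ((0 - x) \<bullet> - xi))*f (0 - x)) = (LL x. cis (- (x \<bullet> - xi))*f x)"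
  by (rule lborel_reflect(1)) measurable
 then show ?thesis unfolding fourier_integral_eq by simp
qed

text \<open>The multiplication formula. It stands in for inner products as long as only integrable
  functions have a transform; Plancherel, inversion and the pairings with test functions all go
  through it.\<close>

lemma fourier_integral_swap:
 fixes f g :: "'a::euclidean_space => complex"
 assumes f: "LI f" and g: "LI g"
 shows "(LL xi. FI f xi*g xi) = (LL x. f x*FI g x)"
proof -
 have [measurable]: "f \<in> BM" "g \<in> BM" using f g by auto
 define F where "F = (%(x::'a) (xi::'a). cis (- (x \<bullet> xi))*f x*g xi)"
 have [measurable]: "(%(x, xi). F x xi) \<in> BM2" unfolding F_def by measurable
 have "(NN x. NN xi. enm (F x xi)) = (NN x. enm (f x))*(NN x. enm (g x))"
  by (simp add: F_def norm_mult ennreal_mult nn_integral_cmult nn_integral_multc)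
 also have "... < \<infinity>" using f g by (auto simp: integrable_iff_bounded ennreal_mult_less_top)
 finally have fin: "(NN x. NN xi. enm (F x xi)) < \<infinity>" .
 have "(LL xi. FI f xi*g xi) = (LL xi. fconst TYPE('a) *R (LL x. F x xi))"
  unfolding fourier_integral_eq F_def by simp
 also have "... = fconst TYPE('a) *R (LL xi. LL x. F x xi)" by simp
 also have "(LL xi. LL x. F x xi) = (LL x. LL xi. F x xi)"
  by (rule fubini_lborel(2)[symmetric]) (use fin in measurable)
 also have "fconst TYPE('a) *R ... = (LL x. fconst TYPE('a) *R (LL xi. F x xi))" by simp
 also have "... = (LL x. f x*FI g x)"
 proof (intro BI_LINT_cong refl)
  fix x
  have "(LL xi. F x xi) = (LL xi. f x*(cis (- (xi \<bullet> x))*g xi))"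
   by (simp add: F_def mult_ac inner_commute)
  then show "fconst TYPE('a) *R (LL xi. F x xi) = f x*FI g x"
   unfolding fourier_integral_eq by simp
 qed
 finally show ?thesis .
qed

definition cconv :: "('a::euclidean_space => complex) => ('a => complex) => 'a => complex" where
 "cconv f g xi = (LL et. f (xi - et)*g et)"

lemma borel_measurable_cconv [measurable (raw)]:
 fixes f :: "'b => 'a::euclidean_space => complex"
 assumes [measurable]: "(%(w, x). f w x) \<in> borel_measurable (M \<Otimes>\<^sub>M borel)"
  "(%(w, x). g w x) \<in> borel_measurable (M \<Otimes>\<^sub>M borel)" "h \<in> borel_measurable M"
 shows "(%w. cconv (f w) (g w) (h w)) \<in> borel_measurable M"
proof -
 have "(%(w, et). f w (h w - et)*g w et) \<in> borel_measurable (M \<Otimes>\<^sub>M lborel)" by measurable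
 from sigma_finite_measure.borel_measurable_lebesgue_integral[OF sigma_finite_lborel this]
 show ?thesis unfolding cconv_def by measurable
qed

text \<open>The unitary normalisation leaves one factor \<open>1/fconst\<close> per convolution. It
  is compensated by the coupling \<open>mu = lam*fconst\<close> in the transformed Klein-Gordon
  equation.\<close>

lemma fourier_integral_cconv:
 fixes f g :: "'a::euclidean_space => complex"
 assumes f: "LI f" and g: "LI g"
 shows "LI (cconv f g)"
  and "FI (cconv f g) x = FI f x*FI g x/fconst TYPE('a)"
proof -
 have [measurable]: "f \<in> BM" "g \<in> BM" using f g by auto
 have fin: "(NN xi. NN et. enm (h xi*(f (xi - et)*g et))) < \<infinity>"
  if [measurable]: "h \<in> BM" and h: "!!xi. norm (h xi) = 1" for h :: "'a => complex"
 proof -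
  have "(NN xi. NN et. enm (h xi*(f (xi - et)*g et)))
   = (NN et. NN xi. enm (f (xi - et)*g et))"
   by (subst Fubini_lborel_nn) (simp_all add: norm_mult h)
  also have "... = (NN et. enm (g et)*(NN xi. enm (f (xi + (- et)))))"
   by (subst nn_integral_cmult[symmetric]) (simp_all add: norm_mult ennreal_mult mult_ac)
  also have "... = (NN et. enm (g et)*(NN xi. enm (f xi)))"
   by (subst nn_integral_lborel_shift) simp_all
  also have "... = (NN et. enm (g et))*(NN xi. enm (f xi))"
   by (rule nn_integral_multc) simp
  also have "... < \<infinity>" using f g by (auto simp: integrable_iff_bounded ennreal_mult_less_top)
  finally show ?thesis .
 qed
 have "LI (%xi. LL et. f (xi - et)*g et)"
  using fin[of "%_. 1"] by (intro fubini_lborel(3)) (simp_all add: case_prod_unfold)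
 then show "LI (cconv f g)" by (simp add: cconv_def[abs_def])
 have "(LL xi. cis (- (xi \<bullet> x))*cconv f g xi) = (LL xi. LL et. cis (- (xi \<bullet> x))*(f (xi - et)*g et))"
  unfolding cconv_def by simp
 also have "... = (LL et. LL xi. cis (- (xi \<bullet> x))*(f (xi - et)*g et))"
  by (rule fubini_lborel(2)) (measurable, rule fin, auto)
 also have "... = (LL et. (cis (- (et \<bullet> x))*g et)*(LL xi. cis (- (xi \<bullet> x))*f xi))"
 proof (intro BI_LINT_cong refl)
  fix et
  have "(LL xi. cis (- (xi \<bullet> x))*(f (xi - et)*g et))
   = (LL xi. (cis (- (et \<bullet> x))*g et)*(cis (- ((xi + - et) \<bullet> x))*f (xi + - et)))"
  proof (intro BI_LINT_cong refl)
   fix xi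
   have "cis (- (xi \<bullet> x)) = cis (- (et \<bullet> x))*cis (- ((xi + - et) \<bullet> x))"
    unfolding cis_mult by (simp add: inner_diff_left)
   then show "cis (- (xi \<bullet> x))*(f (xi - et)*g et) = (cis (- (et \<bullet> x))*g et)*(cis (- ((xi + - et) \<bullet> x))*f (xi + - et))"
    by simp
  qed
  also have "... = (cis (- (et \<bullet> x))*g et)*(LL xi. cis (- ((xi + - et) \<bullet> x))*f (xi + - et))"
   by simp
  also have "(LL xi. cis (- ((xi + - et) \<bullet> x))*f (xi + - et)) = (LL xi. cis (- (xi \<bullet> x))*f xi)"
   by (rule lborel_shift(1)) measurable
  finally show "(LL xi. cis (- (xi \<bullet> x))*(f (xi - et)*g et)) = (cis (- (et \<bullet> x))*g et)*(LL xi. cis (- (xi \<bullet> x))*f xi)" .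
 qed
 also have "... = (LL et. cis (- (et \<bullet> x))*g et)*(LL xi. cis (- (xi \<bullet> x))*f xi)" by simp
 finally show "FI (cconv f g) x = FI f x*FI g x/fconst TYPE('a)"
  unfolding fourier_integral_eq using fconst_pos[where 'a='a]
  by (simp add: scaleR_conv_of_real field_simps)
qed

text \<open>Up to the factor \<open>sqrt (2*pi)\<close>, this is the characteristic function of the
  standard normal distribution.\<close>

lemma gaussian_fourier_real:
 fixes a :: real
 shows "LI (%t. cx (exp (- t\<^sup>2/2))*cis (- (t*a)))"
  and "(LL t. cx (exp (- t\<^sup>2/2))*cis (- (t*a))) = cx (sqrt (2*pi)*exp (- a\<^sup>2/2))"
proof -
 have eq: "cx (exp (- t\<^sup>2/2))*cis (- (t*a))
   = cx (sqrt (2*pi))*(std_normal_density t *R iexp (- a*t))" for t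
  by (simp add: std_normal_density_def scaleR_conv_of_real cis_conv_exp mult_ac)
 have "LI (%t. cx (std_normal_density t))" by simp
 then have "LI (%t. cis (- a*t)*cx (std_normal_density t))"
  by (rule integrable_cis_mult) simp
 then have i: "LI (%t. std_normal_density t *R iexp (- a*t))"
  by (simp add: scaleR_conv_of_real cis_conv_exp mult_ac)
 then show "LI (%t. cx (exp (- t\<^sup>2/2))*cis (- (t*a)))"
  unfolding eq by (rule integrable_mult_right)
 have "(LL t. std_normal_density t *R iexp (- a*t)) = char std_normal_distribution (- a)"
  unfolding char_def by (subst integral_density) auto
 then show "(LL t. cx (exp (- t\<^sup>2/2))*cis (- (t*a))) = cx (sqrt (2*pi)*exp (- a\<^sup>2/2))"
  unfolding eq integral_mult_right_zero by (simp add: char_std_normal_distribution)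
qed

lemma integral_lborel_prod:
 fixes f :: "'a::euclidean_space => real => complex"
 assumes i: "!!b. b \<in> Basis ==> LI (f b)"
 shows "LI (%x::'a. \<Prod>b\<in>Basis. f b (x \<bullet> b))"
  and "(LL x. (\<Prod>b\<in>Basis. f b (x \<bullet> b))) = (\<Prod>b\<in>(Basis::'a set). LL t. f b t)"
proof -
 interpret product_sigma_finite "%_::'a. lborel :: real measure" by standard
 have m [measurable]: "!!b. b \<in> Basis ==> f b \<in> BM" using i by auto
 let ?P = "\<Pi>\<^sub>M b\<in>(Basis::'a set). (lborel :: real measure)"
 let ?g = "%g. \<Sum>b\<in>Basis. g b *R (b::'a)"
 have g: "?g \<in> measurable ?P borel" by measurable
 have F: "(%x::'a. \<Prod>b\<in>Basis. f b (x \<bullet> b)) \<in> BM" by measurable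
 have e: "(\<Prod>b\<in>Basis. f b (?g h \<bullet> b)) = (\<Prod>b\<in>Basis. f b (h b))" for h
  by (intro prod.cong refl) simp
 have I: "integrable ?P (%h. \<Prod>b\<in>Basis. f b (h b))" using i by (intro product_integrable_prod) auto
 show "LI (%x::'a. \<Prod>b\<in>Basis. f b (x \<bullet> b))"
  by (subst lborel_eq, subst integrable_distr_eq[OF g F]) (use I in \<open>simp only: e\<close>)
 have "(LL x. (\<Prod>b\<in>Basis. f b (x \<bullet> b))) = (LINT h|?P. (\<Prod>b\<in>Basis. f b (?g h \<bullet> b)))"
  by (subst lborel_eq, rule integral_distr[OF g F])
 also have "... = (LINT h|?P. (\<Prod>b\<in>Basis. f b (h b)))" by (simp only: e)
 also have "... = (\<Prod>b\<in>(Basis::'a set). LL t. f b t)"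
  using i by (intro product_integral_prod) auto
 finally show "(LL x. (\<Prod>b\<in>Basis. f b (x \<bullet> b))) = (\<Prod>b\<in>(Basis::'a set). LL t. f b t)" .
qed

lemma cis_sum: "finite A ==> cis (sum f A) = (\<Prod>a\<in>A. cis (f a))"
 by (induction A rule: finite_induct) (auto simp: cis_mult[symmetric])

definition gaussian :: "'a::euclidean_space => real" where
 "gaussian x = exp (- (norm x)\<^sup>2/2)"

lemma gaussian_measurable [measurable]: "gaussian \<in> BM"
 unfolding gaussian_def[abs_def] by measurable

lemma gaussian_fourier:
 fixes z :: "'a::euclidean_space"
 shows "LI (%x::'a. cx (gaussian x))"
  and "(LL x. cis (- (x \<bullet> z))*cx (gaussian x)) = cx (gaussian z/fconst TYPE('a))"
proof -
 have n: "(norm (x::'a))^2 = (\<Sum>b\<in>Basis. (x \<bullet> b)^2)" for x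
  unfolding power2_norm_eq_inner by (subst euclidean_inner) (simp add: power2_eq_square)
 have e: "cis (- (x \<bullet> z))*cx (gaussian x)
  = (\<Prod>b\<in>Basis. cx (exp (- (x \<bullet> b)\<^sup>2/2))*cis (- ((x \<bullet> b)*(z \<bullet> b))))" for x z :: 'a
 proof -
  have "cis (- (x \<bullet> z)) = (\<Prod>b\<in>Basis. cis (- ((x \<bullet> b)*(z \<bullet> b))))"
   by (subst euclidean_inner) (simp add: sum_negf[symmetric] cis_sum)
  moreover have "gaussian x = (\<Prod>b\<in>Basis. exp (- (x \<bullet> b)\<^sup>2/2))"
   unfolding gaussian_def n by (simp add: exp_sum[symmetric] sum_negf sum_divide_distrib)
  ultimately show ?thesis by (simp add: prod.distrib mult.commute)
 qed
 have g: "gaussian z = (\<Prod>b\<in>Basis. exp (- (z \<bullet> b)\<^sup>2/2))"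
  unfolding gaussian_def n by (simp add: exp_sum[symmetric] sum_negf sum_divide_distrib)
 have "LI (%x::'a. \<Prod>b\<in>Basis. cx (exp (- (x \<bullet> b)\<^sup>2/2))*cis (- ((x \<bullet> b)*(0 \<bullet> b))))"
  by (intro integral_lborel_prod gaussian_fourier_real)
 then show "LI (%x::'a. cx (gaussian x))"
  unfolding e[symmetric] by simp
 have "(LL x. cis (- (x \<bullet> z))*cx (gaussian x))
  = (\<Prod>b\<in>(Basis::'a set). cx (sqrt (2*pi)*exp (- (z \<bullet> b)\<^sup>2/2)))"
  unfolding e by (subst integral_lborel_prod(2)) (intro gaussian_fourier_real prod.cong refl)+
 also have "... = cx (sqrt (2*pi) ^ DIM('a)*gaussian z)"
  by (simp add: prod.distrib g)
 also have "sqrt (2*pi) ^ DIM('a) = 1/fconst TYPE('a)"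
  unfolding fconst_def by (simp add: powr_minus_divide powr_half_sqrt[symmetric] powr_realpow[symmetric] powr_powr)
 finally show "(LL x. cis (- (x \<bullet> z))*cx (gaussian x)) = cx (gaussian z/fconst TYPE('a))"
  by simp
qed

lemma fourier_integral_gaussian_scaled:
 fixes z :: "'a::euclidean_space"
 assumes n: "n > 0"
 shows "LI (%x::'a. cx (gaussian (x /\<^sub>R n)))"
  and "FI (%x. cx (gaussian (x /\<^sub>R n))) z = cx (n ^ DIM('a)*gaussian (n *R z))"
proof -
 have "LI (%x::'a. cx (gaussian x))" by (rule gaussian_fourier)
 moreover have l: "lborel = density (distr lborel borel (%x::'a. 0 + (1/n) *R x)) (%_. ennreal (\<bar>1/n\<bar> ^ DIM('a)))"
  using n by (intro lborel_affine) auto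
 ultimately have "integrable (density (distr lborel borel (%x::'a. 0 + (1/n) *R x)) (%_. ennreal (\<bar>1/n\<bar> ^ DIM('a)))) (%x::'a. cx (gaussian x))"
  by simp
 then have "LI (%x::'a. (\<bar>1/n\<bar> ^ DIM('a)) *R cx (gaussian (0 + (1/n) *R x)))"
  by (subst (asm) integrable_density) (auto simp: integrable_distr_eq)
 then have "LI (%x::'a. (n ^ DIM('a)) *R (\<bar>1/n\<bar> ^ DIM('a)) *R cx (gaussian (0 + (1/n) *R x)))"
  by (rule integrable_scaleR_right)
 then show "LI (%x::'a. cx (gaussian (x /\<^sub>R n)))"
  using n by (simp add: power_divide inverse_eq_divide)
 have "(LL x. cis (- (x \<bullet> z))*cx (gaussian (x /\<^sub>R n)))
  = n ^ DIM('a) *R (LL x. cis (- (n *R x \<bullet> z))*cx (gaussian ((n *R x) /\<^sub>R n)))"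
  using n by (intro lborel_scale) measurable
 also have "... = n ^ DIM('a) *R (LL x. cis (- (x \<bullet> (n *R z)))*cx (gaussian x))"
  using n by simp
 also have "... = n ^ DIM('a) *R cx (gaussian (n *R z)/fconst TYPE('a))"
  by (simp only: gaussian_fourier)
 finally show "FI (%x. cx (gaussian (x /\<^sub>R n))) z = cx (n ^ DIM('a)*gaussian (n *R z))"
  unfolding fourier_integral_eq using fconst_pos[where 'a='a] by (simp add: scaleR_conv_of_real)
qed

subsection \<open>Weighted square norms\<close>

definition wgt :: "real => 'a::euclidean_space => real" where
 "wgt sm xi = (1 + (norm xi)^2) powr sm"

text \<open>The square of the norm of order \<open>sm\<close>. Since \<open>wgt\<close> is a power
  of \<open>1 + |xi|^2\<close>, multiplication by \<open>wgt k\<close> shifts the order by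
  \<open>2*k\<close> (\<open>hn_wgt\<close>). The argument is a nonnegative extended profile, so
  that sums, convolutions and time integrals can be estimated without integrability side
  conditions.\<close>

definition hn :: "real => ('a::euclidean_space => ennreal) => ennreal" where
 "hn sm F = (NN xi. ennreal (wgt sm xi)*(F xi)^2)"

abbreviation en :: "('a => complex) => 'a => ennreal" where
 "en f \<equiv> (%xi. enm (f xi))"

lemma one_plus_norm2_pos: "1 + (norm (xi::'a::real_normed_vector))^2 > 0" "1 + (norm xi)^2 ~= 0"
 by (auto simp: add_pos_nonneg add_nonneg_eq_0_iff)

lemma wgt_pos [simp]: "wgt sm xi > 0" "wgt sm xi >= 0" "wgt sm xi ~= 0"
 using one_plus_norm2_pos[of xi] by (auto simp: wgt_def)

lemma wgt_not_nonpos [simp]: "\<not> wgt sm xi <= 0"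
 by (simp add: not_le)

lemma borel_measurable_cnj [measurable (raw)]:
 assumes [measurable]: "f \<in> borel_measurable M"
 shows "(%x. cnj (f x)) \<in> borel_measurable M"
proof -
 have "cnj \<in> BM" by (intro borel_measurable_continuous_onI continuous_intros)
 then show ?thesis by measurable
qed

lemma wgt_0 [simp]: "wgt 0 xi = 1"
 using one_plus_norm2_pos[of xi] by (simp add: wgt_def)

lemma wgt_1: "wgt 1 xi = 1 + (norm xi)^2"
 using one_plus_norm2_pos[of xi] by (simp add: wgt_def)

lemma wgt_mono: "sm <= ta ==> wgt sm xi <= wgt ta xi"
 unfolding wgt_def by (intro powr_mono) auto

lemma wgt_ge_1: "0 <= sm ==> 1 <= wgt sm xi"
 using wgt_mono[of 0 sm xi] by simp

lemma wgt_add: "wgt (sm + ta) xi = wgt sm xi*wgt ta xi"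
 by (simp add: wgt_def powr_add)

lemma wgt_uminus [simp]: "wgt sm (- xi) = wgt sm xi"
 by (simp add: wgt_def)

lemma wgt_measurable [measurable]: "wgt sm \<in> BM"
 unfolding wgt_def[abs_def] by measurable

lemma hn_mono_AE: "AEL xi. F xi <= G xi ==> hn sm F <= hn sm G"
 unfolding hn_def by (intro nn_integral_mono_AE) (auto intro!: mult_left_mono power_mono elim!: eventually_mono)

lemma hn_mono: "(!!xi. F xi <= G xi) ==> hn sm F <= hn sm G"
 by (rule hn_mono_AE) simp

lemma hn_cong_AE: "AEL xi. F xi = G xi ==> hn sm F = hn sm G"
 by (intro antisym hn_mono_AE) (auto elim!: eventually_mono)

lemma hn_mono_exp: "sm <= ta ==> hn sm F <= hn ta F"
 unfolding hn_def by (intro nn_integral_mono mult_right_mono ennreal_leI wgt_mono) auto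

lemma hn_cmult:
 assumes [measurable]: "F \<in> BM"
 shows "hn sm (%xi. c*F xi) = c\<^sup>2*hn sm F"
 unfolding hn_def by (subst nn_integral_cmult[symmetric]) (auto simp: power_mult_distrib mult_ac)

lemma hn_wgt:
 "hn sm (%xi. ennreal (wgt ta xi)*F xi) = hn (sm + 2*ta) F"
proof -
 have w: "wgt (sm + 2*ta) xi = wgt sm xi*(wgt ta xi)^2" for xi :: 'a
  unfolding mult_2 wgt_add power2_eq_square by simp
 then have "ennreal (wgt sm xi)*(ennreal (wgt ta xi)*F xi)^2 = ennreal (wgt (sm + 2*ta) xi)*(F xi)^2" for xi
  unfolding w by (simp add: power_mult_distrib ennreal_mult ennreal_power mult.assoc)
 then show ?thesis unfolding hn_def by simp
qed

lemma power2_le_imp_le_ennreal: "x\<^sup>2 <= y\<^sup>2 ==> x <= (y::ennreal)"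
proof (rule ccontr)
 assume a: "x\<^sup>2 <= y\<^sup>2" and "\<not> x <= y"
 then have xy: "y < x" by simp
 show False
 proof (cases x)
  case top
  then have "y\<^sup>2 = top" using a by (simp add: power2_eq_square top_unique)
  then show False using xy top by (simp add: power2_eq_square ennreal_mult_eq_top_iff)
 next
  case (real r)
  then obtain q where q: "y = ennreal q" "0 <= q" using xy by (cases y) (auto simp: top_unique)
  then have "q < r" using xy real by (simp add: ennreal_less_iff del: ennreal_le_iff)
  then have "q\<^sup>2 < r\<^sup>2" using q by (intro power_strict_mono) auto
  then show False using a real q by (simp add: ennreal_power del: power_mono_iff power2_le_iff_abs_le)
 qed
qed

lemma hn_cauchy_schwarz:
 assumes [measurable]: "F \<in> BM" "G \<in> BM"
 shows "(NN xi. ennreal (wgt sm xi)*(F xi*G xi))^2 <= hn sm F*hn sm G"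
proof -
 define r where "r = (%xi::'a. ennreal (sqrt (wgt sm xi)))"
 have r: "r xi*r xi = ennreal (wgt sm xi)" for xi by (simp add: r_def flip: ennreal_mult)
 have [measurable]: "r \<in> BM" unfolding r_def by measurable
 have "(NN xi. (r xi*F xi)*(r xi*G xi))^2 <= (NN xi. (r xi*F xi)^2)*(NN xi. (r xi*G xi)^2)"
  by (rule Cauchy_Schwarz_nn_integral) auto
 moreover have "(r xi*F xi)*(r xi*G xi) = ennreal (wgt sm xi)*(F xi*G xi)" for xi
  unfolding r[symmetric] by (simp add: mult_ac)
 moreover have "(r xi*F xi)^2 = ennreal (wgt sm xi)*(F xi)^2" for xi F
  unfolding r[symmetric] by (simp add: power2_eq_square mult_ac)
 ultimately show ?thesis unfolding hn_def by simp
qed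

text \<open>The triangle inequality without square roots in \<open>ennreal\<close>: the norms are
  represented by any \<open>A\<close> and \<open>B\<close> whose squares dominate, and
  Cauchy-Schwarz bounds the cross term by \<open>A*B\<close>.\<close>

lemma hn_minkowski:
 assumes [measurable]: "F \<in> BM" "G \<in> BM"
  and F: "hn sm F <= A\<^sup>2" and G: "hn sm G <= B\<^sup>2"
 shows "hn sm (%xi. F xi + G xi) <= (A + B)^2"
proof -
 define I where "I = (NN xi. ennreal (wgt sm xi)*(F xi*G xi))"
 have "I\<^sup>2 <= (A*B)^2"
  using order_trans[OF hn_cauchy_schwarz[of F G sm] mult_mono[OF F G]] by (simp add: I_def power_mult_distrib)
 then have I: "I <= A*B" by (rule power2_le_imp_le_ennreal)
 have "hn sm (%xi. F xi + G xi) = (NN xi. ennreal (wgt sm xi)*(F xi)^2 + (ennreal (wgt sm xi)*(G xi)^2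
  + (ennreal (wgt sm xi)*(F xi*G xi) + ennreal (wgt sm xi)*(F xi*G xi))))"
  unfolding hn_def by (intro nn_integral_cong) (simp add: power2_eq_square distrib_left distrib_right add_ac mult_ac)
 also have "... = hn sm F + (hn sm G + (I + I))"
  unfolding hn_def I_def by (simp add: nn_integral_add)
 also have "... <= A\<^sup>2 + (B\<^sup>2 + (A*B + A*B))" by (intro add_mono F G I)
 also have "... = (A + B)^2" by (simp add: power2_eq_square distrib_left distrib_right add_ac mult_ac)
 finally show ?thesis .
qed

text \<open>The cruder version with constant 2 also covers infinite norms; it serves where only
  finiteness or convergence to zero matters.\<close>

lemma hn_add_le:
 assumes [measurable]: "F \<in> BM" "G \<in> BM"
 shows "hn sm (%xi. F xi + G xi) <= 2*(hn sm F + hn sm G)"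
proof -
 have sq: "(x + y)^2 <= 2*(x\<^sup>2 + y\<^sup>2)" for x y :: ennreal
 proof (cases "x = top \<or> y = top")
  case True then show ?thesis by (auto simp: power2_eq_square ennreal_mult_eq_top_iff ennreal_mult_top)
 next
  case False
  then obtain a b where ab: "x = ennreal a" "y = ennreal b" "0 <= a" "0 <= b" by (cases x; cases y) auto
  have "(a + b)^2 <= 2*(a\<^sup>2 + b\<^sup>2)" using sum_squares_bound[of a b] by (simp add: power2_sum)
  then have "ennreal ((a + b)^2) <= ennreal (2*(a\<^sup>2 + b\<^sup>2))" by (rule ennreal_leI)
  then show ?thesis unfolding ab using ab(3,4)
   by (simp add: ennreal_mult ennreal_power[symmetric])
 qed
 have "hn sm (%xi. F xi + G xi) <= (NN xi. 2*(ennreal (wgt sm xi)*(F xi)^2 + ennreal (wgt sm xi)*(G xi)^2))"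
  unfolding hn_def
 proof (intro nn_integral_mono)
  fix xi
  have "ennreal (wgt sm xi)*(F xi + G xi)^2 <= ennreal (wgt sm xi)*(2*((F xi)^2 + (G xi)^2))"
   by (intro mult_left_mono sq) simp
  then show "ennreal (wgt sm xi)*(F xi + G xi)^2 <= 2*(ennreal (wgt sm xi)*(F xi)^2 + ennreal (wgt sm xi)*(G xi)^2)"
   by (simp add: distrib_left mult_ac)
 qed
 also have "... = 2*(hn sm F + hn sm G)" unfolding hn_def by (simp add: nn_integral_cmult nn_integral_add)
 finally show ?thesis .
qed

lemma hn_zero_iff:
 assumes [measurable]: "F \<in> BM"
 shows "hn sm F = 0 \<longleftrightarrow> (AEL xi. F xi = 0)"
 unfolding hn_def by (subst nn_integral_0_iff_AE) (auto simp: power2_eq_square ennreal_eq_0_iff not_le[symmetric])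

lemma hn_reflect:
 assumes [measurable]: "F \<in> BM"
 shows "hn sm (%xi. F (- xi)) = hn sm F"
 unfolding hn_def using nn_integral_lborel_reflect[of "%xi. ennreal (wgt sm xi)*(F xi)^2" 0] by simp

lemma mult_cnj_norm: "z*cnj z = (cx (norm z))^2"
 by (metis complex_norm_square of_real_power)

lemma L2_iff: "f \<in> L2 \<longleftrightarrow> f \<in> BM & hn 0 (en f) < \<infinity>"
 unfolding L2_def hn_def by (auto simp: integrable_iff_bounded ennreal_power)

section \<open>Plancherel's theorem for integrable functions\<close>

text \<open>The autocorrelation \<open>h\<close> of \<open>f\<close> has the transform
  \<open>|FI f|^2/fconst\<close>, and \<open>h 0\<close> is the integral of \<open>|f|^2\<close>.
  Pairing \<open>FI h\<close> with widening Gaussians converges monotonically to its integral, while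
  the dual pairing of \<open>h\<close> with narrowing Gaussians tends to a multiple of
  \<open>h 0\<close>. Boundedness of \<open>f\<close> makes \<open>h\<close> bounded and continuous
  at 0.\<close>

lemma plancherel_bounded:
 fixes f :: "'a::euclidean_space => complex"
 assumes f: "LI f" and B: "!!x. norm (f x) <= B"
 shows "hn 0 (en (FI f)) = hn 0 (en f)"
proof -
 let ?c = "fconst TYPE('a)"
 have c: "?c > 0" by (rule fconst_pos)
 have B0: "0 <= B" using B[of 0] norm_ge_zero order_trans by blast
 have [measurable]: "f \<in> BM" using f by auto
 define f' where "f' = (%y. cnj (f (- y)))"
 have f': "LI f'" unfolding f'_def
  using lborel_reflect(2)[of f 0] f by auto
 have [measurable]: "f' \<in> BM" using f' by auto
 have Ff': "FI f' xi = cnj (FI f xi)" for xi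
 proof -
  have "(%x. cnj (f x)) \<in> BM" by measurable
  from fourier_integral_reflect[OF this] show ?thesis unfolding f'_def cnj_fourier_integral .
 qed
 define h where "h = cconv f f'"
 have h: "LI h" unfolding h_def using fourier_integral_cconv(1)[OF f f'] .
 have [measurable]: "h \<in> BM" using h by auto
 have Fh: "FI h xi = cx ((norm (FI f xi))^2 / ?c)" for xi
  unfolding h_def fourier_integral_cconv(2)[OF f f'] Ff' by (simp add: mult_cnj_norm)
 have h_eq: "h z = (LL y. f (y + z)*cnj (f y))" for z
  using lborel_reflect(1)[of "%y. f (y + z)*cnj (f y)" 0]
  by (simp add: h_def cconv_def f'_def)
 have ifz: "LI (%y. f (y + z))" for z using f by (simp add: lborel_shift(2))
 have iff: "LI (%y. f (y + z)*cnj (f y))" for z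
 proof (rule BI_int_bound[of _ "%y. B*norm (f (y + z))"])
  show "LI (%y. B*norm (f (y + z)))" using ifz[of z] by auto
  show "AEL x. norm (f (x + z)*cnj (f x)) <= norm (B*norm (f (x + z)))"
   using B B0 by (auto simp: norm_mult mult.commute intro!: mult_mono)
 qed measurable
 have h_bound: "norm (h z) <= B*(LL y. norm (f y))" for z
 proof -
  have "norm (h z) <= (LL y. norm (f (y + z)*cnj (f y)))"
   unfolding h_eq by (rule integral_norm_bound)
  also have "... <= (LL y. B*norm (f (y + z)))"
  proof (rule integral_mono)
   show "LI (%y. norm (f (y + z)*cnj (f y)))" using iff by (rule integrable_norm)
   show "LI (%y. B*norm (f (y + z)))" using ifz[of z] by auto
   show "norm (f (y + z)*cnj (f y)) <= B*norm (f (y + z))" for y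
    using B B0 by (auto simp: norm_mult mult.commute intro!: mult_mono)
  qed
  also have "... = B*(LL y. norm (f y))"
   using lborel_shift(1)[of "%y. norm (f y)" z] by simp
  finally show ?thesis .
 qed
 \<comment> \<open>Continuity along each ray: \<open>|h w - h 0|\<close> is at most \<open>B\<close>
   times the \<open>L1\<close> distance between \<open>f\<close> and its translate by
   \<open>w\<close>.\<close>
 have h_cont: "(%n. h (z /\<^sub>R real (Suc n))) ---> h 0" for z
 proof -
  have zn: "(%n. z /\<^sub>R real (Suc n)) ---> 0"
  proof -
   have "(%n. (1/real (Suc n)) *R z) ---> 0 *R z"
    by (intro tendsto_intros LIMSEQ_Suc lim_1_over_n)
   then show ?thesis by (simp add: inverse_eq_divide)
  qed
  have "(%n. ennreal B*(NN x. enm (f (x + z /\<^sub>R real (Suc n)) - f x))) ---> ennreal B*0"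
   by (intro ennreal_tendsto_cmult tendsto_L1_shift f zn) simp
  then have L: "(%n. ennreal B*(NN x. enm (f (x + z /\<^sub>R real (Suc n)) - f x))) ---> 0" by simp
  have "(%n. enm (h (z /\<^sub>R real (Suc n)) - h 0)) ---> 0"
  proof (rule tendsto_sandwich[OF _ _ tendsto_const L])
   have "enm (h w - h 0) <= ennreal B*(NN x. enm (f (x + w) - f x))" for w
   proof -
    have "h w - h 0 = (LL y. f (y + w)*cnj (f y) - f (y + 0)*cnj (f y))"
     unfolding h_eq using iff[of w] iff[of 0] by (subst BI_LINT_diff) auto
    also have "... = (LL y. (f (y + w) - f y)*cnj (f y))"
     by (simp add: left_diff_distrib)
    finally have "enm (h w - h 0) <= (NN y. enm ((f (y + w) - f y)*cnj (f y)))"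
     using norm_integral_le_nn by metis
    also have "... <= (NN y. ennreal B*enm (f (y + w) - f y))"
     using B B0 by (intro nn_integral_mono) (auto simp: norm_mult mult.commute[of B] ennreal_mult[symmetric] intro!: mult_mono ennreal_leI)
    also have "... = ennreal B*(NN x. enm (f (x + w) - f x))"
     by (rule nn_integral_cmult) measurable
    finally show ?thesis .
   qed
   then show "\<forall>\<^sub>F n in sequentially. enm (h (z /\<^sub>R real (Suc n)) - h 0)
    <= ennreal B*(NN x. enm (f (x + z /\<^sub>R real (Suc n)) - f x))"
    by (intro always_eventually allI)
  qed simp
  then have "(%n. norm (h (z /\<^sub>R real (Suc n)) - h 0)) ---> 0"
   by (subst (asm) ennreal_tendsto_0_iff) auto
  then show ?thesis by (simp add: tendsto_norm_zero_iff LIM_zero_iff)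
 qed
 have gi: "LI (%x::'a. cx (gaussian x))" by (rule gaussian_fourier)
 have lim1: "(%n. LL x. h (x /\<^sub>R real (Suc n))*cx (gaussian x)) ---> (LL x. h 0*cx (gaussian (x::'a)))"
 proof (rule integral_dominated_convergence[where w="%x::'a. (B*(LL y. norm (f y)))*gaussian x"])
  show "LI (%x::'a. (B*(LL y. norm (f y)))*gaussian x)"
   using gi integrable_norm[OF gi] by (simp add: gaussian_def)
  show "AEL x. (%n. h (x /\<^sub>R real (Suc n))*cx (gaussian x)) ---> h 0*cx (gaussian x)"
   by (intro AE_I2 tendsto_intros h_cont)
  show "AEL x. norm (h (x /\<^sub>R real (Suc n))*cx (gaussian x)) <= B*(LL y. norm (f y))*gaussian x" for n
   using h_bound by (intro AE_I2) (simp add: norm_mult gaussian_def)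
 qed measurable
 have g0: "(LL x. h 0*cx (gaussian (x::'a))) = h 0/cx ?c"
  using gaussian_fourier(2)[of "0::'a"] by (simp add: gaussian_def)
 define I where "I = (%n. LL xi. (norm (FI f xi))^2*gaussian (xi /\<^sub>R real (Suc n)))"
 \<comment> \<open>After the multiplication formula, the substitution \<open>x / n\<close> moves the
   dilation from the Gaussian to \<open>h\<close>, and the powers of \<open>n\<close>
   cancel.\<close>
 have I_eq: "cx (I n) = cx ?c*(LL x. h (x /\<^sub>R real (Suc n))*cx (gaussian x))" for n
 proof -
  let ?n = "real (Suc n)"
  have n: "?n > 0" by simp
  have "cx (I n) = (LL xi. cx ((norm (FI f xi))^2*gaussian (xi /\<^sub>R ?n)))"
   unfolding I_def by (rule integral_complex_of_real[symmetric])
  also have "... = (LL xi. cx ?c*(FI h xi*cx (gaussian (xi /\<^sub>R ?n))))"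
   unfolding Fh using c by (intro BI_LINT_cong) auto
  also have "... = cx ?c*(LL xi. FI h xi*cx (gaussian (xi /\<^sub>R ?n)))"
   by (rule integral_mult_right_zero)
  also have "(LL xi. FI h xi*cx (gaussian (xi /\<^sub>R ?n)))
   = (LL x. h x*FI (%xi. cx (gaussian (xi /\<^sub>R ?n))) x)"
   by (rule fourier_integral_swap[OF h fourier_integral_gaussian_scaled(1)[OF n]])
  also have "... = (LL x. h x*cx (?n ^ DIM('a)*gaussian (?n *R x)))"
   unfolding fourier_integral_gaussian_scaled(2)[OF n] ..
  also have "... = (1 / ?n) ^ DIM('a) *R (LL x. h ((1 / ?n) *R x)*cx (?n ^ DIM('a)*gaussian (?n *R ((1 / ?n) *R x))))"
   by (intro lborel_scale) simp_all
  also have "... = (1 / ?n) ^ DIM('a) *R (LL x. (?n ^ DIM('a)) *R (h (x /\<^sub>R ?n)*cx (gaussian x)))"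
   by (intro arg_cong2[where f=scaleR] BI_LINT_cong refl) (simp add: scaleR_conv_of_real inverse_eq_divide mult_ac)
  also have "... = (LL x. h (x /\<^sub>R ?n)*cx (gaussian x))"
   by (simp add: power_divide)
  finally show ?thesis .
 qed
 have h0: "h 0 = cx (LL y. (norm (f y))^2)"
  unfolding h_eq integral_complex_of_real[symmetric] by (simp add: mult_cnj_norm)
 have "(%n. cx (I n)) ---> cx ?c*(h 0/cx ?c)"
  unfolding I_eq using lim1 unfolding g0 by (intro tendsto_intros)
 then have I_lim: "I ---> (LL y. (norm (f y))^2)"
  using c unfolding h0 by (simp add: tendsto_of_real_iff flip: of_real_divide of_real_mult)
 have iN: "LI (%xi. (norm (FI f xi))^2*gaussian (xi /\<^sub>R real (Suc n)))" for n
 proof (rule BI_int_bound[of _ "%xi. (?c*(LL x. norm (f x)))^2*norm (cx (gaussian (xi /\<^sub>R real (Suc n))))"])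
  show "LI (%xi::'a. (?c*(LL x. norm (f x)))^2*norm (cx (gaussian (xi /\<^sub>R real (Suc n)))))"
   by (intro integrable_mult_right integrable_norm fourier_integral_gaussian_scaled) simp
  show "AEL x. norm ((norm (FI f x))^2*gaussian (x /\<^sub>R real (Suc n)))
    <= norm ((?c*(LL x. norm (f x)))^2*norm (cx (gaussian (x /\<^sub>R real (Suc n)))))"
   using norm_fourier_integral_le[OF f]
   by (intro AE_I2) (auto simp: gaussian_def abs_mult intro!: mult_right_mono power_mono)
 qed measurable
 have e1: "(NN xi. ennreal ((norm (FI f xi))^2*gaussian (xi /\<^sub>R real (Suc n)))) = ennreal (I n)" for n
  unfolding I_def using iN by (intro nn_integral_eq_integral) (auto simp: gaussian_def)
 have "(%n. NN xi. ennreal ((norm (FI f xi))^2*gaussian (xi /\<^sub>R real (Suc n))))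
   ---> (NN xi. ennreal ((norm (FI f xi))^2))"
 proof (rule nn_integral_LIMSEQ)
  show "incseq (%n (xi::'a). ennreal ((norm (FI f xi))^2*gaussian (xi /\<^sub>R real (Suc n))))"
  proof (intro incseq_SucI le_funI ennreal_leI mult_left_mono)
   fix n and xi :: 'a
   have "norm (xi /\<^sub>R real (Suc (Suc n))) <= norm (xi /\<^sub>R real (Suc n))"
    by (simp add: inverse_eq_divide field_simps mult_left_mono)
   then have "(norm (xi /\<^sub>R real (Suc (Suc n))))^2 <= (norm (xi /\<^sub>R real (Suc n)))^2"
    by (rule power_mono) simp
   then show "gaussian (xi /\<^sub>R real (Suc n)) <= gaussian (xi /\<^sub>R real (Suc (Suc n)))"
    unfolding gaussian_def by simp
  qed simp
  show "(%n. ennreal ((norm (FI f xi))^2*gaussian (xi /\<^sub>R real (Suc n)))) ---> ennreal ((norm (FI f xi))^2)" for xi :: 'a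
  proof (rule tendsto_ennrealI)
   have "(%n. (1/real (Suc n)) *R xi) ---> 0 *R xi"
    by (intro tendsto_intros LIMSEQ_Suc lim_1_over_n)
   then have zn: "(%n. xi /\<^sub>R real (Suc n)) ---> 0" by (simp add: inverse_eq_divide)
   have "(%n. (norm (FI f xi))^2*exp (- (norm (xi /\<^sub>R real (Suc n)))\<^sup>2/2))
     ---> (norm (FI f xi))^2*exp (- (norm (0::'a))\<^sup>2/2)"
    by (intro tendsto_intros zn) simp
   then show "(%n. (norm (FI f xi))^2*gaussian (xi /\<^sub>R real (Suc n))) ---> (norm (FI f xi))^2"
    unfolding gaussian_def by simp
  qed
 qed measurable
 then have "(%n. ennreal (I n)) ---> (NN xi. ennreal ((norm (FI f xi))^2))" unfolding e1 .
 moreover have "(%n. ennreal (I n)) ---> ennreal (LL y. (norm (f y))^2)"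
  by (intro tendsto_ennrealI I_lim)
 ultimately have "(NN xi. ennreal ((norm (FI f xi))^2)) = ennreal (LL y. (norm (f y))^2)"
  by (rule LIMSEQ_unique)
 also have "... = (NN y. ennreal ((norm (f y))^2))"
 proof (rule nn_integral_eq_integral[symmetric])
  show "LI (%y. (norm (f y))^2)"
   using integrable_norm[OF iff[of 0]] by (simp add: norm_mult power2_eq_square)
 qed simp
 finally show ?thesis unfolding hn_def by (simp add: ennreal_power)
qed

lemma ennreal_square_root:
 assumes "N < (\<infinity>::ennreal)"
 obtains A where "0 <= A" "N = (ennreal A)^2"
proof -
 have "N = (ennreal (sqrt (enn2real N)))^2" using assms by (simp add: ennreal_power)
 then show ?thesis using that[of "sqrt (enn2real N)"] by simp
qed

lemma hn0_integral:
 assumes [measurable]: "f \<in> BM" and fin: "hn 0 (en f) < \<infinity>"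
 shows "LI (%x. (norm (f x))^2)"
  and "hn 0 (en f) = ennreal (LL x. (norm (f x))^2)"
proof -
 have e: "hn 0 (en f) = (NN x. ennreal ((norm (f x))^2))"
  unfolding hn_def by (simp add: ennreal_power)
 show i: "LI (%x. (norm (f x))^2)"
  using fin unfolding e by (intro integrableI_bounded) auto
 show "hn 0 (en f) = ennreal (LL x. (norm (f x))^2)"
  unfolding e by (intro nn_integral_eq_integral i) auto
qed

lemma hn_0_nn: "hn 0 (en f) = (NN x. ennreal ((norm (f x))^2))"
 unfolding hn_def by (simp add: ennreal_power)

text \<open>Cutting by amplitude makes an integrable function bounded, as
  \<open>plancherel_bounded\<close> requires, and stays below the function in modulus, as dominated
  convergence requires.\<close>

definition amp_cut :: "('a => complex) => nat => 'a => complex" where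
 "amp_cut f n x = (if norm (f x) <= real n then f x else 0)"

lemma amp_cut:
 fixes f :: "'a::euclidean_space => complex"
 assumes f: "LI f"
 defines "c \<equiv> amp_cut f"
 shows "LI (c n)"
  and "hn 0 (en (FI (c n))) = hn 0 (en (c n))"
  and "norm (c n x) <= norm (f x)"
  and "(%n. c n x) ---> f x"
proof -
 have [measurable]: "f \<in> BM" using f by auto
 have [measurable]: "c n \<in> BM" for n unfolding c_def amp_cut_def[abs_def] by measurable
 show le: "norm (c n x) <= norm (f x)" for n x unfolding c_def amp_cut_def by simp
 show i: "LI (c n)" by (rule BI_int_bound[OF f]) (auto simp: le)
 show "hn 0 (en (FI (c n))) = hn 0 (en (c n))"
  by (rule plancherel_bounded[OF i, of "real n"]) (auto simp: c_def amp_cut_def)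
 obtain N where "norm (f x) <= real N" using real_arch_simple by blast
 then have "eventually (%n. c n x = f x) sequentially"
  unfolding eventually_sequentially c_def amp_cut_def by (intro exI[of _ N]) auto
 then show "(%n. c n x) ---> f x" by (rule tendsto_eventually)
qed

text \<open>Fatou's lemma along the amplitude cuts, whose transforms converge pointwise. The right
  side may be infinite.\<close>

lemma plancherel_le:
 fixes f :: "'a::euclidean_space => complex"
 assumes f: "LI f"
 shows "hn 0 (en (FI f)) <= hn 0 (en f)"
proof -
 define c where "c = amp_cut f"
 note c = amp_cut[OF f, folded c_def]
 have [measurable]: "f \<in> BM" using f by auto
 have [measurable]: "c n \<in> BM" for n using c(1)[of n] by auto
 have lim: "(%n. FI (c n) xi) ---> FI f xi" for xi
  unfolding fourier_integral_eq
  by (intro tendsto_intros integral_dominated_convergence[where w="%x. norm (f x)"] integrable_norm f AE_I2 c(4))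
   (auto simp: norm_mult c(3))
 have "hn 0 (en (FI f)) = (NN xi. liminf (%n. ennreal ((norm (FI (c n) xi))^2)))"
  unfolding hn_0_nn
  by (intro nn_integral_cong lim_imp_Liminf[symmetric] tendsto_ennrealI tendsto_intros lim) simp
 also have "... <= liminf (%n. NN xi. ennreal ((norm (FI (c n) xi))^2))"
  by (rule nn_integral_liminf) measurable
 also have "... <= liminf (%n. hn 0 (en f))"
 proof (intro Liminf_mono always_eventually allI)
  fix n
  have "hn 0 (en (c n)) <= hn 0 (en f)" by (intro hn_mono ennreal_leI c(3))
  then show "(NN xi. ennreal ((norm (FI (c n) xi))^2)) <= hn 0 (en f)"
   unfolding hn_0_nn[symmetric] c(2) .
 qed
 finally show ?thesis by (simp add: Liminf_const)
qed

text \<open>For the remaining inequality write \<open>FI (c n)\<close> as \<open>FI f\<close> minus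
  the transform of \<open>f - c n\<close>. The latter is controlled by \<open>plancherel_le\<close>,
  and Minkowski's inequality with constant 1 keeps the limit sharp.\<close>

theorem plancherel:
 fixes f :: "'a::euclidean_space => complex"
 assumes f: "LI f" and fin: "hn 0 (en f) < \<infinity>"
 shows "hn 0 (en (FI f)) = hn 0 (en f)"
proof (rule antisym[OF plancherel_le[OF f]])
 define c where "c = amp_cut f"
 note c = amp_cut[OF f, folded c_def]
 have [measurable]: "f \<in> BM" using f by auto
 have [measurable]: "c n \<in> BM" for n using c(1)[of n] by auto
 have fin': "(NN x. ennreal ((norm (f x))^2)) < \<infinity>" using fin unfolding hn_0_nn .
 have l1: "(%n. hn 0 (en (c n))) ---> hn 0 (en f)"
  unfolding hn_0_nn
 proof (rule nn_integral_dominated_convergence[where w="%x. ennreal ((norm (f x))^2)"])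
  show "AEL x. (%i. ennreal ((cmod (c i x))^2)) ---> ennreal ((cmod (f x))^2)"
   by (intro AE_I2 tendsto_ennrealI tendsto_intros c(4))
 qed (use fin' c(3) in \<open>auto intro!: ennreal_leI power_mono\<close>)
 have l2: "(%n. hn 0 (en (%x. f x - c n x))) ---> (\<integral>\<^sup>+x. 0 \<partial>(lborel::'a measure))"
  unfolding hn_0_nn
 proof (rule nn_integral_dominated_convergence[where w="%x. ennreal ((norm (f x))^2)"])
  have "(%i. (cmod (f x - c i x))^2) ---> (cmod (f x - f x))^2" for x
   by (intro tendsto_intros c(4))
  then show "AEL x. (%i. ennreal ((cmod (f x - c i x))^2)) ---> 0"
   by (intro AE_I2 tendsto_ennrealI[where x=0, simplified]) simp
  show "AEL x. ennreal ((cmod (f x - c i x))^2) <= ennreal ((cmod (f x))^2)" for i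
   by (intro AE_I2) (auto simp: c_def amp_cut_def)
 qed (use fin' in auto)
 have fin2: "hn 0 (en (%x. f x - c n x)) < \<infinity>" for n
 proof -
  have "hn 0 (en (%x. f x - c n x)) <= hn 0 (en f)" by (intro hn_mono ennreal_leI) (auto simp: c_def amp_cut_def)
  then show ?thesis using fin by (rule le_less_trans)
 qed
 have "hn 0 (en (FI f)) < \<infinity>" using plancherel_le[OF f] fin by (rule le_less_trans)
 then obtain A where A: "0 <= A" "hn 0 (en (FI f)) = (ennreal A)^2" by (rule ennreal_square_root)
 define e where "e = (%n. sqrt (enn2real (hn 0 (en (%x. f x - c n x)))))"
 have e: "hn 0 (en (%x. f x - c n x)) = (ennreal (e n))^2" "0 <= e n" for n
  using fin2[of n] by (auto simp: e_def ennreal_power)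
 have "e ---> 0"
 proof -
  have "(%n. enn2real (hn 0 (en (%x. f x - c n x)))) ---> enn2real 0"
   using l2 by (intro tendsto_enn2real) auto
  then have "e ---> sqrt (enn2real 0)" unfolding e_def by (rule tendsto_real_sqrt)
  then show ?thesis by simp
 qed
 have b: "hn 0 (en (c n)) <= ennreal ((A + e n)^2)" for n
 proof -
  have "hn 0 (en (c n)) = hn 0 (en (FI (c n)))" by (rule c(2)[symmetric])
  also have "... <= hn 0 (%xi. en (FI f) xi + en (FI (%x. f x - c n x)) xi)"
  proof (intro hn_mono)
   fix xi
   have "norm (FI (c n) xi) <= norm (FI f xi) + norm (FI (%x. f x - c n x) xi)"
    using norm_triangle_ineq4[of "FI f xi" "FI (%x. f x - c n x) xi"]
    unfolding fourier_integral_diff[OF f c(1)] by simp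
   then show "enm (FI (c n) xi) <= enm (FI f xi) + enm (FI (%x. f x - c n x) xi)"
    by (simp flip: ennreal_plus)
  qed
  also have "... <= (ennreal A + ennreal (e n))^2"
  proof (intro hn_minkowski)
   have "LI (%x. f x - c n x)" using f c(1) by (rule BI_int_diff)
   then show "hn 0 (en (FI (%x. f x - c n x))) <= (ennreal (e n))^2"
    using plancherel_le e(1) by metis
  qed (use A in auto)
  finally show ?thesis using A(1) e(2)[of n] by (simp add: ennreal_power flip: ennreal_plus)
 qed
 have "(%n. ennreal ((A + e n)^2)) ---> ennreal ((A + 0)^2)"
  by (intro tendsto_ennrealI tendsto_intros \<open>e ---> 0\<close>)
 from LIMSEQ_le[OF l1 this] b have "hn 0 (en f) <= ennreal ((A + 0)^2)" by blast
 then show "hn 0 (en f) <= hn 0 (en (FI f))" using A by (simp add: ennreal_power)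
qed

section \<open>The Fourier-Plancherel transform and its inversion\<close>

definition trunc :: "real => ('a::euclidean_space => complex) => 'a => complex" where
 "trunc R f x = ind (cball 0 R) x *R f x"

lemma trunc_measurable [measurable (raw)]:
 fixes f :: "'b => 'a::euclidean_space => complex"
 assumes [measurable]: "(%(w, x). f w x) \<in> borel_measurable (M \<Otimes>\<^sub>M borel)" "h \<in> borel_measurable M"
 shows "(%w. trunc R (f w) (h w)) \<in> borel_measurable M"
proof -
 have [measurable]: "(%w. f w (h w)) \<in> borel_measurable M"
  using measurable_compose[OF measurable_Pair[OF measurable_ident_sets[OF refl] assms(2)] assms(1)] by simp
 have "trunc R (f w) (h w) = (if norm (h w) <= R then f w (h w) else 0)" for w
  by (simp add: trunc_def indicator_def)
 then show ?thesis by simp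
qed

lemma is_fourier_transform_iff:
 "IFT f g \<longleftrightarrow> f \<in> L2 & g \<in> L2 &
  ((%R. hn 0 (en (%xi. g xi - FI (trunc R f) xi))) \<longlongrightarrow> 0) at_top"
 unfolding is_fourier_transform_def hn_0_nn trunc_def[abs_def] ..

lemma trunc_integrable:
 assumes "f \<in> L2"
 shows "LI (trunc R f)"
proof -
 have [measurable]: "f \<in> BM" and i: "LI (%x. (norm (f x))^2)"
  using assms by (auto simp: L2_def)
 show ?thesis
 proof (rule BI_int_bound[of _ "%x. ind (cball 0 R) x + (norm (f x))^2"])
  show "LI (%x. ind (cball 0 R) x + (norm (f x))^2)"
   by (intro BI_int_add i integrable_real_indicator) (use emeasure_lborel_cball_finite[of "0::'a" R] in auto)
  have "norm (f x) <= 1 + (norm (f x))^2" for x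
  proof -
   have "2*norm (f x) <= 1 + (norm (f x))^2" using sum_squares_bound[of 1 "norm (f x)"] by simp
   then show ?thesis using norm_ge_zero[of "f x"] by linarith
  qed
  then show "AEL x. norm (trunc R f x) <= norm (ind (cball 0 R) x + (norm (f x))^2)"
   by (intro AE_I2) (auto simp: trunc_def indicator_def)
 qed (simp add: trunc_def)
qed

lemma mult_le_sum_squares:
 assumes "0 <= a" "0 <= (b::real)"
 shows "a*b <= a\<^sup>2 + b\<^sup>2"
proof -
 have "2*(a*b) <= a\<^sup>2 + b\<^sup>2" using sum_squares_bound[of a b] by (simp add: mult.assoc)
 moreover have "0 <= a*b" using assms by simp
 ultimately show ?thesis by linarith
qed

lemma cmod_diff_square:
 "(norm (a - b))^2 = (norm a)^2 + (norm b)^2 - 2 * Re (b*cnj a)"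
 by (simp only: cmod_power2 minus_complex.sel times_complex.sel complex_cnj) (simp add: power2_eq_square algebra_simps)

text \<open>Expand the square of \<open>G - FI (trunc R u)\<close>, with \<open>u\<close> the
  claimed inverse transform. Both the cross term and the norm of \<open>FI (trunc R u)\<close> equal
  the mass of \<open>u\<close> in the ball of radius \<open>R\<close>, by the multiplication formula
  and Plancherel, so exactly the mass of \<open>u\<close> outside the ball remains.\<close>

lemma is_fourier_transform_inverse:
 fixes G :: "'a::euclidean_space => complex"
 assumes G: "LI G" and fin: "hn 0 (en G) < \<infinity>"
 shows "IFT (%x. FI G (- x)) G"
proof -
 have [measurable]: "G \<in> BM" using G by auto
 define u where "u = (%x. FI G (- x))"
 have [measurable]: "u \<in> BM" unfolding u_def by measurable
 have hu: "hn 0 (en u) = hn 0 (en G)"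
  unfolding plancherel[OF G fin, symmetric] u_def by (rule hn_reflect[of "en (FI G)"]) measurable
 have uL2: "u \<in> L2" using fin hu by (simp add: L2_iff)
 note iG = hn0_integral[OF _ fin, simplified]
 have fu: "hn 0 (en u) < \<infinity>" using fin hu by simp
 note iu = hn0_integral[OF _ fu, simplified]
 have GU: "(LL x. (norm (G x))^2) = (LL x. (norm (u x))^2)"
  using hu unfolding iG(2) iu(2) by (simp add: ennreal_inj)
 have eq: "hn 0 (en (%xi. G xi - FI (trunc R u) xi))
  = ennreal ((LL x. (norm (u x))^2) - (LL x. ind (cball 0 R) x*(norm (u x))^2))" for R
 proof -
  define t where "t = trunc R u"
  have t: "LI t" unfolding t_def by (rule trunc_integrable[OF uL2])
  have [measurable]: "t \<in> BM" using t by auto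
  have "hn 0 (en t) <= hn 0 (en u)" by (intro hn_mono ennreal_leI) (auto simp: t_def trunc_def indicator_def)
  then have ft: "hn 0 (en t) < \<infinity>" using fu by (rule le_less_trans)
  define F where "F = FI t"
  have [measurable]: "F \<in> BM" unfolding F_def by measurable
  have hF: "hn 0 (en F) = hn 0 (en t)" unfolding F_def by (rule plancherel[OF t ft])
  have fF: "hn 0 (en F) < \<infinity>" using ft hF by simp
  note it = hn0_integral[OF _ ft, simplified] and iF = hn0_integral[OF _ fF, simplified]
  have FT: "(LL x. (norm (F x))^2) = (LL x. (norm (t x))^2)"
   using hF unfolding iF(2) it(2) by (simp add: ennreal_inj)
  have tt: "(norm (t x))^2 = ind (cball 0 R) x*(norm (u x))^2" for x
   by (simp add: t_def trunc_def indicator_def)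
  have iGF: "LI (%x. F x*cnj (G x))"
  proof (rule BI_int_bound[of _ "%x. (norm (F x))^2 + (norm (G x))^2"])
   show "LI (%x. (norm (F x))^2 + (norm (G x))^2)" by (intro BI_int_add iF(1) iG(1))
   show "AEL x. norm (F x*cnj (G x)) <= norm ((norm (F x))^2 + (norm (G x))^2)"
    by (intro AE_I2) (simp add: norm_mult mult_le_sum_squares)
  qed measurable
  have cG: "LI (%x. cnj (G x))" using G by simp
  \<comment> \<open>The transform is moved from the truncation \<open>t\<close> to
    \<open>cnj G\<close>, where it produces \<open>cnj (u x)\<close>.\<close>
  have "(LL x. F x*cnj (G x)) = (LL x. t x*FI (%x. cnj (G x)) x)"
   unfolding F_def by (rule fourier_integral_swap[OF t cG])
  also have "... = (LL x. cx (ind (cball 0 R) x*(norm (u x))^2))"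
  proof (intro BI_LINT_cong refl)
   fix x
   have "FI (%x. cnj (G x)) x = cnj (u x)" unfolding u_def cnj_fourier_integral by simp
   then show "t x*FI (%x. cnj (G x)) x = cx (ind (cball 0 R) x*(norm (u x))^2)"
    by (simp add: t_def trunc_def mult_cnj_norm scaleR_conv_of_real)
  qed
  also have "... = cx (LL x. ind (cball 0 R) x*(norm (u x))^2)"
   by (rule integral_complex_of_real)
  finally have cross: "(LL x. F x*cnj (G x)) = cx (LL x. ind (cball 0 R) x*(norm (u x))^2)" .
  note pw = cmod_diff_square
  have "hn 0 (en (%xi. G xi - F xi)) = (NN x. ennreal ((norm (G x - F x))^2))" by (rule hn_0_nn)
  also have "... = ennreal (LL x. (norm (G x - F x))^2)"
  proof (rule nn_integral_eq_integral)
   show "LI (%x. (norm (G x - F x))^2)"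
    unfolding pw by (intro BI_int_add BI_int_diff integrable_mult_right integrable_Re iG(1) iF(1) iGF)
  qed simp
  also have "(LL x. (norm (G x - F x))^2) = (LL x. (norm (G x))^2) + (LL x. (norm (F x))^2) - 2*(LL x. Re (F x*cnj (G x)))"
  proof -
   have "LI (%x. 2 * Re (F x*cnj (G x)))" by (intro integrable_mult_right integrable_Re iGF)
   then show ?thesis unfolding pw using iG(1) iF(1) by (simp del: times_complex.sel complex_cnj)
  qed
  also have "(LL x. Re (F x*cnj (G x))) = Re (LL x. F x*cnj (G x))"
   by (rule integral_Re[OF iGF])
  finally have X: "hn 0 (en (%xi. G xi - F xi)) = ennreal ((LL x. (norm (G x))^2) + (LL x. (norm (F x))^2) - 2 * Re (LL x. F x*cnj (G x)))" .
  show ?thesis using X[unfolded cross FT GU tt] unfolding F_def t_def by simp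
 qed
 have "((%R. LL x. ind (cball 0 R) x*(norm (u x))^2) \<longlongrightarrow> (LL x. (norm (u x))^2)) at_top"
 proof (rule integral_dominated_convergence_at_top[where w="%x. (norm (u x))^2"])
  show "AEL x. ((%i. ind (cball 0 i) x*(cmod (u x))^2) \<longlongrightarrow> (cmod (u x))^2) at_top"
  proof (rule AE_I2)
   fix x :: 'a
   have "eventually (%R. ind (cball 0 R) x*(cmod (u x))^2 = (cmod (u x))^2) at_top"
    using eventually_ge_at_top[of "norm x"] by eventually_elim (auto simp: indicator_def)
   then show "((%i. ind (cball 0 i) x*(cmod (u x))^2) \<longlongrightarrow> (cmod (u x))^2) at_top" by (rule tendsto_eventually)
  qed
 qed (auto intro!: always_eventually simp: iu(1) indicator_def)
 then have "((%R. ennreal ((LL x. (norm (u x))^2) - (LL x. ind (cball 0 R) x*(norm (u x))^2)))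
  \<longlongrightarrow> ennreal ((LL x. (norm (u x))^2) - (LL x. (norm (u x))^2))) at_top"
  by (intro tendsto_ennrealI tendsto_intros)
 then have "((%R. hn 0 (en (%xi. G xi - FI (trunc R u) xi))) \<longlongrightarrow> 0) at_top"
  unfolding eq by simp
 then show ?thesis
  unfolding is_fourier_transform_iff u_def[symmetric] using uL2 fin by (simp add: L2_iff)
qed

lemma trunc_diff: "trunc R (%x. f x - g x) = (%x. trunc R f x - trunc R g x)"
 by (simp add: trunc_def fun_eq_iff scaleR_diff_right)

lemma L2_measurable: "f \<in> L2 ==> f \<in> BM"
 by (simp add: L2_iff)

lemma L2_diff:
 assumes "f \<in> L2" "g \<in> L2"
 shows "(%x. f x - g x) \<in> L2"
proof -
 note [measurable] = L2_measurable[OF assms(1)] L2_measurable[OF assms(2)]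
 have "hn 0 (en (%x. f x - g x)) <= hn 0 (%x. en f x + en g x)"
  by (intro hn_mono) (simp add: norm_triangle_ineq4 flip: ennreal_plus)
 also have "... <= 2*(hn 0 (en f) + hn 0 (en g))" by (rule hn_add_le) measurable
 also have "... < \<infinity>" using assms by (auto simp: L2_iff ennreal_mult_less_top)
 finally show ?thesis by (simp add: L2_iff)
qed

lemma is_fourier_transform_limit_unique:
 fixes g g' :: "'a::euclidean_space => complex" and F :: "real => 'a => complex"
 assumes [measurable]: "g \<in> BM" "g' \<in> BM" "!!R. F R \<in> BM"
  and l: "((%R. hn 0 (en (%xi. g xi - F R xi))) \<longlongrightarrow> 0) at_top" "((%R. hn 0 (en (%xi. g' xi - F R xi))) \<longlongrightarrow> 0) at_top"
 shows "AEL xi. g xi = g' xi"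
proof -
 have "hn 0 (en (%xi. g xi - g' xi)) <= 2*(hn 0 (en (%xi. g xi - F R xi)) + hn 0 (en (%xi. g' xi - F R xi)))" for R
 proof -
  have "hn 0 (en (%xi. g xi - g' xi)) <= hn 0 (%xi. en (%xi. g xi - F R xi) xi + en (%xi. g' xi - F R xi) xi)"
  proof (intro hn_mono)
   fix xi
   have "norm (g xi - g' xi) <= norm (g xi - F R xi) + norm (g' xi - F R xi)"
    using norm_triangle_ineq4[of "g xi - F R xi" "g' xi - F R xi"] by simp
   then show "ennreal (cmod (g xi - g' xi)) <= ennreal (cmod (g xi - F R xi)) + ennreal (cmod (g' xi - F R xi))"
    by (simp flip: ennreal_plus)
  qed
  also have "... <= 2*(hn 0 (en (%xi. g xi - F R xi)) + hn 0 (en (%xi. g' xi - F R xi)))"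
   by (rule hn_add_le) measurable
  finally show ?thesis .
 qed
 moreover have "((%R. 2*(hn 0 (en (%xi. g xi - F R xi)) + hn 0 (en (%xi. g' xi - F R xi)))) \<longlongrightarrow> 2*(0 + 0)) at_top"
  by (intro ennreal_tendsto_cmult tendsto_add l) simp
 ultimately have "hn 0 (en (%xi. g xi - g' xi)) <= 2*(0 + 0)"
  by (intro tendsto_lowerbound[of _ _ at_top]) auto
 then have "hn 0 (en (%xi. g xi - g' xi)) = 0" by simp
 then have "AEL xi. en (%xi. g xi - g' xi) xi = 0" by (subst (asm) hn_zero_iff) auto
 then show ?thesis by eventually_elim simp
qed

lemma is_fourier_transform_unique:
 assumes "IFT f g" "IFT f g'"
 shows "AEL xi. g xi = g' xi"
proof (rule is_fourier_transform_limit_unique)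
 have [measurable]: "f \<in> BM" using assms by (auto simp: is_fourier_transform_iff intro: L2_measurable)
 show "FI (trunc R f) \<in> BM" for R by measurable
qed (use assms in \<open>auto simp: is_fourier_transform_iff intro: L2_measurable\<close>)

lemma is_fourier_transform_cong_AE:
 assumes "IFT f g" "AEL x. f x = f' x" "AEL x. g x = g' x"
  and [measurable]: "f' \<in> BM" "g' \<in> BM"
 shows "IFT f' g'"
proof -
 have fg: "f \<in> L2" "g \<in> L2" "((%R. hn 0 (en (%xi. g xi - FI (trunc R f) xi))) \<longlongrightarrow> 0) at_top"
  using assms(1) by (auto simp: is_fourier_transform_iff)
 note [measurable] = fg(1,2)[THEN L2_measurable]
 have 1: "hn 0 (en f') = hn 0 (en f)"
  using assms(2) by (auto intro!: hn_cong_AE elim!: eventually_mono)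
 have 4: "hn 0 (en g') = hn 0 (en g)"
  using assms(3) by (auto intro!: hn_cong_AE elim!: eventually_mono)
 have 2: "FI (trunc R f') = FI (trunc R f)" for R
  using assms(2) by (intro ext fourier_integral_cong_AE) (auto simp: trunc_def elim!: eventually_mono)
 have 3: "hn 0 (en (%xi. g' xi - F xi)) = hn 0 (en (%xi. g xi - F xi))" for F
  using assms(3) by (auto intro!: hn_cong_AE elim!: eventually_mono)
 show ?thesis unfolding is_fourier_transform_iff 2 3 using fg 1 4 by (simp add: L2_iff)
qed

text \<open>The distance of the transform to the transform of a truncation is controlled by the tail;
 with constant 2, as only the squared triangle inequality is used.\<close>

lemma is_fourier_transform_trunc_error:
 assumes fg: "IFT f g"
 shows "hn 0 (en (%xi. g xi - FI (trunc n f) xi)) <= 2*hn 0 (en (%x. f x - trunc n f x))"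
proof -
 have L: "f \<in> L2" "g \<in> L2" "((%R. hn 0 (en (%xi. g xi - FI (trunc R f) xi))) \<longlongrightarrow> 0) at_top"
  using fg by (auto simp: is_fourier_transform_iff)
 note [measurable] = L(1,2)[THEN L2_measurable]
 have b: "hn 0 (en (%xi. g xi - FI (trunc n f) xi)) \<le>
   2*(hn 0 (en (%xi. g xi - FI (trunc R f) xi)) + hn 0 (en (%x. f x - trunc n f x)))" if "R >= n" for R
 proof -
  have i: "LI (%x. trunc R f x - trunc n f x)"
   by (intro BI_int_diff trunc_integrable L)
  have "hn 0 (en (%xi. g xi - FI (trunc n f) xi)) <= hn 0 (%xi. en (%xi. g xi - FI (trunc R f) xi) xi
    + en (FI (%x. trunc R f x - trunc n f x)) xi)"
  proof (intro hn_mono)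
   fix xi
   have "norm (g xi - FI (trunc n f) xi) <= norm (g xi - FI (trunc R f) xi) + norm (FI (%x. trunc R f x - trunc n f x) xi)"
    unfolding fourier_integral_diff[OF trunc_integrable[OF L(1)] trunc_integrable[OF L(1)]]
    using norm_triangle_ineq[of "g xi - FI (trunc R f) xi" "FI (trunc R f) xi - FI (trunc n f) xi"] by simp
   then show "enm (g xi - FI (trunc n f) xi) <= enm (g xi - FI (trunc R f) xi) + enm (FI (%x. trunc R f x - trunc n f x) xi)"
    by (simp flip: ennreal_plus)
  qed
  also have "... <= 2*(hn 0 (en (%xi. g xi - FI (trunc R f) xi)) + hn 0 (en (FI (%x. trunc R f x - trunc n f x))))"
   by (rule hn_add_le) measurable
  also have "... <= 2*(hn 0 (en (%xi. g xi - FI (trunc R f) xi)) + hn 0 (en (%x. f x - trunc n f x)))"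
  proof (intro mult_left_mono add_left_mono)
   have "hn 0 (en (FI (%x. trunc R f x - trunc n f x))) <= hn 0 (en (%x. trunc R f x - trunc n f x))"
    by (rule plancherel_le[OF i])
   also have "... <= hn 0 (en (%x. f x - trunc n f x))"
    using that by (intro hn_mono) (auto simp: trunc_def indicator_def)
   finally show "hn 0 (en (FI (%x. trunc R f x - trunc n f x))) <= hn 0 (en (%x. f x - trunc n f x))" .
  qed simp
  finally show ?thesis .
 qed
 have "((%R. 2*(hn 0 (en (%xi. g xi - FI (trunc R f) xi)) + hn 0 (en (%x. f x - trunc n f x)))) \<longlongrightarrow> 2*(0 + hn 0 (en (%x. f x - trunc n f x)))) at_top"
  by (intro ennreal_tendsto_cmult tendsto_add L tendsto_const) simp
 moreover have "eventually (%R. hn 0 (en (%xi. g xi - FI (trunc n f) xi)) \<le>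
   2*(hn 0 (en (%xi. g xi - FI (trunc R f) xi)) + hn 0 (en (%x. f x - trunc n f x)))) at_top"
  using eventually_ge_at_top[of n] by eventually_elim (rule b)
 ultimately have "hn 0 (en (%xi. g xi - FI (trunc n f) xi)) <= 2*(0 + hn 0 (en (%x. f x - trunc n f x)))"
  by (intro tendsto_lowerbound[of _ _ at_top]) auto
 then show ?thesis by simp
qed

text \<open>The inverse transform \<open>u\<close> of \<open>g\<close> has \<open>g\<close> as its
  transform too, so the transforms of the truncations of \<open>f - u\<close> tend to zero in
  \<open>L2\<close>. By Plancherel the truncations themselves do so; as their norms increase with
  \<open>R\<close>, all of them vanish.\<close>

lemma fourier_inversion_L2:
 fixes f g :: "'a::euclidean_space => complex"
 assumes fg: "IFT f g" and g: "LI g"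
 shows "AEL x. f x = FI g (- x)"
proof -
 define u where "u = (%x. FI g (- x))"
 have L: "f \<in> L2" "g \<in> L2" "((%R. hn 0 (en (%xi. g xi - FI (trunc R f) xi))) \<longlongrightarrow> 0) at_top"
  using fg by (auto simp: is_fourier_transform_iff)
 have "IFT u g" unfolding u_def using g L(2) by (intro is_fourier_transform_inverse) (auto simp: L2_iff)
 then have U: "u \<in> L2" "((%R. hn 0 (en (%xi. g xi - FI (trunc R u) xi))) \<longlongrightarrow> 0) at_top"
  by (auto simp: is_fourier_transform_iff)
 note [measurable] = L(1,2)[THEN L2_measurable] U(1)[THEN L2_measurable]
 have D: "(%x. f x - u x) \<in> L2" by (intro L2_diff L U)
 have e: "hn 0 (en (trunc R (%x. f x - u x))) <= 2*(hn 0 (en (%xi. g xi - FI (trunc R u) xi)) + hn 0 (en (%xi. g xi - FI (trunc R f) xi)))" for R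
 proof -
  have i: "LI (trunc R (%x. f x - u x))" by (rule trunc_integrable[OF D])
  have "hn 0 (en (trunc R (%x. f x - u x))) <= hn 0 (en (%x. f x - u x))"
   by (intro hn_mono) (auto simp: trunc_def indicator_def)
  also have "... < \<infinity>" using D by (simp add: L2_iff)
  finally have "hn 0 (en (trunc R (%x. f x - u x))) = hn 0 (en (FI (trunc R (%x. f x - u x))))"
   using plancherel[OF i] by simp
  also have "... <= hn 0 (%xi. en (%xi. g xi - FI (trunc R u) xi) xi + en (%xi. g xi - FI (trunc R f) xi) xi)"
  proof (intro hn_mono)
   fix xi
   have "FI (trunc R (%x. f x - u x)) xi = (g xi - FI (trunc R u) xi) - (g xi - FI (trunc R f) xi)"
    unfolding trunc_diff by (subst fourier_integral_diff) (auto intro!: trunc_integrable L U)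
   then show "ennreal (cmod (FI (trunc R (%x. f x - u x)) xi)) <= ennreal (cmod (g xi - FI (trunc R u) xi)) + ennreal (cmod (g xi - FI (trunc R f) xi))"
    using norm_triangle_ineq4[of "g xi - FI (trunc R u) xi" "g xi - FI (trunc R f) xi"]
    by (simp flip: ennreal_plus)
  qed
  also have "... <= 2*(hn 0 (en (%xi. g xi - FI (trunc R u) xi)) + hn 0 (en (%xi. g xi - FI (trunc R f) xi)))"
   by (rule hn_add_le) measurable
  finally show ?thesis .
 qed
 have lim: "((%R. 2*(hn 0 (en (%xi. g xi - FI (trunc R u) xi)) + hn 0 (en (%xi. g xi - FI (trunc R f) xi)))) \<longlongrightarrow> 2*(0 + 0)) at_top"
  by (intro ennreal_tendsto_cmult tendsto_add L U) simp
 have "hn 0 (en (trunc R (%x. f x - u x))) = 0" for R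
 proof -
  have "eventually (%S. hn 0 (en (trunc R (%x. f x - u x))) <= 2*(hn 0 (en (%xi. g xi - FI (trunc S u) xi)) + hn 0 (en (%xi. g xi - FI (trunc S f) xi)))) at_top"
   using eventually_ge_at_top[of R]
  proof eventually_elim
   case (elim S)
   have "hn 0 (en (trunc R (%x. f x - u x))) <= hn 0 (en (trunc S (%x. f x - u x)))"
    using elim by (intro hn_mono) (auto simp: trunc_def indicator_def)
   then show ?case using e[of S] by (rule order_trans)
  qed
  then have "hn 0 (en (trunc R (%x. f x - u x))) <= 2*(0 + 0)"
   by (intro tendsto_lowerbound[OF lim]) auto
  then show ?thesis by simp
 qed
 then have "AEL x. \<forall>n::nat. en (trunc (real n) (%x. f x - u x)) x = 0"
  unfolding AE_all_countable by (subst (asm) hn_zero_iff) auto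
 then show ?thesis
 proof eventually_elim
  case (elim x)
  obtain n :: nat where "norm x <= real n" using real_arch_simple by blast
  then show ?case using elim[rule_format, of n] by (simp add: trunc_def u_def)
 qed
qed

text \<open>Truncations of a real function are real, so reflecting and conjugating \<open>g\<close>
  preserves its distance to their transforms; uniqueness of the limit gives the symmetry.\<close>

lemma is_fourier_transform_real:
 fixes f g :: "'a::euclidean_space => complex"
 assumes fg: "IFT f g" and r: "!!x. cnj (f x) = f x"
 shows "AEL xi. cnj (g (- xi)) = g xi"
proof (rule is_fourier_transform_unique[OF _ fg])
 have L: "f \<in> L2" "g \<in> L2" "((%R. hn 0 (en (%xi. g xi - FI (trunc R f) xi))) \<longlongrightarrow> 0) at_top"
  using fg by (auto simp: is_fourier_transform_iff)
 note [measurable] = L(1,2)[THEN L2_measurable]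
 have t: "cnj (trunc R f x) = trunc R f x" for R x by (simp add: trunc_def r)
 have "hn 0 (en (%xi. cnj (g (- xi)) - FI (trunc R f) xi)) = hn 0 (en (%xi. g xi - FI (trunc R f) xi))" for R
 proof -
  have "norm (cnj (g (- xi)) - FI (trunc R f) xi) = norm (g (- xi) - FI (trunc R f) (- xi))" for xi
  proof -
   have "FI (trunc R f) xi = cnj (FI (trunc R f) (- xi))"
    unfolding cnj_fourier_integral by (simp add: t)
   then show ?thesis by (metis complex_cnj_diff complex_mod_cnj)
  qed
  then show ?thesis using hn_reflect[of "en (%xi. g xi - FI (trunc R f) xi)" 0] by simp
 qed
 moreover have "hn 0 (en (%xi. cnj (g (- xi)))) = hn 0 (en g)"
  using hn_reflect[of "en g" 0] by simp
 ultimately show "IFT f (%xi. cnj (g (- xi)))"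
  using L by (simp add: is_fourier_transform_iff L2_iff)
qed

section \<open>Integrability of weights and the algebra property\<close>

lemma nn_integral_one_plus_square_powr:
 assumes p: "p > 1/2"
 shows "(NN t. ennreal ((1 + t\<^sup>2) powr (- p))) < (\<infinity>::ennreal)"
proof -
 have pos: "1 + t\<^sup>2 > 0" for t :: real by (simp add: add_pos_nonneg)
 let ?f = "%x::real. x powr (- 2*p)"
 define F where "F = (%x::real. x powr (1 - 2*p)/(1 - 2*p))"
 have tail: "(NN x. ennreal (?f x)*ind {1..} x) = ennreal (0 - F 1)"
 proof (rule nn_integral_FTC_atLeast)
  show "!!x. 1 <= x ==> DERIV F x :> ?f x"
   using p unfolding F_def by (auto intro!: derivative_eq_intros)
  have "((%x::real. x powr (1 - 2*p)/(1 - 2*p)) \<longlongrightarrow> 0/(1 - 2*p)) at_top"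
   using p by (intro tendsto_divide tendsto_neg_powr tendsto_const filterlim_ident) auto
  then show "(F \<longlongrightarrow> 0) at_top" unfolding F_def by simp
 qed auto
 have le: "ennreal ((1 + t\<^sup>2) powr (- p)) <= ind {-1..1} t + (ennreal (?f t)*ind {1..} t + ennreal (?f (0 - t))*ind {1..} (0 - t))" for t :: real
 proof -
  have small: "(1 + t\<^sup>2) powr (- p) <= 1" using powr_mono[of "-p" 0 "1 + t\<^sup>2"] p pos[of t] by simp
  have big: "(1 + t\<^sup>2) powr (- p) <= \<bar>t\<bar> powr (- 2*p)" if "\<bar>t\<bar> >= 1"
  proof -
   have "(1 + t\<^sup>2) powr (- p) <= (t\<^sup>2) powr (- p)" using that p by (intro powr_mono2') auto
   also have "t\<^sup>2 = \<bar>t\<bar> powr 2" using that by (simp add: powr_realpow)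
   finally show ?thesis using that by (simp only: powr_powr) simp
  qed
  consider "-1 <= t & t <= 1" | "t > 1" | "t < -1" by linarith
  then show ?thesis
  proof cases
   case 1
   then have "ennreal ((1 + t\<^sup>2) powr (- p)) <= ind {-1..1} t" using ennreal_leI[OF small] by simp
   then show ?thesis by (rule add_increasing2[rotated]) simp
  next
   case 2 then show ?thesis using ennreal_leI[OF big] by (auto simp: indicator_def)
  next
   case 3 then show ?thesis using ennreal_leI[OF big] by (auto simp: indicator_def)
  qed
 qed
 have "(NN t. ennreal ((1 + t\<^sup>2) powr (- p)))
  <= (NN t. ind {-1..1} t + (ennreal (?f t)*ind {1..} t + ennreal (?f (0 - t))*ind {1..} (0 - t)))"
  by (intro nn_integral_mono le)
 also have "... = (NN t. ind {-1..1::real} t) + ((NN t. ennreal (?f t)*ind {1..} t)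
   + (NN t. ennreal (?f (0 - t))*ind {1..} (0 - t)))"
  by (simp add: nn_integral_add)
 also have "(NN t. ennreal (?f (0 - t))*ind {1..} (0 - t)) = (NN t. ennreal (?f t)*ind {1..} t)"
  by (rule nn_integral_lborel_reflect) measurable
 also have "(NN t. ind {-1..1::real} t) = ennreal 2" by simp
 finally show ?thesis unfolding tail by (rule le_less_trans) simp
qed

definition wint :: "'a::euclidean_space itself => real => real" where
 "wint _ sm = enn2real (NN xi. ennreal (wgt (- sm) (xi::'a)))"

lemma wint_nonneg [simp]: "0 <= wint T sm"
 by (simp add: wint_def)

text \<open>The weight of exponent \<open>- sm\<close> is a product of \<open>d\<close> factors of
  exponent \<open>- sm/d\<close>, and each factor grows when \<open>|xi|^2\<close> is replaced by a
  single squared coordinate. This reduces the claim to dimension one with exponent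
  \<open>p > 1/2\<close>.\<close>

lemma nn_integral_wgt:
 assumes s: "sm > real DIM('a)/2"
 shows "(NN xi. ennreal (wgt (- sm) (xi::'a::euclidean_space))) = ennreal (wint TYPE('a) sm)"
proof -
 define p where "p = sm/real DIM('a)"
 have p: "p > 1/2" using s by (simp add: p_def field_simps)
 have pos: "1 + t\<^sup>2 > 0" for t :: real by (simp add: add_pos_nonneg)
 have le: "wgt (- sm) xi <= (\<Prod>b\<in>Basis. (1 + (xi \<bullet> b)^2) powr (- p))" for xi :: 'a
 proof -
  have "wgt (- sm) xi = (\<Prod>b\<in>(Basis::'a set). (1 + (norm xi)^2) powr (- p))"
   using one_plus_norm2_pos[of xi] by (simp add: wgt_def p_def powr_realpow[symmetric] powr_powr)
  also have "... <= (\<Prod>b\<in>(Basis::'a set). (1 + (xi \<bullet> b)^2) powr (- p))"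
  proof (intro prod_mono conjI powr_mono2')
   fix b :: 'a assume "b \<in> Basis"
   then have "\<bar>xi \<bullet> b\<bar> <= norm xi" by (rule Basis_le_norm)
   then show "1 + (xi \<bullet> b)^2 <= 1 + (norm xi)^2" by (simp add: abs_le_square_iff[symmetric])
  qed (use p pos in auto)
  finally show ?thesis .
 qed
 have "(NN xi. ennreal (wgt (- sm) (xi::'a))) <= (NN xi. (\<Prod>b\<in>Basis. ennreal ((1 + ((xi::'a) \<bullet> b)^2) powr (- p))))"
  by (intro nn_integral_mono) (simp add: prod_ennreal ennreal_leI[OF le])
 also have "... = (\<Prod>b\<in>(Basis::'a set). NN t. ennreal ((1 + t\<^sup>2) powr (- p)))"
  by (rule nn_integral_lborel_prod) auto
 also have "... < \<infinity>"
  using nn_integral_one_plus_square_powr[OF p] by (simp add: power_less_top_ennreal)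
 finally show ?thesis unfolding wint_def by simp
qed

lemma wgt_triangle:
 assumes "0 <= sm"
 shows "wgt sm xi <= 4 powr sm*(wgt sm (xi - et) + wgt sm et)"
proof -
 define m where "m = max (1 + (norm (xi - et))^2) (1 + (norm et)^2)"
 have "norm xi <= norm (xi - et) + norm et" using norm_triangle_ineq[of "xi - et" et] by simp
 then have "(norm xi)^2 <= (norm (xi - et) + norm et)^2" by (intro power_mono) auto
 also have "... <= 2*(norm (xi - et))^2 + 2*(norm et)^2"
  using sum_squares_bound[of "norm (xi - et)" "norm et"] by (simp add: power2_sum)
 finally have "(norm xi)^2 <= 2*(norm (xi - et))^2 + 2*(norm et)^2" .
 moreover have "1 + (norm (xi - et))^2 <= m" "1 + (norm et)^2 <= m" unfolding m_def by simp_all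
 ultimately have "1 + (norm xi)^2 <= 4*m" by linarith
 moreover have m0: "0 < m" unfolding m_def using one_plus_norm2_pos(1)[of et] by simp
 ultimately have "wgt sm xi <= (4*m) powr sm"
  unfolding wgt_def using assms one_plus_norm2_pos(1)[of xi] by (intro powr_mono2) auto
 also have "... = 4 powr sm*m powr sm" using m0 by (simp add: powr_mult)
 also have "m powr sm <= wgt sm (xi - et) + wgt sm et"
  unfolding m_def max_def wgt_def by auto
 finally show ?thesis by simp
qed

text \<open>The constant of \<open>hn_conv\<close>: \<open>4 powr sm\<close> comes from
  \<open>wgt_triangle\<close>, and the 2 from its two summands, each of which integrates to
  \<open>wint\<close>. The root turns it into the constant for norms instead of their
  squares.\<close>

definition kappa :: "'a::euclidean_space itself => real => real" where
 "kappa T sm = sqrt (2*4 powr sm*wint T sm)"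

lemma kappa_nonneg [simp]: "0 <= kappa T sm"
 by (simp add: kappa_def)

lemma wgt_inverse: "wgt sm xi*wgt (- sm) xi = 1"
 using wgt_add[of sm "- sm" xi] by simp

text \<open>The algebra property: one Cauchy--Schwarz with the weight
 \<open>(w(\<xi> - \<eta>) w(\<eta>))\<^sup>\<sigma>\<close>, whose inverse integrates against \<open>w(\<xi>)\<^sup>\<sigma>\<close> to a constant.\<close>

lemma hn_conv:
 fixes F G :: "'a::euclidean_space => ennreal"
 assumes s: "sm > real DIM('a)/2"
  and [measurable]: "F \<in> BM" "G \<in> BM"
 shows "hn sm (%xi. NN et. F (xi - et)*G et) <= ennreal ((kappa TYPE('a) sm)^2)*(hn sm F*hn sm G)"
proof -
 have s0: "0 <= sm" using s by (rule order_trans[OF _ less_imp_le, rotated]) simp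
 define K where "K = ennreal ((kappa TYPE('a) sm)^2)"
 define J where "J = (%xi et::'a. ennreal (wgt sm (xi - et))*(F (xi - et))^2*(ennreal (wgt sm et)*(G et)^2))"
 have [measurable]: "(%(xi, et). J xi et) \<in> BM2" unfolding J_def by measurable
 have K: "ennreal (wgt sm xi)*(NN et. ennreal (wgt (- sm) (xi - et)*wgt (- sm) et)) <= K" for xi :: 'a
 proof -
  have "ennreal (wgt sm xi)*(NN et. ennreal (wgt (- sm) (xi - et)*wgt (- sm) et))
   = (NN et. ennreal (wgt sm xi)*ennreal (wgt (- sm) (xi - et)*wgt (- sm) et))"
   by (rule nn_integral_cmult[symmetric]) measurable
  also have "... <= (NN et. ennreal (4 powr sm)*(ennreal (wgt (- sm) et) + ennreal (wgt (- sm) (xi - et))))"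
  proof (intro nn_integral_mono)
   fix et
   have "wgt sm xi*(wgt (- sm) (xi - et)*wgt (- sm) et) <= (4 powr sm*(wgt sm (xi - et) + wgt sm et))*(wgt (- sm) (xi - et)*wgt (- sm) et)"
    by (intro mult_right_mono wgt_triangle s0) simp
   also have "... = 4 powr sm*((wgt sm (xi - et)*wgt (- sm) (xi - et))*wgt (- sm) et + (wgt sm et*wgt (- sm) et)*wgt (- sm) (xi - et))"
    by (simp add: algebra_simps)
   also have "... = 4 powr sm*(wgt (- sm) et + wgt (- sm) (xi - et))" unfolding wgt_inverse by simp
   finally show "ennreal (wgt sm xi)*ennreal (wgt (- sm) (xi - et)*wgt (- sm) et) <= ennreal (4 powr sm)*(ennreal (wgt (- sm) et) + ennreal (wgt (- sm) (xi - et)))"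
    by (simp add: ennreal_leI flip: ennreal_mult ennreal_plus)
  qed
  also have "... = ennreal (4 powr sm)*((NN et. ennreal (wgt (- sm) (et::'a))) + (NN et. ennreal (wgt (- sm) (xi - et))))"
   by (simp add: nn_integral_cmult nn_integral_add)
  also have "(NN et. ennreal (wgt (- sm) (xi - et))) = (NN et. ennreal (wgt (- sm) (et::'a)))"
   by (rule nn_integral_lborel_reflect) measurable
  also have "ennreal (4 powr sm)*((NN et. ennreal (wgt (- sm) (et::'a))) + (NN et. ennreal (wgt (- sm) (et::'a)))) = K"
   unfolding nn_integral_wgt[OF s] K_def kappa_def by (simp add: algebra_simps flip: ennreal_plus ennreal_mult)
  finally show ?thesis .
 qed
 have CS: "ennreal (wgt sm xi)*(NN et. F (xi - et)*G et)^2 <= K*(NN et. J xi et)" for xi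
 proof -
  define a where "a = (%et::'a. ennreal (sqrt (wgt sm (xi - et)*wgt sm et)))"
  define b where "b = (%et::'a. ennreal (sqrt (wgt (- sm) (xi - et)*wgt (- sm) et)))"
  have [measurable]: "a \<in> BM" "b \<in> BM" unfolding a_def b_def by measurable
  have a2: "(a et)^2 = ennreal (wgt sm (xi - et))*ennreal (wgt sm et)" for et
   unfolding a_def by (simp add: ennreal_power ennreal_mult)
  have b2: "(b et)^2 = ennreal (wgt (- sm) (xi - et)*wgt (- sm) et)" for et
   unfolding b_def by (simp add: ennreal_power)
  have ab: "a et*b et = 1" for et
  proof -
   have "a et*b et = ennreal (sqrt ((wgt sm (xi - et)*wgt (- sm) (xi - et))*(wgt sm et*wgt (- sm) et)))"
    unfolding a_def b_def by (simp add: real_sqrt_mult[symmetric] mult_ac flip: ennreal_mult)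
   then show ?thesis unfolding wgt_inverse by simp
  qed
  have "(NN et. F (xi - et)*G et) = (NN et. (a et*(F (xi - et)*G et))*b et)"
   using ab by (intro nn_integral_cong) (metis mult.assoc mult.commute mult_1)
  then have "(NN et. F (xi - et)*G et)^2 <= (NN et. (a et*(F (xi - et)*G et))^2)*(NN et. (b et)^2)"
   using Cauchy_Schwarz_nn_integral[of "%et. a et*(F (xi - et)*G et)" lborel b] by simp
  also have "(NN et. (a et*(F (xi - et)*G et))^2) = (NN et. J xi et)"
   unfolding power_mult_distrib a2 J_def by (simp add: mult_ac)
  finally have "ennreal (wgt sm xi)*(NN et. F (xi - et)*G et)^2 \<le>
   ennreal (wgt sm xi)*((NN et. J xi et)*(NN et. (b et)^2))"
   by (intro mult_left_mono) auto
  also have "... = (ennreal (wgt sm xi)*(NN et. (b et)^2))*(NN et. J xi et)" by (simp add: mult_ac)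
  also have "... <= K*(NN et. J xi et)" unfolding b2 by (intro mult_right_mono K) simp
  finally show ?thesis .
 qed
 have "hn sm (%xi. NN et. F (xi - et)*G et) <= (NN xi. K*(NN et. J xi et))"
  unfolding hn_def by (intro nn_integral_mono CS)
 also have "... = K*(NN xi. NN et. J xi et)" by (rule nn_integral_cmult) measurable
 also have "(NN xi. NN et. J xi et) = (NN et. NN xi. J xi et)"
  by (rule Fubini_lborel_nn) measurable
 also have "... = (NN et. hn sm F*(ennreal (wgt sm et)*(G et)^2))"
 proof (intro nn_integral_cong)
  fix et :: 'a
  have "(NN xi. J xi et) = (NN xi. ennreal (wgt sm (xi + - et))*(F (xi + - et))^2)*(ennreal (wgt sm et)*(G et)^2)"
   unfolding J_def by (subst nn_integral_multc) auto
  also have "(NN xi. ennreal (wgt sm (xi + - et))*(F (xi + - et))^2) = hn sm F"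
   unfolding hn_def by (rule nn_integral_lborel_shift) measurable
  finally show "(NN xi. J xi et) = hn sm F*(ennreal (wgt sm et)*(G et)^2)" .
 qed
 also have "... = hn sm F*hn sm G" unfolding hn_def by (rule nn_integral_cmult) measurable
 finally show ?thesis unfolding K_def .
qed

text \<open>Cauchy-Schwarz in time followed by Tonelli, in place of Minkowski's integral inequality.
  For bounds uniform in time both give the factor \<open>t\<close> on the level of norms.\<close>

lemma hn_time_integral:
 fixes F :: "real => 'a::euclidean_space => ennreal"
 assumes [measurable]: "(%(t, xi). F t xi) \<in> BM2" and t: "0 <= t"
 shows "hn sm (%xi. NN ta. ind {0..t} ta*F ta xi) <= ennreal t*(NN ta. ind {0..t} ta*hn sm (F ta))"
proof -
 have "(NN ta. ind {0..t} ta*F ta xi)^2 <= ennreal t*(NN ta. ind {0..t} ta*(F ta xi)^2)" for xi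
 proof -
  have "(NN ta. ind {0..t} ta*F ta xi) = (NN ta. ind {0..t} ta*(ind {0..t} ta*F ta xi))"
   by (intro nn_integral_cong) (auto simp: indicator_def)
  also have "(...)^2 <= (NN ta. (ind {0..t} ta)^2)*(NN ta. (ind {0..t} ta*F ta xi)^2)"
   by (rule Cauchy_Schwarz_nn_integral) measurable
  also have "(NN ta. (ind {0..t} ta)^2) = (NN ta. ind {0..t} ta)"
   by (intro nn_integral_cong) (auto simp: indicator_def)
  also have "... = ennreal t" using t by simp
  also have "(NN ta. (ind {0..t} ta*F ta xi)^2) = (NN ta. ind {0..t} ta*(F ta xi)^2)"
   by (intro nn_integral_cong) (auto simp: indicator_def)
  finally show ?thesis .
 qed
 then have "hn sm (%xi. NN ta. ind {0..t} ta*F ta xi)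
  <= (NN xi. ennreal (wgt sm xi)*(ennreal t*(NN ta. ind {0..t} ta*(F ta xi)^2)))"
  unfolding hn_def by (intro nn_integral_mono mult_left_mono) auto
 also have "... = (NN xi. ennreal t*(NN ta. ind {0..t} ta*(ennreal (wgt sm xi)*(F ta xi)^2)))"
  by (intro nn_integral_cong) (simp add: nn_integral_cmult[symmetric] mult_ac)
 also have "... = ennreal t*(NN xi. NN ta. ind {0..t} ta*(ennreal (wgt sm xi)*(F ta xi)^2))"
  by (rule nn_integral_cmult) measurable
 also have "(NN xi. NN ta. ind {0..t} ta*(ennreal (wgt sm xi)*(F ta xi)^2))
   = (NN ta. NN xi. ind {0..t} ta*(ennreal (wgt sm xi)*(F ta xi)^2))"
  by (rule Fubini_lborel_nn) measurable
 also have "... = (NN ta. ind {0..t} ta*hn sm (F ta))"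
  unfolding hn_def by (intro nn_integral_cong nn_integral_cmult) measurable
 finally show ?thesis .
qed

section \<open>Norm bounds as predicates\<close>

text \<open>The bound is a parameter instead of a computed norm: measurability, sign and size travel
  together, and estimates compose like introduction rules.\<close>

definition hb :: "real => ('a::euclidean_space => complex) => real => bool" where
 "hb sm f B \<longleftrightarrow> f \<in> BM & 0 <= B & hn sm (en f) <= ennreal (B\<^sup>2)"

lemma hbD:
 assumes "hb sm f B"
 shows "f \<in> BM" "0 <= B" "hn sm (en f) <= (ennreal B)^2" "hn sm (en f) < \<infinity>"
 using assms by (auto simp: hb_def ennreal_power intro: le_less_trans)

lemma hbI:
 "f \<in> BM ==> 0 <= B ==> hn sm (en f) <= (ennreal B)^2 ==> hb sm f B"
 by (auto simp: hb_def ennreal_power)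

lemma hb_finite:
 assumes "f \<in> BM" "hn sm (en f) < \<infinity>"
 obtains B where "hb sm f B"
proof -
 obtain A where "0 <= A" "hn sm (en f) = (ennreal A)^2" using assms(2) by (rule ennreal_square_root)
 then show ?thesis using that[of A] hbI[OF assms(1), of A sm] by simp
qed

lemma hb_mono_B: "hb sm f A ==> A <= B ==> hb sm f B"
 unfolding hb_def by (auto intro: order_trans ennreal_leI power_mono)

lemma hb_mono_exp: "hb ta f B ==> sm <= ta ==> hb sm f B"
 unfolding hb_def using hn_mono_exp order_trans by blast

lemma hb_le:
 assumes "hb sm g B" "f \<in> BM" "!!xi. norm (f xi) <= norm (g xi)"
 shows "hb sm f B"
 using assms hn_mono[of "en f" "en g" sm] unfolding hb_def by (auto intro: order_trans ennreal_leI)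

lemma hb_add:
 assumes f: "hb sm f A" and g: "hb sm g B"
 shows "hb sm (%xi. f xi + g xi) (A + B)"
proof (rule hbI)
 note [measurable] = hbD(1)[OF f] hbD(1)[OF g]
 show "(%xi. f xi + g xi) \<in> BM" by measurable
 show "0 <= A + B" using hbD(2)[OF f] hbD(2)[OF g] by simp
 have "hn sm (en (%xi. f xi + g xi)) <= hn sm (%xi. en f xi + en g xi)"
  by (intro hn_mono) (simp add: norm_triangle_ineq flip: ennreal_plus)
 also have "... <= (ennreal A + ennreal B)^2"
  by (rule hn_minkowski) (use hbD(3)[OF f] hbD(3)[OF g] in auto)
 finally show "hn sm (en (%xi. f xi + g xi)) <= (ennreal (A + B))^2"
  using hbD(2)[OF f] hbD(2)[OF g] by simp
qed

lemma hb_cmult: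
 assumes f: "hb sm f A" shows "hb sm (%xi. c*f xi) (norm c*A)"
proof (rule hbI)
 note [measurable] = hbD(1)[OF f]
 show "(%xi. c*f xi) \<in> BM" by measurable
 show "0 <= norm c*A" using hbD(2)[OF f] by simp
 have "hn sm (en (%xi. c*f xi)) = (ennreal (norm c))^2*hn sm (en f)"
  by (subst hn_cmult[symmetric]) (auto simp: norm_mult ennreal_mult)
 also have "... <= (ennreal (norm c))^2*(ennreal A)^2" by (intro mult_left_mono hbD(3)[OF f]) simp
 finally show "hn sm (en (%xi. c*f xi)) <= (ennreal (norm c*A))^2"
  using hbD(2)[OF f] by (simp add: ennreal_mult power_mult_distrib)
qed

lemma hb_diff:
 assumes f: "hb sm f A" and g: "hb sm g B"
 shows "hb sm (%xi. f xi - g xi) (A + B)"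
 using hb_add[OF f hb_cmult[OF g, of "-1"]] by simp

lemma hb_zero: "hb sm (%xi. 0) 0"
 unfolding hb_def hn_def by simp

lemma hb_cconv:
 fixes f g :: "'a::euclidean_space => complex"
 assumes s: "sm > real DIM('a)/2" and f: "hb sm f A" and g: "hb sm g B"
 shows "hb sm (cconv f g) (kappa TYPE('a) sm*(A*B))"
proof (rule hbI)
 note [measurable] = hbD(1)[OF f] hbD(1)[OF g]
 show "cconv f g \<in> BM" by measurable
 show "0 <= kappa TYPE('a) sm*(A*B)" using hbD(2)[OF f] hbD(2)[OF g] by simp
 have "hn sm (en (cconv f g)) <= hn sm (%xi. NN et. en f (xi - et)*en g et)"
  using norm_integral_le_nn[of lborel "%et. f (_ - et)*g et"]
  by (intro hn_mono) (simp add: cconv_def norm_mult ennreal_mult)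
 also have "... <= ennreal ((kappa TYPE('a) sm)^2)*(hn sm (en f)*hn sm (en g))"
  by (rule hn_conv[OF s]) measurable
 also have "... <= ennreal ((kappa TYPE('a) sm)^2)*((ennreal A)^2*(ennreal B)^2)"
  by (intro mult_left_mono mult_mono hbD(3) f g) auto
 finally show "hn sm (en (cconv f g)) <= (ennreal (kappa TYPE('a) sm*(A*B)))^2"
  using hbD(2)[OF f] hbD(2)[OF g] by (simp add: ennreal_mult power_mult_distrib ennreal_power[symmetric])
qed

lemma hb_L2: "hb sm f B ==> 0 <= sm ==> f \<in> L2"
 using hb_mono_exp[of sm f B 0] hbD[of 0 f B] by (simp add: L2_iff)

text \<open>Cauchy-Schwarz against the inverse root of the weight, which is square integrable for
  \<open>sm > d/2\<close>. Consequently inverse transforms of such functions are absolutely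
  convergent integrals, defined at every point.\<close>

lemma hb_integrable:
 fixes f :: "'a::euclidean_space => complex"
 assumes s: "sm > real DIM('a)/2" and f: "hb sm f B"
 shows "LI f" and "(LL xi. norm (f xi)) <= sqrt (wint TYPE('a) sm)*B"
proof -
 note [measurable] = hbD(1)[OF f]
 define a where "a = (%xi::'a. ennreal (sqrt (wgt sm xi)))"
 define b where "b = (%xi::'a. ennreal (sqrt (wgt (- sm) xi)))"
 have [measurable]: "a \<in> BM" "b \<in> BM" unfolding a_def b_def by measurable
 have ab: "a xi*b xi = 1" for xi
  unfolding a_def b_def by (simp add: real_sqrt_mult[symmetric] wgt_inverse flip: ennreal_mult)
 have "(NN xi. en f xi) = (NN xi. (a xi*en f xi)*b xi)"
  using ab by (intro nn_integral_cong) (metis mult.assoc mult.commute mult_1)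
 then have "(NN xi. en f xi)^2 <= (NN xi. (a xi*en f xi)^2)*(NN xi. (b xi)^2)"
  using Cauchy_Schwarz_nn_integral[of "%xi. a xi*en f xi" lborel b] by simp
 also have "(NN xi. (a xi*en f xi)^2) = hn sm (en f)"
  unfolding hn_def a_def by (simp add: power_mult_distrib ennreal_power)
 also have "(NN xi. (b xi)^2) = ennreal (wint TYPE('a) sm)"
  unfolding b_def nn_integral_wgt[OF s, symmetric] by (simp add: ennreal_power)
 also have "hn sm (en f)*ennreal (wint TYPE('a) sm) <= (ennreal B)^2*ennreal (wint TYPE('a) sm)"
  by (intro mult_right_mono hbD(3)[OF f]) simp
 also have "... = (ennreal (sqrt (wint TYPE('a) sm)*B))^2"
  using hbD(2)[OF f] by (simp add: ennreal_mult power_mult_distrib ennreal_power mult.commute)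
 finally have le: "(NN xi. en f xi) <= ennreal (sqrt (wint TYPE('a) sm)*B)"
  by (rule power2_le_imp_le_ennreal)
 then show i: "LI f" by (intro integrableI_bounded) (auto intro: le_less_trans)
 have e: "(NN xi. en f xi) = ennreal (LL xi. norm (f xi))"
  by (rule nn_integral_eq_integral) (use i in auto)
 show "(LL xi. norm (f xi)) <= sqrt (wint TYPE('a) sm)*B"
  using le[unfolded e] hbD(2)[OF f] by (subst (asm) ennreal_le_iff) auto
qed

lemma cconv_integrable:
 fixes f g :: "'a::euclidean_space => complex"
 assumes f: "f \<in> L2" and g: "g \<in> L2"
 shows "LI (%et. f (xi - et)*g et)"
proof -
 note [measurable] = L2_measurable[OF f] L2_measurable[OF g]
 have i: "LI (%x. (norm (f x))^2)" "LI (%x. (norm (g x))^2)"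
  using f g by (auto simp: L2_def)
 have i2: "LI (%x. (norm (f (xi - x)))^2)"
  using lborel_reflect(2)[of "%x. (norm (f x))^2" xi] i(1) by simp
 show ?thesis
 proof (rule BI_int_bound[OF BI_int_add[OF i2 i(2)]])
  show "AEL x. norm (f (xi - x)*g x) <= norm ((norm (f (xi - x)))^2 + (norm (g x))^2)"
   by (intro AE_I2) (simp add: norm_mult mult_le_sum_squares)
 qed measurable
qed

lemma cconv_add:
 assumes "f \<in> L2" "g \<in> L2" "h \<in> L2"
 shows "cconv f (%x. g x + h x) xi = cconv f g xi + cconv f h xi"
  and "cconv (%x. g x + h x) f xi = cconv g f xi + cconv h f xi"
  and "cconv f (%x. g x - h x) xi = cconv f g xi - cconv f h xi"
  and "cconv (%x. g x - h x) f xi = cconv g f xi - cconv h f xi"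
 unfolding cconv_def using cconv_integrable[OF assms(1,2), of xi] cconv_integrable[OF assms(1,3), of xi]
  cconv_integrable[OF assms(2,1), of xi] cconv_integrable[OF assms(3,1), of xi]
 by (simp_all add: distrib_left distrib_right left_diff_distrib right_diff_distrib)

lemma cconv_commute:
 assumes [measurable]: "f \<in> BM" "g \<in> BM"
 shows "cconv f g xi = cconv g f xi"
 using lborel_reflect(1)[of "%et. g (xi - et)*f et" xi] unfolding cconv_def by (simp add: mult.commute)

section \<open>Inverse transforms and Sobolev norms\<close>

definition ift :: "('a::euclidean_space => complex) => 'a => complex" where
 "ift G x = FI G (- x)"

lemma borel_measurable_ift [measurable (raw)]:
 fixes f :: "'b => 'a::euclidean_space => complex"
 assumes [measurable]: "(%(w, x). f w x) \<in> borel_measurable (M \<Otimes>\<^sub>M borel)" "h \<in> borel_measurable M"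
 shows "(%w. ift (f w) (h w)) \<in> borel_measurable M"
 unfolding ift_def by measurable

lemma hb_is_fourier_transform_ift:
 fixes G :: "'a::euclidean_space => complex"
 assumes s: "sm > real DIM('a)/2" and G: "hb sm G B"
 shows "IFT (ift G) G"
proof -
 have "0 <= sm" using s by (rule order_trans[OF _ less_imp_le, rotated]) simp
 then show ?thesis unfolding ift_def
  by (intro is_fourier_transform_inverse hb_integrable(1)[OF s G] hbD(4)[OF hb_mono_exp[OF G]])
qed

lemma sobolev_weight: "hn sm (en g) = (NN xi. ennreal ((1 + (norm xi)^2) powr sm*(norm (g xi))^2))"
 unfolding hn_def wgt_def by (simp add: ennreal_mult ennreal_power)

lemma sobolev_norm_eq:
 assumes fg: "IFT f g"
 shows "sobolev_norm sm f = sqrt (enn2real (hn sm (en g)))"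
proof -
 define g' where "g' = (SOME g. IFT f g)"
 have g': "IFT f g'" unfolding g'_def by (rule someI[of "IFT f", OF fg])
 have [measurable]: "g' \<in> BM" using g' by (auto simp: is_fourier_transform_iff intro: L2_measurable)
 have e: "hn sm (en g') = hn sm (en g)"
  using is_fourier_transform_unique[OF g' fg] by (intro hn_cong_AE) (auto elim!: eventually_mono)
 have "(LL xi. (1 + (norm xi)^2) powr sm*(norm (g' xi))^2) = enn2real (hn sm (en g'))"
  unfolding sobolev_weight by (rule integral_eq_nn_integral) auto
 then show ?thesis unfolding sobolev_norm_def g'_def[symmetric] e by simp
qed

lemma sobolev_leI:
 assumes "IFT f g" "hb sm g B"
 shows "sobolev_le sm f B"
proof -
 note [measurable] = hbD(1)[OF assms(2)]
 have "LI (%xi. (1 + (norm xi)^2) powr sm*(norm (g xi))^2)"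
  using hbD(4)[OF assms(2)] unfolding sobolev_weight by (intro integrableI_bounded) auto
 then have "f \<in> sobolev sm" using assms(1) unfolding sobolev_def by blast
 moreover have "enn2real (hn sm (en g)) <= B\<^sup>2"
  using assms(2) by (auto simp: hb_def intro: enn2real_leI)
 then have "sobolev_norm sm f <= B"
  unfolding sobolev_norm_eq[OF assms(1)] using hbD(2)[OF assms(2)] by (simp add: real_le_lsqrt)
 ultimately show ?thesis by (simp add: sobolev_le_def)
qed

lemma sobolevD:
 assumes "f \<in> sobolev sm"
 obtains g where "IFT f g" "hb sm g (sobolev_norm sm f)"
proof -
 obtain g where g: "IFT f g" and i: "LI (%xi. (1 + (norm xi)^2) powr sm*(norm (g xi))^2)"
  using assms by (auto simp: sobolev_def)
 have m: "g \<in> BM" using g by (auto simp: is_fourier_transform_iff intro: L2_measurable)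
 have "hn sm (en g) < \<infinity>" using i unfolding sobolev_weight integrable_iff_bounded by simp
 then have "hb sm g (sobolev_norm sm f)"
  unfolding sobolev_norm_eq[OF g] hb_def using m by simp
 then show ?thesis using that g by blast
qed

lemma sobolev_leD:
 assumes "sobolev_le sm f B"
 obtains g where "IFT f g" "hb sm g B"
 using assms sobolevD[of f sm] hb_mono_B unfolding sobolev_le_def by metis

subsection \<open>Oscillating kernels\<close>

definition om :: "real => 'a::euclidean_space => real" where
 "om ep xi = sqrt (1 + (ep*norm xi)^2)"

definition Om :: "real => 'a::euclidean_space => real" where
 "Om ep xi = om ep xi/ep\<^sup>2"

definition th :: "real => 'a::euclidean_space => real" where
 "th ep xi = 1/ep\<^sup>2 + (norm xi)^2/2"

text \<open>The common shape of the free Klein-Gordon evolution (phase \<open>Om ep\<close>) and of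
  the approximation (phase \<open>th ep\<close>). With an even real phase it maps transforms of real
  functions to transforms of real functions.\<close>

definition trig :: "('a => real) => ('a => complex) => ('a => complex) => real => 'a => complex" where
 "trig b x y t xi = cx (cos (b xi*t))*x xi + cx (sin (b xi*t))*y xi"

text \<open>The fundamental solution of \<open>ep^2*y'' + ep^2*Om^2*y\<close> is
  \<open>sin (Om*t)\<close> divided by \<open>ep^2*Om = om\<close>. Since \<open>om\<close> is at
  least 1, the kernel is bounded by 1 uniformly in \<open>ep\<close>.\<close>

definition duh :: "real => (real => 'a::euclidean_space => complex) => real => 'a => complex" where
 "duh ep F t xi = (LL ta. ind {0..t} ta *R (cx (sin (Om ep xi*(t - ta)) / om ep xi)*F ta xi))"

lemma om_ge_1: "1 <= om ep xi"
 unfolding om_def by simp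

lemma om_pos [simp]: "0 < om ep xi" "om ep xi ~= 0" "0 <= om ep xi"
 using om_ge_1[of ep xi] by linarith+

lemma om_th_measurable [measurable]:
 "om ep \<in> BM" "Om ep \<in> BM" "th ep \<in> BM"
 unfolding om_def[abs_def] Om_def[abs_def] th_def[abs_def] by measurable

lemma om_uminus [simp]: "om ep (- xi) = om ep xi" "Om ep (- xi) = Om ep xi" "th ep (- xi) = th ep xi"
 by (simp_all add: om_def Om_def th_def)

text \<open>The symbol \<open>om ep xi\<close> is the Euclidean norm of the pair of \<open>1\<close>
  and \<open>ep *R xi\<close>, so this is the reverse triangle inequality.\<close>

lemma om_diff: "0 <= ep ==> \<bar>om ep xi - om ep et\<bar> <= ep*norm (xi - et)"
proof -
 assume e: "0 <= ep"
 have "om ep ze = norm (1::real, ep *R ze)" for ze :: 'a using e by (simp add: om_def norm_Pair)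
 then have "\<bar>om ep xi - om ep et\<bar> <= norm ((1::real, ep *R xi) - (1, ep *R et))"
  by (metis norm_triangle_ineq3)
 also have "... = ep*norm (xi - et)" using e by (simp add: norm_Pair flip: scaleR_diff_right)
 finally show ?thesis .
qed

lemma om_le: "om ep xi <= 1 + (ep*norm xi)^2/2"
proof -
 have "1 + (ep*norm xi)^2 <= (1 + (ep*norm xi)^2/2)^2"
  by (simp add: power2_sum)
 then show ?thesis unfolding om_def by (intro real_le_lsqrt) auto
qed

text \<open>Multiplied by \<open>ep^2\<close>, and with \<open>y = ep*|xi - et|\<close>, the phase
  is \<open>om xi +- (1 + y^2/2) +- om et\<close>. If the two \<open>om\<close> have opposite signs,
  they differ by at most \<open>y\<close>, and \<open>1 + y^2/2 - y\<close> is at least 1/2 for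
  every \<open>y\<close>. If both are positive and the middle sign is negative,
  \<open>om >= 1\<close> leaves \<open>1 - y^2/2\<close>, which is at least 1/2 because
  \<open>y <= 1\<close>.\<close>

lemma nonresonance_Om_Om_th:
 fixes xi et :: "'a::euclidean_space"
 assumes e: "0 < ep" and y: "ep*norm (xi - et) <= 1" and d: "d \<in> {1, -1}" and d': "d' \<in> {1, -1}"
 shows "1/(2*ep\<^sup>2) <= \<bar>Om ep xi + d*th ep (xi - et) + d'*Om ep et\<bar>"
proof -
 define y where "y = ep*norm (xi - et)"
 have y: "0 <= y" "y <= 1" using y e by (auto simp: y_def)
 have ab: "\<bar>om ep xi - om ep et\<bar> <= y" unfolding y_def using e by (intro om_diff) simp
 have a: "1 <= om ep xi" "1 <= om ep et" by (rule om_ge_1)+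
 have q: "1/2 <= 1 + y\<^sup>2/2 - y" using zero_le_power2[of "1 - y"] by (simp add: power2_diff)
 have q2: "y\<^sup>2 <= 1" using y by (simp add: power_le_one)
 have q3: "0 <= y\<^sup>2" by simp
 have "1/2 <= \<bar>om ep xi + d*(1 + y\<^sup>2/2) + d' * om ep et\<bar>"
  using d[simplified] d'[simplified] ab a q q2 q3 by - (elim disjE; simp only: mult_1_left mult_minus1; linarith)
 then have "1/2/ep\<^sup>2 <= \<bar>om ep xi + d*(1 + y\<^sup>2/2) + d' * om ep et\<bar>/ep\<^sup>2"
  by (intro divide_right_mono) auto
 also have "\<bar>om ep xi + d*(1 + y\<^sup>2/2) + d' * om ep et\<bar>/ep\<^sup>2 = \<bar>(om ep xi + d*(1 + y\<^sup>2/2) + d' * om ep et)/ep\<^sup>2\<bar>"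
  by simp
 also have "(om ep xi + d*(1 + y\<^sup>2/2) + d' * om ep et)/ep\<^sup>2 = Om ep xi + d*th ep (xi - et) + d'*Om ep et"
  unfolding Om_def th_def y_def using e by (simp add: field_simps power2_eq_square)
 finally show ?thesis by simp
qed

text \<open>The thresholds 1/2 add up to \<open>ep*|xi| <= 1\<close>, hence
  \<open>om xi <= 3/2\<close>. The worst case is the one with two negative signs:
  \<open>om xi\<close> minus at least 2 is at most \<open>- 1/2\<close>.\<close>

lemma nonresonance_Om_th_th:
 fixes xi et :: "'a::euclidean_space"
 assumes e: "0 < ep" and y: "ep*norm (xi - et) <= 1/2" "ep*norm et <= 1/2" and d: "d \<in> {1, -1}" and d': "d' \<in> {1, -1}"
 shows "1/(2*ep\<^sup>2) <= \<bar>Om ep xi + d*th ep (xi - et) + d'*th ep et\<bar>"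
proof -
 define y where "y = ep*norm (xi - et)"
 define z where "z = ep*norm et"
 have yz: "0 <= y" "y <= 1/2" "0 <= z" "z <= 1/2" using y e by (auto simp: y_def z_def)
 have "y\<^sup>2 <= (1/2)^2" "z\<^sup>2 <= (1/2)^2" using yz by (intro power_mono; simp)+
 then have q: "y\<^sup>2 <= 1/4" "z\<^sup>2 <= 1/4" "0 <= y\<^sup>2" "0 <= z\<^sup>2" by (simp_all add: power2_eq_square)
 have "norm xi <= norm (xi - et) + norm et" using norm_triangle_ineq[of "xi - et" et] by simp
 then have "ep*norm xi <= ep*(norm (xi - et) + norm et)" using e by (intro mult_left_mono) auto
 also have "... = y + z" by (simp add: y_def z_def distrib_left)
 finally have "ep*norm xi <= 1" using yz by simp
 then have "(ep*norm xi)^2 <= 1" using e by (intro power_le_one) auto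
 then have a: "om ep xi <= 3/2" "1 <= om ep xi" using om_le[of ep xi] om_ge_1[of ep xi] by auto
 have "1/2 <= \<bar>om ep xi + d*(1 + y\<^sup>2/2) + d'*(1 + z\<^sup>2/2)\<bar>"
  using d[simplified] d'[simplified] a q by - (elim disjE; simp only: mult_1_left mult_minus1; linarith)
 then have "1/2/ep\<^sup>2 <= \<bar>om ep xi + d*(1 + y\<^sup>2/2) + d'*(1 + z\<^sup>2/2)\<bar>/ep\<^sup>2"
  by (intro divide_right_mono) auto
 also have "... = \<bar>(om ep xi + d*(1 + y\<^sup>2/2) + d'*(1 + z\<^sup>2/2))/ep\<^sup>2\<bar>"
  by simp
 also have "(om ep xi + d*(1 + y\<^sup>2/2) + d'*(1 + z\<^sup>2/2))/ep\<^sup>2 = Om ep xi + d*th ep (xi - et) + d'*th ep et"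
  unfolding Om_def th_def y_def z_def using e by (simp add: field_simps power2_eq_square)
 finally show ?thesis by simp
qed

lemma integrable_bounded_Icc:
 fixes f :: "real => 'b::{banach, second_countable_topology}"
 assumes [measurable]: "f \<in> BM" and B: "!!ta. norm (f ta) <= B"
 shows "LI (%ta. ind {s..t} ta *R f ta)"
proof (rule BI_int_bound[of _ "%ta. ind {s..t} ta*B"])
 show "LI (%ta. ind {s..t} ta*B)"
  by (intro integrable_mult_left integrable_real_indicator) (simp_all add: emeasure_lborel_Icc_eq)
 show "AEL x. norm (ind {s..t} x *R f x) <= norm (ind {s..t} x*B)"
  using B by (intro AE_I2) (auto simp: indicator_def intro: order_trans[OF B])
qed measurable

lemma integral_cos_le:
 fixes a b s t :: real
 assumes b: "b ~= 0" and st: "s <= t"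
 shows "\<bar>LL ta. ind {s..t} ta*cos (a + b*ta)\<bar> <= 2/\<bar>b\<bar>"
proof -
 have "(LL ta. ind {s..t} ta *R cos (a + b*ta)) = sin (a + b*t)/b - sin (a + b * s)/b"
 proof (rule integral_FTC_Icc[OF st])
  show "((%ta. sin (a + b*ta)/b) has_vector_derivative cos (a + b*x)) (at x within {s..t})" for x
   using b by (auto intro!: derivative_eq_intros simp: has_real_derivative_iff_has_vector_derivative[symmetric])
  show "continuous_on {s..t} (%ta. cos (a + b*ta))" by (intro continuous_intros)
 qed
 then have "\<bar>LL ta. ind {s..t} ta*cos (a + b*ta)\<bar> = \<bar>sin (a + b*t) - sin (a + b * s)\<bar>/\<bar>b\<bar>"
  by (simp add: diff_divide_distrib flip: abs_divide)
 also have "\<bar>sin (a + b*t) - sin (a + b * s)\<bar> <= 2"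
  using abs_sin_le_one[of "a + b*t"] abs_sin_le_one[of "a + b * s"] by linarith
 finally show ?thesis by (simp add: divide_right_mono)
qed

text \<open>Product-to-sum yields the mean of four cosines with frequencies
  \<open>b1 +- b2 +- b3\<close>. Each integral is at most \<open>2/m\<close>, and so is the
  mean.\<close>

lemma integral_cos_cos_cos_le:
 fixes a1 a2 a3 b1 b2 b3 s t :: real
 assumes m: "m > 0" and st: "s <= t"
  and r: "!!d d'. d \<in> {1,-1} ==> d' \<in> {1,-1::real} ==> m <= \<bar>b1 + d*b2 + d'*b3\<bar>"
 shows "\<bar>LL ta. ind {s..t} ta*(cos (a1 + b1*ta)*cos (a2 + b2*ta)*cos (a3 + b3*ta))\<bar> <= 2/m"
proof -
 define c where "c = (%d d'::real. LL ta. ind {s..t} ta*cos ((a1 + d*a2 + d'*a3) + (b1 + d*b2 + d'*b3)*ta))"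
 have c: "\<bar>c d d'\<bar> <= 2/m" if "d \<in> {1,-1}" "d' \<in> {1,-1}" for d d'
 proof -
  have "b1 + d*b2 + d'*b3 ~= 0" using r[OF that] m by auto
  then have "\<bar>c d d'\<bar> <= 2/\<bar>b1 + d*b2 + d'*b3\<bar>" unfolding c_def by (rule integral_cos_le[OF _ st])
  also have "... <= 2/m" using r[OF that] m by (intro divide_left_mono mult_pos_pos) auto
  finally show ?thesis .
 qed
 have i: "LI (%ta. ind {s..t} ta*cos (a + b*ta))" for a b :: real
  using integrable_bounded_Icc[of "%ta. cos (a + b*ta)" 1 s t] by simp
 have prod: "cos x*cos y*cos z = (cos (x + y + z) + cos (x + y - z) + cos (x - y + z) + cos (x - y - z))/4" for x y z :: real
  by (simp add: cos_add cos_diff sin_add sin_diff algebra_simps)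
 have eq: "ind {s..t} ta*(cos (a1 + b1*ta)*cos (a2 + b2*ta)*cos (a3 + b3*ta))
  = (ind {s..t} ta*cos ((a1 + 1*a2 + 1*a3) + (b1 + 1*b2 + 1*b3)*ta)
  + ind {s..t} ta*cos ((a1 + 1*a2 + (-1)*a3) + (b1 + 1*b2 + (-1)*b3)*ta)
  + ind {s..t} ta*cos ((a1 + (-1)*a2 + 1*a3) + (b1 + (-1)*b2 + 1*b3)*ta)
  + ind {s..t} ta*cos ((a1 + (-1)*a2 + (-1)*a3) + (b1 + (-1)*b2 + (-1)*b3)*ta))/4" for ta
  unfolding prod by (simp add: algebra_simps)
 have "(LL ta. ind {s..t} ta*(cos (a1 + b1*ta)*cos (a2 + b2*ta)*cos (a3 + b3*ta)))
  = (c 1 1 + c 1 (-1) + c (-1) 1 + c (-1) (-1))/4"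
  unfolding eq c_def by (simp only: integral_divide_zero BI_LINT_add BI_int_add i)
 then show ?thesis using c[of 1 1] c[of 1 "-1"] c[of "-1" 1] c[of "-1" "-1"] by simp
qed

lemma integral_cos_cos_cos_trivial:
 fixes a1 a2 a3 b1 b2 b3 s t :: real
 assumes st: "s <= t"
 shows "\<bar>LL ta. ind {s..t} ta*(cos (a1 + b1*ta)*cos (a2 + b2*ta)*cos (a3 + b3*ta))\<bar> <= t - s"
proof -
 have b: "\<bar>cos x*cos y*cos z\<bar> <= 1" for x y z :: real
  unfolding abs_mult by (intro mult_le_one abs_cos_le_one) auto
 have "\<bar>LL ta. ind {s..t} ta*(cos (a1 + b1*ta)*cos (a2 + b2*ta)*cos (a3 + b3*ta))\<bar>
  <= (LL ta. \<bar>indicator {s..t} ta*(cos (a1 + b1*ta)*cos (a2 + b2*ta)*cos (a3 + b3*ta))\<bar>)"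
  by (rule integral_abs_bound)
 also have "... <= (LL ta. ind {s..t} ta)"
 proof (rule integral_mono)
  show "LI (%ta. \<bar>indicator {s..t} ta*(cos (a1 + b1*ta)*cos (a2 + b2*ta)*cos (a3 + b3*ta))\<bar>)"
   using integrable_bounded_Icc[of "%ta. cos (a1 + b1*ta)*cos (a2 + b2*ta)*cos (a3 + b3*ta)" 1 s t] b by auto
  show "LI (ind {s..t} :: real => real)" by (intro integrable_real_indicator) (simp_all add: emeasure_lborel_Icc_eq)
  show "\<bar>indicator {s..t} ta*(cos (a1 + b1*ta)*cos (a2 + b2*ta)*cos (a3 + b3*ta))\<bar> <= ind {s..t} ta" for ta
   using b by (auto simp: indicator_def)
 qed
 also have "... = t - s" using st by simp
 finally show ?thesis .
qed

lemma norm_pow4_le_wgt2: "norm ze ^ 4 <= wgt 2 ze"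
proof -
 have "wgt 2 ze = (1 + (norm ze)^2)^2" using one_plus_norm2_pos[of ze] by (simp add: wgt_def powr_realpow)
 moreover have "norm ze ^ 4 = ((norm ze)^2)^2" by simp
 moreover have "((norm ze)^2)^2 <= (1 + (norm ze)^2)^2" by (intro power_mono) auto
 ultimately show ?thesis by simp
qed

text \<open>Frequencies beyond \<open>1/\<epsilon>\<close> pay for the lack of nonresonance: the trivial bound
 \<open>1/\<epsilon>\<close> is at most \<open>\<epsilon>\<^sup>2\<close> times the weight of order four.\<close>

lemma oscillation_Om_Om_th:
 fixes xi et :: "'a::euclidean_space"
 assumes e: "0 < ep" "ep <= 1" and st: "0 <= s" "s <= t" "t <= 1/ep"
 shows "\<bar>LL ta. ind {s..t} ta*(cos (a1 + Om ep xi*ta)*cos (a2 + th ep (xi - et)*ta)*cos (a3 + Om ep et*ta))\<bar>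
  <= 4*ep\<^sup>2*wgt 2 (xi - et)" (is "\<bar>?I\<bar> <= _")
proof (cases "ep*norm (xi - et) <= 1")
 case True
 have "\<bar>?I\<bar> <= 2/(1/(2*ep\<^sup>2))"
  using e by (intro integral_cos_cos_cos_le st nonresonance_Om_Om_th True) auto
 also have "... = 4*ep\<^sup>2*1" using e by simp
 also have "... <= 4*ep\<^sup>2*wgt 2 (xi - et)" by (intro mult_left_mono wgt_ge_1) auto
 finally show ?thesis .
next
 case False
 have "\<bar>?I\<bar> <= t - s" by (rule integral_cos_cos_cos_trivial[OF st(2)])
 also have "... <= 1/ep" using st by simp
 also have "... <= (1/ep)*(ep*norm (xi - et)) ^ 4"
  using False e by (simp add: divide_right_mono one_le_power)
 also have "... = ep ^ 3*norm (xi - et) ^ 4" using e by (simp add: power_mult_distrib eval_nat_numeral)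
 also have "... <= (4*ep\<^sup>2)*wgt 2 (xi - et)"
 proof (intro mult_mono norm_pow4_le_wgt2)
  have "ep ^ 3 <= ep\<^sup>2" using e by (intro power_decreasing) auto
  then show "ep ^ 3 <= 4*ep\<^sup>2" using zero_le_power2[of ep] by linarith
 qed auto
 finally show ?thesis by simp
qed

lemma oscillation_Om_th_th:
 fixes xi et :: "'a::euclidean_space"
 assumes e: "0 < ep" "ep <= 1" and st: "0 <= s" "s <= t" "t <= 1/ep"
 shows "\<bar>LL ta. ind {s..t} ta*(cos (a1 + Om ep xi*ta)*cos (a2 + th ep (xi - et)*ta)*cos (a3 + th ep et*ta))\<bar>
  <= 16*ep\<^sup>2*(wgt 2 (xi - et)*wgt 2 et)" (is "\<bar>?I\<bar> <= _")
proof (cases "ep*norm (xi - et) <= 1/2 & ep*norm et <= 1/2")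
 case True
 have w: "1*1 <= wgt 2 (xi - et)*wgt 2 et" by (intro mult_mono wgt_ge_1) auto
 have "\<bar>?I\<bar> <= 2/(1/(2*ep\<^sup>2))"
  using e True by (intro integral_cos_cos_cos_le st nonresonance_Om_th_th) auto
 also have "... <= 16*ep\<^sup>2*1" using e by simp
 also have "... <= 16*ep\<^sup>2*(wgt 2 (xi - et)*wgt 2 et)" using w by (intro mult_left_mono) auto
 finally show ?thesis .
next
 case False
 \<comment> \<open>A frequency beyond \<open>1/(2*ep)\<close> satisfies
   \<open>1 <= (2*ep*|ze|) ^ 4\<close>, whence the 16. The trivial bound \<open>1/ep\<close> then
   becomes \<open>16*ep ^ 3*|ze| ^ 4\<close>.\<close>
 have *: "1/ep <= 16*ep\<^sup>2*(wgt 2 ze*w)" if z: "ep*norm ze > 1/2" and w: "1 <= w" for ze :: 'a and w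
 proof -
  have "1 <= (2*(ep*norm ze)) ^ 4" using z by (intro one_le_power) simp
  then have "1 <= 16*(ep*norm ze) ^ 4" by (simp only: power_mult_distrib[of 2]) simp
  then have "1/ep <= 16*(ep*norm ze) ^ 4/ep" using e by (intro divide_right_mono) auto
  also have "... = 16*(ep ^ 3*norm ze ^ 4)" using e by (simp add: power_mult_distrib eval_nat_numeral)
  also have "... <= 16*(ep\<^sup>2*(wgt 2 ze*w))"
  proof (intro mult_left_mono mult_mono)
   show "ep ^ 3 <= ep\<^sup>2" using e by (intro power_decreasing) auto
   have "norm ze ^ 4*1 <= wgt 2 ze*w" using w by (intro mult_mono norm_pow4_le_wgt2) auto
   then show "norm ze ^ 4 <= wgt 2 ze*w" by simp
  qed auto
  finally show ?thesis by simp
 qed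
 have "\<bar>?I\<bar> <= t - s" by (rule integral_cos_cos_cos_trivial[OF st(2)])
 also have "... <= 1/ep" using st by simp
 also have "... <= 16*ep\<^sup>2*(wgt 2 (xi - et)*wgt 2 et)"
  using False *[of "xi - et" "wgt 2 et"] *[of et "wgt 2 (xi - et)"] wgt_ge_1[of 2 et] wgt_ge_1[of 2 "xi - et"]
  by (auto simp: not_le mult.commute)
 finally show ?thesis .
qed

section \<open>Bilinear Duhamel integrals\<close>

text \<open>All sines become cosines with shifted phases, and expanding the product gives four
  integrals of the type bounded by \<open>M\<close>. This is why the oscillation estimates are
  stated for arbitrary shifts \<open>a1\<close>, \<open>a2\<close>, \<open>a3\<close>: they absorb
  both the sines and the dependence on the final time \<open>r\<close>.\<close>

lemma trig_kernel_le:
 fixes b1 b2 b3 s t r M :: real and x2 y2 x3 y3 :: complex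
 assumes M: "!!a1 a2 a3. \<bar>LL ta. ind {s..t} ta*(cos (a1 + b1*ta)*cos (a2 + b2*ta)*cos (a3 + b3*ta))\<bar> <= M"
 shows "norm (LL ta. ind {s..t} ta *R (cx (sin (b1*(r - ta))) *
   ((cx (cos (b2*ta))*x2 + cx (sin (b2*ta))*y2) *
   (cx (cos (b3*ta))*x3 + cx (sin (b3*ta))*y3))))
  <= M*((norm x2 + norm y2)*(norm x3 + norm y3))"
proof -
 define C where "C = (%a2 a3 ta. ind {s..t} ta*(cos ((pi/2 - b1*r) + b1*ta)*cos (a2 + b2*ta)*cos (a3 + b3*ta)))"
 define I where "I = (%a2 a3. LL ta. C a2 a3 ta)"
 have I: "norm (cx (I a2 a3)) <= M" for a2 a3 unfolding I_def C_def using M by simp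
 have sc: "sin (b1*(r - ta)) = cos ((pi/2 - b1*r) + b1*ta)" for ta
  by (simp add: cos_sin_eq right_diff_distrib)
 have ss: "sin z = cos (- (pi/2) + z)" for z :: real unfolding cos_add by simp
 have c1: "cos (b*ta) = cos (0 + b*ta)" for b ta :: real by simp
 have iC: "LI (%ta. cx (C a2 a3 ta)*z)" for a2 a3 z
 proof -
  have b: "\<bar>cos x*cos y*cos z\<bar> <= 1" for x y z :: real
   unfolding abs_mult by (intro mult_le_one abs_cos_le_one) auto
  have "LI (C a2 a3)"
   using integrable_bounded_Icc[of "%ta. cos ((pi/2 - b1*r) + b1*ta)*cos (a2 + b2*ta)*cos (a3 + b3*ta)" 1 s t] b
   unfolding C_def by simp
  then show ?thesis by simp
 qed
 have lc: "(LL ta. cx (C a2 a3 ta)*z) = cx (I a2 a3)*z" for a2 a3 z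
  unfolding I_def by simp
 let ?h = "- (pi/2)"
 have gen: "i*(c*((C2*x2 + S2*y2)*(C3*x3 + S3*y3)))
  = i*(c*C2*C3)*(x2*x3) + i*(c*C2*S3)*(x2*y3) + (i*(c*S2*C3)*(y2*x3) + i*(c*S2*S3)*(y2*y3))"
  for i c C2 S2 C3 S3 :: complex by (simp add: algebra_simps)
 have eq: "ind {s..t} ta *R (cx (sin (b1*(r - ta))) *
   ((cx (cos (b2*ta))*x2 + cx (sin (b2*ta))*y2) *
   (cx (cos (b3*ta))*x3 + cx (sin (b3*ta))*y3)))
  = cx (C 0 0 ta)*(x2*x3) + cx (C 0 ?h ta)*(x2*y3)
   + (cx (C ?h 0 ta)*(y2*x3) + cx (C ?h ?h ta)*(y2*y3))" for ta
  unfolding C_def sc ss[of "b2*ta"] ss[of "b3*ta"] c1[of b2 ta] c1[of b3 ta]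
  by (simp only: scaleR_conv_of_real of_real_mult gen)
 have "(LL ta. ind {s..t} ta *R (cx (sin (b1*(r - ta))) *
   ((cx (cos (b2*ta))*x2 + cx (sin (b2*ta))*y2) *
   (cx (cos (b3*ta))*x3 + cx (sin (b3*ta))*y3))))
  = cx (I 0 0)*(x2*x3) + cx (I 0 ?h)*(x2*y3)
   + (cx (I ?h 0)*(y2*x3) + cx (I ?h ?h)*(y2*y3))"
  unfolding eq by (simp only: BI_LINT_add BI_int_add iC lc)
 also have "norm ... <= (norm (cx (I 0 0))*(norm x2*norm x3) + norm (cx (I 0 ?h))*(norm x2*norm y3))
   + (norm (cx (I ?h 0))*(norm y2*norm x3) + norm (cx (I ?h ?h))*(norm y2*norm y3))"
  unfolding norm_mult[symmetric] by (intro order_trans[OF norm_triangle_ineq] add_mono order_refl norm_triangle_ineq)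
 also have "... <= (M*(norm x2*norm x3) + M*(norm x2*norm y3)) + (M*(norm y2*norm x3) + M*(norm y2*norm y3))"
  by (intro add_mono mult_right_mono I) auto
 also have "... = M*((norm x2 + norm y2)*(norm x3 + norm y3))" by (simp add: algebra_simps)
 finally show ?thesis .
qed

text \<open>Applied with \<open>x\<close> as time: the inner time integral is evaluated first, so
  its oscillation is used before norms are taken in the frequency variable.\<close>

lemma norm_LINT_LINT_le:
 fixes K :: "'b::euclidean_space => 'a::euclidean_space => complex"
 assumes [measurable]: "(%(x,y). K x y) \<in> BM2"
  and fin: "(NN x. NN y. enm (K x y)) < \<infinity>"
 shows "enm (LL x. LL y. K x y) <= (NN y. enm (LL x. K x y))"
 unfolding fubini_lborel(2)[OF assms] by (rule norm_integral_le_nn)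

lemma trig_measurable [measurable (raw)]:
 assumes [measurable]: "b \<in> BM" "x \<in> BM" "y \<in> BM"
  "f \<in> borel_measurable M" "h \<in> measurable M borel"
 shows "(%w. trig b x y (f w) (h w)) \<in> borel_measurable M"
 unfolding trig_def by measurable

lemma duh_measurable [measurable (raw)]:
 fixes F :: "real => 'a::euclidean_space => complex"
 assumes [measurable]: "(%(t, xi). F t xi) \<in> BM2"
  "f \<in> borel_measurable M" "h \<in> borel_measurable M"
 shows "(%w. duh ep F (f w) (h w)) \<in> borel_measurable M"
proof -
 have "(%(w, ta). (if 0 <= ta & ta <= f w then 1 else 0 :: real) *R (cx (sin (Om ep (h w)*(f w - ta)) / om ep (h w))*F ta (h w)))
   \<in> borel_measurable (M \<Otimes>\<^sub>M lborel)" by measurable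
 from sigma_finite_measure.borel_measurable_lebesgue_integral[OF sigma_finite_lborel this]
 show ?thesis unfolding duh_def by (simp add: indicator_def of_bool_def)
qed

lemma sin_div_om_le: "\<bar>sin z / om ep xi\<bar> <= 1"
proof -
 have "\<bar>sin z / om ep xi\<bar> <= 1 / om ep xi" by (simp add: abs_divide divide_right_mono)
 also have "... <= 1" using om_ge_1[of ep xi] by simp
 finally show ?thesis .
qed

lemma norm_trig_le: "norm (trig b x y t xi) <= norm (x xi) + norm (y xi)"
proof -
 have "norm (trig b x y t xi) <= norm (cx (cos (b xi*t))*x xi) + norm (cx (sin (b xi*t))*y xi)"
  unfolding trig_def by (rule norm_triangle_ineq)
 also have "... <= 1*norm (x xi) + 1*norm (y xi)"
  unfolding norm_mult by (intro add_mono mult_right_mono) auto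
 finally show ?thesis by simp
qed

lemma L2_norm_add:
 assumes "f \<in> L2" "g \<in> L2"
 shows "(%x. cx (norm (f x) + norm (g x))) \<in> L2"
proof -
 note [measurable] = L2_measurable[OF assms(1)] L2_measurable[OF assms(2)]
 have "hn 0 (en (%x. cx (norm (f x) + norm (g x)))) <= hn 0 (%x. en f x + en g x)"
  by (intro hn_mono) (simp only: norm_of_real abs_of_nonneg add_nonneg_nonneg norm_ge_zero ennreal_plus order_refl)
 also have "... <= 2*(hn 0 (en f) + hn 0 (en g))" by (rule hn_add_le) measurable
 also have "... < \<infinity>" using assms by (auto simp: L2_iff ennreal_mult_less_top)
 finally show ?thesis by (simp add: L2_iff)
qed

lemma nn_conv_finite:
 assumes "f \<in> L2" "g \<in> L2"
 shows "(NN et. ennreal (norm (f (xi - et))*norm (g et))) < \<infinity>"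
 using cconv_integrable[OF assms, of xi] unfolding integrable_iff_bounded by (simp add: norm_mult)

lemma nn_conv_le:
 assumes f: "hb 0 f A" and g: "hb 0 g B"
 shows "(NN et. ennreal (norm (f (xi - et))*norm (g et))) <= ennreal (A*B)"
proof -
 note [measurable] = hbD(1)[OF f] hbD(1)[OF g]
 have "(NN et. en f (xi - et)*en g et)^2 <= (NN et. (en f (xi - et))^2)*(NN et. (en g et)^2)"
  by (rule Cauchy_Schwarz_nn_integral) measurable
 also have "(NN et. (en f (xi - et))^2) = (NN et. (en f et)^2)"
  by (rule nn_integral_lborel_reflect) measurable
 also have "(NN et. (en f et)^2)*(NN et. (en g et)^2) <= (ennreal A)^2*(ennreal B)^2"
  using hbD(3)[OF f] hbD(3)[OF g] unfolding hn_def by (intro mult_mono) auto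
 also have "... = (ennreal (A*B))^2" using hbD(2)[OF f] hbD(2)[OF g] by (simp add: ennreal_mult power_mult_distrib)
 finally show ?thesis by (simp add: ennreal_mult power2_le_imp_le_ennreal)
qed

lemma cconv_bound:
 assumes f: "hb 0 f A" and g: "hb 0 g B"
 shows "norm (cconv f g xi) <= A*B"
proof -
 have "enm (cconv f g xi) <= (NN et. enm (f (xi - et)*g et))"
  unfolding cconv_def by (rule norm_integral_le_nn)
 also have "... <= ennreal (A*B)" using nn_conv_le[OF f g] by (simp add: norm_mult)
 finally show ?thesis using hbD(2)[OF f] hbD(2)[OF g] by (subst (asm) ennreal_le_iff) auto
qed

lemma duh_integrable:
 fixes F :: "real => 'a::euclidean_space => complex"
 assumes [measurable]: "(%ta. F ta xi) \<in> BM"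
  and B: "!!ta. 0 <= ta ==> ta <= t ==> norm (F ta xi) <= B"
 shows "LI (%ta. ind {0..t} ta *R (cx (sin (Om ep xi*(t - ta)) / om ep xi)*F ta xi))"
proof (rule BI_int_bound[of _ "%ta. ind {0..t} ta*B"])
 show "LI (%ta. ind {0..t} ta*B)"
  by (intro integrable_mult_left integrable_real_indicator) (simp_all add: emeasure_lborel_Icc_eq)
 have "norm (cx (sin (Om ep xi*(t - ta)) / om ep xi)*F ta xi) <= 1*B" if "0 <= ta" "ta <= t" for ta
  unfolding norm_mult norm_of_real by (intro mult_mono sin_div_om_le B that) auto
 then show "AEL x. norm (ind {0..t} x *R (cx (sin (Om ep xi*(t - x)) / om ep xi)*F x xi)) <= norm (ind {0..t} x*B)"
  by (intro AE_I2) (auto simp: indicator_def intro!: order_trans[OF _ abs_ge_self])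
qed measurable

lemma duh_add:
 fixes F G :: "real => 'a::euclidean_space => complex"
 assumes "(%ta. F ta xi) \<in> BM" "(%ta. G ta xi) \<in> BM"
  and "!!ta. 0 <= ta ==> ta <= t ==> norm (F ta xi) <= A" "!!ta. 0 <= ta ==> ta <= t ==> norm (G ta xi) <= B"
 shows "duh ep (%ta xi. F ta xi + G ta xi) t xi = duh ep F t xi + duh ep G t xi"
 unfolding duh_def distrib_left scaleR_add_right
 by (intro BI_LINT_add duh_integrable[where F=F, OF assms(1,3)] duh_integrable[where F=G, OF assms(2,4)])

lemma duh_cong:
 assumes "!!ta. 0 <= ta ==> ta <= t ==> F ta xi = G ta xi"
 shows "duh ep F t xi = duh ep G t xi"
 unfolding duh_def using assms by (intro BI_LINT_cong) (auto simp: indicator_def)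

lemma duh_cmult: "duh ep (%ta xi. c*F ta xi) t xi = c*duh ep F t xi"
proof -
 have "duh ep (%ta xi. c*F ta xi) t xi = (LL ta. c*(ind {0..t} ta *R (cx (sin (Om ep xi*(t - ta)) / om ep xi)*F ta xi)))"
  unfolding duh_def by (intro BI_LINT_cong) (auto simp: scaleR_conv_of_real mult_ac)
 then show ?thesis by (simp only: duh_def integral_mult_right_zero)
qed

lemma hn_duh:
 fixes F :: "real => 'a::euclidean_space => complex"
 assumes [measurable]: "(%(t, xi). F t xi) \<in> BM2" and t: "0 <= t"
 shows "hn sm (en (duh ep F t)) <= ennreal t*(NN ta. ind {0..t} ta*hn sm (en (F ta)))"
proof -
 have "hn sm (en (duh ep F t)) <= hn sm (%xi. NN ta. ind {0..t} ta*en (F ta) xi)"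
 proof (rule hn_mono)
  fix xi
  have "enm (duh ep F t xi) <= (NN ta. enm (ind {0..t} ta *R (cx (sin (Om ep xi*(t - ta)) / om ep xi)*F ta xi)))"
   unfolding duh_def by (rule norm_integral_le_nn)
  also have "... <= (NN ta. ind {0..t} ta*en (F ta) xi)"
  proof (intro nn_integral_mono)
   fix ta
   have "norm (cx (sin (Om ep xi*(t - ta)) / om ep xi)*F ta xi) <= 1*norm (F ta xi)"
    unfolding norm_mult norm_of_real by (intro mult_right_mono sin_div_om_le) auto
   then show "enm (ind {0..t} ta *R (cx (sin (Om ep xi*(t - ta)) / om ep xi)*F ta xi)) <= ind {0..t} ta*en (F ta) xi"
    by (auto simp: indicator_def intro: ennreal_leI)
  qed
  finally show "enm (duh ep F t xi) <= (NN ta. ind {0..t} ta*en (F ta) xi)" .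
 qed
 also have "... <= ennreal t*(NN ta. ind {0..t} ta*hn sm (en (F ta)))"
  by (rule hn_time_integral[OF _ t]) measurable
 finally show ?thesis .
qed

lemma nn_integral_indicator_le:
 assumes "!!ta. 0 <= ta ==> ta <= t ==> f ta <= C" "0 <= t"
 shows "(NN ta. ind {0..t} ta*f ta) <= ennreal t*(C::ennreal)"
proof -
 have "(NN ta. ind {0..t} ta*f ta) <= (NN ta. C*ind {0..t} ta)"
  using assms by (intro nn_integral_mono) (auto simp: indicator_def)
 also have "... = C*emeasure lborel {0..t}" by (rule nn_integral_cmult_indicator) simp
 finally show ?thesis using assms(2) by (simp add: mult.commute)
qed

text \<open>The bound without oscillation. On times up to \<open>T/ep\<close> it loses a factor
  \<open>1/ep\<close>, which the quadratic term of the remainder, of size \<open>ep^2\<close>, can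
  afford.\<close>

lemma hb_duh:
 fixes F :: "real => 'a::euclidean_space => complex"
 assumes m [measurable]: "(%(t, xi). F t xi) \<in> BM2" and t: "0 <= t"
  and B: "!!ta. 0 <= ta ==> ta <= t ==> hb sm (F ta) B"
 shows "hb sm (duh ep F t) (t*B)"
proof (rule hbI)
 show "duh ep F t \<in> BM" by measurable
 show "0 <= t*B" using t hbD(2)[OF B[of 0]] by simp
 have "hn sm (en (duh ep F t)) <= ennreal t*(NN ta. ind {0..t} ta*hn sm (en (F ta)))"
  by (rule hn_duh[OF m t])
 also have "... <= ennreal t*(ennreal t*(ennreal B)^2)"
  by (intro mult_left_mono nn_integral_indicator_le hbD(3) B t) auto
 also have "... = (ennreal (t*B))^2"
  using t hbD(2)[OF B[of 0]] by (simp add: ennreal_mult power_mult_distrib power2_eq_square mult_ac)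
 finally show "hn sm (en (duh ep F t)) <= (ennreal (t*B))^2" .
qed

text \<open>For fixed \<open>xi\<close> the time integral is pulled inside the convolution integral
  over \<open>et\<close>. There the amplitudes are constants, and the three phases at
  \<open>xi\<close>, \<open>xi - et\<close> and \<open>et\<close> are exposed to the bound
  \<open>M et\<close>.\<close>

lemma duh_cconv_trig_le:
 fixes b2 b3 :: "'a::euclidean_space => real"
 assumes [measurable]: "b2 \<in> BM" "b3 \<in> BM"
  and L: "x2 \<in> L2" "y2 \<in> L2" "x3 \<in> L2" "y3 \<in> L2" and t: "0 <= t"
  and M: "!!et a1 a2 a3. \<bar>LL ta. ind {0..t} ta*(cos (a1 + Om ep xi*ta)*cos (a2 + b2 (xi - et)*ta)*cos (a3 + b3 et*ta))\<bar> <= M et"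
 shows "enm (duh ep (%ta. cconv (trig b2 x2 y2 ta) (trig b3 x3 y3 ta)) t xi)
  <= (NN et. ennreal (M et*((norm (x2 (xi - et)) + norm (y2 (xi - et)))*(norm (x3 et) + norm (y3 et)))))"
proof -
 note [measurable] = L[THEN L2_measurable]
 define K where "K = (%ta et. ind {0..t} ta *R (cx (sin (Om ep xi*(t - ta)) / om ep xi)*(trig b2 x2 y2 ta (xi - et)*trig b3 x3 y3 ta et)))"
 define X2 where "X2 = (%ze. cx (norm (x2 ze) + norm (y2 ze)))"
 define X3 where "X3 = (%ze. cx (norm (x3 ze) + norm (y3 ze)))"
 have X: "X2 \<in> L2" "X3 \<in> L2" unfolding X2_def X3_def by (intro L2_norm_add L)+
 note [measurable] = X[THEN L2_measurable]
 have [measurable]: "(%(ta, et). K ta et) \<in> BM2"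
  unfolding K_def indicator_def by measurable
 have "(NN ta. NN et. enm (K ta et)) <= (NN ta. ind {0..t} ta*(NN et. ennreal (norm (X2 (xi - et))*norm (X3 et))))"
 proof (intro nn_integral_mono)
  fix ta
  have "norm (cx (sin (Om ep xi*(t - ta)) / om ep xi)*(trig b2 x2 y2 ta (xi - et)*trig b3 x3 y3 ta et))
   <= 1*(norm (X2 (xi - et))*norm (X3 et))" for et
   unfolding norm_mult norm_of_real X2_def X3_def
   by (intro mult_mono sin_div_om_le order_trans[OF norm_trig_le]) auto
  then have "enm (K ta et) <= ind {0..t} ta*ennreal (norm (X2 (xi - et))*norm (X3 et))" for et
   unfolding K_def by (auto simp: indicator_def intro: ennreal_leI)
  then have "(NN et. enm (K ta et)) <= (NN et. ind {0..t} ta*ennreal (norm (X2 (xi - et))*norm (X3 et)))"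
   by (intro nn_integral_mono)
  also have "... = ind {0..t} ta*(NN et. ennreal (norm (X2 (xi - et))*norm (X3 et)))"
   by (intro nn_integral_cmult) measurable
  finally show "(NN et. enm (K ta et)) <= ind {0..t} ta*(NN et. ennreal (norm (X2 (xi - et))*norm (X3 et)))" .
 qed
 also have "... <= ennreal t*(NN et. ennreal (norm (X2 (xi - et))*norm (X3 et)))"
  by (intro nn_integral_indicator_le t) simp
 also have "... < \<infinity>" using nn_conv_finite[OF X, of xi] by (simp add: ennreal_mult_less_top)
 finally have fin: "(NN ta. NN et. enm (K ta et)) < \<infinity>" .
 have "duh ep (%ta. cconv (trig b2 x2 y2 ta) (trig b3 x3 y3 ta)) t xi = (LL ta. LL et. K ta et)"
  unfolding duh_def cconv_def K_def by simp
 then have "enm (duh ep (%ta. cconv (trig b2 x2 y2 ta) (trig b3 x3 y3 ta)) t xi) <= (NN et. enm (LL ta. K ta et))"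
  using norm_LINT_LINT_le[OF _ fin] by simp
 also have "... <= (NN et. ennreal (M et*((norm (x2 (xi - et)) + norm (y2 (xi - et)))*(norm (x3 et) + norm (y3 et)))))"
 proof (intro nn_integral_mono ennreal_leI)
  fix et
  define J where "J = (LL ta. ind {0..t} ta *R (cx (sin (Om ep xi*(t - ta)))*(trig b2 x2 y2 ta (xi - et)*trig b3 x3 y3 ta et)))"
  have "(LL ta. K ta et) = (LL ta. cx (1 / om ep xi)*(ind {0..t} ta *R (cx (sin (Om ep xi*(t - ta)))*(trig b2 x2 y2 ta (xi - et)*trig b3 x3 y3 ta et))))"
   unfolding K_def by (intro BI_LINT_cong) (auto simp: scaleR_conv_of_real)
  then have "(LL ta. K ta et) = cx (1 / om ep xi)*J" by (simp only: J_def integral_mult_right_zero)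
  then have "norm (LL ta. K ta et) = norm J / om ep xi" by (simp add: norm_mult norm_divide)
  also have "... <= norm J/1" using om_ge_1[of ep xi] by (intro divide_left_mono) auto
  also have "norm J <= M et*((norm (x2 (xi - et)) + norm (y2 (xi - et)))*(norm (x3 et) + norm (y3 et)))"
   unfolding J_def trig_def by (rule trig_kernel_le[OF M])
  finally show "norm (LL ta. K ta et) <= M et*((norm (x2 (xi - et)) + norm (y2 (xi - et)))*(norm (x3 et) + norm (y3 et)))" by simp
 qed
 finally show ?thesis .
qed

text \<open>The key estimate for double Duhamel integrals. Nothing is known about the source
  \<open>g\<close>, which depends on the inner time \<open>s\<close>. Exchanging the integrals
  leaves an integral over the outer time between \<open>s\<close> and \<open>t\<close> whose factors
  oscillate with phases \<open>Om\<close> at \<open>xi\<close>, \<open>th\<close> at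
  \<open>xi - et\<close> and \<open>Om\<close> at \<open>et\<close>, the last one coming from the
  inner Duhamel kernel. It gains \<open>ep^2\<close>, and the weight \<open>wgt 2\<close> falls on
  \<open>p\<close> and \<open>q\<close> only.\<close>

lemma duh_cconv_app_duh_le:
 fixes p q :: "'a::euclidean_space => complex"
 assumes e: "0 < ep" "ep <= 1" and L: "p \<in> L2" "q \<in> L2" and t: "0 <= t" "t <= 1/ep"
  and g [measurable]: "(%(t, xi). g t xi) \<in> BM2"
  and B: "!!ta. 0 <= ta ==> ta <= t ==> hb 0 (g ta) B"
 shows "enm (duh ep (%ta. cconv (trig (th ep) p q ta) (duh ep g ta)) t xi)
  <= (NN s. ind {0..t} s*(NN et. ennreal (8*ep\<^sup>2*(wgt 2 (xi - et)*(norm (p (xi - et)) + norm (q (xi - et)))))*en (g s) et))"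
proof -
 note [measurable] = L[THEN L2_measurable]
 define S where "S = (%ta. cx (sin (Om ep xi*(t - ta)) / om ep xi))"
 define k where "k = (%ta s et. ind {0..ta} s *R (cx (sin (Om ep et*(ta - s)) / om ep et)*g s et))"
 define K where "K = (%ta z. ind {0..t} ta *R (S ta*(trig (th ep) p q ta (xi - snd z)*k ta (fst z) (snd z))))"
 define X where "X = (%ze. cx (norm (p ze) + norm (q ze)))"
 have normX: "norm (X ze) = norm (p ze) + norm (q ze)" for ze by (simp add: X_def del: of_real_add)
 have X: "X \<in> L2" unfolding X_def by (intro L2_norm_add L)
 have [measurable]: "X \<in> BM" using X by (rule L2_measurable)
 have [measurable]: "S \<in> BM" unfolding S_def by measurable
 have [measurable]: "(%(ta, s, et). k ta s et) \<in> borel_measurable (borel \<Otimes>\<^sub>M borel \<Otimes>\<^sub>M borel)"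
  unfolding k_def indicator_def atLeastAtMost_iff by measurable
 then have [measurable]: "(%x. k (fst x) (fst (snd x)) (snd (snd x))) \<in> borel_measurable (borel \<Otimes>\<^sub>M borel \<Otimes>\<^sub>M borel)"
  by (simp add: case_prod_unfold)
 have S1: "norm (S ta) <= 1" for ta unfolding S_def norm_of_real by (rule sin_div_om_le)
 have k1: "norm (k ta s et) <= ind {0..ta} s*norm (g s et)" for ta s et
 proof -
  have "norm (cx (sin (Om ep et*(ta - s)) / om ep et)*g s et) <= 1*norm (g s et)"
   unfolding norm_mult norm_of_real by (intro mult_right_mono sin_div_om_le) auto
  then show ?thesis unfolding k_def by (auto simp: indicator_def)
 qed
 obtain A where A: "hb 0 X A" using X unfolding L2_iff by (metis hb_finite)
 have fin0: "(NN s. NN et. enm (trig (th ep) p q ta (xi - et)*k ta s et)) <= ennreal t*ennreal (A*B)" if ta: "ta <= t" for ta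
 proof -
  have "(NN s. NN et. enm (trig (th ep) p q ta (xi - et)*k ta s et))
   <= (NN s. ind {0..t} s*(NN et. ennreal (norm (X (xi - et))*norm (g s et))))"
  proof (intro nn_integral_mono)
   fix s
   have "enm (trig (th ep) p q ta (xi - et)*k ta s et) <= ind {0..t} s*ennreal (norm (X (xi - et))*norm (g s et))" for et
   proof -
    have "norm (trig (th ep) p q ta (xi - et)*k ta s et) <= norm (X (xi - et))*(ind {0..ta} s*norm (g s et))"
     unfolding norm_mult normX by (intro mult_mono norm_trig_le k1) auto
    also have "... <= norm (X (xi - et))*(ind {0..t} s*norm (g s et))"
     using ta by (intro mult_left_mono mult_right_mono) (auto simp: indicator_def)
    also have "... = ind {0..t} s*(norm (X (xi - et))*norm (g s et))" by simp
    finally have "enm (trig (th ep) p q ta (xi - et)*k ta s et) <= ennreal (ind {0..t} s*(norm (X (xi - et))*norm (g s et)))"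
     by (rule ennreal_leI)
    also have "... = ind {0..t} s*ennreal (norm (X (xi - et))*norm (g s et))"
     by (simp add: ennreal_mult ennreal_indicator)
    finally show ?thesis .
   qed
   then have "(NN et. enm (trig (th ep) p q ta (xi - et)*k ta s et)) <= (NN et. ind {0..t} s*ennreal (norm (X (xi - et))*norm (g s et)))"
    by (intro nn_integral_mono)
   also have "... = ind {0..t} s*(NN et. ennreal (norm (X (xi - et))*norm (g s et)))"
    by (intro nn_integral_cmult) measurable
   finally show "(NN et. enm (trig (th ep) p q ta (xi - et)*k ta s et)) <= ind {0..t} s*(NN et. ennreal (norm (X (xi - et))*norm (g s et)))" .
  qed
  also have "... <= ennreal t*ennreal (A*B)"
   by (intro nn_integral_indicator_le nn_conv_le[OF A] B t)
  finally show ?thesis .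
 qed
 have inner: "ind {0..t} ta *R (S ta*cconv (trig (th ep) p q ta) (duh ep g ta) xi) = (LL z. K ta z)" for ta
 proof (cases "ta \<in> {0..t}")
  case False then show ?thesis unfolding K_def by simp
 next
  case True
  define H where "H = (%s et. trig (th ep) p q ta (xi - et)*k ta s et)"
  have m: "(%(s, et). H s et) \<in> BM2" unfolding H_def by measurable
  have f: "(NN s. NN et. enm (H s et)) < \<infinity>"
   unfolding H_def by (rule le_less_trans[OF fin0]) (use True in \<open>auto simp: ennreal_mult_less_top\<close>)
  have "cconv (trig (th ep) p q ta) (duh ep g ta) xi = (LL et. LL s. H s et)"
   unfolding cconv_def duh_def H_def k_def by (simp only: integral_mult_right_zero)
  also have "... = (LL s. LL et. H s et)" by (rule fubini_lborel(2)[OF m f, symmetric])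
  also have "... = (LL z. H (fst z) (snd z))" by (rule fubini_lborel(7)[OF m f, symmetric])
  finally show ?thesis using True unfolding K_def H_def by simp
 qed
 have [measurable]: "(%(ta, z). K ta z) \<in> BM2"
  unfolding K_def borel_prod[symmetric] indicator_def by measurable
 have "(NN ta. NN z. enm (K ta z)) <= (NN ta. ind {0..t} ta*(ennreal t*ennreal (A*B)))"
 proof (intro nn_integral_mono)
  fix ta
  show "(NN z. enm (K ta z)) <= ind {0..t} ta*(ennreal t*ennreal (A*B))"
  proof (cases "ta \<in> {0..t}")
   case False then show ?thesis unfolding K_def by simp
  next
   case True
   have "(NN z. enm (K ta z)) <= (NN z. enm (trig (th ep) p q ta (xi - snd z)*k ta (fst z) (snd z)))"
    unfolding K_def using True S1[of ta]
    by (intro nn_integral_mono ennreal_leI) (simp add: norm_mult mult_left_le_one_le)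
   also have "... = (NN s. NN et. enm (trig (th ep) p q ta (xi - et)*k ta s et))"
    unfolding lborel_prod[symmetric] by (subst lborel.nn_integral_fst[symmetric]) auto
   finally show ?thesis using fin0[of ta] True by simp
  qed
 qed
 also have "... <= ennreal t*(ennreal t*ennreal (A*B))" by (intro nn_integral_indicator_le t) simp
 also have "... < \<infinity>" by (simp add: ennreal_mult_less_top)
 finally have fin: "(NN ta. NN z. enm (K ta z)) < \<infinity>" .
 have "duh ep (%ta. cconv (trig (th ep) p q ta) (duh ep g ta)) t xi = (LL ta. LL z. K ta z)"
  unfolding inner[symmetric] S_def by (simp add: duh_def[of ep "%ta. cconv (trig (th ep) p q ta) (duh ep g ta)"])
 then have "enm (duh ep (%ta. cconv (trig (th ep) p q ta) (duh ep g ta)) t xi) <= (NN z. enm (LL ta. K ta z))"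
  using norm_LINT_LINT_le[OF _ fin] by simp
 also have "... <= (NN z. ind {0..t} (fst z)*(ennreal (8*ep\<^sup>2*(wgt 2 (xi - snd z)*(norm (p (xi - snd z)) + norm (q (xi - snd z)))))*en (g (fst z)) (snd z)))"
 proof (intro nn_integral_mono)
  fix z :: "real \<times> 'a"
  obtain s et where z: "z = (s, et)" by (cases z)
  show "enm (LL ta. K ta z) <= ind {0..t} (fst z)*(ennreal (8*ep\<^sup>2*(wgt 2 (xi - snd z)*(norm (p (xi - snd z)) + norm (q (xi - snd z)))))*en (g (fst z)) (snd z))"
  proof (cases "s \<in> {0..t}")
   case False
   then have "K ta z = 0" for ta unfolding K_def k_def z by (auto simp: indicator_def)
   then show ?thesis by simp
  next
   case True
   define c where "c = cx (1 / om ep xi)*(cx (1 / om ep et)*g s et)"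
   define x3 where "x3 = cx (- sin (Om ep et * s))"
   define y3 where "y3 = cx (cos (Om ep et * s))"
   define J where "J = (LL ta. ind {s..t} ta *R (cx (sin (Om ep xi*(t - ta))) *
    ((cx (cos (th ep (xi - et)*ta))*p (xi - et) + cx (sin (th ep (xi - et)*ta))*q (xi - et)) *
    (cx (cos (Om ep et*ta))*x3 + cx (sin (Om ep et*ta))*y3))))"
   \<comment> \<open>The inner kernel is itself a combination of \<open>cos\<close> and
     \<open>sin\<close> of \<open>Om ep et*ta\<close>, with coefficients of modulus at most 1. These
     two coefficients contribute the factor 2 that turns the constant 4 of the oscillation estimate
     into 8.\<close>
   have sn: "cx (sin (Om ep et*(ta - s))) = cx (cos (Om ep et*ta))*x3 + cx (sin (Om ep et*ta))*y3" for ta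
    unfolding x3_def y3_def by (simp add: right_diff_distrib sin_diff)
   have "K ta z = c*(ind {s..t} ta *R (cx (sin (Om ep xi*(t - ta))) *
    ((cx (cos (th ep (xi - et)*ta))*p (xi - et) + cx (sin (th ep (xi - et)*ta))*q (xi - et)) *
    (cx (cos (Om ep et*ta))*x3 + cx (sin (Om ep et*ta))*y3))))" for ta
   proof -
    \<comment> \<open>The two nested time constraints amount to \<open>ta\<close> lying between
      \<open>s\<close> and \<open>t\<close>.\<close>
    have "cx (ind {0..t} ta)*cx (ind {0..ta} s) = cx (ind {s..t} ta)"
     using True by (auto simp: indicator_def)
    then show ?thesis unfolding K_def k_def z fst_conv snd_conv sn[symmetric] S_def c_def trig_def
     by (simp add: scaleR_conv_of_real)
   qed
   then have "(LL ta. K ta z) = c*J" by (simp only: J_def integral_mult_right_zero)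
   then have "norm (LL ta. K ta z) = norm c*norm J" by (simp add: norm_mult)
   also have "... <= norm (g s et)*((4*ep\<^sup>2*wgt 2 (xi - et))*((norm (p (xi - et)) + norm (q (xi - et)))*2))"
   proof (intro mult_mono)
    have "norm c = (1 / om ep xi)*((1 / om ep et)*norm (g s et))" unfolding c_def by (simp add: norm_mult norm_divide)
    also have "... <= 1*(1*norm (g s et))"
     using om_ge_1[of ep xi] om_ge_1[of ep et] by (intro mult_mono) auto
    finally show "norm c <= norm (g s et)" by simp
    have "norm J <= (4*ep\<^sup>2*wgt 2 (xi - et))*((norm (p (xi - et)) + norm (q (xi - et)))*(norm x3 + norm y3))"
     unfolding J_def using True t by (intro trig_kernel_le oscillation_Om_Om_th e) auto
    also have "... <= (4*ep\<^sup>2*wgt 2 (xi - et))*((norm (p (xi - et)) + norm (q (xi - et)))*2)"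
    proof (intro mult_left_mono)
     have "\<bar>sin (Om ep et * s)\<bar> <= 1" "\<bar>cos (Om ep et * s)\<bar> <= 1" by simp_all
     then show "norm x3 + norm y3 <= 2" unfolding x3_def y3_def norm_of_real abs_minus_cancel by linarith
    qed auto
    finally show "norm J <= (4*ep\<^sup>2*wgt 2 (xi - et))*((norm (p (xi - et)) + norm (q (xi - et)))*2)" .
   qed auto
   also have "... = (8*ep\<^sup>2*(wgt 2 (xi - et)*(norm (p (xi - et)) + norm (q (xi - et)))))*norm (g s et)" by (simp add: algebra_simps)
   finally have "enm (LL ta. K ta z) <= ennreal ((8*ep\<^sup>2*(wgt 2 (xi - et)*(norm (p (xi - et)) + norm (q (xi - et)))))*norm (g s et))"
    by (rule ennreal_leI)
   then show ?thesis using True unfolding z by (simp add: ennreal_mult)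
  qed
 qed
 also have "... = (NN s. NN et. ind {0..t} s*(ennreal (8*ep\<^sup>2*(wgt 2 (xi - et)*(norm (p (xi - et)) + norm (q (xi - et)))))*en (g s) et))"
  unfolding lborel_prod[symmetric] by (subst lborel.nn_integral_fst[symmetric]) auto
 also have "... = (NN s. ind {0..t} s*(NN et. ennreal (8*ep\<^sup>2*(wgt 2 (xi - et)*(norm (p (xi - et)) + norm (q (xi - et)))))*en (g s) et))"
  by (intro nn_integral_cong nn_integral_cmult) measurable
 finally show ?thesis .
qed

text \<open>The bound is required at every time of the interval, because the Duhamel formula and the
  limits of the iteration are evaluated at single times; joint measurability permits Fubini.\<close>

definition tb :: "real => real => (real => 'a::euclidean_space => complex) => real => bool" where
 "tb sm t f B \<longleftrightarrow> (%(t, xi). f t xi) \<in> BM2 & 0 <= B &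
  (\<forall>ta. 0 <= ta --> ta <= t --> hb sm (f ta) B)"

lemma tbD:
 assumes "tb sm t f B"
 shows "(%(t, xi). f t xi) \<in> BM2" "0 <= B"
  "!!ta. 0 <= ta ==> ta <= t ==> hb sm (f ta) B"
 using assms by (auto simp: tb_def)

lemma tb_mono: "tb sm t f A ==> A <= B ==> tb sm t f B"
 unfolding tb_def by (auto intro: hb_mono_B)

lemma tb_cong:
 assumes "tb sm t f A" "(%(t, xi). g t xi) \<in> BM2"
  "!!ta xi. 0 <= ta ==> ta <= t ==> g ta xi = f ta xi"
 shows "tb sm t g A"
proof -
 have "g ta = f ta" if "0 <= ta" "ta <= t" for ta using assms(3)[OF that] by auto
 then show ?thesis using assms(1,2) unfolding tb_def by auto
qed

lemma tb_add:
 assumes f: "tb sm t f A" and g: "tb sm t g B"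
 shows "tb sm t (%ta xi. f ta xi + g ta xi) (A + B)"
proof -
 note [measurable] = tbD(1)[OF f] tbD(1)[OF g]
 show ?thesis unfolding tb_def using tbD(2,3)[OF f] tbD(2,3)[OF g] by (auto intro: hb_add)
qed

lemma tb_cmult:
 assumes f: "tb sm t f A"
 shows "tb sm t (%ta xi. c*f ta xi) (norm c*A)"
proof -
 note [measurable] = tbD(1)[OF f]
 show ?thesis unfolding tb_def using tbD(2,3)[OF f] by (auto intro: hb_cmult)
qed

lemma tb_diff:
 assumes f: "tb sm t f A" and g: "tb sm t g B"
 shows "tb sm t (%ta xi. f ta xi - g ta xi) (A + B)"
 using tb_add[OF f tb_cmult[OF g, of "-1"]] by simp

lemma tb_trig:
 assumes [measurable]: "b \<in> BM" and x: "hb sm x A" and y: "hb sm y B"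
 shows "tb sm t (trig b x y) (A + B)"
proof -
 note [measurable] = hbD(1)[OF x] hbD(1)[OF y]
 have *: "hb sm (%xi. cx (cos (b xi*ta))*x xi + cx (sin (b xi*ta))*y xi) (A + B)" for ta
 proof (intro hb_add)
  show "hb sm (%xi. cx (cos (b xi*ta))*x xi) A"
   by (rule hb_le[OF x]) (measurable, simp add: norm_mult mult_left_le_one_le)
  show "hb sm (%xi. cx (sin (b xi*ta))*y xi) B"
   by (rule hb_le[OF y]) (measurable, simp add: norm_mult mult_left_le_one_le)
 qed
 then have "hb sm (trig b x y ta) (A + B)" for ta unfolding trig_def[abs_def] .
 moreover have "(%(t, xi). trig b x y t xi) \<in> BM2" by measurable
 ultimately show ?thesis unfolding tb_def using hbD(2)[OF x] hbD(2)[OF y] by auto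
qed

definition Bq :: "real => (real => 'a::euclidean_space => complex) => (real => 'a => complex) => real => 'a => complex" where
 "Bq ep f g = duh ep (%ta. cconv (f ta) (g ta))"

subsection \<open>Long-time solutions of the Duhamel equation\<close>

locale sobolev_algebra =
 fixes sm :: real and TT :: "'a::euclidean_space itself"
 assumes s: "sm > real DIM('a)/2"
begin

lemma s0: "0 <= sm"
 using s by (rule order_trans[OF _ less_imp_le, rotated]) simp

lemma tb_L2: "tb sm t (f :: real => 'a => complex) A ==> 0 <= ta ==> ta <= t ==> f ta \<in> L2"
 using tbD(3) hb_L2 s0 by blast

lemma tb_cconv:
 fixes f g :: "real => 'a => complex"
 assumes f: "tb sm t f A" and g: "tb sm t g B"
 shows "tb sm t (%ta. cconv (f ta) (g ta)) (kappa TYPE('a) sm*(A*B))"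
proof -
 note [measurable] = tbD(1)[OF f] tbD(1)[OF g]
 have "(%(t, xi). cconv (f t) (g t) xi) \<in> BM2"
  unfolding case_prod_unfold
  by (rule borel_measurable_cconv[where M="borel \<Otimes>\<^sub>M borel" and f="%w. f (fst w)" and g="%w. g (fst w)" and h=snd]) measurable
 then show ?thesis unfolding tb_def using tbD(2,3)[OF f] tbD(2,3)[OF g] by (auto intro: hb_cconv[OF s])
qed

lemma tb_duh:
 fixes f :: "real => 'a => complex"
 assumes f: "tb sm t f A" and t: "0 <= t"
 shows "tb sm t (duh ep f) (t*A)"
proof -
 note [measurable] = tbD(1)[OF f]
 have "hb sm (duh ep f ta) (t*A)" if "0 <= ta" "ta <= t" for ta
 proof (rule hb_mono_B)
  show "hb sm (duh ep f ta) (ta*A)" using that by (intro hb_duh tbD[OF f]) auto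
  show "ta*A <= t*A" using that tbD(2)[OF f] by (intro mult_right_mono) auto
 qed
 moreover have "(%(t, xi). duh ep f t xi) \<in> BM2" by measurable
 ultimately show ?thesis unfolding tb_def using tbD(2)[OF f] t by auto
qed

lemma tb_Bq:
 fixes f g :: "real => 'a => complex"
 assumes f: "tb sm t f A" and g: "tb sm t g B" and t: "0 <= t"
 shows "tb sm t (Bq ep f g) (t*(kappa TYPE('a) sm*(A*B)))"
 unfolding Bq_def by (intro tb_duh tb_cconv f g t)

lemma cconv_tb_bound:
 fixes f g :: "real => 'a => complex"
 assumes f: "tb sm t f A" and g: "tb sm t g B" and "0 <= ta" "ta <= t"
 shows "norm (cconv (f ta) (g ta) xi) <= A*B"
 using assms(3,4) by (intro cconv_bound hb_mono_exp[OF tbD(3)[OF f] s0] hb_mono_exp[OF tbD(3)[OF g] s0])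

lemma cconv_tb_measurable:
 fixes f g :: "real => 'a => complex"
 assumes f: "tb sm t f A" and g: "tb sm t g B"
 shows "(%ta. cconv (f ta) (g ta) xi) \<in> BM"
proof -
 note [measurable] = tbD(1)[OF f] tbD(1)[OF g]
 show ?thesis by measurable
qed

lemma Bq_add_right:
 fixes f g h :: "real => 'a => complex"
 assumes f: "tb sm t f A" and g: "tb sm t g B" and h: "tb sm t h C" and ta: "0 <= ta" "ta <= t"
 shows "Bq ep f (%ta xi. g ta xi + h ta xi) ta xi = Bq ep f g ta xi + Bq ep f h ta xi"
proof -
 have "Bq ep f (%ta xi. g ta xi + h ta xi) ta xi = duh ep (%ta xi. cconv (f ta) (g ta) xi + cconv (f ta) (h ta) xi) ta xi"
  unfolding Bq_def using ta by (intro duh_cong cconv_add(1) tb_L2[OF f] tb_L2[OF g] tb_L2[OF h]) auto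
 also have "... = Bq ep f g ta xi + Bq ep f h ta xi"
  unfolding Bq_def using ta
  by (intro duh_add[where A="A*B" and B="A*C"] cconv_tb_measurable[OF f g] cconv_tb_measurable[OF f h] cconv_tb_bound[OF f g] cconv_tb_bound[OF f h]) auto
 finally show ?thesis .
qed

lemma Bq_commute:
 fixes f g :: "real => 'a => complex"
 assumes f: "tb sm t f A" and g: "tb sm t g B" and ta: "0 <= ta" "ta <= t"
 shows "Bq ep f g ta xi = Bq ep g f ta xi"
 unfolding Bq_def using ta by (intro duh_cong cconv_commute hbD(1)[OF tbD(3)[OF f]] hbD(1)[OF tbD(3)[OF g]]) auto

lemma Bq_cmult_right: "Bq ep f (%ta xi. c*g ta xi) ta xi = c*Bq ep f g ta (xi::'a)"
proof -
 have c: "cconv (f ta) (%xi. c*g ta xi) = (%xi. c*cconv (f ta) (g ta) xi)" for ta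
 proof
  fix xi
  have "cconv (f ta) (%xi. c*g ta xi) xi = (LL et. c*(f ta (xi - et)*g ta et))"
   unfolding cconv_def by (simp add: mult_ac)
  then show "cconv (f ta) (%xi. c*g ta xi) xi = c*cconv (f ta) (g ta) xi"
   by (simp only: cconv_def integral_mult_right_zero)
 qed
 show ?thesis unfolding Bq_def c by (rule duh_cmult)
qed

lemma Bq_diff_right:
 fixes f g h :: "real => 'a => complex"
 assumes f: "tb sm t f A" and g: "tb sm t g B" and h: "tb sm t h C" and ta: "0 <= ta" "ta <= t"
 shows "Bq ep f (%ta xi. g ta xi - h ta xi) ta xi = Bq ep f g ta xi - Bq ep f h ta xi"
 using Bq_add_right[OF f g tb_cmult[OF h, of "-1"] ta] unfolding Bq_cmult_right by simp

lemma Bq_add_left: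
 fixes f g h :: "real => 'a => complex"
 assumes f: "tb sm t f A" and g: "tb sm t g B" and h: "tb sm t h C" and ta: "0 <= ta" "ta <= t"
 shows "Bq ep (%ta xi. g ta xi + h ta xi) f ta xi = Bq ep g f ta xi + Bq ep h f ta xi"
 using Bq_commute[OF tb_add[OF g h] f ta] Bq_add_right[OF f g h ta] Bq_commute[OF f g ta] Bq_commute[OF f h ta] by metis

lemma Bq_square_diff:
 fixes f g :: "real => 'a => complex"
 assumes f: "tb sm t f A" and g: "tb sm t g B" and ta: "0 <= ta" "ta <= t"
 shows "Bq ep f f ta xi - Bq ep g g ta xi = Bq ep (%ta xi. f ta xi + g ta xi) (%ta xi. f ta xi - g ta xi) ta xi"
 using Bq_diff_right[OF tb_add[OF f g] f g ta] Bq_add_left[OF f f g ta] Bq_add_left[OF g f g ta] Bq_commute[OF f g ta] by simp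

lemma Bq_square_add:
 fixes f g :: "real => 'a => complex"
 assumes f: "tb sm t f A" and g: "tb sm t g B" and ta: "0 <= ta" "ta <= t"
 shows "Bq ep (%ta xi. f ta xi + g ta xi) (%ta xi. f ta xi + g ta xi) ta xi = Bq ep f f ta xi + 2*Bq ep f g ta xi + Bq ep g g ta xi"
 using Bq_add_right[OF tb_add[OF f g] f g ta] Bq_add_left[OF f f g ta] Bq_add_left[OF g f g ta] Bq_commute[OF f g ta] by simp

text \<open>This is where four derivatives are spent: the weight \<open>wgt 2\<close> left over by
  the oscillation estimates raises the order from \<open>sm\<close> to
  \<open>sm + 4\<close>.\<close>

lemma hn_wgt2_sum:
 assumes p: "hb (sm + 4) (p :: 'a => complex) A" and q: "hb (sm + 4) q A"
 shows "hn sm (%ze. ennreal (wgt 2 ze*(norm (p ze) + norm (q ze)))) <= (ennreal (2*A))^2"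
proof -
 note [measurable] = hbD(1)[OF p] hbD(1)[OF q]
 have "hn sm (%ze. ennreal (wgt 2 ze*(norm (p ze) + norm (q ze)))) = hn sm (%ze. ennreal (wgt 2 ze)*(en p ze + en q ze))"
  by (simp add: ennreal_mult)
 also have "... = hn (sm + 4) (%ze. en p ze + en q ze)" unfolding hn_wgt by simp
 also have "... <= (ennreal A + ennreal A)^2" by (intro hn_minkowski hbD(3) p q) measurable
 finally show ?thesis using hbD(2)[OF p] by (simp flip: ennreal_plus)
qed

lemma hb_from_conv:
 fixes f :: "'a => complex" and F G :: "'a => ennreal"
 assumes [measurable]: "f \<in> BM" "F \<in> BM" "G \<in> BM"
  and F: "hn sm F <= (ennreal A)^2" and G: "hn sm G <= (ennreal B)^2" and AB: "0 <= A" "0 <= B" "0 <= c"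
  and le: "!!xi. enm (f xi) <= (NN et. ennreal c*(F (xi - et)*G et))"
 shows "hb sm f (c*(kappa TYPE('a) sm*(A*B)))"
proof (rule hbI)
 have "hn sm (en f) <= hn sm (%xi. ennreal c*(NN et. F (xi - et)*G et))"
  using le by (intro hn_mono) (simp add: nn_integral_cmult)
 also have "... = (ennreal c)^2*hn sm (%xi. NN et. F (xi - et)*G et)" by (rule hn_cmult) measurable
 also have "... <= (ennreal c)^2*(ennreal ((kappa TYPE('a) sm)^2)*((ennreal A)^2*(ennreal B)^2))"
  by (intro mult_left_mono order_trans[OF hn_conv[OF s]] mult_mono F G) auto
 finally show "hn sm (en f) <= (ennreal (c*(kappa TYPE('a) sm*(A*B))))^2"
  using AB by (simp add: ennreal_mult power_mult_distrib ennreal_power[symmetric])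
qed (use AB in auto)

lemma tb_Bq_app_app:
 assumes e: "0 < ep" "ep <= 1" and t: "0 <= t" "t <= 1/ep"
  and p: "hb (sm + 4) (p :: 'a => complex) A" and q: "hb (sm + 4) q A"
 shows "tb sm t (Bq ep (trig (th ep) p q) (trig (th ep) p q)) (16*ep\<^sup>2*(kappa TYPE('a) sm*((2*A)*(2*A))))"
proof -
 note [measurable] = hbD(1)[OF p] hbD(1)[OF q]
 have pq: "hb sm p A" "hb sm q A" using p q hb_mono_exp by fastforce+
 have A: "0 <= A" using hbD(2)[OF p] .
 have L: "p \<in> L2" "q \<in> L2" using pq by (auto intro: hb_L2 s0)
 have "tb sm t (Bq ep (trig (th ep) p q) (trig (th ep) p q)) (t*(kappa TYPE('a) sm*((A + A)*(A + A))))"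
  by (intro tb_Bq tb_trig pq t) measurable
 note m [measurable] = tbD(1)[OF this]
 have "hb sm (Bq ep (trig (th ep) p q) (trig (th ep) p q) ta) (16*ep\<^sup>2*(kappa TYPE('a) sm*((2*A)*(2*A))))" if ta: "0 <= ta" "ta <= t" for ta
 proof (rule hb_from_conv[OF _ _ _ hn_wgt2_sum[OF p q] hn_wgt2_sum[OF p q]])
  fix xi :: 'a
  have "enm (Bq ep (trig (th ep) p q) (trig (th ep) p q) ta xi) \<le>
   (NN et. ennreal (16*ep\<^sup>2*(wgt 2 (xi - et)*wgt 2 et)*((norm (p (xi - et)) + norm (q (xi - et)))*(norm (p et) + norm (q et)))))"
   unfolding Bq_def using ta t by (intro duh_cconv_trig_le L oscillation_Om_th_th e) auto
  also have "... = (NN et. ennreal (16*ep\<^sup>2)*(ennreal (wgt 2 (xi - et)*(norm (p (xi - et)) + norm (q (xi - et))))*ennreal (wgt 2 et*(norm (p et) + norm (q et)))))"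
   by (intro nn_integral_cong) (simp add: mult_ac del: ennreal_plus flip: ennreal_mult)
  finally show "enm (Bq ep (trig (th ep) p q) (trig (th ep) p q) ta xi) <= ..." .
 qed (use A in \<open>measurable, auto\<close>)
 then show ?thesis unfolding tb_def using m A by auto
qed

lemma tb_Bq_app_free:
 assumes e: "0 < ep" "ep <= 1" and t: "0 <= t" "t <= 1/ep"
  and p: "hb (sm + 4) (p :: 'a => complex) A" and q: "hb (sm + 4) q A"
  and x: "hb sm x B" and y: "hb sm y B"
 shows "tb sm t (Bq ep (trig (th ep) p q) (trig (Om ep) x y)) (4*ep\<^sup>2*(kappa TYPE('a) sm*((2*A)*(2*B))))"
proof -
 note [measurable] = hbD(1)[OF p] hbD(1)[OF q] hbD(1)[OF x] hbD(1)[OF y]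
 have pq: "hb sm p A" "hb sm q A" using p q hb_mono_exp by fastforce+
 have A: "0 <= A" "0 <= B" using hbD(2)[OF p] hbD(2)[OF x] by auto
 have L: "p \<in> L2" "q \<in> L2" "x \<in> L2" "y \<in> L2" using pq x y by (auto intro: hb_L2 s0)
 have "tb sm t (Bq ep (trig (th ep) p q) (trig (Om ep) x y)) (t*(kappa TYPE('a) sm*((A + A)*(B + B))))"
  by (intro tb_Bq tb_trig pq x y t) measurable
 note m [measurable] = tbD(1)[OF this]
 have B: "hn sm (%et. ennreal (norm (x et) + norm (y et))) <= (ennreal (2*B))^2"
 proof -
  have "hn sm (%et. en x et + en y et) <= (ennreal B + ennreal B)^2" by (intro hn_minkowski hbD(3) x y) measurable
  then show ?thesis using A by (simp flip: ennreal_plus)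
 qed
 have "hb sm (Bq ep (trig (th ep) p q) (trig (Om ep) x y) ta) (4*ep\<^sup>2*(kappa TYPE('a) sm*((2*A)*(2*B))))" if ta: "0 <= ta" "ta <= t" for ta
 proof (rule hb_from_conv[OF _ _ _ hn_wgt2_sum[OF p q] B])
  fix xi :: 'a
  have "enm (Bq ep (trig (th ep) p q) (trig (Om ep) x y) ta xi) \<le>
   (NN et. ennreal (4*ep\<^sup>2*wgt 2 (xi - et)*((norm (p (xi - et)) + norm (q (xi - et)))*(norm (x et) + norm (y et)))))"
   unfolding Bq_def using ta t by (intro duh_cconv_trig_le L oscillation_Om_Om_th e) auto
  also have "... = (NN et. ennreal (4*ep\<^sup>2)*(ennreal (wgt 2 (xi - et)*(norm (p (xi - et)) + norm (q (xi - et))))*ennreal (norm (x et) + norm (y et))))"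
   by (intro nn_integral_cong) (simp add: mult_ac del: ennreal_plus flip: ennreal_mult)
  finally show "enm (Bq ep (trig (th ep) p q) (trig (Om ep) x y) ta xi) <= ..." .
 qed (use A in \<open>measurable, auto\<close>)
 then show ?thesis unfolding tb_def using m A by auto
qed

text \<open>The plain estimate would give \<open>t^2\<close>. Here one of the two time factors is
  replaced by \<open>8*ep^2\<close>, so that with \<open>t = T/ep\<close> the double integral is of
  size \<open>T*ep\<close>, with norms of order \<open>sm\<close> for \<open>x\<close> and
  \<open>y\<close>.\<close>

lemma tb_Bq_app_Bq:
 fixes x y :: "real => 'a => complex"
 assumes e: "0 < ep" "ep <= 1" and t: "0 <= t" "t <= 1/ep"
  and p: "hb (sm + 4) p A" and q: "hb (sm + 4) q A"
  and x: "tb sm t x X" and y: "tb sm t y Y"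
 shows "tb sm t (Bq ep (trig (th ep) p q) (Bq ep x y)) (t*(8*ep\<^sup>2*(kappa TYPE('a) sm*((2*A)*(kappa TYPE('a) sm*(X*Y))))))"
proof -
 note [measurable] = hbD(1)[OF p] hbD(1)[OF q]
 have pq: "hb sm p A" "hb sm q A" using p q hb_mono_exp by fastforce+
 have A: "0 <= A" "0 <= X" "0 <= Y" using hbD(2)[OF p] tbD(2)[OF x] tbD(2)[OF y] by auto
 have L: "p \<in> L2" "q \<in> L2" using pq by (auto intro: hb_L2 s0)
 define g where "g = (%ta. cconv (x ta) (y ta))"
 define G where "G = kappa TYPE('a) sm*(X*Y)"
 have G0: "0 <= G" unfolding G_def using A by simp
 have g: "tb sm t g G" unfolding g_def G_def by (rule tb_cconv[OF x y])
 note [measurable] = tbD(1)[OF g]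
 define W where "W = (%ze. wgt 2 ze*(norm (p ze) + norm (q ze)))"
 have [measurable]: "W \<in> BM" unfolding W_def by measurable
 have W: "hn sm (%ze. ennreal (W ze)) <= (ennreal (2*A))^2" unfolding W_def by (rule hn_wgt2_sum[OF p q])
 have "tb sm t (Bq ep (trig (th ep) p q) (Bq ep x y)) (t*(kappa TYPE('a) sm*((A + A)*(t*(kappa TYPE('a) sm*(X*Y))))))"
  by (intro tb_Bq tb_trig pq x y t) measurable
 note m [measurable] = tbD(1)[OF this]
 define c where "c = 8*ep\<^sup>2*(kappa TYPE('a) sm*((2*A)*G))"
 have c0: "0 <= c" unfolding c_def using A G0 by simp
 define V where "V = (%s xi. NN et. ennreal (8*ep\<^sup>2*W (xi - et))*en (g s) et)"
 have [measurable]: "(%(s, xi). V s xi) \<in> BM2" unfolding V_def by measurable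
 have V: "hn sm (V r) <= (ennreal c)^2" if r: "0 <= r" "r <= t" for r
 proof -
  have gr: "hb sm (g r) G" using tbD(3)[OF g r] .
  note [measurable] = hbD(1)[OF gr]
  define k where "k = 8*ep\<^sup>2"
  have w: "ennreal (k*W z) = ennreal k*ennreal (W z)" for z
   by (rule ennreal_mult) (auto simp: W_def k_def)
  have "V r = (%xi. ennreal k*(NN et. ennreal (W (xi - et))*en (g r) et))"
  proof
   fix xi
   have "V r xi = (NN et. ennreal k*(ennreal (W (xi - et))*en (g r) et))"
    unfolding V_def k_def[symmetric] by (intro nn_integral_cong) (simp only: w mult.assoc)
   also have "... = ennreal k*(NN et. ennreal (W (xi - et))*en (g r) et)"
    by (rule nn_integral_cmult) measurable
   finally show "V r xi = ennreal k*(NN et. ennreal (W (xi - et))*en (g r) et)" .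
  qed
  note Veq = this[unfolded k_def]
  have "hn sm (V r) = (ennreal (8*ep\<^sup>2))^2*hn sm (%xi. NN et. ennreal (W (xi - et))*en (g r) et)"
   unfolding Veq by (intro hn_cmult) measurable
  also have "... <= (ennreal (8*ep\<^sup>2))^2*(ennreal ((kappa TYPE('a) sm)^2)*((ennreal (2*A))^2*(ennreal G)^2))"
   by (intro mult_left_mono order_trans[OF hn_conv[OF s]] mult_mono W hbD(3)[OF gr]) auto
  also have "... = (ennreal c)^2"
  proof -
   have "(ennreal a)^2*(ennreal (b\<^sup>2)*((ennreal d)^2*(ennreal f)^2)) = (ennreal (a*(b*(d*f))))^2"
    if "0 <= a" "0 <= b" "0 <= d" "0 <= f" for a b d f :: real
    using that by (simp add: ennreal_mult power_mult_distrib ennreal_power[symmetric])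
   then show ?thesis unfolding c_def using A G0 by simp
  qed
  finally show ?thesis .
 qed
 have "hb sm (Bq ep (trig (th ep) p q) (Bq ep x y) ta) (t*c)" if ta: "0 <= ta" "ta <= t" for ta
 proof (rule hbI)
  have "enm (Bq ep (trig (th ep) p q) (Bq ep x y) ta xi) <= (NN s. ind {0..ta} s*V s xi)" for xi
  proof -
   have "hb 0 (g r) G" if "0 <= r" "r <= ta" for r using hb_mono_exp[OF tbD(3)[OF g] s0] that ta by auto
   then show ?thesis
    using duh_cconv_app_duh_le[OF e L, of ta g G xi] ta t unfolding Bq_def g_def[symmetric] V_def W_def by simp
  qed
  then have "hn sm (en (Bq ep (trig (th ep) p q) (Bq ep x y) ta)) <= hn sm (%xi. NN s. ind {0..ta} s*V s xi)"
   by (intro hn_mono)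
  also have "... <= ennreal ta*(NN s. ind {0..ta} s*hn sm (V s))"
   using ta by (intro hn_time_integral) auto
  also have "... <= ennreal ta*(ennreal ta*(ennreal c)^2)"
   using ta by (intro mult_left_mono nn_integral_indicator_le V) auto
  also have "... = (ennreal (ta*c))^2"
   using ta c0 by (simp add: ennreal_mult power_mult_distrib power2_eq_square mult_ac)
  also have "... <= (ennreal (t*c))^2" using ta c0 by (intro power_mono ennreal_leI mult_right_mono) auto
  finally show "hn sm (en (Bq ep (trig (th ep) p q) (Bq ep x y) ta)) <= (ennreal (t*c))^2" .
 qed (use t c0 in \<open>measurable, auto\<close>)
 then show ?thesis unfolding tb_def c_def[symmetric] G_def[symmetric] using m t c0 by auto
qed

end

section \<open>Limits of iterates in weighted norms\<close>

lemma hb_fatou: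
 fixes f :: "nat => 'a::euclidean_space => complex"
 assumes f: "!!n. hb sm (f n) B" and g [measurable]: "g \<in> BM"
  and lim: "AEL xi. (%n. f n xi) ---> g xi"
 shows "hb sm g B"
 unfolding hb_def
proof (intro conjI g)
 have [measurable]: "f n \<in> BM" for n using hbD(1)[OF f] .
 show "0 <= B" using hbD(2)[OF f] .
 have e: "hn sm (en h) = (NN xi. ennreal (wgt sm xi*(norm (h xi))^2))" for h :: "'a => complex"
  unfolding hn_def by (simp add: ennreal_mult ennreal_power)
 have "hn sm (en g) = (NN xi. liminf (%n. ennreal (wgt sm xi*(norm (f n xi))^2)))"
  unfolding e
 proof (intro nn_integral_cong_AE)
  show "AEL xi. ennreal (wgt sm xi*(norm (g xi))^2) = liminf (%n. ennreal (wgt sm xi*(norm (f n xi))^2))"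
   using lim
  proof eventually_elim
   case (elim xi)
   have "(%n. ennreal (wgt sm xi*(norm (f n xi))^2)) ---> ennreal (wgt sm xi*(norm (g xi))^2)"
    by (intro tendsto_ennrealI tendsto_intros elim)
   then show ?case by (intro lim_imp_Liminf[symmetric]) simp_all
  qed
 qed
 also have "... <= liminf (%n. NN xi. ennreal (wgt sm xi*(norm (f n xi))^2))"
  by (rule nn_integral_liminf) measurable
 also have "... <= liminf (%n::nat. ennreal (B\<^sup>2))"
  unfolding e[symmetric] using f by (intro Liminf_mono always_eventually allI) (auto simp: hb_def)
 finally show "hn sm (en g) <= ennreal (B\<^sup>2)" by (simp add: Liminf_const)
qed

text \<open>The squares \<open>2\<^sup>n |d\<^sub>n|\<^sup>2\<close> are summable almost everywhere, so no sum of infinitely many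
 norms has to be squared.\<close>

lemma AE_summable_geometric:
 fixes d :: "nat => 'a::euclidean_space => complex"
 assumes s: "0 <= sm" and d: "!!n. hb sm (d n) (E*(1/2)^n)" and E: "0 <= E"
 shows "AEL xi. summable (%n. norm (d n xi))"
proof -
 have [measurable]: "d n \<in> BM" for n using hbD(1)[OF d] .
 have "(NN xi. (\<Sum>n. ennreal (2^n*(norm (d n xi))^2))) = (\<Sum>n. NN xi. ennreal (2^n*(norm (d n xi))^2))"
  by (rule nn_integral_suminf) measurable
 also have "... <= (\<Sum>n. ennreal (E\<^sup>2*(1/2)^n))"
 proof (intro suminf_le allI)
  fix n
  have "(NN xi. ennreal (2^n*(norm (d n xi))^2)) = ennreal (2^n)*hn 0 (en (d n))"
   unfolding hn_def by (simp add: ennreal_mult nn_integral_cmult ennreal_power)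
  also have "... <= ennreal (2^n)*ennreal ((E*(1/2)^n)^2)"
   using hb_mono_exp[OF d s] by (intro mult_left_mono) (auto simp: hb_def)
  also have "... = ennreal (2^n*(E*(1/2)^n)^2)" by (rule ennreal_mult[symmetric]) auto
  also have "2^n*(E*(1/2)^n)^2 = E\<^sup>2*(1/2)^n"
   by (simp add: power_mult_distrib power_divide power2_eq_square)
  finally show "(NN xi. ennreal (2^n*(norm (d n xi))^2)) <= ennreal (E\<^sup>2*(1/2)^n)" .
 qed auto
 also have "... = ennreal (\<Sum>n. E\<^sup>2*(1/2)^n)"
  by (rule suminf_ennreal2[OF _ summable_mult[OF summable_geometric]]) auto
 also have "... < \<infinity>" by simp
 finally have "(NN xi. (\<Sum>n. ennreal (2^n*(norm (d n xi))^2))) ~= \<infinity>" by simp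
 then have "AEL xi. (\<Sum>n. ennreal (2^n*(norm (d n xi))^2)) ~= \<infinity>"
  by (intro nn_integral_PInf_AE) auto
 then show ?thesis
 proof eventually_elim
  case (elim xi)
  then have "summable (%n. 2^n*(norm (d n xi))^2)" by (intro summable_suminf_not_top) auto
  then have "(%n. 2^n*(norm (d n xi))^2) ---> 0" by (rule summable_LIMSEQ_zero)
  then have "Bseq (%n. 2^n*(norm (d n xi))^2)" by (intro convergent_imp_Bseq convergentI)
  then obtain C where C: "!!n. norm (2^n*(norm (d n xi))^2) <= C" by (auto simp: Bseq_def)
  have C0: "0 <= C" using C[of 0] norm_ge_zero order_trans by blast
  have le: "norm (d n xi) <= sqrt C*(sqrt (1/2))^n" for n
  proof -
   have "(norm (d n xi))^2 <= C*(1/2)^n" using C[of n] by (simp add: field_simps power_divide)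
   also have "... = (sqrt C*(sqrt (1/2))^n)^2" using C0 by (simp add: power_mult_distrib power_mult[symmetric] mult.commute[of n 2]) (simp add: power_mult)
   finally show ?thesis by (rule power2_le_imp_le) (use C0 in auto)
  qed
  have sg: "summable (%n. sqrt C*(sqrt (1/2))^n)"
   by (rule summable_mult[OF summable_geometric]) (simp add: real_sqrt_lt_1_iff)
  show ?case by (rule summable_comparison_test'[OF sg, of 0]) (use le in simp)
 qed
qed

section \<open>The free evolution against the approximation\<close>

text \<open>With \<open>y = ep*|xi|\<close> and \<open>a = 1 + y^2/2\<close> one has
  \<open>a^2 - om^2 = y ^ 4/4\<close>, and dividing by \<open>a + om >= 1\<close> bounds
  \<open>a - om\<close>. The phase error over a time \<open>1/ep\<close> is therefore
  \<open>ep ^ 4/(ep^2*ep) = ep\<close> times a fourth power of the frequency.\<close>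

lemma Om_th_diff:
 fixes xi :: "'a::euclidean_space"
 assumes e: "0 < ep" "ep <= 1" and t: "0 <= t" "t <= 1/ep"
 shows "\<bar>Om ep xi*t - th ep xi*t\<bar> <= ep*(norm xi ^ 4/4)"
proof -
 define y where "y = ep*norm xi"
 define a where "a = 1 + y\<^sup>2/2"
 have om: "om ep xi = sqrt (1 + y\<^sup>2)" by (simp add: om_def y_def)
 have le: "om ep xi <= a" unfolding a_def y_def by (rule om_le)
 have a1: "1 <= a + om ep xi" using om_ge_1[of ep xi] by (simp add: a_def add_increasing)
 have "(a - om ep xi)*1 <= (a - om ep xi)*(a + om ep xi)" using le a1 by (intro mult_left_mono) auto
 also have "... = a\<^sup>2 - (om ep xi)\<^sup>2" by (simp add: power2_eq_square algebra_simps)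
 also have "... = y ^ 4/4" unfolding om a_def by (simp add: power2_sum power_divide)
 finally have d: "a - om ep xi <= y ^ 4/4" by simp
 have th: "th ep xi - Om ep xi = (a - om ep xi)/ep\<^sup>2"
  using e unfolding th_def Om_def a_def y_def by (simp add: field_simps power2_eq_square)
 have "Om ep xi*t - th ep xi*t = - ((a - om ep xi)/ep\<^sup>2*t)"
  unfolding th[symmetric] by (simp add: algebra_simps)
 then have "\<bar>Om ep xi*t - th ep xi*t\<bar> = \<bar>(a - om ep xi)/ep\<^sup>2*t\<bar>"
  by (simp only: abs_minus_cancel)
 also have "... = (a - om ep xi)/ep\<^sup>2*t"
  using le t e by (intro abs_of_nonneg mult_nonneg_nonneg divide_nonneg_nonneg) auto
 also have "... <= (y ^ 4/4)/ep\<^sup>2*(1/ep)"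
  using d t e le by (intro mult_mono divide_right_mono) auto
 also have "... = ep*(norm xi ^ 4/4)"
  using e unfolding y_def by (simp add: power_mult_distrib eval_nat_numeral)
 finally show ?thesis .
qed

lemma cos_diff_le: "\<bar>cos x - cos y\<bar> <= \<bar>x - (y::real)\<bar>"
proof -
 have "\<bar>cos x - cos y\<bar> = 2*(\<bar>sin ((x + y)/2)\<bar>*\<bar>sin ((y - x)/2)\<bar>)"
  by (simp add: cos_diff_cos abs_mult)
 also have "... <= 2*(1*\<bar>(y - x)/2\<bar>)"
  by (intro mult_left_mono mult_mono abs_sin_x_le_abs_x) auto
 finally show ?thesis by simp
qed

lemma sin_diff_le: "\<bar>sin x - sin y\<bar> <= \<bar>x - (y::real)\<bar>"
 using cos_diff_le[of "x - pi/2" "y - pi/2"] by (simp add: cos_diff)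

text \<open>The fourth power from the phase error and the square from \<open>1 - 1 / om\<close> both
  fit under \<open>wgt 2 = 1 + 2*|xi|^2 + |xi| ^ 4\<close>.\<close>

lemma free_minus_app_pointwise:
 fixes xi :: "'a::euclidean_space"
 assumes e: "0 < ep" "ep <= 1" and t: "0 <= t" "t <= 1/ep"
 shows "\<bar>cos (Om ep xi*t) - cos (th ep xi*t)\<bar> <= ep*wgt 2 xi"
  and "\<bar>sin (Om ep xi*t) / om ep xi - sin (th ep xi*t)\<bar> <= ep*wgt 2 xi"
proof -
 have w: "wgt 2 xi = 1 + 2*(norm xi)^2 + norm xi ^ 4"
  using one_plus_norm2_pos[of xi] by (simp add: wgt_def powr_realpow power2_sum)
 have n4: "0 <= norm xi ^ 4" by simp
 have n2: "0 <= (norm xi)^2" by simp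
 have a: "ep*(norm xi ^ 4/4) + ep*(norm xi)^2 <= ep*wgt 2 xi"
  unfolding w distrib_left[symmetric] using e n4 n2 by (intro mult_left_mono) auto
 have b: "ep*(norm xi ^ 4/4) <= ep*wgt 2 xi"
  unfolding w using e n4 n2 by (intro mult_left_mono) auto
 show "\<bar>cos (Om ep xi*t) - cos (th ep xi*t)\<bar> <= ep*wgt 2 xi"
  by (rule order_trans[OF cos_diff_le order_trans[OF Om_th_diff[OF e t] b]])
 have o: "1 - 1 / om ep xi <= ep*(norm xi)^2"
 proof -
  have "1 - 1 / om ep xi = (om ep xi - 1) / om ep xi" by (simp add: diff_divide_distrib)
  also have "... <= (om ep xi - 1)/1" using om_ge_1[of ep xi] by (intro divide_left_mono) auto
  also have "... = om ep xi - 1" by simp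
  also have "... <= (ep*norm xi)^2" using om_le[of ep xi] zero_le_power2[of "ep*norm xi"] by linarith
  also have "... = ep*(ep*(norm xi)^2)" by (simp add: power2_eq_square)
  also have "... <= ep*(1*(norm xi)^2)" using e by (intro mult_left_mono mult_right_mono) auto
  finally show ?thesis by simp
 qed
 have o1: "0 <= 1 - 1 / om ep xi" using om_ge_1[of ep xi] by simp
 have "sin (Om ep xi*t) / om ep xi - sin (th ep xi*t)
  = (sin (Om ep xi*t) - sin (th ep xi*t)) - sin (Om ep xi*t)*(1 - 1 / om ep xi)"
  by (simp add: algebra_simps)
 then have "\<bar>sin (Om ep xi*t) / om ep xi - sin (th ep xi*t)\<bar>
  <= \<bar>sin (Om ep xi*t) - sin (th ep xi*t)\<bar> + \<bar>sin (Om ep xi*t)\<bar>*(1 - 1 / om ep xi)"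
  using abs_triangle_ineq4[of "sin (Om ep xi*t) - sin (th ep xi*t)" "sin (Om ep xi*t)*(1 - 1 / om ep xi)"] o1
  by (simp only: abs_mult abs_of_nonneg)
 also have "... <= ep*(norm xi ^ 4/4) + 1*(ep*(norm xi)^2)"
  using o o1 by (intro add_mono mult_mono order_trans[OF sin_diff_le Om_th_diff[OF e t]]) auto
 also have "... <= ep*wgt 2 xi" using a by simp
 finally show "\<bar>sin (Om ep xi*t) / om ep xi - sin (th ep xi*t)\<bar> <= ep*wgt 2 xi" .
qed

definition free :: "real => ('a::euclidean_space => complex) => ('a => complex) => real => 'a => complex" where
 "free ep P Q = trig (Om ep) P (%xi. Q xi/cx (om ep xi))"

lemma hb_div_om:
 assumes "hb sm Q B" shows "hb sm (%xi. Q xi/cx (om ep xi)) B"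
proof (rule hb_le[OF assms])
 note [measurable] = hbD(1)[OF assms]
 show "(%xi. Q xi/cx (om ep xi)) \<in> BM" by measurable
 show "norm (Q xi/cx (om ep xi)) <= norm (Q xi)" for xi
 proof -
  have "norm (Q xi) / om ep xi <= norm (Q xi)/1" using om_ge_1[of ep xi] by (intro divide_left_mono) auto
  then show ?thesis by (simp add: norm_divide)
 qed
qed

lemma tb_free:
 assumes "hb sm P B" "hb sm Q B"
 shows "tb sm t (free ep P Q) (2*B)"
proof -
 have "tb sm t (free ep P Q) (B + B)" unfolding free_def by (intro tb_trig hb_div_om assms) measurable
 then show ?thesis by simp
qed

text \<open>Four contributions of size \<open>ep*A\<close>: the phase errors acting on
  \<open>p\<close> and \<open>q\<close>, which cost four derivatives, and the perturbations
  \<open>p1\<close> and \<open>q1\<close>, which carry a factor \<open>ep\<close> already and cost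
  none.\<close>

lemma tb_free_minus_app:
 fixes p q p1 q1 :: "'a::euclidean_space => complex"
 assumes e: "0 < ep" "ep <= 1" and t: "0 <= t" "t <= 1/ep"
  and p: "hb (sm + 4) p A" and q: "hb (sm + 4) q A" and p1: "hb sm p1 A" and q1: "hb sm q1 A"
 shows "tb sm t (%ta xi. free ep (%xi. p xi + ep*p1 xi) (%xi. q xi + ep*q1 xi) ta xi - trig (th ep) p q ta xi) (4*A*ep)"
proof -
 note [measurable] = hbD(1)[OF p] hbD(1)[OF q] hbD(1)[OF p1] hbD(1)[OF q1]
 have A: "0 <= A" using hbD(2)[OF p] .
 have m: "(%(ta, xi). free ep (%xi. p xi + ep*p1 xi) (%xi. q xi + ep*q1 xi) ta xi - trig (th ep) p q ta xi) \<in> BM2"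
  unfolding free_def by measurable
 have w: "hb sm (%xi. cx (ep*wgt 2 xi)*f xi) (ep*A)" if f: "hb (sm + 4) f A" for f :: "'a => complex"
 proof (rule hbI)
  note [measurable] = hbD(1)[OF f]
  show "(%xi. cx (ep*wgt 2 xi)*f xi) \<in> BM" by measurable
  have "hn sm (en (%xi. cx (ep*wgt 2 xi)*f xi)) = hn sm (%xi. ennreal ep*(ennreal (wgt 2 xi)*en f xi))"
   using e by (simp add: norm_mult ennreal_mult mult.assoc del: of_real_mult)
  also have "... = (ennreal ep)^2*hn (sm + 4) (en f)" by (subst hn_cmult) (auto simp: hn_wgt)
  also have "... <= (ennreal ep)^2*(ennreal A)^2" by (intro mult_left_mono hbD(3)[OF f]) simp
  finally show "hn sm (en (%xi. cx (ep*wgt 2 xi)*f xi)) <= (ennreal (ep*A))^2"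
   using e A by (simp add: ennreal_mult power_mult_distrib)
 qed (use e A in auto)
 have "hb sm (%xi. free ep (%xi. p xi + ep*p1 xi) (%xi. q xi + ep*q1 xi) ta xi - trig (th ep) p q ta xi) (4*A*ep)" if ta: "0 <= ta" "ta <= t" for ta
 proof -
  have t': "ta <= 1/ep" using ta t by simp
  note pw = free_minus_app_pointwise[OF e ta(1) t']
  have X: "hb sm (%xi. (cx (cos (Om ep xi*ta) - cos (th ep xi*ta))*p xi + cx (sin (Om ep xi*ta) / om ep xi - sin (th ep xi*ta))*q xi)
   + (cx (ep*cos (Om ep xi*ta))*p1 xi + cx (ep*(sin (Om ep xi*ta) / om ep xi))*q1 xi)) ((ep*A + ep*A) + (norm (cx ep)*A + norm (cx ep)*A))"
  proof (intro hb_add)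
   show "hb sm (%xi. cx (cos (Om ep xi*ta) - cos (th ep xi*ta))*p xi) (ep*A)"
    by (rule hb_le[OF w[OF p]]) (measurable, unfold norm_mult norm_of_real, intro mult_right_mono order_trans[OF pw(1) abs_ge_self], simp)
   show "hb sm (%xi. cx (sin (Om ep xi*ta) / om ep xi - sin (th ep xi*ta))*q xi) (ep*A)"
    by (rule hb_le[OF w[OF q]]) (measurable, unfold norm_mult norm_of_real, intro mult_right_mono order_trans[OF pw(2) abs_ge_self], simp)
   show "hb sm (%xi. cx (ep*cos (Om ep xi*ta))*p1 xi) (norm (cx ep)*A)"
    by (rule hb_le[OF hb_cmult[OF p1]]) (measurable, unfold norm_mult norm_of_real abs_mult, intro mult_right_mono mult_left_le, auto)
   show "hb sm (%xi. cx (ep*(sin (Om ep xi*ta) / om ep xi))*q1 xi) (norm (cx ep)*A)"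
    by (rule hb_le[OF hb_cmult[OF q1]]) (measurable, unfold norm_mult norm_of_real abs_mult, intro mult_right_mono mult_left_le sin_div_om_le, auto)
  qed
  have E1: "(ep*A + ep*A) + (norm (cx ep)*A + norm (cx ep)*A) = 4*A*ep" using e by simp
  have E2: "(cx (cos (Om ep xi*ta) - cos (th ep xi*ta))*p xi + cx (sin (Om ep xi*ta) / om ep xi - sin (th ep xi*ta))*q xi)
   + (cx (ep*cos (Om ep xi*ta))*p1 xi + cx (ep*(sin (Om ep xi*ta) / om ep xi))*q1 xi)
   = free ep (%xi. p xi + ep*p1 xi) (%xi. q xi + ep*q1 xi) ta xi - trig (th ep) p q ta xi" for xi
   unfolding free_def trig_def by (simp add: field_simps)
  show ?thesis using X unfolding E1 E2 .
 qed
 then show ?thesis unfolding tb_def using m e A by auto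
qed

section \<open>Hermitian symmetry and the Picard iteration for the remainder\<close>

text \<open>Transforms of real functions have this symmetry almost everywhere. It is demanded at
  every point so that it passes through convolutions, Duhamel integrals and pointwise limits without
  exceptional sets.\<close>

definition hermitian :: "('a::euclidean_space => complex) => bool" where
 "hermitian f \<longleftrightarrow> (\<forall>xi. f (- xi) = cnj (f xi))"

lemma hermitian_cconv:
 fixes f g :: "'a::euclidean_space => complex"
 assumes [measurable]: "f \<in> BM" "g \<in> BM" and h: "hermitian f" "hermitian g"
 shows "hermitian (cconv f g)"
 unfolding hermitian_def
proof
 fix xi :: 'a
 have "cconv f g (- xi) = (LL et. f (- xi - (0 - et))*g (0 - et))"
  unfolding cconv_def by (rule lborel_reflect(1)[symmetric]) measurable
 also have "... = (LL et. cnj (f (xi - et)*g et))"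
 proof (intro BI_LINT_cong refl)
  fix et
  have "f (- (xi - et)) = cnj (f (xi - et))" "g (- et) = cnj (g et)" using h by (auto simp: hermitian_def simp del: minus_diff_eq)
  then show "f (- xi - (0 - et))*g (0 - et) = cnj (f (xi - et)*g et)" by simp
 qed
 also have "... = cnj (cconv f g xi)" unfolding cconv_def by (rule BI_LINT_cnj)
 finally show "cconv f g (- xi) = cnj (cconv f g xi)" .
qed

lemma hermitian_duh:
 assumes "!!ta. hermitian (F ta)"
 shows "hermitian (duh ep F t)"
 unfolding hermitian_def
proof
 fix xi
 have "duh ep F t (- xi) = (LL ta. cnj (ind {0..t} ta *R (cx (sin (Om ep xi*(t - ta)) / om ep xi)*F ta xi)))"
  unfolding duh_def using assms by (intro BI_LINT_cong) (auto simp: hermitian_def scaleR_conv_of_real)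
 also have "... = cnj (duh ep F t xi)" unfolding duh_def by (rule BI_LINT_cnj)
 finally show "duh ep F t (- xi) = cnj (duh ep F t xi)" .
qed

text \<open>\<open>R\<close> and \<open>Q\<close> bound the iterates \<open>r\<close> and
  \<open>Bq ep app r\<close> in units of \<open>ep\<close>; \<open>c1\<close> and \<open>c2\<close>
  make these bounds reproduce themselves. \<open>E\<close> and \<open>F\<close> bound the
  differences of successive iterates; \<open>c3\<close> and \<open>c4\<close> start the induction,
  \<open>c5\<close> and \<open>c6\<close> halve them. The coupling is triangular: \<open>Q\<close>
  enters \<open>c1\<close> and \<open>F\<close> enters \<open>c5\<close> without a factor
  \<open>T\<close>, whereas \<open>R\<close> enters \<open>c2\<close> and \<open>E\<close> enters
  \<open>c6\<close> on the left only together with \<open>T\<close>.\<close>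

locale kg_iteration = sobolev_algebra sm TT for sm and TT :: "'a::euclidean_space itself" +
 fixes ep T A mu R Q E F :: real and p q p1 q1 :: "'a => complex"
 assumes e: "0 < ep" "ep <= 1" and T: "0 < T" "T <= 1"
  and p: "hb (sm + 4) p A" and q: "hb (sm + 4) q A" and p1: "hb sm p1 A" and q1: "hb sm q1 A"
  and herm: "hermitian p" "hermitian q" "hermitian p1" "hermitian q1"
  and nonneg: "0 <= R" "0 <= Q" "0 <= E" "0 <= F"
  and c1: "(4*A + \<bar>mu\<bar>*(64*(kappa TYPE('a) sm*A\<^sup>2))) + 2*\<bar>mu\<bar>*Q + T*(\<bar>mu\<bar>*kappa TYPE('a) sm * R\<^sup>2) <= R"
  and c2: "(96*(kappa TYPE('a) sm*A\<^sup>2) + \<bar>mu\<bar>*(64*((kappa TYPE('a) sm)^2*A ^ 3)))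
   + T*(64*\<bar>mu\<bar>*(kappa TYPE('a) sm)^2*A\<^sup>2 * R + 16*\<bar>mu\<bar>*(kappa TYPE('a) sm)^2*A * R\<^sup>2) <= Q"
  and c3: "4*A + \<bar>mu\<bar>*(64*(kappa TYPE('a) sm*A\<^sup>2)) <= E"
  and c4: "96*(kappa TYPE('a) sm*A\<^sup>2) + \<bar>mu\<bar>*(64*((kappa TYPE('a) sm)^2*A ^ 3)) <= F"
  and c5: "2*(2*\<bar>mu\<bar>*F + T*(2*\<bar>mu\<bar>*kappa TYPE('a) sm * R)*E) <= E"
  and c6: "2*(T*(64*\<bar>mu\<bar>*(kappa TYPE('a) sm)^2*A\<^sup>2 + 32*\<bar>mu\<bar>*(kappa TYPE('a) sm)^2*A * R)*E) <= F"
begin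

definition t0 :: real where "t0 = T/ep"
definition K :: real where "K = kappa TYPE('a) sm"
definition b :: real where "b = \<bar>mu\<bar>"
definition app :: "real => 'a => complex" where "app = trig (th ep) p q"
definition fr :: "real => 'a => complex" where
 "fr = free ep (%xi. p xi + ep*p1 xi) (%xi. q xi + ep*q1 xi)"
text \<open>The function \<open>app + r\<close> satisfies the Duhamel equation with free part
  \<open>fr\<close> exactly when \<open>r = nxt r\<close>; \<open>S\<close> collects the terms
  without \<open>r\<close>.\<close>

definition S :: "real => 'a => complex" where
 "S = (%t xi. (fr t xi - app t xi) + mu*Bq ep app app t xi)"
definition nxt :: "(real => 'a => complex) => real => 'a => complex" where
 "nxt r = (%t xi. S t xi + (2*mu*Bq ep app r t xi + mu*Bq ep r r t xi))"

primrec rho :: "nat => real => 'a => complex" where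
 "rho 0 = (%t xi. 0)"
| "rho (Suc n) = nxt (rho n)"

lemma basic: "0 <= t0" "t0 <= 1/ep" "t0*ep = T" "0 <= K" "0 <= b" "0 <= A" "ep\<^sup>2 <= ep"
 using e T hbD(2)[OF p] by (auto simp: t0_def K_def b_def divide_right_mono power2_eq_square mult_left_le)

lemma app: "tb sm t app (2*A)"
proof -
 have "tb sm t app (A + A)"
  unfolding app_def using p q hb_mono_exp by (intro tb_trig) fastforce+
 then show ?thesis by simp
qed

lemma PQ: "hb sm (%xi. p xi + ep*p1 xi) (2*A)" "hb sm (%xi. q xi + ep*q1 xi) (2*A)"
proof -
 have *: "hb sm (%xi. f xi + ep*g xi) (2*A)" if f: "hb (sm + 4) f A" and g: "hb sm g A" for f g :: "'a => complex"
 proof (rule hb_mono_B)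
  show "hb sm (%xi. f xi + ep*g xi) (A + norm (cx ep)*A)"
   using f hb_mono_exp by (intro hb_add hb_cmult g) fastforce
  have "norm (cx ep)*A <= 1*A" using e basic by (intro mult_right_mono) auto
  then show "A + norm (cx ep)*A <= 2*A" by simp
 qed
 show "hb sm (%xi. p xi + ep*p1 xi) (2*A)" "hb sm (%xi. q xi + ep*q1 xi) (2*A)"
  by (intro * p q p1 q1)+
qed

lemma fr: "tb sm t fr (2*(2*A))"
 unfolding fr_def by (intro tb_free PQ)

lemma le_eps: "0 <= x ==> x*ep\<^sup>2 <= x*ep"
 using basic by (intro mult_left_mono) auto

lemma S: "tb sm t0 S ((4*A + b*(64*(K*A\<^sup>2)))*ep)"
proof (rule tb_mono)
 show "tb sm t0 S (4*A*ep + norm (cx mu)*(16*ep\<^sup>2*(K*((2*A)*(2*A)))))"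
  unfolding S_def app_def fr_def K_def
  by (intro tb_add tb_cmult tb_free_minus_app tb_Bq_app_app e basic p q p1 q1)
 have "b*(64*(K*A\<^sup>2))*ep\<^sup>2 <= b*(64*(K*A\<^sup>2))*ep" using basic by (intro le_eps) auto
 then show "4*A*ep + norm (cx mu)*(16*ep\<^sup>2*(K*((2*A)*(2*A)))) <= (4*A + b*(64*(K*A\<^sup>2)))*ep"
  by (simp add: b_def power2_eq_square algebra_simps)
qed

lemma app_Bq:
 assumes x: "tb sm t0 x X" and y: "tb sm t0 y Y"
 shows "tb sm t0 (Bq ep app (Bq ep x y)) (16*T*ep*K\<^sup>2*A*X*Y)"
proof -
 have "tb sm t0 (Bq ep app (Bq ep x y)) (t0*(8*ep\<^sup>2*(K*((2*A)*(K*(X*Y))))))"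
  unfolding app_def K_def by (intro tb_Bq_app_Bq e basic p q x y)
 also have "t0*(8*ep\<^sup>2*(K*((2*A)*(K*(X*Y))))) = 16*(t0*ep)*ep*K\<^sup>2*A*X*Y"
  by (simp add: power2_eq_square)
 finally show ?thesis unfolding basic(3) .
qed

lemma tb_measurable: "tb sm t f X ==> (%(t, xi). f t xi) \<in> BM2"
 by (rule tbD(1))

text \<open>Knowing only that \<open>S\<close> is of size \<open>ep\<close> would give a bound of
  size 1 on times \<open>T/ep\<close>. Instead \<open>S\<close> is inserted term by term: its free
  part and \<open>app\<close> interact nonresonantly with \<open>app\<close>, and its quadratic part
  produces a double Duhamel integral.\<close>

lemma app_S: "tb sm t0 (Bq ep app S) ((96*(K*A\<^sup>2) + b*(64*(K\<^sup>2*A ^ 3)))*ep)"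
proof -
 have BA: "tb sm t0 (Bq ep app app) (16*ep\<^sup>2*(K*((2*A)*(2*A))))"
  unfolding app_def K_def by (intro tb_Bq_app_app e basic p q)
 have BF: "tb sm t0 (Bq ep app fr) (4*ep\<^sup>2*(K*((2*A)*(2*(2*A)))))"
  unfolding app_def K_def fr_def free_def by (intro tb_Bq_app_free e basic p q hb_div_om PQ)
 have BB: "tb sm t0 (Bq ep app (Bq ep app app)) (16*T*ep*K\<^sup>2*A*(2*A)*(2*A))"
  by (intro app_Bq app)
 have eq: "Bq ep app S ta xi = (Bq ep app fr ta xi - Bq ep app app ta xi) + mu*Bq ep app (Bq ep app app) ta xi"
  if ta: "0 <= ta" "ta <= t0" for ta xi
  unfolding S_def Bq_add_right[OF app tb_diff[OF fr app] tb_cmult[OF BA] ta] Bq_diff_right[OF app fr app ta] Bq_cmult_right ..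
 have "tb sm t0 (Bq ep app S) ((4*ep\<^sup>2*(K*((2*A)*(2*(2*A)))) + 16*ep\<^sup>2*(K*((2*A)*(2*A)))) + norm (cx mu)*(16*T*ep*K\<^sup>2*A*(2*A)*(2*A)))"
  by (rule tb_cong[OF tb_add[OF tb_diff[OF BF BA] tb_cmult[OF BB, of mu]]])
   (rule tb_measurable[OF tb_Bq[OF app S basic(1)]], rule eq)
 then show ?thesis
 proof (rule tb_mono)
  have 1: "96*(K*A\<^sup>2)*ep\<^sup>2 <= 96*(K*A\<^sup>2)*ep" using basic by (intro le_eps) auto
  have 2: "T*(b*(64*(K\<^sup>2*A ^ 3))*ep) <= 1*(b*(64*(K\<^sup>2*A ^ 3))*ep)"
   using T basic e by (intro mult_right_mono) auto
  have "(4*ep\<^sup>2*(K*((2*A)*(2*(2*A)))) + 16*ep\<^sup>2*(K*((2*A)*(2*A)))) + norm (cx mu)*(16*T*ep*K\<^sup>2*A*(2*A)*(2*A))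
   = 96*(K*A\<^sup>2)*ep\<^sup>2 + T*(b*(64*(K\<^sup>2*A ^ 3))*ep)"
   by (simp add: b_def power2_eq_square eval_nat_numeral algebra_simps)
  also have "... <= 96*(K*A\<^sup>2)*ep + 1*(b*(64*(K\<^sup>2*A ^ 3))*ep)" using 1 2 by (rule add_mono)
  finally show "(4*ep\<^sup>2*(K*((2*A)*(2*(2*A)))) + 16*ep\<^sup>2*(K*((2*A)*(2*A)))) + norm (cx mu)*(16*T*ep*K\<^sup>2*A*(2*A)*(2*A))
   <= (96*(K*A\<^sup>2) + b*(64*(K\<^sup>2*A ^ 3)))*ep" by (simp add: algebra_simps)
 qed
qed

lemma norm_2mu: "norm (cx (2*mu)) = 2*b" "norm (cx mu) = b"
 by (simp_all only: norm_of_real abs_mult b_def abs_numeral)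

text \<open>The first bound takes the interaction \<open>Bq ep app r\<close> from the assumption.
  The second never estimates \<open>Bq ep app\<close> of the new iterate directly; its definition is
  inserted, which leaves \<open>app_S\<close> and double Duhamel integrals.\<close>

lemma nxt_tb:
 assumes r: "tb sm t0 r (R*ep)" and ar: "tb sm t0 (Bq ep app r) (Q*ep)"
 shows "tb sm t0 (nxt r) (R*ep)" and "tb sm t0 (Bq ep app (nxt r)) (Q*ep)"
proof -
 have rr: "tb sm t0 (Bq ep r r) (t0*(K*((R*ep)*(R*ep))))"
  unfolding K_def by (intro tb_Bq r basic)
 have n: "tb sm t0 (nxt r) ((4*A + b*(64*(K*A\<^sup>2)))*ep + (norm (cx (2*mu))*(Q*ep) + norm (cx mu)*(t0*(K*((R*ep)*(R*ep))))))"
  unfolding nxt_def by (intro tb_add S tb_cmult ar rr)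
 moreover have "(4*A + b*(64*(K*A\<^sup>2)))*ep + (norm (cx (2*mu))*(Q*ep) + norm (cx mu)*(t0*(K*((R*ep)*(R*ep)))))
  = ((4*A + b*(64*(K*A\<^sup>2))) + 2*b*Q + (t0*ep)*(b*K * R\<^sup>2))*ep"
  unfolding norm_2mu by (simp add: power2_eq_square algebra_simps)
 moreover have "... <= R*ep"
  using c1 e unfolding basic(3) b_def K_def by (intro mult_right_mono) auto
 ultimately show nR: "tb sm t0 (nxt r) (R*ep)" by (metis tb_mono)
 have eq: "Bq ep app (nxt r) ta xi = Bq ep app S ta xi + (2*mu*Bq ep app (Bq ep app r) ta xi + mu*Bq ep app (Bq ep r r) ta xi)"
  if ta: "0 <= ta" "ta <= t0" for ta xi
  unfolding nxt_def Bq_add_right[OF app S tb_add[OF tb_cmult[OF ar] tb_cmult[OF rr]] ta]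
   Bq_add_right[OF app tb_cmult[OF ar] tb_cmult[OF rr] ta] Bq_cmult_right ..
 have "tb sm t0 (Bq ep app (nxt r)) ((96*(K*A\<^sup>2) + b*(64*(K\<^sup>2*A ^ 3)))*ep +
  (norm (cx (2*mu))*(16*T*ep*K\<^sup>2*A*(2*A)*(R*ep)) + norm (cx mu)*(16*T*ep*K\<^sup>2*A*(R*ep)*(R*ep))))"
  by (rule tb_cong[OF tb_add[OF app_S tb_add[OF tb_cmult[OF app_Bq[OF app r], of "2*mu"] tb_cmult[OF app_Bq[OF r r], of mu]]]])
   (rule tb_measurable[OF tb_Bq[OF app n basic(1)]], use eq in simp)
 then show "tb sm t0 (Bq ep app (nxt r)) (Q*ep)"
 proof (rule tb_mono)
  have "T*(64*b*K\<^sup>2*A\<^sup>2 * R*ep) <= T*(64*b*K\<^sup>2*A\<^sup>2 * R*1)"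
   using T basic e nonneg by (intro mult_left_mono) auto
  moreover have "T*(16*b*K\<^sup>2*A * R\<^sup>2*ep\<^sup>2) <= T*(16*b*K\<^sup>2*A * R\<^sup>2*1)"
   using T basic e nonneg by (intro mult_left_mono) auto
  ultimately have "(96*(K*A\<^sup>2) + b*(64*(K\<^sup>2*A ^ 3))) + (T*(64*b*K\<^sup>2*A\<^sup>2 * R*ep) + T*(16*b*K\<^sup>2*A * R\<^sup>2*ep\<^sup>2)) <= Q"
   using c2 unfolding K_def[symmetric] b_def[symmetric] by (simp add: algebra_simps)
  then have "((96*(K*A\<^sup>2) + b*(64*(K\<^sup>2*A ^ 3))) + (T*(64*b*K\<^sup>2*A\<^sup>2 * R*ep) + T*(16*b*K\<^sup>2*A * R\<^sup>2*ep\<^sup>2)))*ep <= Q*ep"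
   using e by (intro mult_right_mono) auto
  then show "(96*(K*A\<^sup>2) + b*(64*(K\<^sup>2*A ^ 3)))*ep +
  (norm (cx (2*mu))*(16*T*ep*K\<^sup>2*A*(2*A)*(R*ep)) + norm (cx mu)*(16*T*ep*K\<^sup>2*A*(R*ep)*(R*ep))) <= Q*ep"
   unfolding norm_2mu by (simp add: power2_eq_square algebra_simps)
 qed
qed

text \<open>The quadratic terms factor as \<open>Bq ep (r + r') (r - r')\<close>, where
  \<open>r + r'\<close> supplies an \<open>ep\<close> that pays for the long time. The linear term
  enters the first bound through the known \<open>G\<close>, and the second through a double Duhamel
  integral, so the second bound contains only \<open>D\<close>, with a factor
  \<open>T\<close>.\<close>

lemma nxt_diff:
 assumes r: "tb sm t0 r (R*ep)" and r': "tb sm t0 r' (R*ep)"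
  and d: "tb sm t0 (%ta xi. r ta xi - r' ta xi) D" and ad: "tb sm t0 (Bq ep app (%ta xi. r ta xi - r' ta xi)) G"
 shows "tb sm t0 (%ta xi. nxt r ta xi - nxt r' ta xi) (2*b*G + T*(2*b*K * R)*D)"
  and "tb sm t0 (Bq ep app (%ta xi. nxt r ta xi - nxt r' ta xi)) (T*(64*b*K\<^sup>2*A\<^sup>2 + 32*b*K\<^sup>2*A * R)*D)"
proof -
 define dd where "dd = (%ta xi. r ta xi - r' ta xi)"
 define ss where "ss = (%ta xi. r ta xi + r' ta xi)"
 have d: "tb sm t0 dd D" and ad: "tb sm t0 (Bq ep app dd) G" using d ad by (simp_all add: dd_def)
 have D0: "0 <= D" using tbD(2)[OF d] .
 have ss: "tb sm t0 ss (2*(R*ep))" using tb_add[OF r r'] by (simp add: ss_def)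
 have sd: "tb sm t0 (Bq ep ss dd) (t0*(K*((2*(R*ep))*D)))" unfolding K_def by (intro tb_Bq ss d basic)
 have ar: "tb sm t0 (Bq ep app r) (t0*(K*((2*A)*(R*ep))))" "tb sm t0 (Bq ep app r') (t0*(K*((2*A)*(R*ep))))"
  unfolding K_def by (intro tb_Bq app r r' basic)+
 have rr: "tb sm t0 (Bq ep r r) (t0*(K*((R*ep)*(R*ep))))" "tb sm t0 (Bq ep r' r') (t0*(K*((R*ep)*(R*ep))))"
  unfolding K_def by (intro tb_Bq r r' basic)+
 have nm: "tb sm t0 (%ta xi. nxt r ta xi - nxt r' ta xi) (
   ((4*A + b*(64*(K*A\<^sup>2)))*ep + (norm (cx (2*mu))*(t0*(K*((2*A)*(R*ep)))) + norm (cx mu)*(t0*(K*((R*ep)*(R*ep))))))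
  + ((4*A + b*(64*(K*A\<^sup>2)))*ep + (norm (cx (2*mu))*(t0*(K*((2*A)*(R*ep)))) + norm (cx mu)*(t0*(K*((R*ep)*(R*ep)))))))"
  unfolding nxt_def by (intro tb_diff tb_add S tb_cmult ar rr)
 have eq: "nxt r ta xi - nxt r' ta xi = 2*mu*Bq ep app dd ta xi + mu*Bq ep ss dd ta xi"
  if ta: "0 <= ta" "ta <= t0" for ta xi
 proof -
  have "nxt r ta xi - nxt r' ta xi = 2*mu*(Bq ep app r ta xi - Bq ep app r' ta xi) + mu*(Bq ep r r ta xi - Bq ep r' r' ta xi)"
   unfolding nxt_def by (simp add: algebra_simps)
  then show ?thesis
   unfolding Bq_square_diff[OF r r' ta] Bq_diff_right[OF app r r' ta, symmetric] dd_def ss_def .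
 qed
 have 1: "tb sm t0 (%ta xi. nxt r ta xi - nxt r' ta xi) (norm (cx (2*mu))*G + norm (cx mu)*(t0*(K*((2*(R*ep))*D))))"
  by (rule tb_cong[OF tb_add[OF tb_cmult[OF ad, of "2*mu"] tb_cmult[OF sd, of mu]]])
   (rule tb_measurable[OF nm], use eq in simp)
 also have "norm (cx (2*mu))*G + norm (cx mu)*(t0*(K*((2*(R*ep))*D))) = 2*b*G + (t0*ep)*(2*b*K * R)*D"
  unfolding norm_2mu by simp
 finally show "tb sm t0 (%ta xi. nxt r ta xi - nxt r' ta xi) (2*b*G + T*(2*b*K * R)*D)" unfolding basic(3) .
 have eq2: "Bq ep app (%ta xi. nxt r ta xi - nxt r' ta xi) ta xi = 2*mu*Bq ep app (Bq ep app dd) ta xi + mu*Bq ep app (Bq ep ss dd) ta xi"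
  if ta: "0 <= ta" "ta <= t0" for ta xi
 proof -
  have "Bq ep app (%ta xi. nxt r ta xi - nxt r' ta xi) ta xi = Bq ep app (%ta xi. 2*mu*Bq ep app dd ta xi + mu*Bq ep ss dd ta xi) ta xi"
   unfolding Bq_def[of ep app] using ta
   by (intro duh_cong arg_cong2[where f="cconv (app _)"] arg_cong[where f="%g. cconv (app _) g xi"] ext) (simp add: eq[unfolded Bq_def[of ep app]])
  then show ?thesis
   unfolding Bq_add_right[OF app tb_cmult[OF ad] tb_cmult[OF sd] ta] Bq_cmult_right .
 qed
 have 2: "tb sm t0 (Bq ep app (%ta xi. nxt r ta xi - nxt r' ta xi)) (norm (cx (2*mu))*(16*T*ep*K\<^sup>2*A*(2*A)*D) + norm (cx mu)*(16*T*ep*K\<^sup>2*A*(2*(R*ep))*D))"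
  by (rule tb_cong[OF tb_add[OF tb_cmult[OF app_Bq[OF app d], of "2*mu"] tb_cmult[OF app_Bq[OF ss d], of mu]]])
   (rule tb_measurable[OF tb_Bq[OF app 1 basic(1)]], use eq2 in simp)
 then show "tb sm t0 (Bq ep app (%ta xi. nxt r ta xi - nxt r' ta xi)) (T*(64*b*K\<^sup>2*A\<^sup>2 + 32*b*K\<^sup>2*A * R)*D)"
 proof (rule tb_mono)
  have 1: "(T*(64*b*K\<^sup>2*A\<^sup>2)*D)*ep <= (T*(64*b*K\<^sup>2*A\<^sup>2)*D)*1"
   using T basic e nonneg D0 by (intro mult_left_mono) auto
  have 2: "(T*(32*b*K\<^sup>2*A * R)*D)*ep\<^sup>2 <= (T*(32*b*K\<^sup>2*A * R)*D)*1"
   using T basic e nonneg D0 by (intro mult_left_mono) auto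
  show "norm (cx (2*mu))*(16*T*ep*K\<^sup>2*A*(2*A)*D) + norm (cx mu)*(16*T*ep*K\<^sup>2*A*(2*(R*ep))*D)
   <= T*(64*b*K\<^sup>2*A\<^sup>2 + 32*b*K\<^sup>2*A * R)*D"
   using add_mono[OF 1 2] unfolding norm_2mu by (simp add: power2_eq_square algebra_simps)
 qed
qed

lemma Bq_zero: "Bq ep f (%ta xi. 0) ta xi = 0"
 unfolding Bq_def duh_def cconv_def by simp

lemma rho_tb: "tb sm t0 (rho n) (R*ep) & tb sm t0 (Bq ep app (rho n)) (Q*ep)"
proof (induction n)
 case 0
 have z: "tb sm t0 (%t xi. 0 :: complex) 0" unfolding tb_def by (auto intro: hb_zero)
 have "tb sm t0 (rho 0) (R*ep)" by (rule tb_mono[where A=0]) (use z e nonneg in auto)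
 moreover have "Bq ep app (rho 0) = (%t xi. 0)" by (intro ext) (simp add: Bq_zero)
 then have "tb sm t0 (Bq ep app (rho 0)) (Q*ep)" using z e nonneg by (auto intro: tb_mono)
 ultimately show ?case ..
next
 case (Suc n)
 then show ?case unfolding rho.simps by (intro conjI nxt_tb) auto
qed

text \<open>Convergence takes place at fixed \<open>ep\<close>, so the differences are bounded
  without a power of \<open>ep\<close>; the size \<open>R*ep\<close> of the limit comes from
  \<open>rho_tb\<close>.\<close>

lemma rho_diff:
 "tb sm t0 (%ta xi. rho (Suc n) ta xi - rho n ta xi) (E*(1/2)^n) &
 tb sm t0 (Bq ep app (%ta xi. rho (Suc n) ta xi - rho n ta xi)) (F*(1/2)^n)"
proof (induction n)
 case 0
 have "(%ta xi. rho (Suc 0) ta xi - rho 0 ta xi) = S"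
  by (intro ext) (simp add: nxt_def Bq_zero)
 moreover have "(4*A + b*(64*(K*A\<^sup>2)))*ep <= E*1"
  using c3 e nonneg basic unfolding b_def[symmetric] K_def[symmetric] by (intro mult_mono) auto
 moreover have "(96*(K*A\<^sup>2) + b*(64*(K\<^sup>2*A ^ 3)))*ep <= F*1"
  using c4 e nonneg basic unfolding b_def[symmetric] K_def[symmetric] by (intro mult_mono) auto
 ultimately show ?case using S app_S by (auto intro: tb_mono)
next
 case (Suc n)
 define d where "d = (%ta xi. rho (Suc n) ta xi - rho n ta xi)"
 have r: "tb sm t0 (rho (Suc n)) (R*ep)" "tb sm t0 (rho n) (R*ep)" using rho_tb by blast+
 have nx: "(%ta xi. rho (Suc (Suc n)) ta xi - rho (Suc n) ta xi) = (%ta xi. nxt (rho (Suc n)) ta xi - nxt (rho n) ta xi)" by simp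
 note s = nxt_diff[OF r conjunct1[OF Suc.IH] conjunct2[OF Suc.IH]]
 have h0: "0 <= (1/2::real)^n" by simp
 have 1: "2*b*(F*(1/2)^n) + T*(2*b*K * R)*(E*(1/2)^n) <= E*(1/2)^Suc n"
  using mult_right_mono[OF c5 h0] unfolding b_def[symmetric] K_def[symmetric] by (simp add: algebra_simps)
 have 2: "T*(64*b*K\<^sup>2*A\<^sup>2 + 32*b*K\<^sup>2*A * R)*(E*(1/2)^n) <= F*(1/2)^Suc n"
  using mult_right_mono[OF c6 h0] unfolding b_def[symmetric] K_def[symmetric] by (simp add: algebra_simps)
 show ?case unfolding nx using tb_mono[OF s(1) 1] tb_mono[OF s(2) 2] by blast
qed

end

context kg_iteration
begin

text \<open>The norm bounds give convergence for almost every \<open>xi\<close> at each time. A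
  pointwise limit with default 0 off the Cauchy set is jointly measurable and inherits the hermitian
  symmetry everywhere.\<close>

definition rhoL :: "real => 'a => complex" where
 "rhoL t xi = (if Cauchy (%n. rho n t xi) then lim (%n. rho n t xi) else 0)"

lemma rho_measurable: "(%(t, xi). rho n t xi) \<in> BM2"
 using rho_tb tbD(1) by blast

lemma rhoL_measurable [measurable]: "(%(t, xi). rhoL t xi) \<in> BM2"
proof -
 have [measurable]: "(%z. rho n (fst z) (snd z)) \<in> BM2" for n
  using rho_measurable[of n] by (simp add: case_prod_unfold)
 have "{z \<in> space (borel \<Otimes>\<^sub>M borel). Cauchy (%n. rho n (fst z) (snd z))} \<in> sets (borel \<Otimes>\<^sub>M borel)"
  by (rule sets_Collect_Cauchy) measurable
 then show ?thesis unfolding rhoL_def case_prod_unfold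
  by (intro measurable_If borel_measurable_lim_metric) auto
qed

lemma rho_diff_hb:
 assumes t: "0 <= t" "t <= t0"
 shows "hb sm (%xi. rho (n + m) t xi - rho n t xi) (2*E*(1/2)^n - 2*E*(1/2)^(n + m))"
proof (induction m)
 case 0 then show ?case by (simp add: hb_zero)
next
 case (Suc m)
 have "hb sm (%xi. rho (Suc (n + m)) t xi - rho (n + m) t xi) (E*(1/2)^(n + m))"
  using tbD(3)[OF conjunct1[OF rho_diff[of "n + m"]] t] .
 from hb_add[OF Suc.IH this]
 have "hb sm (%xi. rho (Suc (n + m)) t xi - rho n t xi) (2*E*(1/2)^n - 2*E*(1/2)^(n + m) + E*(1/2)^(n + m))"
  by (simp add: algebra_simps del: rho.simps)
 moreover have "2*E*(1/2)^n - 2*E*(1/2)^(n + m) + E*(1/2)^(n + m) = 2*E*(1/2)^n - 2*E*(1/2)^(n + Suc m)"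
  by simp
 ultimately show ?case by (simp del: rho.simps)
qed

lemma rho_converges:
 assumes t: "0 <= t" "t <= t0"
 shows "AEL xi. (%n. rho n t xi) ---> rhoL t xi"
proof -
 have "AEL xi. summable (%n. norm (rho (Suc n) t xi - rho n t xi))"
  using tbD(3)[OF conjunct1[OF rho_diff] t] nonneg(3) by (intro AE_summable_geometric[OF s0]) auto
 then show ?thesis
 proof eventually_elim
  case (elim xi)
  then have "summable (%n. rho (Suc n) t xi - rho n t xi)" by (rule summable_norm_cancel)
  then have "(%n. \<Sum>k<n. rho (Suc k) t xi - rho k t xi) ---> (\<Sum>k. rho (Suc k) t xi - rho k t xi)"
   by (rule summable_LIMSEQ)
  moreover have "(\<Sum>k<n. rho (Suc k) t xi - rho k t xi) = rho n t xi" for n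
   using sum_lessThan_telescope[of "%k. rho k t xi" n] by simp
  ultimately have "(%n. rho n t xi) ---> (\<Sum>k. rho (Suc k) t xi - rho k t xi)" by (simp only:)
  then have c: "convergent (%n. rho n t xi)" by (rule convergentI)
  have "rhoL t xi = lim (%n. rho n t xi)" unfolding rhoL_def using convergent_Cauchy[OF c] by (rule if_P)
  then show ?case using c unfolding convergent_LIMSEQ_iff by (simp only:)
 qed
qed

lemma rhoL_tb: "tb sm t0 rhoL (R*ep)"
 unfolding tb_def
proof (intro conjI allI impI rhoL_measurable)
 show "0 <= R*ep" using nonneg e by simp
 fix t assume t: "0 <= t" "t <= t0"
 show "hb sm (rhoL t) (R*ep)"
 proof (rule hb_fatou[OF _ _ rho_converges[OF t]])
  show "hb sm (rho n t) (R*ep)" for n using tbD(3)[OF conjunct1[OF rho_tb] t] .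
 qed measurable
qed

lemma rho_rhoL_diff: "tb sm t0 (%t xi. rho n t xi - rhoL t xi) (2*E*(1/2)^n)"
 unfolding tb_def
proof (intro conjI allI impI)
 note [measurable] = rho_measurable
 show "(%(t, xi). rho n t xi - rhoL t xi) \<in> BM2"
  using rho_measurable[of n] rhoL_measurable unfolding case_prod_unfold by (rule borel_measurable_diff)
 show "0 <= 2*E*(1/2)^n" using nonneg by simp
 fix t assume t: "0 <= t" "t <= t0"
 have r: "hb sm (rho n t) (R*ep)" for n using tbD(3)[OF conjunct1[OF rho_tb] t] .
 note m [measurable] = hbD(1)[OF r]
 show "hb sm (%xi. rho n t xi - rhoL t xi) (2*E*(1/2)^n)"
 proof (rule hb_fatou[where f="%m xi. rho n t xi - rho (n + m) t xi"])
  show "hb sm (%xi. rho n t xi - rho (n + m) t xi) (2*E*(1/2)^n)" for m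
  proof (rule hb_mono_B)
   show "hb sm (%xi. rho n t xi - rho (n + m) t xi) (2*E*(1/2)^n - 2*E*(1/2)^(n + m))"
    by (rule hb_le[OF rho_diff_hb[OF t, of n m]]) (measurable, simp add: norm_minus_commute)
   show "2*E*(1/2)^n - 2*E*(1/2)^(n + m) <= 2*E*(1/2)^n" using nonneg by simp
  qed
  show "AEL xi. (%m. rho n t xi - rho (n + m) t xi) ---> rho n t xi - rhoL t xi"
   using rho_converges[OF t]
  proof eventually_elim
   case (elim xi)
   then have "(%m. rho (m + n) t xi) ---> rhoL t xi" by (rule LIMSEQ_ignore_initial_segment)
   then show ?case by (intro tendsto_intros) (simp add: add.commute)
  qed
 qed measurable
qed

lemma rhoL_fixed:
 assumes t: "0 <= t" "t <= t0"
 shows "AEL xi. rhoL t xi = nxt rhoL t xi"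
proof -
 have r: "tb sm t0 (rho n) (R*ep)" for n using rho_tb by blast
 define M where "M = 2*b*(t0*(K*((2*A)*(2*E)))) + T*(2*b*K * R)*(2*E) + 2*E"
 have bound: "hb sm (%xi. rhoL t xi - nxt rhoL t xi) (M*(1/2)^n)" for n
 proof -
  have d: "tb sm t0 (%ta xi. rho n ta xi - rhoL ta xi) (2*E*(1/2)^n)" by (rule rho_rhoL_diff)
  \<comment> \<open>At fixed \<open>ep\<close> the plain estimate with the factor \<open>t0\<close>
    suffices, since the bound is only multiplied by \<open>(1/2)^n\<close>.\<close>
  have ad: "tb sm t0 (Bq ep app (%ta xi. rho n ta xi - rhoL ta xi)) (t0*(K*((2*A)*(2*E*(1/2)^n))))"
   unfolding K_def by (rule tb_Bq[OF app d basic(1)])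
  have 1: "hb sm (%xi. rho (Suc n) t xi - nxt rhoL t xi) (2*b*(t0*(K*((2*A)*(2*E*(1/2)^n)))) + T*(2*b*K * R)*(2*E*(1/2)^n))"
   using tbD(3)[OF nxt_diff(1)[OF r rhoL_tb d ad] t] by simp
  have 2: "hb sm (%xi. rho (Suc n) t xi - rhoL t xi) (2*E*(1/2)^Suc n)"
   using tbD(3)[OF rho_rhoL_diff t] .
  have "hb sm (%xi. (rho (Suc n) t xi - nxt rhoL t xi) - (rho (Suc n) t xi - rhoL t xi))
    (2*b*(t0*(K*((2*A)*(2*E*(1/2)^n)))) + T*(2*b*K * R)*(2*E*(1/2)^n) + 2*E*(1/2)^Suc n)"
   by (rule hb_diff[OF 1 2])
  moreover have "(rho (Suc n) t xi - nxt rhoL t xi) - (rho (Suc n) t xi - rhoL t xi) = rhoL t xi - nxt rhoL t xi" for xi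
   by (simp del: rho.simps)
  ultimately have "hb sm (%xi. rhoL t xi - nxt rhoL t xi)
    (2*b*(t0*(K*((2*A)*(2*E*(1/2)^n)))) + T*(2*b*K * R)*(2*E*(1/2)^n) + 2*E*(1/2)^Suc n)"
   by (simp only:)
  then show ?thesis
  proof (rule hb_mono_B)
   have "E*(1/2)^n <= 2*(E*(1/2)^n)" using nonneg by simp
   then show "2*b*(t0*(K*((2*A)*(2*E*(1/2)^n)))) + T*(2*b*K * R)*(2*E*(1/2)^n) + 2*E*(1/2)^Suc n <= M*(1/2)^n"
    unfolding M_def by (simp add: algebra_simps)
  qed
 qed
 have lim: "(%n. ennreal ((M*(1/2)^n)^2)) ---> ennreal ((M*0)^2)"
  by (intro tendsto_ennrealI tendsto_intros LIMSEQ_realpow_zero) auto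
 have "hn sm (en (%xi. rhoL t xi - nxt rhoL t xi)) <= ennreal ((M*0)^2)"
  using bound unfolding hb_def by (intro LIMSEQ_le_const[OF lim]) auto
 then have "hn sm (en (%xi. rhoL t xi - nxt rhoL t xi)) = 0" by simp
 then have "AEL xi. en (%xi. rhoL t xi - nxt rhoL t xi) xi = 0"
  using hbD(1)[OF bound[of 0]] by (subst (asm) hn_zero_iff) auto
 then show ?thesis by eventually_elim simp
qed

lemma hermitian_fr: "hermitian (fr t)" and hermitian_app: "hermitian (app t)"
 unfolding fr_def free_def app_def using herm
 by (auto simp: hermitian_def trig_def)

lemma hermitian_Bq:
 assumes f: "!!ta. f ta \<in> BM" "!!ta. hermitian (f ta)"
  and g: "!!ta. g ta \<in> BM" "!!ta. hermitian (g ta :: 'a => complex)"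
 shows "hermitian (Bq ep f g t)"
 unfolding Bq_def by (intro hermitian_duh hermitian_cconv f g)

lemma joint_measurable_slice:
 assumes "(%(t, xi). f t xi) \<in> BM2"
 shows "f t \<in> borel_measurable (borel :: 'a measure)"
 using measurable_compose[OF measurable_Pair1'[of t borel borel] assms] by simp

lemma hermitian_rho: "hermitian (rho n t)"
proof (induction n arbitrary: t)
 case 0 then show ?case by (simp add: hermitian_def)
next
 case (Suc n)
 have m: "rho n ta \<in> BM" "app ta \<in> BM" for ta
  by (intro joint_measurable_slice rho_measurable tbD(1)[OF app])+
 have 1: "hermitian (Bq ep app app t)" "hermitian (Bq ep app (rho n) t)" "hermitian (Bq ep (rho n) (rho n) t)"
  by (intro hermitian_Bq m hermitian_app Suc.IH)+
 show ?case
  using 1 hermitian_fr[of t] hermitian_app[of t] unfolding rho.simps nxt_def S_def hermitian_def by simp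
qed

lemma hermitian_rhoL: "hermitian (rhoL t)"
 unfolding hermitian_def
proof
 fix xi
 have h: "rho n t (- xi) = cnj (rho n t xi)" for n using hermitian_rho[of n t] by (simp add: hermitian_def)
 have C: "Cauchy (%n. rho n t (- xi)) \<longleftrightarrow> Cauchy (%n. rho n t xi)"
  unfolding h Cauchy_def dist_norm by (simp flip: complex_cnj_diff)
 show "rhoL t (- xi) = cnj (rhoL t xi)"
 proof (cases "Cauchy (%n. rho n t xi)")
  case True
  then have "(%n. rho n t xi) ---> lim (%n. rho n t xi)"
   using Cauchy_convergent_iff convergent_LIMSEQ_iff by blast
  then have "(%n. rho n t (- xi)) ---> cnj (lim (%n. rho n t xi))" unfolding h by (rule tendsto_cnj)
  then show ?thesis using True C unfolding rhoL_def by (simp add: limI)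
 qed (use C in \<open>simp add: rhoL_def\<close>)
qed

theorem kg_solution:
 obtains uh where
  "(%(t, xi). uh t xi) \<in> BM2"
  "!!t. hermitian (uh t)"
  "tb sm (T/ep) uh (2*A + R*ep)"
  "tb sm (T/ep) (%t xi. uh t xi - trig (th ep) p q t xi) (R*ep)"
  "!!t. 0 <= t ==> t <= T/ep ==> AEL xi. uh t xi =
   free ep (%xi. p xi + ep*p1 xi) (%xi. q xi + ep*q1 xi) t xi + mu*Bq ep uh uh t xi"
proof -
 define uh where "uh = (%t xi. app t xi + rhoL t xi)"
 have tb: "tb sm (T/ep) uh (2*A + R*ep)"
  unfolding uh_def t0_def[symmetric] by (intro tb_add app rhoL_tb)
 have "uh t xi - trig (th ep) p q t xi = rhoL t xi" for t xi unfolding uh_def app_def by simp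
 then have tb2: "tb sm (T/ep) (%t xi. uh t xi - trig (th ep) p q t xi) (R*ep)"
  using rhoL_tb unfolding t0_def by simp
 have h: "hermitian (uh t)" for t
  using hermitian_app[of t] hermitian_rhoL[of t] unfolding uh_def hermitian_def by simp
 have "AEL xi. uh t xi = fr t xi + mu*Bq ep uh uh t xi" if t: "0 <= t" "t <= t0" for t
  using rhoL_fixed[OF t]
 proof eventually_elim
  case (elim xi)
  have "uh t xi = app t xi + nxt rhoL t xi" unfolding uh_def using elim by simp
  also have "... = fr t xi + mu*(Bq ep app app t xi + 2*Bq ep app rhoL t xi + Bq ep rhoL rhoL t xi)"
   unfolding nxt_def S_def by (simp add: algebra_simps)
  also have "Bq ep app app t xi + 2*Bq ep app rhoL t xi + Bq ep rhoL rhoL t xi = Bq ep uh uh t xi"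
   unfolding uh_def by (rule Bq_square_add[OF app rhoL_tb t, symmetric])
  finally show ?case .
 qed
 then show ?thesis using that[of uh] tbD(1)[OF tb] h tb tb2 unfolding fr_def t0_def by blast
qed

end

text \<open>All constraints on \<open>T\<close> have the form \<open>T X <= 1\<close>.\<close>

theorem (in sobolev_algebra) kg_long_time_solution:
 fixes p q :: "'a => complex" and mu :: real
 assumes p: "hb (sm + 4) p A" "hermitian p" and q: "hb (sm + 4) q A" "hermitian q"
 obtains T R where "0 < T" "T <= 1" "0 <= R"
  "!!ep p1 q1. 0 < ep ==> ep <= 1 ==> hb sm p1 A ==> hermitian p1 ==> hb sm q1 A ==> hermitian q1 ==>
   \<exists>uh. (%(t, xi). uh t xi) \<in> BM2 & (\<forall>t. hermitian (uh t)) &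
    tb sm (T/ep) uh (2*A + R*ep) & tb sm (T/ep) (%t xi. uh t xi - trig (th ep) p q t xi) (R*ep) &
    (\<forall>t. 0 <= t --> t <= T/ep --> (AEL xi. uh t xi =
     free ep (%xi. p xi + ep*p1 xi) (%xi. q xi + ep*q1 xi) t xi + mu*Bq ep uh uh t xi))"
proof -
 define K where "K = kappa TYPE('a) sm"
 define m where "m = \<bar>mu\<bar>"
 have A: "0 <= A" using hbD(2)[OF p(1)] .
 have K: "0 <= K" "0 <= m" by (auto simp: K_def m_def)
 define CS where "CS = 4*A + m*(64*(K*A\<^sup>2))"
 define CK where "CK = 96*(K*A\<^sup>2) + m*(64*(K\<^sup>2*A ^ 3))"
 have C0: "0 <= CS" "0 <= CK" unfolding CS_def CK_def using A K by auto
 \<comment> \<open>\<open>Q\<close> and \<open>R\<close> exceed the parts of \<open>c2\<close> and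
   \<open>c1\<close> without \<open>T\<close> by 1, which is the room left for the terms with
   \<open>T\<close>. The triangular coupling dictates the order: \<open>Q\<close> before
   \<open>R\<close>, \<open>F\<close> before \<open>E\<close>, and \<open>T\<close> last. The
   summand \<open>8*m*F\<close> reserves one half of \<open>E\<close> for each of the two terms in
   \<open>c5\<close>.\<close>
 define Q where "Q = CK + 1"
 define R where "R = CS + 2*m*Q + 1"
 define F where "F = CK + 1"
 define E where "E = CS + 8*m*F + 1"
 have pos: "0 <= Q" "0 <= R" "0 <= F" "0 <= E" unfolding Q_def R_def F_def E_def using C0 K by auto
 define X1 where "X1 = m*K * R\<^sup>2"
 define X2 where "X2 = 64*m*K\<^sup>2*A\<^sup>2 * R + 16*m*K\<^sup>2*A * R\<^sup>2"
 define X3 where "X3 = 4*(2*m*K * R)"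
 define X4 where "X4 = 2*((64*m*K\<^sup>2*A\<^sup>2 + 32*m*K\<^sup>2*A * R)*E)"
 have X: "0 <= X1" "0 <= X2" "0 <= X3" "0 <= X4" unfolding X1_def X2_def X3_def X4_def using A K pos by auto
 define T where "T = 1/(1 + X1 + X2 + X3 + X4)"
 have T: "0 < T" "T <= 1" unfolding T_def using X by auto
 have TX: "T*x <= 1" if "x <= 1 + X1 + X2 + X3 + X4" for x
  unfolding T_def using that X by (simp add: divide_le_eq)
 have TX1: "T*X1 <= 1" "T*X2 <= 1" "T*X3 <= 1" "T*X4 <= 1" using X by (auto intro!: TX)
 show ?thesis
 proof (rule that[OF T pos(2)])
  fix ep :: real and p1 q1 :: "'a => complex"
  assume a: "0 < ep" "ep <= 1" "hb sm p1 A" "hermitian p1" "hb sm q1 A" "hermitian q1"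
  have k5: "2*(2*m*F + T*(2*m*K * R)*E) <= E"
  proof -
   have "4*(T*(2*m*K * R)) <= 1" using TX1(3) unfolding X3_def by (simp add: algebra_simps)
   then have "4*(T*(2*m*K * R))*E <= 1*E" using pos by (intro mult_right_mono) auto
   moreover have "8*(m*F) <= E" unfolding E_def using C0 by simp
   ultimately show ?thesis by (simp add: algebra_simps)
  qed
  interpret kg_iteration sm TT ep T A mu R Q E F p q p1 q1
  proof unfold_locales
   show "(4*A + \<bar>mu\<bar>*(64*(kappa TYPE('a) sm*A\<^sup>2))) + 2*\<bar>mu\<bar>*Q + T*(\<bar>mu\<bar>*kappa TYPE('a) sm * R\<^sup>2) <= R"
    using TX1(1) unfolding K_def[symmetric] m_def[symmetric] X1_def CS_def[symmetric] R_def by simp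
   show "(96*(kappa TYPE('a) sm*A\<^sup>2) + \<bar>mu\<bar>*(64*((kappa TYPE('a) sm)^2*A ^ 3)))
    + T*(64*\<bar>mu\<bar>*(kappa TYPE('a) sm)^2*A\<^sup>2 * R + 16*\<bar>mu\<bar>*(kappa TYPE('a) sm)^2*A * R\<^sup>2) <= Q"
    using TX1(2) unfolding K_def[symmetric] m_def[symmetric] X2_def[symmetric] CK_def[symmetric] Q_def by simp
   show "4*A + \<bar>mu\<bar>*(64*(kappa TYPE('a) sm*A\<^sup>2)) <= E"
    unfolding K_def[symmetric] m_def[symmetric] CS_def[symmetric] E_def using K C0 unfolding F_def by simp
   show "96*(kappa TYPE('a) sm*A\<^sup>2) + \<bar>mu\<bar>*(64*((kappa TYPE('a) sm)^2*A ^ 3)) <= F"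
    unfolding K_def[symmetric] m_def[symmetric] CK_def[symmetric] F_def by simp
   show "2*(2*\<bar>mu\<bar>*F + T*(2*\<bar>mu\<bar>*kappa TYPE('a) sm * R)*E) <= E"
    using k5 unfolding K_def m_def .
   show "2*(T*(64*\<bar>mu\<bar>*(kappa TYPE('a) sm)^2*A\<^sup>2 + 32*\<bar>mu\<bar>*(kappa TYPE('a) sm)^2*A * R)*E) <= F"
   proof -
    have "2*(T*(64*m*K\<^sup>2*A\<^sup>2 + 32*m*K\<^sup>2*A * R)*E) = T*X4" unfolding X4_def by simp
    also have "... <= F" using TX1(4) C0 unfolding F_def by simp
    finally show ?thesis unfolding K_def m_def .
   qed
  qed (use a T p q pos in auto)
  show "\<exists>uh. (%(t, xi). uh t xi) \<in> BM2 & (\<forall>t. hermitian (uh t)) &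
    tb sm (T/ep) uh (2*A + R*ep) & tb sm (T/ep) (%t xi. uh t xi - trig (th ep) p q t xi) (R*ep) &
    (\<forall>t. 0 <= t --> t <= T/ep --> (AEL xi. uh t xi =
     free ep (%xi. p xi + ep*p1 xi) (%xi. q xi + ep*q1 xi) t xi + mu*Bq ep uh uh t xi))"
   by (rule kg_solution) blast
 qed
qed

section \<open>Smoothness classes and bump functions\<close>

lemma partial_eqI: "(f has_derivative f') (at x) ==> partial b f x = f' b"
 unfolding partial_def by (simp add: frechet_derivative_at[symmetric])

lemma has_derivative_partial:
 "f differentiable (at x) ==> (f has_derivative frechet_derivative f (at x)) (at x)"
 by (simp add: frechet_derivative_works)

lemma C_k_Suc_D: "C_k (Suc k) f ==> C_k k f"
proof (induction k arbitrary: f)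
 case 0
 then show ?case by (auto intro!: continuous_at_imp_continuous_on differentiable_imp_continuous_within)
next
 case (Suc k)
 then show ?case by (metis C_k.simps(2))
qed

lemma C_k_const: "C_k k (%x. c)"
proof (induction k arbitrary: c)
 case (Suc k)
 have "partial b (%x. c) = (%x. 0)" for b :: 'a
  by (intro ext partial_eqI[where f'="%_. 0"]) (rule has_derivative_const)
 then show ?case using Suc by simp
qed simp

lemma C_k_add: "C_k k f ==> C_k k g ==> C_k k (%x. f x + g x)"
proof (induction k arbitrary: f g)
 case 0 then show ?case by (simp add: continuous_on_add)
next
 case (Suc k)
 have d: "f differentiable (at x)" "g differentiable (at x)" for x using Suc.prems by auto
 have "partial b (%x. f x + g x) = (%x. partial b f x + partial b g x)" for b
 proof
  fix x show "partial b (%x. f x + g x) x = partial b f x + partial b g x"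
   unfolding partial_def[of b f] partial_def[of b g]
   by (rule partial_eqI[OF has_derivative_add[OF has_derivative_partial[OF d(1)] has_derivative_partial[OF d(2)]]])
 qed
 then show ?case using Suc d by (auto intro!: differentiable_add)
qed

lemma partial_mult:
 fixes f g :: "'a::euclidean_space => real"
 assumes "f differentiable (at x)" "g differentiable (at x)"
 shows "partial b (%x. f x*g x) x = f x*partial b g x + partial b f x*g x"
 unfolding partial_def[of b f] partial_def[of b g]
 by (rule partial_eqI[OF has_derivative_mult[OF has_derivative_partial[OF assms(1)] has_derivative_partial[OF assms(2)]]])

lemma C_k_mult: "C_k k f ==> C_k k g ==> C_k k (%x. f x*g x)"
proof (induction k arbitrary: f g)
 case 0 then show ?case by (simp add: continuous_on_mult)
next
 case (Suc k)
 have d: "f differentiable (at x)" "g differentiable (at x)" for x using Suc.prems by auto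
 have "partial b (%x. f x*g x) = (%x. f x*partial b g x + partial b f x*g x)" for b
  by (intro ext partial_mult d)
 moreover have "C_k k f" "C_k k g" using Suc.prems by (auto intro: C_k_Suc_D)
 ultimately show ?case using Suc d by (auto intro!: differentiable_mult C_k_add Suc.IH)
qed

lemma C_k_cmult: "C_k k f ==> C_k k (%x. c*f x)"
 by (intro C_k_mult C_k_const)

lemma C_k_diff: "C_k k f ==> C_k k g ==> C_k k (%x. f x - g x)"
 using C_k_add[of k f "%x. -1*g x"] C_k_cmult[of k g "-1"] by simp

lemma C_k_sum: "(!!i. i \<in> I ==> C_k k (f i)) ==> C_k k (%x. \<Sum>i\<in>I. f i x)"
 by (induction I rule: infinite_finite_induct) (auto intro: C_k_const C_k_add)

lemma C_k_linear:
 assumes "bounded_linear f" shows "C_k k f"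
proof (cases k)
 case 0
 then show ?thesis using assms by (simp add: linear_continuous_on)
next
 case (Suc m)
 have d: "(f has_derivative f) (at x)" for x using assms by (rule bounded_linear_imp_has_derivative)
 then have "partial b f = (%x. f b)" for b by (intro ext partial_eqI)
 then show ?thesis using Suc d by (auto simp: C_k_const differentiable_def)
qed

text \<open>The family is closed under differentiation up to linear combinations: the derivative of
  member \<open>n\<close> involves members \<open>n + 2\<close> and \<open>n + 1\<close>. Smoothness
  of \<open>exp (- (1/t))\<close> extended by 0 is thus proved for the whole family by one
  induction.\<close>

definition expinv :: "nat => real => real" where
 "expinv n t = (if t > 0 then exp (- (1/t))/t ^ n else 0)"

lemma expinv_nonneg: "0 <= expinv n t"
 by (simp add: expinv_def)

text \<open>The term of index \<open>Suc n\<close> in the series of \<open>exp (1/t)\<close>. A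
  linear bound for every \<open>n\<close> makes the difference quotients of member \<open>n\<close>
  at 0, which are values of member \<open>Suc n\<close>, tend to 0.\<close>

lemma expinv_le: "expinv n t <= fact (Suc n)*\<bar>t\<bar>"
proof (cases "t > 0")
 case True
 have "(1/t) ^ Suc n/fact (Suc n) <= exp (1/t)"
 proof -
  have s: "(%k. (1/t) ^ k /\<^sub>R fact k) sums exp (1/t)" by (rule exp_converges)
  have "(\<Sum>k\<in>{Suc n}. (1/t) ^ k /\<^sub>R fact k) <= suminf (%k. (1/t) ^ k /\<^sub>R fact k)"
   using True by (intro sum_le_suminf sums_summable[OF s]) auto
  then show ?thesis using sums_unique[OF s] by (simp add: inverse_eq_divide del: fact_Suc power_Suc)
 qed
 then have "1 <= exp (1/t)*(fact (Suc n)*t ^ Suc n)"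
  using True by (simp add: power_divide divide_simps mult_ac del: fact_Suc power_Suc)
 then have "exp (- (1/t)) <= fact (Suc n)*t ^ Suc n"
  by (simp add: exp_minus divide_simps mult_ac del: fact_Suc power_Suc)
 then have "exp (- (1/t))/t ^ n <= fact (Suc n)*t ^ Suc n/t ^ n"
  using True by (intro divide_right_mono) auto
 then show ?thesis using True by (simp add: expinv_def del: fact_Suc)
qed (auto simp: expinv_def not_less intro!: mult_nonneg_nonpos simp del: fact_Suc)

lemma expinv_deriv: "(expinv n has_real_derivative (expinv (n + 2) t - real n*expinv (n + 1) t)) (at t)"
proof -
 consider "t > 0" | "t < 0" | "t = 0" by linarith
 then show ?thesis
 proof cases
  case 1
  have "((%t. exp (- (1/t))/t ^ n) has_real_derivative
   (exp (- (1/t))*(1/t\<^sup>2)*t ^ n - exp (- (1/t))*(real n*t ^ (n - 1)))/(t ^ n*t ^ n)) (at t)"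
   using 1 by (auto intro!: derivative_eq_intros simp: power2_eq_square)
  also have "(exp (- (1/t))*(1/t\<^sup>2)*t ^ n - exp (- (1/t))*(real n*t ^ (n - 1)))/(t ^ n*t ^ n)
   = expinv (n + 2) t - real n*expinv (n + 1) t"
   using 1 by (cases n) (simp_all add: expinv_def field_simps power2_eq_square)
  finally have d: "((%t. exp (- (1/t))/t ^ n) has_real_derivative expinv (n + 2) t - real n*expinv (n + 1) t) (at t)" .
  show ?thesis
   by (rule has_field_derivative_transform_within_open[OF d, of "{0<..}"]) (use 1 in \<open>auto simp: expinv_def\<close>)
 next
  case 2
  have "((%t. 0) has_real_derivative (expinv (n + 2) t - real n*expinv (n + 1) t)) (at t)"
   using 2 by (simp add: expinv_def)
  then show ?thesis
   by (rule has_field_derivative_transform_within_open[where S="{..<0}"]) (use 2 in \<open>auto simp: expinv_def\<close>)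
 next
  case 3
  have q: "\<bar>(expinv n h - expinv n 0)/h\<bar> <= fact (Suc (Suc n))*\<bar>h\<bar>" for h
  proof (cases "h > 0")
   case True
   then have "(expinv n h - expinv n 0)/h = expinv (Suc n) h" by (simp add: expinv_def)
   then show ?thesis using expinv_le[of "Suc n" h] expinv_nonneg[of "Suc n" h] by (simp del: fact_Suc)
  qed (auto simp: expinv_def not_less intro!: mult_nonneg_nonpos simp del: fact_Suc)
  have "((%h. fact (Suc (Suc n))*\<bar>h\<bar>) \<longlongrightarrow> fact (Suc (Suc n))*\<bar>0::real\<bar>) (at 0)" by (intro tendsto_intros)
  then have "((%h. (expinv n h - expinv n 0)/h) \<longlongrightarrow> 0) (at 0)"
   unfolding abs_zero mult_zero_right
   by (rule Lim_null_comparison[OF always_eventually, rotated]) (simp only: real_norm_def q simp_thms)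
  then show ?thesis using 3 by (simp add: DERIV_def expinv_def)
 qed
qed

lemma C_k_expinv:
 fixes q :: "'a::euclidean_space => real"
 assumes q: "!!k. C_k k q"
 shows "C_k k (%x. expinv n (q x))"
proof (induction k arbitrary: n)
 case 0
 have "continuous_on UNIV q" using q[of 0] by simp
 moreover have "continuous_on UNIV (expinv n)"
  by (intro continuous_at_imp_continuous_on ballI DERIV_isCont[OF expinv_deriv])
 ultimately show ?case by (simp only: C_k.simps) (rule continuous_on_compose2[of UNIV "expinv n" UNIV q], auto)
next
 case (Suc k)
 have d: "((%x. expinv n (q x)) has_derivative (%h. (expinv (n + 2) (q x) - real n*expinv (n + 1) (q x))*frechet_derivative q (at x) h)) (at x)" for x
 proof -
  have "q differentiable (at x)" using q[of 1] by simp
  then have 1: "(q has_derivative frechet_derivative q (at x)) (at x)" by (rule has_derivative_partial)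
  have 2: "(expinv n has_derivative (*) (expinv (n + 2) (q x) - real n*expinv (n + 1) (q x))) (at (q x))"
   using expinv_deriv[of n "q x"] by (simp add: has_field_derivative_def)
  show ?thesis using has_derivative_compose[OF 1 2] .
 qed
 have "partial b (%x. expinv n (q x)) = (%x. (expinv (n + 2) (q x) - real n*expinv (n + 1) (q x))*partial b q x)" for b
  by (intro ext, unfold partial_def[of b q]) (rule partial_eqI[OF d])
 moreover have "C_k k (%x. (expinv (n + 2) (q x) - real n*expinv (n + 1) (q x))*partial b q x)" if "b \<in> Basis" for b
  using q[of "Suc k"] that by (intro C_k_mult C_k_diff C_k_cmult Suc.IH) simp
 moreover have "(%x. expinv n (q x)) differentiable (at x)" for x using d[of x] unfolding differentiable_def by blast
 ultimately show ?case by (simp only: C_k.simps) blast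
qed

definition bump :: "real => 'a::euclidean_space => 'a => real" where
 "bump r x0 x = expinv 0 (r\<^sup>2 - (norm (x - x0))\<^sup>2)"

lemma norm_diff_square: "(norm (x - x0))^2 = (\<Sum>b\<in>Basis. (x \<bullet> b - x0 \<bullet> b)*((x::'a::euclidean_space) \<bullet> b - x0 \<bullet> b))"
 unfolding power2_norm_eq_inner by (subst euclidean_inner) (simp add: inner_diff_left)

lemma C_k_bump_comp:
 fixes f :: "'b::euclidean_space => 'a::euclidean_space"
 assumes f: "bounded_linear f"
 shows "C_k k (%z. bump r x0 (f z))"
 unfolding bump_def norm_diff_square
 by (intro C_k_expinv C_k_diff C_k_const C_k_sum C_k_mult C_k_linear bounded_linear_compose[OF bounded_linear_inner_left f])

lemma bump_support: "bump r x0 x ~= 0 ==> norm (x - x0) <= \<bar>r\<bar>"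
 using abs_le_square_iff[of "norm (x - x0)" r] unfolding bump_def expinv_def by (auto split: if_splits)

lemma bump_pos: "norm (x - x0) < r ==> 0 < bump r x0 x"
 unfolding bump_def expinv_def by (auto simp: power_strict_mono)

lemma bump_nonneg: "0 <= bump r x0 x"
 unfolding bump_def by (rule expinv_nonneg)

lemma bump_test: "bump r x0 \<in> test_functions UNIV"
proof -
 have "C_k k (bump r x0)" for k using C_k_bump_comp[OF bounded_linear_ident, of k r x0] by simp
 moreover have "{x. bump r x0 x ~= 0} \<subseteq> cball x0 \<bar>r\<bar>" using bump_support[of r x0] by (auto simp: dist_norm norm_minus_commute[of x0])
 then have "bounded {x. bump r x0 x ~= 0}" using bounded_cball bounded_subset by blast
 then have "compact (closure {x. bump r x0 x ~= 0})" by (simp add: compact_closure)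
 ultimately show ?thesis by (simp add: test_functions_def)
qed

subsection \<open>Calculus of test functions\<close>

lemma test_C_k: "et \<in> test_functions Oz ==> C_k k et"
 by (simp add: test_functions_def)

lemma test_differentiable: "et \<in> test_functions Oz ==> et differentiable (at x)"
 using test_C_k[of et Oz 1] by simp

lemma test_continuous: "et \<in> test_functions Oz ==> continuous_on UNIV et"
 using test_C_k[of et Oz 0] by simp

lemma test_measurable: "et \<in> test_functions Oz ==> et \<in> BM"
 by (rule borel_measurable_continuous_onI[OF test_continuous])

lemma test_support:
 assumes "et \<in> test_functions Oz"
 obtains K where "compact K" "closed K" "K \<subseteq> Oz" "!!x. x \<notin> K ==> et x = 0"
proof (rule that[of "closure {x. et x ~= 0}"])
 show "x \<notin> closure {x. et x ~= 0} ==> et x = 0" for x using closure_subset[of "{x. et x ~= 0}"] by auto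
qed (use assms in \<open>auto simp: test_functions_def\<close>)

lemma partial_zero_outside:
 assumes K: "closed K" "!!x. x \<notin> K ==> f x = 0" and x: "x \<notin> K"
 shows "partial b f x = 0"
proof -
 have "((%x. 0) has_derivative (%h. 0)) (at x)" by (rule has_derivative_const)
 then have "(f has_derivative (%h. 0)) (at x)"
  by (rule has_derivative_transform_within_open[of _ _ _ _ "- K"]) (use K x in auto)
 then show ?thesis by (rule partial_eqI)
qed

lemma test_partial:
 assumes et: "et \<in> test_functions Oz" and b: "b \<in> Basis"
 shows "partial b et \<in> test_functions Oz"
proof -
 have "C_k k (partial b et)" for k using test_C_k[OF et, of "Suc k"] b by simp
 moreover obtain K where K: "compact K" "closed K" "K \<subseteq> Oz" "!!x. x \<notin> K ==> et x = 0" by (rule test_support[OF et]) blast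
 have "{x. partial b et x ~= 0} \<subseteq> K" using partial_zero_outside[of K et, OF K(2) K(4)] by auto
 then have "closure {x. partial b et x ~= 0} \<subseteq> K" using K(2) by (rule closure_minimal)
 moreover from this have "compact (closure {x. partial b et x ~= 0})" using K(1) compact_closure compact_imp_bounded bounded_subset closure_subset by (metis closed_closure compact_eq_bounded_closed)
 ultimately show ?thesis using K(3) by (auto simp: test_functions_def)
qed

lemma compact_support_bounded:
 fixes f :: "'a::euclidean_space => real"
 assumes f: "continuous_on UNIV f" and K: "compact K" "!!x. x \<notin> K ==> f x = 0"
 obtains B where "0 <= B" "!!x. \<bar>f x\<bar> <= B"
proof -
 have "compact (f ` K)" using f K by (intro compact_continuous_image) (auto intro: continuous_on_subset)
 then obtain B where B: "!!y. y \<in> f ` K ==> norm y <= B" using compact_imp_bounded bounded_iff by metis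
 have "\<bar>f x\<bar> <= max B 0" for x using B[of "f x"] K(2)[of x] by (cases "x \<in> K") auto
 then show ?thesis using that[of "max B 0"] by simp
qed

lemma compact_support_integrable:
 fixes f :: "'a::euclidean_space => real"
 assumes f: "continuous_on UNIV f" and K: "compact K" "!!x. x \<notin> K ==> f x = 0"
 shows "LI f"
proof -
 obtain B where B: "0 <= B" "!!x. \<bar>f x\<bar> <= B" using compact_support_bounded[OF f K] by blast
 have [measurable]: "f \<in> BM" using f by (rule borel_measurable_continuous_onI)
 have [measurable]: "K \<in> sets borel" using K(1) by (simp add: borel_compact)
 show ?thesis
 proof (rule BI_int_bound[of _ "%x. ind K x*B"])
  show "LI (%x. ind K x*B)"
   using emeasure_compact_finite[OF K(1)] by (intro integrable_mult_left integrable_real_indicator) auto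
  show "AEL x. norm (f x) <= norm (ind K x*B)"
   using B K(2) by (intro AE_I2) (auto simp: indicator_def)
 qed simp
qed

lemma test_integrable: "et \<in> test_functions Oz ==> LI et"
 by (metis compact_support_integrable test_support test_continuous)

text \<open>The partial derivative is a dominated limit of difference quotients in the direction
  \<open>b\<close>, and each of these has integral 0 by translation invariance.\<close>

lemma integral_partial_zero:
 fixes h :: "'a::euclidean_space => real"
 assumes d: "!!x. h differentiable (at x)" and c: "continuous_on UNIV (partial b h)"
  and K: "compact K" "!!x. x \<notin> K ==> h x = 0"
 shows "(LL x. partial b h x) = 0"
proof -
 have hc: "continuous_on UNIV h" using d by (intro continuous_at_imp_continuous_on ballI differentiable_imp_continuous_within)
 have [measurable]: "h \<in> BM" "partial b h \<in> BM"
  using hc c by (auto intro: borel_measurable_continuous_onI)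
 have cl: "closed K" using K(1) compact_imp_closed by blast
 obtain B where B: "0 <= B" "!!x. \<bar>partial b h x\<bar> <= B"
  by (rule compact_support_bounded[OF c K(1)]) (use partial_zero_outside[of K h, OF cl K(2)] in auto)
 obtain r where r: "!!x. x \<in> K ==> norm x <= r" using compact_imp_bounded[OF K(1)] bounded_iff by metis
 \<comment> \<open>The steps \<open>u n\<close> are at most 1, so the quotients vanish outside the
   support enlarged by \<open>norm b\<close>.\<close>
 define C where "C = cball (0::'a) (r + norm b)"
 have deriv: "((%s. h (x + s *R b)) has_real_derivative partial b h (x + s *R b)) (at s)" for x s
 proof -
  have "((%s. x + s *R b) has_derivative (%s. s *R b)) (at s)" by (auto intro!: derivative_eq_intros)
  from has_derivative_compose[OF this has_derivative_partial[OF d]]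
  have 1: "((%s. h (x + s *R b)) has_derivative (%s'. frechet_derivative h (at (x + s *R b)) (s' *R b))) (at s)" .
  have "linear (frechet_derivative h (at (x + s *R b)))"
   using has_derivative_linear[OF has_derivative_partial[OF d]] .
  then have "(%s'. frechet_derivative h (at (x + s *R b)) (s' *R b)) = (*) (partial b h (x + s *R b))"
   unfolding partial_def by (simp add: fun_eq_iff linear_scale mult.commute)
  then show ?thesis using 1 unfolding has_field_derivative_def by simp
 qed
 define u where "u = (%n::nat. 1/real (Suc n))"
 have u: "0 < u n" "u n <= 1" for n by (auto simp: u_def)
 have u0: "u ---> 0" unfolding u_def by (rule LIMSEQ_Suc[OF lim_1_over_n])
 have mvt: "\<bar>h (x + s *R b) - h x\<bar> <= s*B" if "0 < s" for x s
 proof -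
  have "\<exists>z>0. z < s & h (x + s *R b) - h (x + 0 *R b) = (s - 0)*partial b h (x + z *R b)"
   by (rule MVT2[OF that]) (rule deriv)
  then obtain z where "h (x + s *R b) - h x = s*partial b h (x + z *R b)" by auto
  then have "\<bar>h (x + s *R b) - h x\<bar> = s*\<bar>partial b h (x + z *R b)\<bar>" using that by (simp add: abs_mult)
  also have "... <= s*B" using that B by (intro mult_left_mono) auto
  finally show ?thesis .
 qed
 have "(%n. LL x. (h (x + u n *R b) - h x)/u n) ---> (LL x. partial b h x)"
 proof (rule integral_dominated_convergence[where w="%x. ind C x*B"])
  show "LI (%x. ind C x*B)"
   unfolding C_def using emeasure_lborel_cball_finite[of "0::'a" "r + norm b"]
   by (intro integrable_mult_left integrable_real_indicator) auto
  show "AEL x. (%n. (h (x + u n *R b) - h x)/u n) ---> partial b h x"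
  proof (rule AE_I2)
   fix x
   have "((%s. (h (x + s *R b) - h x) / s) \<longlongrightarrow> partial b h x) (at 0)"
    using deriv[of x 0] by (simp add: DERIV_def)
   moreover have "filterlim u (at 0) sequentially"
    using u0 u by (intro filterlim_atI) (auto simp: u_def)
   ultimately show "(%n. (h (x + u n *R b) - h x)/u n) ---> partial b h x" by (rule filterlim_compose)
  qed
  show "AEL x. norm ((h (x + u n *R b) - h x)/u n) <= ind C x*B" for n
  proof (rule AE_I2)
   fix x
   show "norm ((h (x + u n *R b) - h x)/u n) <= ind C x*B"
   proof (cases "x \<in> C")
    case True
    then show ?thesis using mvt[OF u(1)[of n], of x] u(1)[of n] by (simp add: divide_le_eq mult.commute)
   next
    case False
    then have nx: "norm x > r + norm b" by (simp add: C_def)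
    have "norm x <= norm (x + u n *R b) + norm (u n *R b)" using norm_triangle_ineq4[of "x + u n *R b" "u n *R b"] by simp
    moreover have "norm (u n *R b) <= 1*norm b" using u[of n] unfolding norm_scaleR by (intro mult_right_mono) auto
    ultimately have "norm (x + u n *R b) > r" using nx by simp
    moreover have "norm x > r" using nx norm_ge_zero[of b] by linarith
    ultimately have "h (x + u n *R b) = 0" "h x = 0" using K(2) r by (meson not_le)+
    then show ?thesis using False by simp
   qed
  qed
 qed measurable
 moreover have "(LL x. (h (x + u n *R b) - h x)/u n) = 0" for n
 proof -
  have i: "LI h" by (rule compact_support_integrable[OF hc K])
  then have "LI (%x. h (x + u n *R b))" by (simp add: lborel_shift(2))
  then show ?thesis using i by (simp add: lborel_shift(1))
 qed
 ultimately have "(%n::nat. 0) ---> (LL x. partial b h x)" by (simp only:)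
 then show ?thesis by (simp add: LIMSEQ_const_iff)
qed

abbreviation cr :: "('a => real) => 'a => complex" where
 "cr f \<equiv> (%x. cx (f x))"

lemma ift_eq: "ift f xi = fconst TYPE('a) *R (LL x. cis (x \<bullet> xi)*f (x::'a::euclidean_space))"
 unfolding ift_def fourier_integral_eq by simp

text \<open>As \<open>partial\<close> acts on real functions, the exponential is split into cosine
  and sine, each integrated by parts through \<open>integral_partial_zero\<close>. The auxiliary
  form \<open>ibp\<close> divides by \<open>b \<bullet> xi\<close>; if this vanishes, cosine and
  sine are constant in the direction \<open>b\<close> and both integrals are 0.\<close>

lemma ift_partial:
 fixes et :: "'a::euclidean_space => real"
 assumes et: "et \<in> test_functions Oz" and b: "b \<in> Basis"
 shows "ift (cr (partial b et)) xi = - \<i>*cx (xi \<bullet> b)*ift (cr et) xi"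
proof -
 obtain K where K: "compact K" "closed K" "K \<subseteq> Oz" "!!x. x \<notin> K ==> et x = 0" by (rule test_support[OF et]) blast
 note pt = test_partial[OF et b]
 note [measurable] = test_measurable[OF et] test_measurable[OF pt]
 have ibp: "(LL x. partial b et x*g x) = - (LL x. et x*g' x)"
  if g: "!!x. (g has_derivative (%h. g' x*((h \<bullet> xi)/(b \<bullet> xi)))) (at x)" and bx: "b \<bullet> xi ~= 0"
   and gc: "continuous_on UNIV g" "continuous_on UNIV g'" for g g' :: "'a => real"
 proof -
  have dg: "g differentiable (at x)" for x using g by (auto simp: differentiable_def)
  have pg: "partial b g x = g' x" for x using partial_eqI[OF g, of b] bx by simp
  have p: "partial b (%x. et x*g x) x = et x*g' x + partial b et x*g x" for x
   using partial_mult[OF test_differentiable[OF et] dg] pg by simp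
  have "(LL x. partial b (%x. et x*g x) x) = 0"
  proof (rule integral_partial_zero[OF _ _ K(1)])
   show "continuous_on UNIV (partial b (%x. et x*g x))"
    unfolding p by (intro continuous_intros gc test_continuous[OF et] test_continuous[OF pt])
  qed (use K(4) test_differentiable[OF et] dg in auto)
  moreover have "LI (%x. et x*g' x)"
   by (rule compact_support_integrable[OF _ K(1)]) (use K(4) in \<open>auto intro!: continuous_intros gc test_continuous[OF et]\<close>)
  moreover have "LI (%x. partial b et x*g x)"
   by (rule compact_support_integrable[OF _ K(1)])
    (use partial_zero_outside[of K et, OF K(2) K(4)] in \<open>auto intro!: continuous_intros gc test_continuous[OF pt]\<close>)
  ultimately show ?thesis unfolding p by simp
 qed
 have icr: "LI (%x. et' x*cos (x \<bullet> xi))" "LI (%x. et' x * sin (x \<bullet> xi))"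
  if tt: "et' \<in> test_functions Oz" for et'
 proof -
  obtain K where K: "compact K" "!!x. x \<notin> K ==> et' x = 0" by (rule test_support[of et' Oz, OF tt]) blast
  show "LI (%x. et' x*cos (x \<bullet> xi))"
   by (rule compact_support_integrable[OF _ K(1)])
    (intro continuous_on_mult test_continuous[OF tt] continuous_on_cos continuous_on_inner continuous_on_id continuous_on_const, simp add: K(2))
  show "LI (%x. et' x * sin (x \<bullet> xi))"
   by (rule compact_support_integrable[OF _ K(1)])
    (intro continuous_on_mult test_continuous[OF tt] continuous_on_sin continuous_on_inner continuous_on_id continuous_on_const, simp add: K(2))
 qed
 have split: "(LL x. cis (x \<bullet> xi)*cx (et' x))
  = cx (LL x. et' x*cos (x \<bullet> xi)) + \<i>*cx (LL x. et' x * sin (x \<bullet> xi))"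
  if t: "et' \<in> test_functions Oz" for et'
 proof -
  have "(LL x. cis (x \<bullet> xi)*cx (et' x)) = (LL x. cx (et' x*cos (x \<bullet> xi)) + \<i>*cx (et' x * sin (x \<bullet> xi)))"
   by (intro BI_LINT_cong) (auto simp: complex_eq_iff)
  also have "... = (LL x. cx (et' x*cos (x \<bullet> xi))) + (LL x. \<i>*cx (et' x * sin (x \<bullet> xi)))"
   by (intro BI_LINT_add integrable_mult_right integrable_of_real icr t)
  finally show ?thesis by (simp only: integral_mult_right_zero integral_complex_of_real)
 qed
 have cs: "(LL x. partial b et x*cos (x \<bullet> xi)) = (b \<bullet> xi)*(LL x. et x * sin (x \<bullet> xi)) &
  (LL x. partial b et x * sin (x \<bullet> xi)) = - (b \<bullet> xi)*(LL x. et x*cos (x \<bullet> xi))"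
 proof (cases "b \<bullet> xi = 0")
  case True
  have z: "(LL x. partial b et x*g x) = 0" if g: "!!x. (g has_derivative (%h. g' x*(h \<bullet> xi))) (at x)" for g g' :: "'a => real"
  proof -
   have dg: "g differentiable (at x)" for x using g by (auto simp: differentiable_def)
   have gc: "continuous_on UNIV g" using dg by (intro continuous_at_imp_continuous_on ballI differentiable_imp_continuous_within)
   have p: "partial b (%x. et x*g x) = (%x. partial b et x*g x)"
    using partial_mult[OF test_differentiable[OF et] dg] partial_eqI[OF g, of b] True by auto
   have "(LL x. partial b (%x. et x*g x) x) = 0"
   proof (rule integral_partial_zero[OF _ _ K(1)])
    show "continuous_on UNIV (partial b (%x. et x*g x))"
     unfolding p by (intro continuous_intros gc test_continuous[OF pt])
   qed (use K(4) test_differentiable[OF et] dg in auto)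
   then show ?thesis unfolding p .
  qed
  have "((%x. cos (x \<bullet> xi)) has_derivative (%h. - sin (x \<bullet> xi)*(h \<bullet> xi))) (at x)"
   "((%x. sin (x \<bullet> xi)) has_derivative (%h. cos (x \<bullet> xi)*(h \<bullet> xi))) (at x)" for x
   by (auto intro!: derivative_eq_intros)
  then have "(LL x. partial b et x*cos (x \<bullet> xi)) = 0" "(LL x. partial b et x * sin (x \<bullet> xi)) = 0"
   by (intro z; blast)+
  then show ?thesis using True by simp
 next
  case False
  have 1: "(LL x. partial b et x*cos (x \<bullet> xi)) = - (LL x. et x*(- sin (x \<bullet> xi)*(b \<bullet> xi)))"
   by (rule ibp[OF _ False]) (use False in \<open>auto intro!: derivative_eq_intros continuous_intros\<close>)
  have 2: "(LL x. partial b et x * sin (x \<bullet> xi)) = - (LL x. et x*(cos (x \<bullet> xi)*(b \<bullet> xi)))"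
   by (rule ibp[OF _ False]) (use False in \<open>auto intro!: derivative_eq_intros continuous_intros\<close>)
  have "(LL x. et x*(- sin (x \<bullet> xi)*(b \<bullet> xi))) = (LL x. - (b \<bullet> xi)*(et x * sin (x \<bullet> xi)))"
   "(LL x. et x*(cos (x \<bullet> xi)*(b \<bullet> xi))) = (LL x. (b \<bullet> xi)*(et x*cos (x \<bullet> xi)))"
   by (simp_all add: mult_ac)
  then show ?thesis using 1 2 by (simp only: integral_mult_right_zero) simp
 qed
 show ?thesis
  unfolding ift_eq split[OF et] split[OF pt] using cs
  by (simp add: scaleR_conv_of_real inner_commute algebra_simps)
qed

lemma ift_laplacian:
 fixes et :: "'a::euclidean_space => real"
 assumes et: "et \<in> test_functions Oz"
 shows "ift (cr (laplacian et)) xi = - cx ((norm xi)^2)*ift (cr et) xi"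
  and "LI (laplacian et)"
  and "continuous_on UNIV (laplacian et)"
proof -
 have t: "partial b (partial b et) \<in> test_functions Oz" if "b \<in> Basis" for b
  using that et by (intro test_partial)
 note tt = test_integrable[OF t] test_continuous[OF t]
 show "LI (laplacian et)" unfolding laplacian_def[abs_def]
  by (intro BI_int_sum tt)
 show "continuous_on UNIV (laplacian et)" unfolding laplacian_def[abs_def]
  by (intro continuous_on_sum tt)
 have "ift (cr (laplacian et)) xi = fconst TYPE('a) *R (LL x. (\<Sum>b\<in>Basis. cis (x \<bullet> xi)*cr (partial b (partial b et)) x))"
  unfolding ift_eq laplacian_def by (simp add: sum_distrib_left)
 also have "... = fconst TYPE('a) *R (\<Sum>b\<in>Basis. (LL x. cis (x \<bullet> xi)*cr (partial b (partial b et)) x))"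
  using t test_integrable by (subst BI_LINT_sum) (auto intro!: integrable_cis_mult)
 also have "... = (\<Sum>b\<in>Basis. ift (cr (partial b (partial b et))) xi)"
  unfolding ift_eq by (simp add: scaleR_sum_right)
 also have "... = (\<Sum>b\<in>Basis. - cx ((xi \<bullet> b)*(xi \<bullet> b))*ift (cr et) xi)"
 proof (intro sum.cong refl)
  fix b :: 'a assume b: "b \<in> Basis"
  have "ift (cr (partial b (partial b et))) xi = - \<i>*cx (xi \<bullet> b)*(- \<i>*cx (xi \<bullet> b)*ift (cr et) xi)"
   unfolding ift_partial[OF test_partial[OF et b] b] ift_partial[OF et b] ..
  then show "ift (cr (partial b (partial b et))) xi = - cx ((xi \<bullet> b)*(xi \<bullet> b))*ift (cr et) xi"
   by (simp add: algebra_simps)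
 qed
 also have "... = - cx ((norm xi)^2)*ift (cr et) xi"
  unfolding power2_norm_eq_inner by (subst euclidean_inner) (simp add: sum_distrib_right sum_negf)
 finally show "ift (cr (laplacian et)) xi = - cx ((norm xi)^2)*ift (cr et) xi" .
qed

lemma ift_pairing:
 fixes G f :: "'a::euclidean_space => complex"
 assumes G: "LI G" and f: "LI f"
 shows "(LL x. ift G x*f x) = (LL xi. G xi*ift f xi)"
proof -
 note [measurable] = borel_measurable_integrable[OF G] borel_measurable_integrable[OF f]
 have f': "LI (%x. f (- x))" using lborel_reflect(2)[of f 0] f by simp
 have "(LL x. ift G x*f x) = (LL x. FI G (0 - x)*f (- (0 - x)))"
  by (simp add: ift_def)
 also have "... = (LL x. FI G x*f (- x))"
  by (subst lborel_reflect(1)[of "%y. FI G y*f (- y)"]) auto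
 also have "... = (LL xi. G xi*FI (%x. f (- x)) xi)"
  by (rule fourier_integral_swap[OF G f'])
 also have "... = (LL xi. G xi*ift f xi)"
  by (simp add: fourier_integral_reflect ift_def)
 finally show ?thesis .
qed

lemma test_integrable_cr: "et \<in> test_functions Oz ==> LI (cr et)"
 by (intro integrable_of_real test_integrable)

lemma norm_ift_le:
 fixes f :: "'a::euclidean_space => complex"
 assumes "LI f"
 shows "norm (ift f xi) <= fconst TYPE('a)*(LL x. norm (f x))"
 unfolding ift_def by (rule norm_fourier_integral_le[OF assms])

lemma ift_diff:
 assumes "LI f" "LI g"
 shows "ift (%x. f x - g x) xi = ift f xi - ift g xi"
 unfolding ift_def by (rule fourier_integral_diff[OF assms])

text \<open>Multiplication by \<open>wgt 1\<close> corresponds to subtracting the Laplacian, so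
  \<open>wgt 1 xi\<close> times the transform is the transform of an integrable function and hence
  bounded.\<close>

lemma ift_test_decay:
 fixes et :: "'a::euclidean_space => real"
 assumes et: "et \<in> test_functions Oz"
 shows "norm (ift (cr et) xi) <= fconst TYPE('a)*((LL x. \<bar>et x\<bar>) + (LL x. \<bar>laplacian et x\<bar>))*wgt (- 1) xi"
proof -
 note L = ift_laplacian[OF et]
 have li: "LI (cr (laplacian et))" using L(2) by (rule integrable_of_real)
 have "cx (wgt 1 xi)*ift (cr et) xi = ift (cr et) xi - ift (cr (laplacian et)) xi"
  unfolding L(1) wgt_1 by (simp add: algebra_simps)
 then have "wgt 1 xi*norm (ift (cr et) xi) = norm (ift (cr et) xi - ift (cr (laplacian et)) xi)"
  by (metis norm_mult norm_of_real abs_of_pos wgt_pos(1))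
 also have "... <= norm (ift (cr et) xi) + norm (ift (cr (laplacian et)) xi)" by (rule norm_triangle_ineq4)
 also have "... <= fconst TYPE('a)*(LL x. norm (cr et x)) + fconst TYPE('a)*(LL x. norm (cr (laplacian et) x))"
  by (intro add_mono norm_ift_le test_integrable_cr[OF et] li)
 finally have "wgt (- 1) xi*(wgt 1 xi*norm (ift (cr et) xi)) <= wgt (- 1) xi*(fconst TYPE('a)*((LL x. \<bar>et x\<bar>) + (LL x. \<bar>laplacian et x\<bar>)))"
  by (intro mult_left_mono) (auto simp: algebra_simps)
 moreover have "wgt (- 1) xi*(wgt 1 xi*norm (ift (cr et) xi)) = norm (ift (cr et) xi)"
  using wgt_inverse[of "1" xi] by (metis mult.commute mult.assoc mult_1)
 ultimately show ?thesis by (metis mult.commute)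
qed

section \<open>Detecting zero by pairing with bumps\<close>

lemma bump_measurable [measurable]: "bump r x0 \<in> BM"
 by (rule test_measurable[OF bump_test])

lemma ift_bump_translate:
 "ift (cr (bump r x0)) xi = cis (x0 \<bullet> xi)*ift (cr (bump r 0)) xi"
proof -
 have "(LL x. cis (x \<bullet> xi)*cr (bump r x0) x) = (LL x. cis ((x + x0) \<bullet> xi)*cr (bump r x0) (x + x0))"
  by (rule lborel_shift(1)[symmetric]) measurable
 also have "... = (LL x. cis (x0 \<bullet> xi)*(cis (x \<bullet> xi)*cr (bump r 0) x))"
  by (intro BI_LINT_cong) (simp_all add: bump_def inner_add_left cis_mult[symmetric] mult_ac)
 finally show ?thesis unfolding ift_eq by simp
qed

text \<open>On the support of the bump the phase \<open>x \<bullet> xi\<close> is at most 1 in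
  modulus, hence below \<open>pi/2\<close>, so the cosine is positive there.\<close>

lemma Re_ift_bump_pos:
 fixes xi :: "'a::euclidean_space"
 assumes r: "0 < r" "r*norm xi <= 1"
 shows "0 < Re (ift (cr (bump r 0)) xi)"
proof -
 have i: "LI (%x. cis (x \<bullet> xi)*cr (bump r 0) x)"
  by (intro integrable_cis_mult test_integrable_cr[OF bump_test]) measurable
 then have ir: "LI (%x. cos (x \<bullet> xi)*bump r 0 x)" using integrable_Re[OF i] by simp
 have Re: "Re (ift (cr (bump r 0)) xi) = fconst TYPE('a)*(LL x. cos (x \<bullet> xi)*bump r 0 x)"
  unfolding ift_eq using integral_Re[OF i, symmetric] by simp
 have c: "0 < cos (x \<bullet> xi)" if "norm x <= r" for x
 proof -
  have "\<bar>x \<bullet> xi\<bar> <= norm x*norm xi" by (rule Cauchy_Schwarz_ineq2)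
  also have "... <= r*norm xi" using that by (intro mult_right_mono) auto
  finally have "\<bar>x \<bullet> xi\<bar> < pi/2" using r pi_gt3 by linarith
  then show ?thesis by (intro cos_gt_zero_pi) auto
 qed
 have nn: "0 <= cos (x \<bullet> xi)*bump r 0 x" for x
  using c[of x] bump_support[of r 0 x] bump_nonneg[of r 0 x] r(1)
  by (cases "bump r 0 x = 0") auto
 have "(LL x. cos (x \<bullet> xi)*bump r 0 x) ~= 0"
 proof
  assume "(LL x. cos (x \<bullet> xi)*bump r 0 x) = 0"
  then have "AEL x. cos (x \<bullet> xi)*bump r 0 x = 0"
   using integral_nonneg_eq_0_iff_AE[OF ir] nn by auto
  then have "AEL x. x \<notin> ball (0::'a) r"
  proof eventually_elim
   case (elim x)
   then show ?case using c[of x] bump_pos[of x 0 r] by (auto simp: dist_norm)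
  qed
  then have "ball (0::'a) r \<in> null_sets lborel" by (subst (asm) AE_iff_null_sets[symmetric]) auto
  then have "emeasure lborel (ball (0::'a) r) = 0" by auto
  then show False using content_ball_pos[OF r(1), of "0::'a"] by (simp add: measure_def)
 qed
 moreover have "0 <= (LL x. cos (x \<bullet> xi)*bump r 0 x)" using nn by (intro BI_LINT_nonneg) auto
 ultimately show ?thesis unfolding Re using fconst_pos[where 'a='a] by (intro mult_pos_pos) auto
qed

text \<open>Translating a bump multiplies its transform by a character. The pairings with all
  translates of one bump therefore form the Fourier integral of \<open>M\<close> times the transform
  of that bump, and Plancherel makes this product vanish. Radii tending to 0 make the second factor
  nonzero at any given frequency. The weight \<open>wgt (- 1)\<close> in the hypothesis admits the
  quadratic growth caused by second derivatives; the decay of the transformed bump compensates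
  it.\<close>

lemma test_pairing_zero_imp_AE:
 fixes M :: "'a::euclidean_space => complex"
 assumes s: "sm > real DIM('a)/2" and M: "M \<in> BM"
  and N: "hb sm (%xi. cx (wgt (- 1) xi)*M xi) B"
  and z: "!!r x0. 0 < r ==> (LL xi. M xi*ift (cr (bump r x0)) xi) = 0"
 shows "AEL xi. M xi = 0"
proof -
 note [measurable] = M
 have s0: "0 <= sm" using s by (meson divide_nonneg_nonneg le_less_trans less_imp_le of_nat_0_le_iff zero_le_numeral)
 have ae: "AEL xi. M xi*ift (cr (bump r 0)) xi = 0" if r: "0 < r" for r :: real
 proof -
  define C where "C = fconst TYPE('a)*((LL x. \<bar>bump r (0::'a) x\<bar>) + (LL x. \<bar>laplacian (bump r (0::'a)) x\<bar>))"
  let ?h = "%xi. M xi*ift (cr (bump r 0)) xi"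
  have C0: "0 <= C" unfolding C_def using fconst_pos[where 'a='a] by (intro mult_nonneg_nonneg add_nonneg_nonneg BI_LINT_nonneg) auto
  have "hb sm (%xi. cx C*(cx (wgt (- 1) xi)*M xi)) (norm (cx C)*B)"
   by (rule hb_cmult[OF N])
  then have h: "hb sm ?h (norm (cx C)*B)"
  proof (rule hb_le)
   fix xi :: 'a
   have "norm (ift (cr (bump r 0)) xi) <= C*wgt (- 1) xi" unfolding C_def by (rule ift_test_decay[OF bump_test])
   then have "norm (M xi)*norm (ift (cr (bump r 0)) xi) <= norm (M xi)*(C*wgt (- 1) xi)" by (intro mult_left_mono) auto
   then show "norm (?h xi) <= norm (cx C*(cx (wgt (- 1) xi)*M xi))"
    using C0 by (simp add: norm_mult mult_ac)
  qed measurable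
  have hi: "LI ?h" by (rule hb_integrable(1)[OF s h])
  have "FI ?h x = 0" for x
  proof -
   have "(LL xi. cis (- (xi \<bullet> x)) * ?h xi) = (LL xi. M xi*ift (cr (bump r (- x))) xi)"
    by (subst ift_bump_translate) (simp add: mult_ac inner_commute)
   then show ?thesis using z[OF r, of "- x"] by (simp add: fourier_integral_eq)
  qed
  moreover have "hn 0 (en (FI ?h)) = hn 0 (en ?h)"
   by (rule plancherel[OF hi hbD(4)[OF hb_mono_exp[OF h s0]]])
  ultimately have "hn 0 (en ?h) = 0" by (simp add: hn_def)
  then have "AEL xi. en ?h xi = 0" by (subst (asm) hn_zero_iff) auto
  then show ?thesis by eventually_elim simp
 qed
 have "AEL xi. \<forall>n. M xi*ift (cr (bump (1/real (Suc n)) 0)) xi = 0"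
  unfolding AE_all_countable by (intro allI ae) simp
 then show ?thesis
 proof eventually_elim
  case (elim xi)
  obtain n where "norm xi < real n" using reals_Archimedean2 by blast
  then have "1/real (Suc n)*norm xi <= 1" by (simp add: divide_simps)
  then have "0 < Re (ift (cr (bump (1/real (Suc n)) 0)) xi)" by (intro Re_ift_bump_pos) auto
  then show ?case using elim[rule_format, of n] by (metis less_irrefl mult_eq_0_iff zero_complex.sel(1))
 qed
qed

section \<open>Real-valued norms and limits in time\<close>

definition hnr :: "real => ('a::euclidean_space => complex) => real" where
 "hnr sm f = sqrt (enn2real (hn sm (en f)))"

lemma hnr_nonneg [simp]: "0 <= hnr sm f"
 by (simp add: hnr_def)

lemma hb_hnr:
 assumes f: "hb sm f B" shows "hb sm f (hnr sm f)"
proof -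
 have "hn sm (en f) = ennreal (enn2real (hn sm (en f)))" using hbD(4)[OF f] by simp
 then show ?thesis using hbD(1)[OF f] by (simp add: hb_def hnr_def)
qed

lemma hnr_le: assumes f: "hb sm f B" shows "hnr sm f <= B"
proof -
 have "hn sm (en f) <= ennreal (B\<^sup>2)" using f by (simp add: hb_def)
 then have "enn2real (hn sm (en f)) <= B\<^sup>2" by (simp add: enn2real_leI)
 then show ?thesis using hbD(2)[OF f] unfolding hnr_def by (metis real_sqrt_le_mono real_sqrt_abs abs_of_nonneg)
qed

lemma hnr_zero_iff:
 assumes f: "hb sm f B"
 shows "hnr sm f = 0 \<longleftrightarrow> (AEL xi. f xi = 0)"
proof -
 note [measurable] = hbD(1)[OF f]
 have "hnr sm f = 0 \<longleftrightarrow> hn sm (en f) = 0" using hbD(4)[OF f] by (auto simp: hnr_def enn2real_eq_0_iff)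
 also have "... \<longleftrightarrow> (AEL xi. en f xi = 0)" by (rule hn_zero_iff) measurable
 finally show ?thesis by simp
qed

text \<open>Dominated convergence along arbitrary sequences of times tending to \<open>t\<close>;
  this is how norm continuity and norm differentiability follow from pointwise statements about the
  multipliers.\<close>

lemma hnr_tendsto_0:
 fixes g :: "real => 'a::euclidean_space => complex"
 assumes [measurable]: "!!ta. ta \<in> S ==> g ta \<in> BM"
  and dom: "!!ta xi. ta \<in> S ==> ta ~= t ==> norm (g ta xi) <= norm (b xi)" and b: "hb sm b B"
  and lim: "!!xi. ((%ta. g ta xi) \<longlongrightarrow> 0) (at t within S)"
 shows "((%ta. hnr sm (g ta)) \<longlongrightarrow> 0) (at t within S)"
 unfolding tendsto_at_iff_sequentially
proof (intro allI impI)
 fix X :: "nat => real" assume XS: "\<forall>i. X i \<in> S - {t}" and X: "X ---> t"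
 have [measurable]: "g (X n) \<in> BM" for n using XS assms(1) by auto
 note [measurable] = hbD(1)[OF b]
 have "(%n. hn sm (en (g (X n)))) ---> (\<integral>\<^sup>+xi. 0 \<partial>(lborel :: 'a measure))"
  unfolding hn_def
 proof (rule nn_integral_dominated_convergence[where w="%xi. ennreal (wgt sm xi)*(en b xi)^2"])
  show "(NN xi. ennreal (wgt sm xi)*(en b xi)^2) < \<infinity>" using hbD(4)[OF b] by (simp add: hn_def)
  show "AEL xi. ennreal (wgt sm xi)*(en (g (X n)) xi)^2 <= ennreal (wgt sm xi)*(en b xi)^2" for n
   using XS dom by (intro AE_I2 mult_left_mono power_mono ennreal_leI) auto
  show "AEL xi. (%n. ennreal (wgt sm xi)*(en (g (X n)) xi)^2) ---> 0"
  proof (rule AE_I2)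
   fix xi :: 'a
   have "(%n. g (X n) xi) ---> 0" using lim[of xi] XS X unfolding tendsto_at_iff_sequentially comp_def by blast
   then have "(%n. wgt sm xi*(norm (g (X n) xi))^2) ---> wgt sm xi*(norm (0::complex))^2" by (intro tendsto_intros)
   then have "(%n. ennreal (wgt sm xi*(norm (g (X n) xi))^2)) ---> ennreal (wgt sm xi*(norm (0::complex))^2)" by (rule tendsto_ennrealI)
   then show "(%n. ennreal (wgt sm xi)*(en (g (X n)) xi)^2) ---> 0" by (simp add: ennreal_mult ennreal_power)
  qed
 qed measurable
 then have "(%n. enn2real (hn sm (en (g (X n))))) ---> enn2real 0" by (intro tendsto_enn2real) simp_all
 from tendsto_real_sqrt[OF this] show "((%ta. hnr sm (g ta)) \<circ> X) ---> 0" by (simp add: comp_def hnr_def)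
qed

lemma tendsto_cis_quotient:
 "((%ta. (cis (c*ta) - cis (c*t)) /\<^sub>R (ta - t)) \<longlongrightarrow> \<i>*cx c*cis (c*t)) (at t within S)"
proof -
 have "((%ta. cos (c*ta)) has_real_derivative - sin (c*t)*c) (at t within S)"
  "((%ta. sin (c*ta)) has_real_derivative cos (c*t)*c) (at t within S)"
  by (auto intro!: derivative_eq_intros)
 then have 1: "((%ta. (cos (c*ta) - cos (c*t))/(ta - t)) \<longlongrightarrow> - sin (c*t)*c) (at t within S)"
  "((%ta. (sin (c*ta) - sin (c*t))/(ta - t)) \<longlongrightarrow> cos (c*t)*c) (at t within S)"
  by (simp_all add: has_field_derivative_iff)
 show ?thesis unfolding tendsto_complex_iff using 1 by (simp add: divide_inverse mult.commute)
qed

lemma norm_cis_diff_le: "norm (cis x - cis y) <= 2*\<bar>x - y\<bar>"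
proof -
 have "norm (cis x - cis y) <= \<bar>Re (cis x - cis y)\<bar> + \<bar>Im (cis x - cis y)\<bar>" by (rule cmod_le)
 also have "... <= \<bar>x - y\<bar> + \<bar>x - y\<bar>" using cos_diff_le sin_diff_le by (intro add_mono) auto
 finally show ?thesis by simp
qed

lemma norm_cis_quotient_le: "norm ((cis (c*ta) - cis (c*t)) /\<^sub>R (ta - t)) <= 2*\<bar>c\<bar>"
proof (cases "ta = t")
 case False
 have "norm (cis (c*ta) - cis (c*t)) <= 2*\<bar>c\<bar>*\<bar>ta - t\<bar>"
  using norm_cis_diff_le[of "c*ta" "c*t"] by (simp add: abs_mult[symmetric] right_diff_distrib mult.assoc)
 then show ?thesis using False by (simp add: divide_simps)
qed simp

lemma hb_wgt1:
 assumes "hb (sm + 2) f B" shows "hb sm (%xi. cx (wgt 1 xi)*f xi) B"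
proof -
 note [measurable] = hbD(1)[OF assms]
 have "hn sm (en (%xi. cx (wgt 1 xi)*f xi)) = hn (sm + 2*1) (en f)"
  by (subst hn_wgt[symmetric]) (simp add: norm_mult ennreal_mult')
 then show ?thesis using assms unfolding hb_def by (auto intro!: borel_measurable_times)
qed

lemma ift_inversion_AE:
 fixes F :: "'a::euclidean_space => complex"
 assumes "sm > real DIM('a)/2" "IFT f F" "hb sm F B"
 shows "AEL x. f x = ift F x"
 using fourier_inversion_L2[OF assms(2) hb_integrable(1)[OF assms(1,3)]] by (simp add: ift_def)

lemma is_fourier_transform_measurable:
 assumes "IFT f g"
 shows "f \<in> BM" "g \<in> BM"
 using assms by (auto simp: is_fourier_transform_def L2_iff)

lemma ift_linear:
 assumes "LI F" "LI G"
 shows "ift (%x. c*F x + d*G x) xi = c*ift F xi + d*ift G xi"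
 unfolding ift_def using assms by (simp add: fourier_integral_add fourier_integral_cmult)

text \<open>The combination of the transforms is again a transform, namely of its own inverse
  transform, which the inversion formula identifies almost everywhere with the combination of the
  functions.\<close>

lemma is_fourier_transform_linear:
 fixes F G :: "'a::euclidean_space => complex"
 assumes s: "sm > real DIM('a)/2" and f: "IFT f F" "hb sm F A" and g: "IFT g G" "hb sm G B"
 shows "IFT (%x. c*f x + d*g x) (%xi. c*F xi + d*G xi)"
proof -
 note [measurable] = is_fourier_transform_measurable[OF f(1)] is_fourier_transform_measurable[OF g(1)]
 have "hb sm (%xi. c*F xi + d*G xi) (norm c*A + norm d*B)" by (intro hb_add hb_cmult f g)
 then have "IFT (ift (%xi. c*F xi + d*G xi)) (%xi. c*F xi + d*G xi)"
  by (rule hb_is_fourier_transform_ift[OF s])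
 moreover have "AEL x. ift (%xi. c*F xi + d*G xi) x = c*f x + d*g x"
  using ift_inversion_AE[OF s f] ift_inversion_AE[OF s g]
 proof eventually_elim
  case (elim x)
  then show ?case using ift_linear[OF hb_integrable(1)[OF s f(2)] hb_integrable(1)[OF s g(2)]] by simp
 qed
 ultimately show ?thesis by (rule is_fourier_transform_cong_AE) auto
qed

lemma is_fourier_transform_quotient:
 fixes F G :: "'a::euclidean_space => complex"
 assumes s: "sm > real DIM('a)/2" and f: "IFT f F" "hb sm F A" and g: "IFT g G" "hb sm G B"
  and w: "IFT w W" "hb sm W C"
 shows "IFT (%x. (f x - g x) /\<^sub>R h - w x) (%xi. (F xi - G xi) /\<^sub>R h - W xi)"
proof -
 let ?i = "cx (inverse h)"
 have "IFT (%x. ?i*f x + (- ?i)*g x) (%xi. ?i*F xi + (- ?i)*G xi)"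
  by (rule is_fourier_transform_linear[OF s f g])
 moreover have "hb sm (%xi. ?i*F xi + (- ?i)*G xi) (norm ?i*A + norm (- ?i)*B)"
  by (intro hb_add hb_cmult f g)
 ultimately have "IFT (%x. 1*(?i*f x + (- ?i)*g x) + (-1)*w x) (%xi. 1*(?i*F xi + (- ?i)*G xi) + (-1)*W xi)"
  using w by (rule is_fourier_transform_linear[OF s])
 then show ?thesis by (simp add: scaleR_conv_of_real right_diff_distrib)
qed

subsection \<open>The linear Schroedinger equation\<close>

definition sv :: "('a::euclidean_space => complex) => real => 'a => complex" where
 "sv a t xi = cis (- ((norm xi)^2/2)*t)*a xi"

lemma sv_measurable [measurable (raw)]:
 assumes [measurable]: "a \<in> BM" "f \<in> borel_measurable M" "h \<in> measurable M borel"
 shows "(%w. sv a (f w) (h w)) \<in> borel_measurable M"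
 unfolding sv_def by measurable

lemma norm_sv [simp]: "norm (sv a t xi) = norm (a xi)"
 by (simp add: sv_def norm_mult)

lemma hb_sv: assumes "hb sm a B" shows "hb sm (sv a t) B"
proof -
 note [measurable] = hbD(1)[OF assms]
 show ?thesis by (rule hb_le[OF assms]) simp_all
qed

lemma hnr_sv_tendsto:
 assumes a: "hb sm a B"
 shows "((%ta. hnr sm (%xi. 1 * sv a ta xi + (-1) * sv a t xi)) \<longlongrightarrow> 0) (at t within S)"
proof (rule hnr_tendsto_0[OF _ _ hb_cmult[OF a, of 2]])
 note [measurable] = hbD(1)[OF a]
 show "(%xi. 1 * sv a ta xi + (-1) * sv a t xi) \<in> BM" for ta by measurable
 show "norm (1 * sv a ta xi + (-1) * sv a t xi) <= norm (2*a xi)" for ta xi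
  using norm_triangle_ineq4[of "sv a ta xi" "sv a t xi"] by (simp add: norm_mult)
 show "((%ta. 1 * sv a ta xi + (-1) * sv a t xi) \<longlongrightarrow> 0) (at t within S)" for xi
 proof -
  have "((%ta. cis (- ((norm xi)^2/2)*ta)*a xi - cis (- ((norm xi)^2/2)*t)*a xi) \<longlongrightarrow> cis (- ((norm xi)^2/2)*t)*a xi - cis (- ((norm xi)^2/2)*t)*a xi) (at t within S)"
   unfolding cis_conv_exp by (intro tendsto_intros)
  then show ?thesis by (simp add: sv_def)
 qed
qed

lemma Cb_sobolev_ift_sv:
 fixes a :: "'a::euclidean_space => complex"
 assumes s: "sm > real DIM('a)/2" and a: "hb sm a B"
 shows "(%t. ift (sv a t)) \<in> Cb_sobolev sm"
proof -
 note ft = hb_is_fourier_transform_ift[OF s hb_sv[OF a]]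
 have "sobolev_le sm (ift (sv a t)) B" for t by (rule sobolev_leI[OF ft hb_sv[OF a]])
 moreover have "((%ta. sobolev_norm sm (%x. ift (sv a ta) x - ift (sv a t) x)) \<longlongrightarrow> 0) (at t within {0..})" for t
 proof -
  have "IFT (%x. 1*ift (sv a ta) x + (-1)*ift (sv a t) x) (%xi. 1 * sv a ta xi + (-1) * sv a t xi)" for ta
   by (rule is_fourier_transform_linear[OF s ft hb_sv[OF a] ft hb_sv[OF a]])
  then have "sobolev_norm sm (%x. ift (sv a ta) x - ift (sv a t) x) = hnr sm (%xi. 1 * sv a ta xi + (-1) * sv a t xi)" for ta
   using sobolev_norm_eq unfolding hnr_def by fastforce
  then show ?thesis using hnr_sv_tendsto[OF a, of t "{0..}"] by simp
 qed
 ultimately show ?thesis unfolding Cb_sobolev_def by blast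
qed

lemma locally_integrable_ift:
 fixes G :: "'a::euclidean_space => complex"
 assumes G: "LI G"
 shows "locally_integrable (ift G)"
proof -
 note [measurable] = borel_measurable_integrable[OF G]
 have "set_integrable lborel K (ift G)" if K: "compact K" for K :: "'a set"
 proof -
  have [measurable]: "K \<in> sets borel" using K by (simp add: borel_compact)
  show ?thesis unfolding set_integrable_def
  proof (rule BI_int_bound[of _ "%x. ind K x*(fconst TYPE('a)*(LL x. norm (G x)))"])
   show "LI (%x. ind K x*(fconst TYPE('a)*(LL x. norm (G x))))"
    using emeasure_compact_finite[OF K] by (intro integrable_mult_left integrable_real_indicator) auto
   show "AEL x. norm (ind K x *R ift G x) <= norm (ind K x*(fconst TYPE('a)*(LL x. norm (G x))))"
    using norm_ift_le[OF G] order_trans[OF norm_ge_zero norm_ift_le[OF G]] by (intro AE_I2) (auto simp: indicator_def)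
  qed measurable
 qed
 moreover have "ift G \<in> borel_measurable lborel" by simp
 ultimately show ?thesis unfolding locally_integrable_def by blast
qed

lemma weak_laplacian_ift:
 fixes G :: "'a::euclidean_space => complex"
 assumes G: "LI G" and LG: "LI (%xi. - cx ((norm xi)^2)*G xi)"
 shows "weak_laplacian (ift G) (ift (%xi. - cx ((norm xi)^2)*G xi))"
 unfolding weak_laplacian_def
proof (intro conjI ballI locally_integrable_ift G LG)
 fix et :: "'a => real" assume et: "et \<in> test_functions UNIV"
 note L = ift_laplacian[OF et]
 have "(LL x. laplacian et x *R ift G x) = (LL x. ift G x*cr (laplacian et) x)"
  by (simp add: scaleR_conv_of_real mult.commute)
 also have "... = (LL xi. G xi*ift (cr (laplacian et)) xi)"
  by (rule ift_pairing[OF G integrable_of_real[OF L(2)]])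
 also have "... = (LL xi. (- cx ((norm xi)^2)*G xi)*ift (cr et) xi)"
  unfolding L(1) by (simp add: mult_ac)
 also have "... = (LL x. ift (%xi. - cx ((norm xi)^2)*G xi) x*cr et x)"
  by (rule ift_pairing[OF LG test_integrable_cr[OF et], symmetric])
 finally show "(LL x. laplacian et x *R ift G x) = (LL x. et x *R ift (%xi. - cx ((norm xi)^2)*G xi) x)"
  by (simp add: scaleR_conv_of_real mult.commute)
qed

lemma norm_sq_le_wgt: "(norm xi)^2 <= wgt 1 xi" by (simp add: wgt_1)

text \<open>The generator of the Schroedinger flow on the Fourier side: the time derivative of
  \<open>sv a t\<close> is \<open>sv (svd a) t\<close>.\<close>

definition svd :: "('a::euclidean_space => complex) => 'a => complex" where
 "svd a xi = - \<i>*cx ((norm xi)^2/2)*a xi"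

lemma hb_svd: assumes a: "hb (sm + 2) a B" shows "hb sm (svd a) B"
proof (rule hb_le[OF hb_wgt1[OF a]])
 show "norm (svd a xi) <= norm (cx (wgt 1 xi)*a xi)" for xi
 proof -
  have "(norm xi)^2/2 <= wgt 1 xi" using norm_sq_le_wgt[of xi] wgt_pos(1)[of 1 xi] by linarith
  then have "(norm xi)^2/2*norm (a xi) <= wgt 1 xi*norm (a xi)" by (rule mult_right_mono) simp
  then show ?thesis by (simp add: svd_def norm_mult norm_power)
 qed
qed (use hbD(1)[OF a] in \<open>unfold svd_def, measurable\<close>)

text \<open>The difference quotients of the phase are at most \<open>|xi|^2\<close> and the
  derivative is \<open>|xi|^2/2\<close>, so \<open>2*wgt 1\<close> dominates their sum. This is the
  price of two derivatives.\<close>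

lemma sobolev_time_derivative_sv:
 fixes a :: "'a::euclidean_space => complex"
 assumes s: "sm > real DIM('a)/2" and a: "hb (sm + 2) a B"
 shows "sobolev_time_derivative sm (%t. ift (sv a t)) (%t. ift (sv (svd a) t))"
 unfolding sobolev_time_derivative_def
proof (intro allI impI)
 fix t :: real
 note [measurable] = hbD(1)[OF a]
 have a': "hb sm a B" using a by (rule hb_mono_exp) simp
 note ft = hb_is_fourier_transform_ift[OF s hb_sv[OF a']]
 note ftd = hb_is_fourier_transform_ift[OF s hb_sv[OF hb_svd[OF a]]]
 have e: "sobolev_norm sm (%x. (ift (sv a ta) x - ift (sv a t) x) /\<^sub>R (ta - t) - ift (sv (svd a) t) x)
  = hnr sm (%xi. (sv a ta xi - sv a t xi) /\<^sub>R (ta - t) - sv (svd a) t xi)" for ta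
  unfolding hnr_def
  by (rule sobolev_norm_eq[OF is_fourier_transform_quotient[OF s ft hb_sv[OF a'] ft hb_sv[OF a'] ftd hb_sv[OF hb_svd[OF a]]]])
 show "((%ta. sobolev_norm sm (%x. (ift (sv a ta) x - ift (sv a t) x) /\<^sub>R (ta - t) - ift (sv (svd a) t) x)) \<longlongrightarrow> 0) (at t within {0..})"
  unfolding e
 proof (rule hnr_tendsto_0[OF _ _ hb_cmult[OF hb_wgt1[OF a], of 2]])
  show "(%xi. (sv a ta xi - sv a t xi) /\<^sub>R (ta - t) - sv (svd a) t xi) \<in> BM" for ta
   unfolding svd_def by measurable
  have d: "(sv a ta xi - sv a t xi) /\<^sub>R (ta - t) = (cis (- ((norm xi)^2/2)*ta) - cis (- ((norm xi)^2/2)*t)) /\<^sub>R (ta - t)*a xi" for ta xi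
   by (simp add: sv_def scaleR_conv_of_real algebra_simps)
  show "norm ((sv a ta xi - sv a t xi) /\<^sub>R (ta - t) - sv (svd a) t xi) <= norm (2*(cx (wgt 1 xi)*a xi))" for ta xi
  proof -
   have "norm ((sv a ta xi - sv a t xi) /\<^sub>R (ta - t) - sv (svd a) t xi) <= norm ((sv a ta xi - sv a t xi) /\<^sub>R (ta - t)) + norm (svd a xi)"
    using norm_triangle_ineq4[of "(sv a ta xi - sv a t xi) /\<^sub>R (ta - t)" "sv (svd a) t xi"] by simp
   also have "... <= 2*\<bar>- ((norm xi)^2/2)\<bar>*norm (a xi) + (norm xi)^2/2*norm (a xi)"
    unfolding d norm_mult[of _ "a xi"]
    by (intro add_mono mult_right_mono norm_cis_quotient_le) (simp_all add: svd_def norm_mult norm_power)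
   also have "... = (3/2*(norm xi)^2)*norm (a xi)" by (simp add: algebra_simps)
   also have "... <= (2*wgt 1 xi)*norm (a xi)" by (intro mult_right_mono) (simp_all add: wgt_1)
   finally show ?thesis by (simp add: norm_mult)
  qed
  show "((%ta. (sv a ta xi - sv a t xi) /\<^sub>R (ta - t) - sv (svd a) t xi) \<longlongrightarrow> 0) (at t within {0..})" for xi
  proof -
   have "((%ta. (cis (- ((norm xi)^2/2)*ta) - cis (- ((norm xi)^2/2)*t)) /\<^sub>R (ta - t)*a xi - sv (svd a) t xi) \<longlongrightarrow>
    \<i>*cx (- ((norm xi)^2/2))*cis (- ((norm xi)^2/2)*t)*a xi - sv (svd a) t xi) (at t within {0..})"
    by (intro tendsto_diff tendsto_mult tendsto_cis_quotient tendsto_const)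
   moreover have "\<i>*cx (- ((norm xi)^2/2))*cis (- ((norm xi)^2/2)*t)*a xi - sv (svd a) t xi = 0"
    by (simp add: sv_def svd_def)
   ultimately show ?thesis unfolding d by simp
  qed
 qed
qed

theorem schroedinger_solution_ift_sv:
 fixes a :: "'a::euclidean_space => complex"
 assumes s: "s > real DIM('a)/2 + 2" and a: "hb s a B" and f: "AEL x. ift a x = f x"
 shows "schroedinger_solution s f (%t. ift (sv a t))"
proof -
 have s2: "s - 2 > real DIM('a)/2" and s1: "s > real DIM('a)/2" using s by auto
 have a2: "hb (s - 2) a B" using a by (rule hb_mono_exp) simp
 have a3: "hb (s - 2 + 2) a B" using a by simp
 note d = hb_svd[OF a3]
 have L: "\<exists>L. weak_laplacian (ift (sv a t)) L & (AEL x. 2*\<i>*ift (sv (svd a) t) x + L x = 0)" for t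
 proof (intro exI conjI)
  have G: "LI (sv a t)" by (rule hb_integrable(1)[OF s1 hb_sv[OF a]])
  have e: "(%xi. - cx ((norm xi)^2) * sv a t xi) = (%xi. (- 2*\<i>) * sv (svd a) t xi)"
   by (rule ext) (simp add: sv_def svd_def mult.left_commute[of "cis _" "\<i>"])
  have LG: "LI (%xi. - cx ((norm xi)^2) * sv a t xi)"
   unfolding e by (rule hb_integrable(1)[OF s2 hb_cmult[OF hb_sv[OF d]]])
  show "weak_laplacian (ift (sv a t)) (ift (%xi. - cx ((norm xi)^2) * sv a t xi))"
   by (rule weak_laplacian_ift[OF G LG])
  show "AEL x. 2*\<i>*ift (sv (svd a) t) x + ift (%xi. - cx ((norm xi)^2) * sv a t xi) x = 0"
   unfolding e ift_def fourier_integral_cmult by simp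
 qed
 have "sv a 0 = a" by (rule ext) (simp add: sv_def)
 then show ?thesis unfolding schroedinger_solution_def
  using Cb_sobolev_ift_sv[OF s1 a] Cb_sobolev_ift_sv[OF s2 a2] Cb_sobolev_ift_sv[OF s2 d]
   sobolev_time_derivative_sv[OF s2 a3] L f by auto
qed

lemma hnr_diff_le:
 assumes f: "hb sm f A" and g: "hb sm g B"
 shows "\<bar>hnr sm f - hnr sm g\<bar> <= hnr sm (%xi. f xi - g xi)"
proof -
 have d: "hb sm (%xi. f xi - g xi) (hnr sm (%xi. f xi - g xi))" using hb_hnr[OF hb_diff[OF f g]] .
 have "hb sm (%xi. g xi + (f xi - g xi)) (hnr sm g + hnr sm (%xi. f xi - g xi))" by (intro hb_add d hb_hnr[OF g])
 moreover have "hb sm (%xi. f xi + (-1)*(f xi - g xi)) (hnr sm f + norm (-1 :: complex)*hnr sm (%xi. f xi - g xi))"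
  by (intro hb_add hb_cmult d hb_hnr[OF f])
 ultimately have "hnr sm f <= hnr sm g + hnr sm (%xi. f xi - g xi)" "hnr sm g <= hnr sm f + hnr sm (%xi. f xi - g xi)"
  using hnr_le by fastforce+
 then show ?thesis by linarith
qed

text \<open>Conjugating with the free propagator turns the equation into \<open>P' = 0\<close>; in \<open>L\<^sup>2\<close> the
 difference quotients of \<open>P\<close> tend to zero, so \<open>\<parallel>P t - P 0\<parallel>\<close> has vanishing derivative.\<close>

lemma schroedinger_transform_unique:
 fixes V W :: "real => 'a::euclidean_space => complex"
 assumes sm: "0 <= sm"
  and V: "!!t. 0 <= t ==> hb (sm + 2) (V t) (B t)" and W: "!!t. 0 <= t ==> hb sm (W t) (C t)"
  and eq: "!!t. 0 <= t ==> AEL xi. W t xi = svd (V t) xi"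
  and lim: "!!t. 0 <= t ==> ((%ta. hnr sm (%xi. (V ta xi - V t xi) /\<^sub>R (ta - t) - W t xi)) \<longlongrightarrow> 0) (at t within {0..})"
  and t: "0 <= t"
 shows "AEL xi. V t xi = sv (V 0) t xi"
proof -
 define c :: "'a => real" where "c xi = (norm xi)^2/2" for xi
 have [measurable]: "c \<in> BM" unfolding c_def by measurable
 define P where "P t xi = cis (c xi*t)*V t xi" for t xi
 have Vm: "V t \<in> BM" if "0 <= t" for t using hbD(1)[OF V[OF that]] .
 have Vsm: "hb sm (V t) (B t)" if "0 <= t" for t using V[OF that] by (rule hb_mono_exp) simp
 have P: "hb 0 (P t) (B t)" if t: "0 <= t" for t
 proof (rule hb_le[OF hb_mono_exp[OF Vsm[OF t] sm]])
  show "P t \<in> BM" using Vm[OF t] unfolding P_def by measurable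
 qed (simp add: P_def norm_mult)
 define ph where "ph t = hnr 0 (%xi. P t xi - P 0 xi)" for t
 have "(ph has_real_derivative 0) (at t within {0..})" if t: "0 <= t" for t
 proof -
  define D where "D ta xi = (V ta xi - V t xi) /\<^sub>R (ta - t) - W t xi" for ta xi
  \<comment> \<open>The quotients of the unimodular multiplier converge to its derivative, so
    \<open>k\<close> tends to 0 pointwise; it is the error made by freezing \<open>V\<close> at time
    \<open>t\<close> while the multiplier moves. \<open>D\<close> is the complementary error of the
    quotients of \<open>V\<close>.\<close>
  define k where "k ta xi = (- \<i>*cx (c xi) - cis (c xi*t)*((cis (- c xi*ta) - cis (- c xi*t)) /\<^sub>R (ta - t)))*V t xi" for ta xi
  note [measurable] = Vm[OF t] hbD(1)[OF W[OF t]]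
  have km [measurable]: "k ta \<in> BM" for ta unfolding k_def by measurable
  have w: "hb 0 (%xi. 2*(cx (wgt 1 xi)*V t xi)) (norm (2::complex)*B t)"
   by (rule hb_cmult, rule hb_wgt1, rule hb_mono_exp[OF V[OF t]]) (use sm in simp)
  have kb: "norm (k ta xi) <= norm (2*(cx (wgt 1 xi)*V t xi))" for ta xi
  proof -
   have "norm (- \<i>*cx (c xi) - cis (c xi*t)*((cis (- c xi*ta) - cis (- c xi*t)) /\<^sub>R (ta - t)))
    <= norm (- \<i>*cx (c xi)) + norm (cis (c xi*t)*((cis (- c xi*ta) - cis (- c xi*t)) /\<^sub>R (ta - t)))"
    by (rule norm_triangle_ineq4)
   also have "... <= c xi + 2*\<bar>- c xi\<bar>"
    using norm_cis_quotient_le[where c="- c xi" and ta=ta and t=t] by (intro add_mono) (simp_all add: norm_mult c_def norm_power)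
   also have "... <= 2*wgt 1 xi" by (simp add: c_def wgt_1)
   finally have "norm (k ta xi) <= 2*wgt 1 xi*norm (V t xi)" unfolding k_def norm_mult[of _ "V t xi"] by (rule mult_right_mono) simp
   then show ?thesis by (simp add: norm_mult)
  qed
  have k0: "((%ta. hnr 0 (k ta)) \<longlongrightarrow> 0) (at t within {0..})"
  proof (rule hnr_tendsto_0[OF km kb w])
   show "((%ta. k ta xi) \<longlongrightarrow> 0) (at t within {0..})" for xi
   proof -
    have "((%ta. k ta xi) \<longlongrightarrow> (- \<i>*cx (c xi) - cis (c xi*t)*(\<i>*cx (- c xi)*cis (- c xi*t)))*V t xi) (at t within {0..})"
     unfolding k_def by (intro tendsto_diff tendsto_mult tendsto_cis_quotient tendsto_const)
    moreover have "cis (c xi*t)*(\<i>*cx (- c xi)*cis (- c xi*t)) = - \<i>*cx (c xi)"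
    proof -
     have "cis (c xi*t)*cis (- c xi*t) = 1" by (simp add: cis_mult)
     then show ?thesis unfolding of_real_minus by algebra
    qed
    ultimately show ?thesis by (simp only: diff_self mult_zero_left)
   qed
  qed
  have le: "\<bar>(ph ta - ph t)/(ta - t)\<bar> <= hnr sm (D ta) + hnr 0 (k ta)" if ta: "0 <= ta" "ta ~= t" for ta
  proof -
   note [measurable] = Vm[OF ta(1)]
   have D: "hb sm (D ta) (hnr sm (D ta))"
   proof (rule hb_hnr)
    have "hb sm (%xi. cx (inverse (ta - t))*(V ta xi - V t xi) - W t xi) (norm (cx (inverse (ta - t)))*(B ta + B t) + C t)"
     by (intro hb_diff hb_cmult Vsm W t ta)
    then show "hb sm (D ta) (norm (cx (inverse (ta - t)))*(B ta + B t) + C t)"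
     unfolding D_def[abs_def] scaleR_conv_of_real .
   qed
   have Dk: "hb 0 (%xi. cx (ta - t)*(D ta xi + k ta xi)) (norm (cx (ta - t))*(hnr sm (D ta) + hnr 0 (k ta)))"
    by (intro hb_cmult hb_add hb_mono_exp[OF D sm] hb_hnr[OF hb_le[OF w km kb]])
   \<comment> \<open>The increment of \<open>P\<close> is exactly \<open>ta - t\<close> times the
     two errors, up to a unimodular factor: the derivative of the multiplier cancels
     \<open>W t\<close>, because \<open>W t = svd (V t)\<close>.\<close>
   have "AEL xi. P ta xi - P t xi = cis (c xi*ta)*(cx (ta - t)*(D ta xi + k ta xi))"
    using eq[OF t]
   proof eventually_elim
    case (elim xi)
    have u: "cis (c xi*ta)*cis (c xi*t)*cis (- c xi*ta) = cis (c xi*t)" "cis (c xi*t)*cis (- c xi*t) = 1"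
     by (simp_all add: cis_mult algebra_simps)
    have alg: "a*X - b*Y = a*(X - Y + r*w*Y + (- r*w*Y - b*(d - e)*Y))"
     if "a*b*d = b" "b*e = 1" for a b d e X Y r w :: complex
    proof -
     have "a*(X - Y + r*w*Y + (- r*w*Y - b*(d - e)*Y)) = a*X - a*Y - (a*b*d)*Y + a*(b*e)*Y"
      by (simp add: algebra_simps)
     then show ?thesis unfolding that by simp
    qed
    have e1: "cx (ta - t)*D ta xi = V ta xi - V t xi + cx (ta - t)*(\<i>*cx (c xi))*V t xi"
     using ta(2) elim unfolding D_def svd_def c_def scaleR_conv_of_real by (simp add: field_simps del: of_real_diff) (simp add: algebra_simps)?
    have e2: "cx (ta - t)*k ta xi = - cx (ta - t)*(\<i>*cx (c xi))*V t xi
     - cis (c xi*t)*(cis (- c xi*ta) - cis (- c xi*t))*V t xi"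
    proof -
     have "cx (ta - t)*(z /\<^sub>R (ta - t)) = z" for z using ta(2) by (simp add: scaleR_conv_of_real del: of_real_diff)
     from this[of "cis (- c xi*ta) - cis (- c xi*t)"] show ?thesis unfolding k_def by algebra
    qed
    show ?case unfolding distrib_left[of "cx (ta - t)"] e1 e2 P_def
     by (rule alg[OF u])
   qed
   then have ae: "AEL xi. norm (P ta xi - P t xi) = norm (cx (ta - t)*(D ta xi + k ta xi))"
    by eventually_elim (simp add: norm_mult)
   have "hn 0 (en (%xi. P ta xi - P t xi)) = hn 0 (en (%xi. cx (ta - t)*(D ta xi + k ta xi)))"
    using ae by (intro hn_cong_AE) (auto elim!: eventually_mono)
   then have "hnr 0 (%xi. P ta xi - P t xi) = hnr 0 (%xi. cx (ta - t)*(D ta xi + k ta xi))"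
    by (simp add: hnr_def)
   also have "... <= norm (cx (ta - t))*(hnr sm (D ta) + hnr 0 (k ta))" by (rule hnr_le[OF Dk])
   finally have 1: "hnr 0 (%xi. P ta xi - P t xi) <= \<bar>ta - t\<bar>*(hnr sm (D ta) + hnr 0 (k ta))" by (simp only: norm_of_real)
   have "\<bar>ph ta - ph t\<bar> <= hnr 0 (%xi. (P ta xi - P 0 xi) - (P t xi - P 0 xi))"
    unfolding ph_def by (rule hnr_diff_le[OF hb_diff[OF P[OF ta(1)] P] hb_diff[OF P[OF t] P]]) auto
   with 1 have "\<bar>ph ta - ph t\<bar> <= \<bar>ta - t\<bar>*(hnr sm (D ta) + hnr 0 (k ta))" by simp
   then show ?thesis using ta(2) by (simp add: divide_simps mult.commute)
  qed
  have "((%ta. hnr sm (D ta) + hnr 0 (k ta)) \<longlongrightarrow> 0 + 0) (at t within {0..})"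
   using lim[OF t] k0 unfolding D_def by (rule tendsto_add)
  then have z: "((%ta. hnr sm (D ta) + hnr 0 (k ta)) \<longlongrightarrow> 0) (at t within {0..})" by simp
  have "\<forall>\<^sub>F ta in at t within {0..}. norm ((ph ta - ph t)/(ta - t)) <= hnr sm (D ta) + hnr 0 (k ta)"
   using le by (auto simp: eventually_at_filter)
  then have "((%ta. (ph ta - ph t)/(ta - t)) \<longlongrightarrow> 0) (at t within {0..})"
   using z by (rule Lim_null_comparison)
  then show ?thesis by (simp add: has_field_derivative_iff)
 qed
 then have "\<exists>c. \<forall>x\<in>{0..}. ph x = c"
  by (intro has_field_derivative_zero_constant) auto
 moreover have "ph 0 = 0" unfolding ph_def hnr_def hn_def by simp
 ultimately have "ph t = 0" using t by auto
 then have "AEL xi. P t xi - P 0 xi = 0"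
  unfolding ph_def using hnr_zero_iff[OF hb_diff[OF P[OF t] P[of 0]]] by simp
 then show ?thesis
 proof eventually_elim
  case (elim xi)
  have "cis (- c xi*t)*cis (c xi*t) = 1" by (simp add: cis_mult)
  then have "V t xi = cis (- c xi*t)*(cis (c xi*t)*V t xi)" by (metis mult.assoc mult_1)
  also have "cis (c xi*t)*V t xi = V 0 xi" using elim by (simp add: P_def)
  finally show ?case unfolding sv_def c_def .
 qed
qed

lemma integrable_mult_bounded:
 fixes f c :: "'a::euclidean_space => complex"
 assumes f: "LI f" and [measurable]: "c \<in> BM" and c: "!!x. norm (c x) <= C"
 shows "LI (%x. f x*c x)"
proof (rule BI_int_bound[OF integrable_mult_right[OF f, of "cx C"]])
 note [measurable] = borel_measurable_integrable[OF f]
 have "0 <= C" using order_trans[OF norm_ge_zero c] .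
 then have "norm (f x*c x) <= norm (cx C*f x)" for x
  using mult_right_mono[OF c[of x], of "norm (f x)"] by (simp add: norm_mult mult.commute)
 then show "AEL x. norm (f x*c x) <= norm (cx C*f x)" by (rule AE_I2)
qed (use borel_measurable_integrable[OF f] in measurable)

text \<open>The weak Laplacian is only known through pairings. Transformed to the Fourier side and
  tested with bumps, the equation becomes the pointwise relation between the transforms
  \<open>W\<close> and \<open>V\<close> required by
  \<open>schroedinger_transform_unique\<close>.\<close>

theorem schroedinger_solution_unique:
 fixes f a :: "'a::euclidean_space => complex"
 assumes s: "s > real DIM('a)/2 + 2" and a: "hb s a B" and f: "AEL x. ift a x = f x"
  and v: "schroedinger_solution s f v" and t: "0 <= t"
 shows "AEL x. v t x = ift (sv a t) x"
proof -
 have s2: "s - 2 > real DIM('a)/2" and s1: "s > real DIM('a)/2" using s by auto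
 have s0: "0 <= s - 2" using s2 by (meson divide_nonneg_nonneg le_less_trans less_imp_le of_nat_0_le_iff zero_le_numeral)
 from v obtain w where vC: "v \<in> Cb_sobolev s" and wC: "w \<in> Cb_sobolev (s - 2)" and d: "sobolev_time_derivative (s - 2) v w"
  and L: "!!t. 0 <= t ==> \<exists>L. weak_laplacian (v t) L & (AEL x. 2*\<i>*w t x + L x = 0)"
  and v0: "AEL x. v 0 x = f x"
  unfolding schroedinger_solution_def by blast
 obtain B1 where B1: "!!t. 0 <= t ==> sobolev_le s (v t) B1" using vC unfolding Cb_sobolev_def by blast
 obtain B2 where B2: "!!t. 0 <= t ==> sobolev_le (s - 2) (w t) B2" using wC unfolding Cb_sobolev_def by blast
 have "\<forall>t. \<exists>V. 0 <= t --> IFT (v t) V & hb s V B1" using sobolev_leD[OF B1] by metis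
 then obtain V where V: "!!t. 0 <= t ==> IFT (v t) (V t)" "!!t. 0 <= t ==> hb s (V t) B1" by metis
 have "\<forall>t. \<exists>V. 0 <= t --> IFT (w t) V & hb (s - 2) V B2" using sobolev_leD[OF B2] by metis
 then obtain W where W: "!!t. 0 <= t ==> IFT (w t) (W t)" "!!t. 0 <= t ==> hb (s - 2) (W t) B2" by metis
 have V2: "hb (s - 2) (V t) B1" if "0 <= t" for t using V(2)[OF that] by (rule hb_mono_exp) simp
 have eq: "AEL xi. W t xi = svd (V t) xi" if t: "0 <= t" for t
 proof -
  note [measurable] = hbD(1)[OF V(2)[OF t]] hbD(1)[OF W(2)[OF t]] is_fourier_transform_measurable(1)[OF V(1)[OF t]] is_fourier_transform_measurable(1)[OF W(1)[OF t]]
  have Vi: "LI (V t)" and Wi: "LI (W t)"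
   using hb_integrable(1)[OF s1 V(2)[OF t]] hb_integrable(1)[OF s2 W(2)[OF t]] by auto
  obtain L' where wl: "weak_laplacian (v t) L'" and Lw: "AEL x. 2*\<i>*w t x + L' x = 0" using L[OF t] by blast
  have Lm [measurable]: "L' \<in> BM" using wl by (simp add: weak_laplacian_def locally_integrable_def)
  \<comment> \<open>The transform of the Laplacian of \<open>v\<close> plus \<open>2*\<i>*w\<close>.
    It grows like \<open>|xi|^2*V\<close>, so the weight \<open>wgt (- 1)\<close> brings it back to
    order \<open>s - 2\<close>.\<close>
  define M where "M xi = - cx ((norm xi)^2)*V t xi + 2*\<i>*W t xi" for xi
  have "AEL xi. M xi = 0"
  proof (rule test_pairing_zero_imp_AE[OF s2])
   show Mm: "M \<in> BM" unfolding M_def by measurable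
   have w1: "wgt (- 1) xi*(norm xi)^2 <= 1" "wgt (- 1) xi <= 1" for xi :: 'a
   proof -
    have "wgt (- 1) xi*(norm xi)^2 <= wgt (- 1) xi*wgt 1 xi" by (intro mult_left_mono norm_sq_le_wgt) simp
    then show "wgt (- 1) xi*(norm xi)^2 <= 1" using wgt_inverse[of 1 xi] by (simp add: mult.commute)
    show "wgt (- 1) xi <= 1" using wgt_mono[of "- 1" 0 xi] by simp
   qed
   have h1: "hb (s - 2) (%xi. cx (wgt (- 1) xi)*(- cx ((norm xi)^2)*V t xi)) B1"
   proof (rule hb_le[OF V2[OF t]])
    fix xi :: 'a
    have "wgt (- 1) xi*(norm xi)^2*norm (V t xi) <= 1*norm (V t xi)" by (rule mult_right_mono[OF w1(1)]) simp
    then show "norm (cx (wgt (- 1) xi)*(- cx ((norm xi)^2)*V t xi)) <= norm (V t xi)"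
     by (simp add: norm_mult norm_power mult.assoc)
   qed measurable
   have h2: "hb (s - 2) (%xi. cx (wgt (- 1) xi)*(2*\<i>*W t xi)) (norm (2*\<i>)*B2)"
   proof (rule hb_le[OF hb_cmult[OF W(2)[OF t]]])
    fix xi :: 'a
    have "wgt (- 1) xi*norm (2*\<i>*W t xi) <= 1*norm (2*\<i>*W t xi)" by (rule mult_right_mono[OF w1(2)]) simp
    then show "norm (cx (wgt (- 1) xi)*(2*\<i>*W t xi)) <= norm (2*\<i>*W t xi)"
     by (simp add: norm_mult mult.assoc)
   qed measurable
   show "hb (s - 2) (%xi. cx (wgt (- 1) xi)*M xi) (B1 + norm (2*\<i>)*B2)"
    unfolding M_def distrib_left by (rule hb_add[OF h1 h2])
   fix r :: real and x0 :: 'a assume "0 < r"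
   let ?et = "bump r x0"
   note T = bump_test[of r x0]
   note La = ift_laplacian[OF T]
   have La_m [measurable]: "laplacian ?et \<in> BM" using La(3) by (rule borel_measurable_continuous_onI)
   have i1: "LI (%xi. V t xi*ift (cr (laplacian ?et)) xi)"
    by (rule integrable_mult_bounded[OF Vi _ norm_ift_le[OF integrable_of_real[OF La(2)]]]) simp
   have i2: "LI (%xi. W t xi*ift (cr ?et) xi)"
    by (rule integrable_mult_bounded[OF Wi _ norm_ift_le[OF test_integrable_cr[OF T]]]) simp
   have "(LL x. laplacian ?et x *R v t x) = (LL x. ift (V t) x*cr (laplacian ?et) x)"
   proof (intro integral_cong_AE)
    show "AEL x. laplacian ?et x *R v t x = ift (V t) x*cr (laplacian ?et) x"
     using ift_inversion_AE[OF s1 V(1,2)[OF t]] by eventually_elim (simp add: scaleR_conv_of_real mult.commute)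
   qed measurable
   also have "... = (LL xi. V t xi*ift (cr (laplacian ?et)) xi)"
    by (rule ift_pairing[OF Vi integrable_of_real[OF La(2)]])
   finally have e1: "(LL x. laplacian ?et x *R v t x) = (LL xi. V t xi*ift (cr (laplacian ?et)) xi)" .
   have "(LL x. ?et x *R L' x) = (LL x. (- 2*\<i>)*(ift (W t) x*cr ?et x))"
   proof (intro integral_cong_AE)
    show "AEL x. ?et x *R L' x = (- 2*\<i>)*(ift (W t) x*cr ?et x)"
     using ift_inversion_AE[OF s2 W(1,2)[OF t]] Lw
    proof eventually_elim
     case (elim x)
     have "L' x = - 2*\<i>*w t x" using elim(2) by (metis add.inverse_unique mult_minus_left)
     then show ?case using elim(1) by (simp add: scaleR_conv_of_real mult_ac)
    qed
   qed measurable
   also have "... = (- 2*\<i>)*(LL xi. W t xi*ift (cr ?et) xi)"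
    by (simp only: integral_mult_right_zero ift_pairing[OF Wi test_integrable_cr[OF T]])
   finally have e2: "(LL x. ?et x *R L' x) = (- 2*\<i>)*(LL xi. W t xi*ift (cr ?et) xi)" .
   have "(LL x. laplacian ?et x *R v t x) = (LL x. ?et x *R L' x)"
    using wl T unfolding weak_laplacian_def by blast
   then have "(LL xi. V t xi*ift (cr (laplacian ?et)) xi) + (LL xi. 2*\<i>*(W t xi*ift (cr ?et) xi)) = 0"
    unfolding e1 e2 by simp
   moreover have "(%xi. M xi*ift (cr ?et) xi) = (%xi. V t xi*ift (cr (laplacian ?et)) xi + 2*\<i>*(W t xi*ift (cr ?et) xi))"
    unfolding La(1) M_def by (simp add: algebra_simps)
   ultimately show "(LL xi. M xi*ift (cr ?et) xi) = 0"
    using i1 i2 by (simp del: integral_mult_right_zero add: BI_LINT_add)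
  qed
  then show ?thesis
  proof eventually_elim
   case (elim xi)
   then have "2*\<i>*W t xi = cx ((norm xi)^2)*V t xi" by (simp add: M_def)
   then have "(- \<i>/2)*(2*\<i>*W t xi) = (- \<i>/2)*(cx ((norm xi)^2)*V t xi)" by simp
   moreover have "(- \<i>/2)*(2*\<i>*W t xi) = W t xi" by simp
   ultimately show ?case by (simp add: svd_def)
  qed
 qed
 have lim: "((%ta. hnr (s - 2) (%xi. (V ta xi - V t xi) /\<^sub>R (ta - t) - W t xi)) \<longlongrightarrow> 0) (at t within {0..})" if t: "0 <= t" for t
 proof (rule Lim_transform_eventually)
  show "((%ta. sobolev_norm (s - 2) (%x. (v ta x - v t x) /\<^sub>R (ta - t) - w t x)) \<longlongrightarrow> 0) (at t within {0..})"
   using d t unfolding sobolev_time_derivative_def by blast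
  have "sobolev_norm (s - 2) (%x. (v ta x - v t x) /\<^sub>R (ta - t) - w t x) = hnr (s - 2) (%xi. (V ta xi - V t xi) /\<^sub>R (ta - t) - W t xi)" if ta: "0 <= ta" for ta
   unfolding hnr_def
   by (rule sobolev_norm_eq[OF is_fourier_transform_quotient[OF s2 V(1)[OF ta] V2[OF ta] V(1)[OF t] V2[OF t] W[OF t]]])
  then show "\<forall>\<^sub>F ta in at t within {0..}. sobolev_norm (s - 2) (%x. (v ta x - v t x) /\<^sub>R (ta - t) - w t x) = hnr (s - 2) (%xi. (V ta xi - V t xi) /\<^sub>R (ta - t) - W t xi)"
   by (auto simp: eventually_at_filter)
 qed
 have V': "hb (s - 2 + 2) (V t) B1" if "0 <= t" for t using V(2)[OF that] by simp
 have Vt: "AEL xi. V t xi = sv (V 0) t xi"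
  by (rule schroedinger_transform_unique[OF s0 V' W(2) eq lim t])
 note fa = hb_is_fourier_transform_ift[OF s1 a]
 note fm = is_fourier_transform_measurable(1)[OF V(1)[of 0, simplified]]
 have "IFT (v 0) a"
 proof (rule is_fourier_transform_cong_AE[OF fa])
  show "AEL x. ift a x = v 0 x" using f v0 by eventually_elim simp
 qed (use fm hbD(1)[OF a] in auto)
 then have V0: "AEL xi. V 0 xi = a xi" using is_fourier_transform_unique[OF V(1)[of 0]] by simp
 note [measurable] = hbD(1)[OF V(2)[OF t]] hbD(1)[OF a]
 have "AEL xi. V t xi = sv a t xi" using Vt V0 by eventually_elim (simp add: sv_def)
 then have "FI (V t) x = FI (sv a t) x" for x by (rule fourier_integral_cong_AE) auto
 then show ?thesis using ift_inversion_AE[OF s1 V(1,2)[OF t]] by (simp add: ift_def)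
qed

subsection \<open>The weak Klein--Gordon equation\<close>

lemma test_functionsI:
 assumes "!!k. C_k k et" and K: "compact K" "K \<subseteq> Oz" "!!x. x \<notin> K ==> et x = 0"
 shows "et \<in> test_functions Oz"
proof -
 have "closure {x. et x ~= 0} \<subseteq> K" using K by (intro closure_minimal compact_imp_closed) auto
 moreover from this have "compact (closure {x. et x ~= 0})" using compact_Int_closed[OF K(1) closed_closure, of "{x. et x ~= 0}"]
  by (simp add: Int_absorb1)
 ultimately show ?thesis using assms by (auto simp: test_functions_def)
qed

lemma has_derivative_slice:
 assumes "Ph differentiable (at (t, x))"
 shows "((%x. Ph (t, x)) has_derivative (%h. frechet_derivative Ph (at (t, x)) (0, h))) (at x)"
proof -
 have "((%x. (t, x)) has_derivative (%h. (0, h))) (at x)" by (intro has_derivative_Pair has_derivative_const has_derivative_ident)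
 from has_derivative_compose[OF this has_derivative_partial[OF assms]] show ?thesis .
qed

lemma partial_slice:
 assumes "!!p. Ph differentiable (at p)"
 shows "partial b (%x. Ph (t, x)) = (%x. partial (0, b) Ph (t, x))"
 by (rule ext, unfold partial_def[of "(0, b)"]) (rule partial_eqI[OF has_derivative_slice[OF assms]])

lemma Basis_prod_right: "b \<in> Basis ==> (0, b) \<in> Basis"
 by (simp add: Basis_prod_def)

lemma Basis_prod_time: "(1, 0) \<in> (Basis :: (real \<times> 'a::euclidean_space) set)"
 by (simp add: Basis_prod_def)

lemma C_k_slice:
 fixes Ph :: "real \<times> 'a::euclidean_space => real"
 shows "C_k k Ph ==> C_k k (%x. Ph (t, x))"
proof (induction k arbitrary: Ph)
 case 0
 have "continuous_on UNIV (%x::'a. (t, x))" by (intro continuous_intros)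
 then show ?case using 0 by (simp only: C_k.simps) (rule continuous_on_compose2[of UNIV Ph], auto)
next
 case (Suc k)
 have d: "Ph differentiable (at p)" for p using Suc.prems by (cases p) simp
 have "C_k k (%x. partial (0, b) Ph (t, x))" if "b \<in> Basis" for b :: 'a
  using Suc.prems Basis_prod_right[OF that] unfolding C_k.simps by (intro Suc.IH) blast
 moreover have "(%x. Ph (t, x)) differentiable (at x)" for x
  using has_derivative_slice[OF d] unfolding differentiable_def by blast
 ultimately show ?case by (simp only: C_k.simps partial_slice[OF d]) blast
qed

lemma test_slice:
 fixes Ph :: "real \<times> 'a::euclidean_space => real"
 assumes Ph: "Ph \<in> test_functions Oz"
 shows "(%x. Ph (t, x)) \<in> test_functions UNIV"
proof -
 obtain K where K: "compact K" "closed K" "K \<subseteq> Oz" "!!x. x \<notin> K ==> Ph x = 0" by (rule test_support[OF Ph]) blast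
 show ?thesis
 proof (rule test_functionsI)
  show "compact (snd ` K)" using K(1) by (intro compact_continuous_image continuous_intros)
  show "Ph (t, x) = 0" if "x \<notin> snd ` K" for x using K(4)[of "(t, x)"] that by force
 qed (use C_k_slice[OF test_C_k[OF Ph]] in auto)
qed

lemma has_real_derivative_time:
 fixes Ph :: "real \<times> 'a::euclidean_space => real"
 assumes "Ph differentiable (at (t, x))"
 shows "((%t. Ph (t, x)) has_real_derivative dt Ph (t, x)) (at t)"
proof -
 have p: "((%t. (t, x)) has_derivative (%h. (h, 0))) (at t)" by (intro has_derivative_Pair has_derivative_const has_derivative_ident)
 note F = has_derivative_partial[OF assms]
 have "frechet_derivative Ph (at (t, x)) (h, 0) = dt Ph (t, x)*h" for h
  using linear_scale[OF has_derivative_linear[OF F], of h "(1, 0)"] by (simp add: partial_def mult.commute)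
 then show ?thesis using has_derivative_compose[OF p F] by (simp add: has_field_derivative_def)
qed

lemma laplacian_slice:
 fixes Ph :: "real \<times> 'a::euclidean_space => real"
 assumes Ph: "Ph \<in> test_functions Oz"
 shows "laplacian (%x. Ph (t, x)) x = (\<Sum>b\<in>Basis. partial (0, b) (partial (0, b) Ph) (t, x))"
 unfolding laplacian_def
 by (intro sum.cong refl)
  (simp add: partial_slice[OF test_differentiable[OF Ph]] partial_slice[OF test_differentiable[OF test_partial[OF Ph Basis_prod_right]]])

lemma tb_L1_bound:
 fixes G :: "real => 'a::euclidean_space => complex"
 assumes s: "sm > real DIM('a)/2" and G: "tb sm T G B" and t: "0 <= t" "t <= T"
 shows "LI (G t)" "(LL xi. norm (G t xi)) <= sqrt (wint TYPE('a) sm)*B"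
 using hb_integrable[OF s tbD(3)[OF G t]] .

lemma slice_integrable_bound:
 fixes te :: "real \<times> 'a::euclidean_space => real"
 assumes te: "continuous_on UNIV te" and K: "compact K" "!!p. p \<notin> K ==> te p = 0"
 obtains m where "!!t. LI (%x. te (t, x))" "!!t. (LL x. norm (cr (%x. te (t, x)) x)) <= m"
  "!!t xi. norm (ift (cr (%x. te (t, x))) xi) <= fconst TYPE('a)*m"
proof -
 obtain D where D: "0 <= D" "!!p. \<bar>te p\<bar> <= D" using compact_support_bounded[OF te K] by blast
 define K' where "K' = snd ` K"
 have K': "compact K'" unfolding K'_def using K(1) by (intro compact_continuous_image continuous_intros)
 have [measurable]: "K' \<in> sets borel" using K' by (simp add: borel_compact)
 have te0: "te (t, x) = 0" if "x \<notin> K'" for t x using K(2)[of "(t, x)"] that unfolding K'_def by force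
 have tec: "continuous_on UNIV (%x. te (t, x))" for t
  by (rule continuous_on_compose2[OF te]) (auto intro!: continuous_intros)
 have tei: "LI (%x. te (t, x))" for t
  by (rule compact_support_integrable[OF tec K' te0])
 define m where "m = D*measure lborel K'"
 have teL: "(LL x. norm (cr (%x. te (t, x)) x)) <= m" for t
 proof -
  have "(LL x. norm (cr (%x. te (t, x)) x)) <= (LL x. ind K' x*D)"
  proof (rule integral_mono)
   show "LI (%x. norm (cr (%x. te (t, x)) x))" using tei[of t] by simp
   show "LI (%x. ind K' x*D)"
    using emeasure_compact_finite[OF K'] by (intro integrable_mult_left integrable_real_indicator) auto
   show "norm (cr (%x. te (t, x)) x) <= ind K' x*D" for x using D te0[of x t] by (auto simp: indicator_def)
  qed
  also have "... = m" unfolding m_def by simp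
  finally show ?thesis .
 qed
 have fc: "0 <= fconst TYPE('a)" using fconst_pos[where 'a='a] by simp
 have ite: "norm (ift (cr (%x. te (t, x))) xi) <= fconst TYPE('a)*m" for t xi
  using norm_ift_le[OF integrable_of_real[OF tei[of t]], of xi] mult_left_mono[OF teL[of t] fc] by linarith
 show ?thesis by (rule that[OF tei teL ite])
qed

text \<open>Parseval in space at each time, then Fubini. The result has the frequency outside and
  the time inside, so that the weak equation can be treated as an oscillator equation for each fixed
  \<open>xi\<close>.\<close>

lemma pairing_time:
 fixes G :: "real => 'a::euclidean_space => complex" and te :: "real \<times> 'a => real"
 assumes s: "sm > real DIM('a)/2" and G: "tb sm T G B" and T: "0 <= T"
  and te: "continuous_on UNIV te" and K: "compact K" "!!p. p \<notin> K ==> te p = 0"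
 shows "LI (%p. ind ({0<..<T} \<times> UNIV) p *R (ift (G (fst p)) (snd p)*cr te p))" (is ?A)
  and "(LL p. ind ({0<..<T} \<times> UNIV) p *R (ift (G (fst p)) (snd p)*cr te p))
   = (LL xi. LL t. ind {0..T} t *R (G t xi*ift (cr (%x. te (t, x))) xi))" (is ?B)
  and "LI (%xi. LL t. ind {0..T} t *R (G t xi*ift (cr (%x. te (t, x))) xi))" (is ?C)
  and "AEL xi. LI (%t. ind {0..T} t *R (G t xi*ift (cr (%x. te (t, x))) xi))" (is ?D)
proof -
 note Gm [measurable] = tbD(1)[OF G]
 have teb: "te \<in> BM" using te by (rule borel_measurable_continuous_onI)
 then have tem [measurable]: "te \<in> BM2" by (simp only: borel_prod)
 have [measurable]: "(%x. te (t, x)) \<in> BM" for t by measurable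
 define W where "W = sqrt (wint TYPE('a) sm)*B"
 have L1: "LI (G t)" "(LL xi. norm (G t xi)) <= W" if "0 <= t" "t <= T" for t
  unfolding W_def using tb_L1_bound[OF s G that] .
 obtain m where tei: "!!t. LI (%x. te (t, x))"
  and teL: "!!t. (LL x. norm (cr (%x. te (t, x)) x)) <= m"
  and ite: "!!t xi. norm (ift (cr (%x. te (t, x))) xi) <= fconst TYPE('a)*m"
  using slice_integrable_bound[OF te K] by blast
 have fc: "0 <= fconst TYPE('a)" using fconst_pos[where 'a='a] by simp
 have iG: "norm (ift (G t) x) <= fconst TYPE('a)*W" if "0 <= t" "t <= T" for t x
  using norm_ift_le[OF L1(1)[OF that], of x] mult_left_mono[OF L1(2)[OF that] fc] by linarith
 have fW: "0 <= fconst TYPE('a)*W" using iG[of 0] T order_trans[OF norm_ge_zero] by blast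
 have fm: "0 <= fconst TYPE('a)*m" using ite order_trans[OF norm_ge_zero] by blast
 define f1 where "f1 t x = ind {0<..<T} t *R (ift (G t) x*cr te (t, x))" for t x
 define f2 where "f2 t xi = ind {0..T} t *R (G t xi*ift (cr (%x. te (t, x))) xi)" for t xi
 have f1m [measurable]: "(%(t, x). f1 t x) \<in> BM2" unfolding f1_def by measurable
 have f2m [measurable]: "(%(t, x). f2 t x) \<in> BM2" unfolding f2_def by measurable
 have "(NN t. NN x. enm (f1 t x)) <= (NN t. ind {0..T} t*ennreal (fconst TYPE('a)*W*m))"
 proof (rule nn_integral_mono)
  fix t :: real
  show "(NN x. enm (f1 t x)) <= ind {0..T} t*ennreal (fconst TYPE('a)*W*m)"
  proof (cases "t \<in> {0<..<T}")
   case True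
   have "(NN x. enm (f1 t x)) <= (NN x. ennreal (fconst TYPE('a)*W)*enm (cr (%x. te (t, x)) x))"
    using iG[of t] True fW by (intro nn_integral_mono) (auto simp: f1_def norm_mult ennreal_mult'[symmetric] intro!: ennreal_leI mult_right_mono)
   also have "... = ennreal (fconst TYPE('a)*W)*(NN x. enm (cr (%x. te (t, x)) x))"
    by (rule nn_integral_cmult) measurable
   also have "(NN x. enm (cr (%x. te (t, x)) x)) = ennreal (LL x. norm (cr (%x. te (t, x)) x))"
    using tei[of t] by (intro nn_integral_eq_integral) auto
   also have "ennreal (fconst TYPE('a)*W) * ... <= ennreal (fconst TYPE('a)*W*m)"
    using mult_left_mono[OF teL[of t] fW] fW by (subst ennreal_mult'[symmetric]) (auto intro!: ennreal_leI)
   finally show ?thesis using True by simp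
  qed (simp add: f1_def)
 qed
 also have "... <= ennreal T*ennreal (fconst TYPE('a)*W*m)" using T by (intro nn_integral_indicator_le) auto
 also have "... < \<infinity>" by (simp add: ennreal_mult_less_top)
 finally have fin1: "(NN t. NN x. enm (f1 t x)) < \<infinity>" .
 have "(NN t. NN x. enm (f2 t x)) <= (NN t. ind {0..T} t*ennreal (fconst TYPE('a)*m*W))"
 proof (rule nn_integral_mono)
  fix t :: real
  show "(NN x. enm (f2 t x)) <= ind {0..T} t*ennreal (fconst TYPE('a)*m*W)"
  proof (cases "t \<in> {0..T}")
   case True
   have "(NN x. enm (f2 t x)) <= (NN x. ennreal (fconst TYPE('a)*m)*enm (G t x))"
    using ite[of t] True fm by (intro nn_integral_mono) (auto simp: f2_def norm_mult ennreal_mult'[symmetric] mult.commute[of "norm (G _ _)"] intro!: ennreal_leI mult_right_mono)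
   also have "... = ennreal (fconst TYPE('a)*m)*(NN x. enm (G t x))"
    using borel_measurable_integrable[OF L1(1)[of t]] True by (intro nn_integral_cmult) auto
   also have "(NN x. enm (G t x)) = ennreal (LL x. norm (G t x))"
    using L1(1)[of t] True by (intro nn_integral_eq_integral) auto
   also have "ennreal (fconst TYPE('a)*m) * ... <= ennreal (fconst TYPE('a)*m*W)"
    using mult_left_mono[OF L1(2)[of t] fm] fm True by (subst ennreal_mult'[symmetric]) (auto intro!: ennreal_leI)
   finally show ?thesis using True by simp
  qed (simp add: f2_def)
 qed
 also have "... <= ennreal T*ennreal (fconst TYPE('a)*m*W)" using T by (intro nn_integral_indicator_le) auto
 also have "... < \<infinity>" by (simp add: ennreal_mult_less_top)
 finally have fin2: "(NN t. NN x. enm (f2 t x)) < \<infinity>" .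
 note F1 = fubini_lborel[OF f1m fin1] and F2 = fubini_lborel[OF f2m fin2]
 have i1: "(%p. ind ({0<..<T} \<times> UNIV) p *R (ift (G (fst p)) (snd p)*cr te p)) = (%p. f1 (fst p) (snd p))"
  by (rule ext) (auto simp: f1_def indicator_def)
 show ?A unfolding i1 using F1(1) by (simp add: lborel_prod case_prod_unfold)
 show ?C using F2(4) unfolding f2_def .
 show ?D using F2(6) unfolding f2_def .
 have "(LL p. f1 (fst p) (snd p)) = (LL t. LL x. f1 t x)" by (rule F1(7))
 also have "... = (LL t. LL xi. f2 t xi)"
 proof (rule integral_cong_AE)
  \<comment> \<open>The open time interval of the weak formulation and the closed one of the bounds
    differ by two points.\<close>
  show "AEL t. (LL x. f1 t x) = (LL xi. f2 t xi)"
   using AE_lborel_singleton[of 0] AE_lborel_singleton[of T]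
  proof eventually_elim
   case (elim t)
   show ?case
   proof (cases "t \<in> {0<..<T}")
    case True
    have "(LL x. ift (G t) x*cr (%x. te (t, x)) x) = (LL xi. G t xi*ift (cr (%x. te (t, x))) xi)"
     using True by (intro ift_pairing L1 integrable_of_real tei) auto
    then show ?thesis using True by (simp add: f1_def f2_def)
   next
    case False
    then have "t \<notin> {0..T}" using elim by auto
    then show ?thesis using False by (simp add: f1_def f2_def)
   qed
  qed
  show "(%t. LL x. f1 t x) \<in> borel_measurable lborel" "(%t. LL x. f2 t x) \<in> borel_measurable lborel"
   using borel_measurable_integrable[OF F1(3)] borel_measurable_integrable[OF F2(3)] by auto
 qed
 also have "... = (LL xi. LL t. f2 t xi)" by (rule F2(2))
 finally show ?B unfolding i1 f2_def .
qed

lemma compact_support_nn_finite: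
 fixes te :: "real \<times> 'a::euclidean_space => real"
 assumes te: "continuous_on UNIV te" and K: "compact K" "!!p. p \<notin> K ==> te p = 0"
 shows "(NN t. NN x. ennreal \<bar>te (t, x)\<bar>) < \<infinity>"
proof -
 have [measurable]: "te \<in> BM2"
  using borel_measurable_continuous_onI[OF te] by (simp only: borel_prod)
 have "(NN p. enm (te p)) < \<infinity>"
  using compact_support_integrable[OF te K] unfolding integrable_iff_bounded by blast
 also have "(NN p. enm (te p)) = (\<integral>\<^sup>+p. enm (te p) \<partial>(lborel \<Otimes>\<^sub>M lborel))"
  by (simp only: lborel_prod)
 also have "... = (NN t. NN x. enm (te (t, x)))"
  by (rule lborel.nn_integral_fst[symmetric]) measurable
 finally show ?thesis by simp
qed

lemma slice_ift_bound:
 fixes te :: "real \<times> 'a::euclidean_space => real"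
 assumes te: "continuous_on UNIV te" and K: "compact K" "!!p. p \<notin> K ==> te p = 0"
 shows "\<exists>M. \<forall>t xi. norm (ift (cr (%x. te (t, x))) xi) <= M"
proof -
 obtain m where "!!t. LI (%x. te (t, x))"
  and "!!t. (LL x. norm (cr (%x. te (t, x)) x)) <= m"
  and ite: "!!t xi. norm (ift (cr (%x. te (t, x))) xi) <= fconst TYPE('a)*m"
  using slice_integrable_bound[OF te K] by blast
 show ?thesis by (intro exI[of _ "fconst TYPE('a)*m"] allI ite)
qed

text \<open>The factor \<open>g\<close> solves \<open>g'' = - w^2*g\<close>, so
  \<open>g*Ph' - g'*Ph\<close> is an antiderivative of the integrand. It vanishes at
  \<open>T\<close> by the support condition, and its value at \<open>ta\<close> yields the boundary
  terms.\<close>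

lemma time_integration_by_parts:
 fixes Ph :: "real \<times> 'a::euclidean_space => real"
 assumes Ph: "Ph \<in> test_functions ({..<T} \<times> UNIV)" and ta: "ta <= T"
 shows "(LL t. ((al*cos (w*(t - ta)) + bb * sin (w*(t - ta)))*(dt (dt Ph) (t, x) + w\<^sup>2*Ph (t, x)))*ind {ta..T} t)
  = - al*dt Ph (ta, x) + bb*w*Ph (ta, x)"
proof -
 note P1 = test_partial[OF Ph Basis_prod_time] 
 note P2 = test_partial[OF P1 Basis_prod_time]
 note d0 = has_real_derivative_time[OF test_differentiable[OF Ph], where x=x]
 note d1 = has_real_derivative_time[OF test_differentiable[OF P1], where x=x]
 define g where "g t = al*cos (w*(t - ta)) + bb * sin (w*(t - ta))" for t
 define g' where "g' t = w*(- al * sin (w*(t - ta)) + bb*cos (w*(t - ta)))" for t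
 have dg: "(g has_real_derivative g' t) (at t)" "(g' has_real_derivative - w\<^sup>2*g t) (at t)" for t
  unfolding g_def g'_def by (auto intro!: derivative_eq_intros simp: algebra_simps power2_eq_square)
 define F where "F t = g t*dt Ph (t, x) - g' t*Ph (t, x)" for t
 define h where "h t = g t*(dt (dt Ph) (t, x) + w\<^sup>2*Ph (t, x))" for t
 have "(LL t. h t*ind {ta..T} t) = F T - F ta"
 proof (rule integral_FTC_Icc_real[OF ta])
  show "DERIV F t :> h t" for t
  proof -
   have "DERIV F t :> g t*dt (dt Ph) (t, x) + g' t*dt Ph (t, x)
    - (g' t*dt Ph (t, x) + (- w\<^sup>2*g t)*Ph (t, x))"
    unfolding F_def using DERIV_diff[OF DERIV_mult[OF dg(1) d1] DERIV_mult[OF dg(2) d0], of t]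
    by (simp only: mult.commute[of "partial _ _ _"] add.commute mult.commute[of "Ph _"])
     (simp add: algebra_simps)?
   then show ?thesis unfolding h_def by (simp add: algebra_simps)
  qed
  show "isCont h t" for t
  proof -
   have "continuous_on UNIV (%t. dt (dt Ph) (t, x))" "continuous_on UNIV (%t. Ph (t, x))"
    by (rule continuous_on_compose2[OF test_continuous[OF P2]] continuous_on_compose2[OF test_continuous[OF Ph]],
      auto intro!: continuous_intros)+
   moreover have "continuous_on UNIV g" unfolding g_def by (intro continuous_intros)
   ultimately have "continuous_on UNIV h" unfolding h_def by (intro continuous_intros)
   then show ?thesis by (simp add: continuous_on_eq_continuous_at)
  qed
 qed
 moreover have "F T = 0"
 proof -
  obtain K where K: "K \<subseteq> {..<T} \<times> (UNIV :: 'a set)" "closed K" "!!p. p \<notin> K ==> Ph p = 0" by (rule test_support[OF Ph], rule that)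
  then have n: "(T, x) \<notin> K" by auto
  then show ?thesis using K(3)[OF n] partial_zero_outside[of K Ph, OF K(2) K(3) n, of "(1, 0)"] by (simp add: F_def)
 qed
 moreover have "F ta = al*dt Ph (ta, x) - bb*w*Ph (ta, x)"
  unfolding F_def g_def g'_def by simp
 ultimately show ?thesis unfolding h_def g_def by simp
qed

text \<open>The same identity after the spatial inverse transform. With \<open>ta = 0\<close> the
  coefficients \<open>(1, 0)\<close> and \<open>(0, 1)\<close> handle the two initial data, and
  \<open>(0, 1)\<close> at a general \<open>ta\<close> handles a source acting at time
  \<open>ta\<close>.\<close>

lemma kernel_integral:
 fixes Ph :: "real \<times> 'a::euclidean_space => real"
 assumes Ph: "Ph \<in> test_functions ({..<T} \<times> UNIV)" and ta: "ta <= T"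
 shows "(LL t. ind {ta..T} t *R (cx (al*cos (w*(t - ta)) + bb * sin (w*(t - ta)))
   * (ift (cr (%x. dt (dt Ph) (t, x))) xi + cx (w\<^sup>2)*ift (cr (%x. Ph (t, x))) xi)))
  = - cx al*ift (cr (%x. dt Ph (ta, x))) xi + cx (bb*w)*ift (cr (%x. Ph (ta, x))) xi"
proof -
 note P1 = test_partial[OF Ph Basis_prod_time] 
 note P2 = test_partial[OF P1 Basis_prod_time]
 note S0 = test_slice[OF Ph] and S1 = test_slice[OF P1] and S2 = test_slice[OF P2]
 obtain K where K: "compact K" "closed K" "!!p. p \<notin> K ==> Ph p = 0" by (rule test_support[OF Ph], rule that)
 define te where "te p = dt (dt Ph) p + w\<^sup>2*Ph p" for p
 define g where "g t = al*cos (w*(t - ta)) + bb * sin (w*(t - ta))" for t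
 have gm [measurable]: "g \<in> BM" unfolding g_def by measurable
 define N where "N = \<bar>al\<bar> + \<bar>bb\<bar>"
 have gb: "\<bar>g t\<bar> <= N" for t
 proof -
  have "\<bar>g t\<bar> <= \<bar>al\<bar>*\<bar>cos (w*(t - ta))\<bar> + \<bar>bb\<bar>*\<bar>sin (w*(t - ta))\<bar>" unfolding g_def by (simp only: abs_mult[symmetric] abs_triangle_ineq)
  also have "... <= \<bar>al\<bar>*1 + \<bar>bb\<bar>*1" by (intro add_mono mult_left_mono) auto
  finally show ?thesis by (simp add: N_def)
 qed
 have tec: "continuous_on UNIV te" unfolding te_def by (intro continuous_intros test_continuous[OF P2] test_continuous[OF Ph])
 have z1: "dt Ph p = 0" if "p \<notin> K" for p by (rule partial_zero_outside[of K Ph, OF K(2,3) that])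
 have te0: "te p = 0" if "p \<notin> K" for p
  using partial_zero_outside[of K "dt Ph", OF K(2) z1 that, of "(1, 0)"] K(3)[OF that] by (simp add: te_def)
 have [measurable]: "te \<in> BM2"
  using borel_measurable_continuous_onI[OF tec] by (simp only: borel_prod)
 define H where "H t x = ind {ta..T} t *R (cx (g t)*(cis (x \<bullet> xi)*cr te (t, x)))" for t x
 have Hm [measurable]: "(%(t, x). H t x) \<in> BM2" unfolding H_def by measurable
 have "(NN t. NN x. enm (H t x)) <= (NN t. NN x. ennreal N*ennreal \<bar>te (t, x)\<bar>)"
 proof (intro nn_integral_mono)
  fix t x
  have "norm (H t x) <= N*\<bar>te (t, x)\<bar>"
   using mult_right_mono[OF gb[of t], of "\<bar>te (t, x)\<bar>"] by (auto simp: H_def norm_mult indicator_def N_def)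
  then have "enm (H t x) <= ennreal (N*\<bar>te (t, x)\<bar>)" by (rule ennreal_leI)
  then show "enm (H t x) <= ennreal N*ennreal \<bar>te (t, x)\<bar>" by (simp add: ennreal_mult N_def)
 qed
 also have "... = ennreal N*(NN t. NN x. ennreal \<bar>te (t, x)\<bar>)"
  by (simp add: nn_integral_cmult)
 also have "... < \<infinity>" using compact_support_nn_finite[OF tec K(1) te0] by (simp add: ennreal_mult_less_top)
 finally have fin: "(NN t. NN x. enm (H t x)) < \<infinity>" .
 have lin: "ift (cr (%x. dt (dt Ph) (t, x))) xi + cx (w\<^sup>2)*ift (cr (%x. Ph (t, x))) xi = ift (cr (%x. te (t, x))) xi" for t
  using ift_linear[OF test_integrable_cr[OF S2[of t]] test_integrable_cr[OF S0[of t]], of 1 "cx (w\<^sup>2)" xi]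
  by (simp add: te_def)
 have inner: "(LL t. H t x) = cis (x \<bullet> xi)*cx (- al*dt Ph (ta, x) + bb*w*Ph (ta, x))" for x
 proof -
  have "(LL t. H t x) = (LL t. cis (x \<bullet> xi)*cx ((g t*te (t, x))*ind {ta..T} t))"
   by (intro BI_LINT_cong) (auto simp: H_def indicator_def)
  also have "... = cis (x \<bullet> xi)*cx (LL t. (g t*te (t, x))*ind {ta..T} t)"
   by (simp only: integral_mult_right_zero integral_complex_of_real)
  finally show ?thesis unfolding g_def te_def time_integration_by_parts[OF Ph ta] .
 qed
 have "(LL t. ind {ta..T} t *R (cx (g t)*ift (cr (%x. te (t, x))) xi)) = (LL t. fconst TYPE('a) *R (LL x. H t x))"
  unfolding ift_eq H_def integral_scaleR_right integral_mult_right_zero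
  by (subst integral_scaleR_right[symmetric], intro BI_LINT_cong refl) (simp add: scaleR_conv_of_real mult_ac)
 also have "... = fconst TYPE('a) *R (LL x. LL t. H t x)"
  using fubini_lborel(2)[OF Hm fin] by simp
 also have "... = ift (cr (%x. - al*dt Ph (ta, x) + bb*w*Ph (ta, x))) xi"
  unfolding inner ift_eq ..
 also have "... = ift (%x. (- cx al)*cr (%x. dt Ph (ta, x)) x + cx (bb*w)*cr (%x. Ph (ta, x)) x) xi"
  by (simp add: mult.assoc)
 also have "... = (- cx al)*ift (cr (%x. dt Ph (ta, x))) xi + cx (bb*w)*ift (cr (%x. Ph (ta, x))) xi"
  by (rule ift_linear[OF test_integrable_cr[OF S1] test_integrable_cr[OF S0]])
 finally show ?thesis unfolding lin g_def .
qed

lemma Om_square: "0 < ep ==> ep\<^sup>2*(Om ep xi)^2 = (norm xi)^2 + 1/ep\<^sup>2"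
proof -
 assume e: "0 < ep"
 have "(om ep xi)^2 = 1 + (ep*norm xi)^2" unfolding om_def by simp
 then show ?thesis using e unfolding Om_def power_divide by (simp add: field_simps power2_eq_square)
qed

definition kg_adjoint :: "real => (real \<times> 'a::euclidean_space => real) => real \<times> 'a => real" where
 "kg_adjoint ep Ph p = ep\<^sup>2*dt (dt Ph) p - laplacian (%x. Ph (fst p, x)) (snd p) + Ph p/ep\<^sup>2"

lemma kg_adjoint_continuous:
 fixes Ph :: "real \<times> 'a::euclidean_space => real"
 assumes Ph: "Ph \<in> test_functions Oz"
 shows "continuous_on UNIV (kg_adjoint ep Ph)"
proof -
 have L: "laplacian (%x. Ph (fst p, x)) (snd p) = (\<Sum>b\<in>Basis. partial (0, b) (partial (0, b) Ph) p)" for p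
  using laplacian_slice[OF Ph, of "fst p" "snd p"] by simp
 show ?thesis unfolding kg_adjoint_def[abs_def] L divide_inverse
  by (intro continuous_intros test_continuous[OF test_partial[OF test_partial[OF Ph]]] test_continuous[OF Ph] Basis_prod_right Basis_prod_time)
qed

lemma kg_adjoint_outside:
 fixes Ph :: "real \<times> 'a::euclidean_space => real"
 assumes Ph: "Ph \<in> test_functions Oz" and K: "closed K" "!!p. p \<notin> K ==> Ph p = 0" and p: "p \<notin> K"
 shows "kg_adjoint ep Ph p = 0"
proof -
 have z: "partial b Ph q = 0" if "q \<notin> K" for b q by (rule partial_zero_outside[of K Ph, OF K that])
 have zz: "partial b (partial b Ph) p = 0" for b by (rule partial_zero_outside[of K "partial b Ph", OF K(1) z p])
 show ?thesis unfolding kg_adjoint_def using laplacian_slice[OF Ph, of "fst p" "snd p"] zz K(2)[OF p] by simp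
qed

lemma ift_kg_adjoint:
 fixes Ph :: "real \<times> 'a::euclidean_space => real"
 assumes Ph: "Ph \<in> test_functions Oz" and e: "0 < ep"
 shows "ift (cr (%x. kg_adjoint ep Ph (t, x))) xi = cx (ep\<^sup>2) *
  (ift (cr (%x. dt (dt Ph) (t, x))) xi + cx ((Om ep xi)^2)*ift (cr (%x. Ph (t, x))) xi)"
proof -
 note P2 = test_partial[OF test_partial[OF Ph Basis_prod_time] Basis_prod_time]
 note S0 = test_slice[OF Ph, of t] and S2 = test_slice[OF P2, of t]
 note L = ift_laplacian[OF S0]
 have i: "LI (%x. cx (ep\<^sup>2)*cr (%x. dt (dt Ph) (t, x)) x + cx (1/ep\<^sup>2)*cr (%x. Ph (t, x)) x)"
  by (intro BI_int_add integrable_mult_right test_integrable_cr[OF S0] test_integrable_cr[OF S2])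
 have "(cr (%x. kg_adjoint ep Ph (t, x))) = (%x. 1*(cx (ep\<^sup>2)*cr (%x. dt (dt Ph) (t, x)) x + cx (1/ep\<^sup>2)*cr (%x. Ph (t, x)) x)
  + (-1)*cr (laplacian (%x. Ph (t, x))) x)"
  by (rule ext) (simp add: kg_adjoint_def)
 then have "ift (cr (%x. kg_adjoint ep Ph (t, x))) xi = 1*(cx (ep\<^sup>2)*ift (cr (%x. dt (dt Ph) (t, x))) xi + cx (1/ep\<^sup>2)*ift (cr (%x. Ph (t, x))) xi)
  + (-1)*ift (cr (laplacian (%x. Ph (t, x)))) xi"
  by (simp only: ift_linear[OF i integrable_of_real[OF L(2)]] ift_linear[OF test_integrable_cr[OF S2] test_integrable_cr[OF S0]])
 also have "... = cx (ep\<^sup>2)*ift (cr (%x. dt (dt Ph) (t, x))) xi + cx ((norm xi)^2 + 1/ep\<^sup>2)*ift (cr (%x. Ph (t, x))) xi"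
 proof -
  have "1*(a*X + b*Y) + (-1)*(- n*Y) = a*X + (n + b)*Y" for a X b Y n :: complex by (simp add: algebra_simps)
  then show ?thesis unfolding L(1) of_real_add .
 qed
 finally show ?thesis unfolding Om_square[OF e, symmetric] by (simp add: algebra_simps)
qed

text \<open>For fixed \<open>xi\<close> the three parts of \<open>Z\<close> are paired with the
  adjoint oscillator by \<open>kernel_integral\<close>. The relation \<open>ep^2*Om = om\<close>
  turns the coefficients of \<open>Q\<close> and of the source into 1; the cosine part retains
  \<open>ep^2\<close>, as in the weak formulation.\<close>

theorem weak_form_duhamel:
 fixes P Q :: "'a::euclidean_space => complex" and f :: "real => 'a => complex"
 assumes s: "sm > real DIM('a)/2" and e: "0 < ep" and T: "0 <= T"
  and P: "hb sm P A" and Q: "hb sm Q A" and f: "tb sm T f B"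
  and fb: "!!ta xi. 0 <= ta ==> ta <= T ==> norm (f ta xi) <= C"
  and Ph: "Ph \<in> test_functions ({..<T} \<times> UNIV)"
 defines "Z \<equiv> %t xi. free ep P Q t xi + duh ep f t xi"
 shows "(LL p. ind ({0<..<T} \<times> UNIV) p *R (ift (Z (fst p)) (snd p)*cr (kg_adjoint ep Ph) p))
   + cx (ep\<^sup>2)*(LL x. ift P x*cr (%x. dt Ph (0, x)) x)
   - (LL x. ift Q x*cr (%x. Ph (0, x)) x)
  = (LL p. ind ({0<..<T} \<times> UNIV) p *R (ift (f (fst p)) (snd p)*cr Ph p))"
proof -
 interpret sobolev_algebra sm "TYPE('a)" by unfold_locales (rule s)
 note P1 = test_partial[OF Ph Basis_prod_time] 
 note P2 = test_partial[OF P1 Basis_prod_time]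
 note S0 = test_slice[OF Ph] and S1 = test_slice[OF P1] and S2 = test_slice[OF P2]
 note [measurable] = hbD(1)[OF P] hbD(1)[OF Q] tbD(1)[OF f]
 obtain K where K: "compact K" "closed K" "!!p. p \<notin> K ==> Ph p = 0" by (rule test_support[OF Ph], rule that)
 have z1: "dt Ph p = 0" if "p \<notin> K" for p by (rule partial_zero_outside[of K Ph, OF K(2,3) that])
 have z2: "dt (dt Ph) p = 0" if "p \<notin> K" for p
  by (rule partial_zero_outside[of K "dt Ph", OF K(2) z1 that])
 obtain m0 where m0: "!!t xi. norm (ift (cr (%x. Ph (t, x))) xi) <= m0"
  using slice_ift_bound[OF test_continuous[OF Ph] K(1,3)] by metis
 obtain m1 where m1: "!!t xi. norm (ift (cr (%x. dt Ph (t, x))) xi) <= m1"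
  using slice_ift_bound[OF test_continuous[OF P1] K(1) z1] by metis
 obtain m2 where m2: "!!t xi. norm (ift (cr (%x. dt (dt Ph) (t, x))) xi) <= m2"
  using slice_ift_bound[OF test_continuous[OF P2] K(1) z2] by metis
 have [measurable]: "Ph \<in> BM2" "dt Ph \<in> BM2"
   "dt (dt Ph) \<in> BM2"
  using test_measurable[OF Ph] test_measurable[OF P1] test_measurable[OF P2] by (simp_all only: borel_prod)
 have Z: "tb sm T Z (2*A + T*B)" unfolding Z_def by (intro tb_add tb_free P Q tb_duh f T)
 define oq where "oq t xi = ift (cr (%x. dt (dt Ph) (t, x))) xi + cx ((Om ep xi)^2)*ift (cr (%x. Ph (t, x))) xi" for t xi
 have kernel: "(LL t. ind {ta..T} t *R (cx (al*cos (Om ep xi*(t - ta)) + bb * sin (Om ep xi*(t - ta))) * oq t xi))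
  = - cx al*ift (cr (%x. dt Ph (ta, x))) xi + cx (bb*Om ep xi)*ift (cr (%x. Ph (ta, x))) xi"
  if "ta <= T" for ta al bb xi
  unfolding oq_def by (rule kernel_integral[OF Ph that])
 have inner: "(LL t. ind {0..T} t *R (Z t xi*ift (cr (%x. kg_adjoint ep Ph (t, x))) xi))
  = - cx (ep\<^sup>2)*(P xi*ift (cr (%x. dt Ph (0, x))) xi) + Q xi*ift (cr (%x. Ph (0, x))) xi
   + (LL ta. ind {0..T} ta *R (f ta xi*ift (cr (%x. Ph (ta, x))) xi))" for xi
 proof -
  define X where "X = m2 + (Om ep xi)^2*m0"
  have X: "norm (oq t xi) <= X" for t
  proof -
   have "norm (oq t xi) <= norm (ift (cr (%x. dt (dt Ph) (t, x))) xi) + norm (cx ((Om ep xi)^2)*ift (cr (%x. Ph (t, x))) xi)"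
    unfolding oq_def by (rule norm_triangle_ineq)
   also have "... <= X" unfolding X_def norm_mult using m2 m0[of t xi] by (intro add_mono) (auto simp: norm_power intro!: mult_left_mono)
   finally show ?thesis .
  qed
  have X0: "0 <= X" using order_trans[OF norm_ge_zero X] .
  have oqm [measurable]: "(%t. oq t xi) \<in> BM" unfolding oq_def by measurable
  define w where "w = Om ep xi"
  have c_int: "LI (%t. ind {0..T} t *R (cx (cos (w*t)) * oq t xi))"
   "LI (%t. ind {0..T} t *R (cx (sin (w*t)) * oq t xi))"
  proof -
   have "norm (cx (cos (w*t)) * oq t xi) <= X" "norm (cx (sin (w*t)) * oq t xi) <= X" for t
    using mult_mono[OF abs_cos_le_one X[of t], of "w*t"] mult_mono[OF abs_sin_le_one X[of t], of "w*t"] by (auto simp: norm_mult)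
   then show "LI (%t. ind {0..T} t *R (cx (cos (w*t)) * oq t xi))"
    "LI (%t. ind {0..T} t *R (cx (sin (w*t)) * oq t xi))"
    by (auto intro!: integrable_bounded_Icc)
  qed
  have kc: "(LL t. ind {0..T} t *R (cx (cos (w*t)) * oq t xi)) = - ift (cr (%x. dt Ph (0, x))) xi"
   using kernel[OF T, where al=1 and bb=0 and xi=xi] by (simp add: w_def)
  have ks: "(LL t. ind {0..T} t *R (cx (sin (w*t)) * oq t xi)) = cx w*ift (cr (%x. Ph (0, x))) xi"
   using kernel[OF T, where al=0 and bb=1 and xi=xi] by (simp add: w_def)
  \<comment> \<open>Exchanging the source time \<open>ta\<close> and the outer time \<open>t\<close>
    lets \<open>t\<close> run from \<open>ta\<close> to \<open>T\<close>, the range for which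
    \<open>kernel_integral\<close> is stated.\<close>
  define H where "H t ta = ind {0..T} t *R ((ind {0..t} ta *R (cx (sin (w*(t - ta)) / om ep xi)*f ta xi))*(cx (ep\<^sup>2) * oq t xi))" for t ta
  have ind [measurable]: "(%(t :: real, ta). ind {0..t} ta :: real) \<in> BM2"
  proof -
   have e: "(%(t::real, ta). ind {0..t} ta :: real) = (%(t, ta). if 0 <= ta & ta <= t then 1 else 0)" by (auto simp: indicator_def fun_eq_iff)
   show ?thesis unfolding e by measurable
  qed
  have Hm [measurable]: "(%(t, ta). H t ta) \<in> BM2" unfolding H_def by measurable
  have C0: "0 <= C" using fb[of 0] T order_trans[OF norm_ge_zero] by blast
  define Y where "Y = C*(ep\<^sup>2*X)"
  have Hb: "enm (H t ta) <= ind {0..T} t*(ind {0..T} ta*ennreal Y)" for t ta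
  proof (cases "t \<in> {0..T} & ta \<in> {0..t}")
   case True
   have "norm (H t ta) = \<bar>sin (w*(t - ta)) / om ep xi\<bar>*norm (f ta xi)*(ep\<^sup>2*norm (oq t xi))"
    using True by (simp add: H_def norm_mult norm_divide norm_power)
   also have "... <= 1*C*(ep\<^sup>2*X)"
    using True X0 C0 by (intro mult_mono sin_div_om_le fb mult_left_mono X mult_nonneg_nonneg) auto
   finally show ?thesis using True by (auto simp: Y_def intro!: ennreal_leI)
  qed (auto simp: H_def indicator_def)
  have "(NN t. NN ta. enm (H t ta)) <= (NN t. NN ta. ind {0..T} t*(ind {0..T} ta*ennreal Y))"
   by (intro nn_integral_mono Hb)
  also have "... = ennreal Y*emeasure lborel {0..T} * emeasure lborel {0..T}"
   by (simp add: nn_integral_cmult nn_integral_multc mult_ac)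
  also have "... < \<infinity>" using T by (simp add: ennreal_mult_less_top)
  finally have fin: "(NN t. NN ta. enm (H t ta)) < \<infinity>" .
  note FH = fubini_lborel[OF Hm fin]
  have Hduh: "(LL ta. H t ta) = ind {0..T} t *R (duh ep f t xi*(cx (ep\<^sup>2) * oq t xi))" for t
   unfolding H_def duh_def w_def by (simp only: integral_scaleR_right integral_mult_left_zero)
  have Hin: "(LL t. H t ta) = ind {0..T} ta *R (f ta xi*ift (cr (%x. Ph (ta, x))) xi)" for ta
  proof (cases "ta \<in> {0..T}")
   case True
   have "(LL t. H t ta) = (LL t. (cx (ep\<^sup>2 / om ep xi)*f ta xi)*(ind {ta..T} t *R (cx (0*cos (w*(t - ta)) + 1 * sin (w*(t - ta))) * oq t xi)))"
    using True by (intro BI_LINT_cong) (auto simp: H_def indicator_def)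
   also have "... = (cx (ep\<^sup>2 / om ep xi)*f ta xi)*(- cx 0*ift (cr (%x. dt Ph (ta, x))) xi + cx (1*w)*ift (cr (%x. Ph (ta, x))) xi)"
    unfolding integral_mult_right_zero w_def using True by (subst kernel) auto
   also have "... = cx (ep\<^sup>2 / om ep xi*w)*(f ta xi*ift (cr (%x. Ph (ta, x))) xi)" by simp
   also have "ep\<^sup>2 / om ep xi*w = 1" using e by (simp add: w_def Om_def)
   finally show ?thesis using True by simp
  next
   case False
   then have "H t ta = 0" for t by (auto simp: H_def indicator_def)
   then show ?thesis using False by simp
  qed
  have "(LL t. ind {0..T} t *R (Z t xi*ift (cr (%x. kg_adjoint ep Ph (t, x))) xi))
   = (LL t. (cx (ep\<^sup>2)*P xi)*(ind {0..T} t *R (cx (cos (w*t)) * oq t xi))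
    + (cx (ep\<^sup>2)*(Q xi/cx (om ep xi)))*(ind {0..T} t *R (cx (sin (w*t)) * oq t xi))
    + (LL ta. H t ta))"
   unfolding ift_kg_adjoint[OF Ph e] Hduh oq_def[symmetric]
   by (intro BI_LINT_cong refl) (simp add: Z_def free_def trig_def w_def scaleR_conv_of_real algebra_simps)
  also have "... = (cx (ep\<^sup>2)*P xi)*(- ift (cr (%x. dt Ph (0, x))) xi)
    + (cx (ep\<^sup>2)*(Q xi/cx (om ep xi)))*(cx w*ift (cr (%x. Ph (0, x))) xi)
    + (LL t. LL ta. H t ta)"
   unfolding kc[symmetric] ks[symmetric] integral_mult_right_zero[symmetric]
   by (subst BI_LINT_add; (subst BI_LINT_add)?; intro BI_int_add integrable_mult_right c_int FH(3) refl)
  also have "(LL t. LL ta. H t ta) = (LL ta. ind {0..T} ta *R (f ta xi*ift (cr (%x. Ph (ta, x))) xi))"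
   unfolding FH(2) Hin ..
  also have "(cx (ep\<^sup>2)*(Q xi/cx (om ep xi)))*(cx w*ift (cr (%x. Ph (0, x))) xi) = Q xi*ift (cr (%x. Ph (0, x))) xi"
   using e by (simp add: w_def Om_def)
  finally show ?thesis by simp
 qed
 have iP: "LI (%xi. P xi*ift (cr (%x. dt Ph (0, x))) xi)"
  by (rule integrable_mult_bounded[OF hb_integrable(1)[OF s P] _ m1]) simp
 have iQ: "LI (%xi. Q xi*ift (cr (%x. Ph (0, x))) xi)"
  by (rule integrable_mult_bounded[OF hb_integrable(1)[OF s Q] _ m0]) simp
 have ko: "kg_adjoint ep Ph p = 0" if "p \<notin> K" for p
  by (rule kg_adjoint_outside[OF Ph K(2) _ that]) (rule K(3))
 note pf = pairing_time[OF s f T test_continuous[OF Ph] K(1,3)]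
 have "(LL p. ind ({0<..<T} \<times> UNIV) p *R (ift (Z (fst p)) (snd p)*cr (kg_adjoint ep Ph) p))
  = (LL xi. - cx (ep\<^sup>2)*(P xi*ift (cr (%x. dt Ph (0, x))) xi) + Q xi*ift (cr (%x. Ph (0, x))) xi
   + (LL ta. ind {0..T} ta *R (f ta xi*ift (cr (%x. Ph (ta, x))) xi)))"
  by (rule trans[OF pairing_time(2)[OF s Z T kg_adjoint_continuous[OF Ph] K(1)]], erule ko) (simp only: inner)
 also have "... = - cx (ep\<^sup>2)*(LL xi. P xi*ift (cr (%x. dt Ph (0, x))) xi) + (LL xi. Q xi*ift (cr (%x. Ph (0, x))) xi)
   + (LL xi. LL ta. ind {0..T} ta *R (f ta xi*ift (cr (%x. Ph (ta, x))) xi))"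
  unfolding integral_mult_right_zero[symmetric]
  by (subst BI_LINT_add; (subst BI_LINT_add)?; intro BI_int_add integrable_mult_right iP iQ pf(3) refl)
 also have "(LL xi. LL ta. ind {0..T} ta *R (f ta xi*ift (cr (%x. Ph (ta, x))) xi))
   = (LL p. ind ({0<..<T} \<times> UNIV) p *R (ift (f (fst p)) (snd p)*cr Ph p))"
  by (rule sym, rule pairing_time(2)[OF s f T test_continuous[OF Ph] K(1)], erule K(3))
 finally show ?thesis
  unfolding ift_pairing[OF hb_integrable(1)[OF s P] test_integrable_cr[OF S1]] ift_pairing[OF hb_integrable(1)[OF s Q] test_integrable_cr[OF S0]]
  by simp
qed

subsection \<open>Uniqueness of weak solutions\<close>

lemma AE_lborel_commute:
 fixes P :: "'a::euclidean_space => 'b::euclidean_space => bool"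
 assumes P: "Measurable.pred (borel \<Otimes>\<^sub>M borel) (%p. P (fst p) (snd p))"
  and ae: "AEL x. AEL y. P x y"
 shows "AEL y. AEL x. P x y"
proof -
 have "sets (lborel \<Otimes>\<^sub>M lborel :: ('a \<times> 'b) measure) = sets (borel \<Otimes>\<^sub>M borel)"
  by (intro sets_pair_measure_cong sets_lborel)
 then have "Measurable.pred (lborel \<Otimes>\<^sub>M lborel) (%p. P (fst p) (snd p))"
  using P measurable_cong_sets[of "lborel \<Otimes>\<^sub>M lborel" "borel \<Otimes>\<^sub>M borel"] by blast
 from lborel_pair.AE_commute[OF predE[OF this]] ae show ?thesis by simp
qed

lemma has_real_derivative_partial:
 fixes et :: "real => real"
 assumes "et differentiable (at t)"
 shows "(et has_real_derivative partial 1 et t) (at t)"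
proof -
 note F = has_derivative_partial[OF assms]
 have "frechet_derivative et (at t) h = partial 1 et t*h" for h
  using linear_scale[OF has_derivative_linear[OF F], of h 1] by (simp add: partial_def mult.commute)
 then have "frechet_derivative et (at t) = (*) (partial 1 et t)" by (rule ext)
 then show ?thesis using F by (simp add: has_field_derivative_def)
qed

lemma partial_real_eqI: "(f has_real_derivative D) (at t) ==> partial 1 f t = D"
 unfolding has_field_derivative_def by (drule partial_eqI[where b=1]) simp

lemma partial_real_shift:
 fixes et :: "real => real"
 assumes "!!t. et differentiable (at t)"
 shows "partial 1 (%t. et (t - s)) = (%t. partial 1 et (t - s))"
proof (intro ext partial_real_eqI)
 fix t
 have "((%t. et (t + (- s))) has_real_derivative partial 1 et (t + (- s))) (at t)"
  by (rule DERIV_shift[THEN iffD1], rule has_real_derivative_partial[OF assms])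
 then show "((%t. et (t - s)) has_real_derivative partial 1 et (t - s)) (at t)" by simp
qed

lemma one_Basis_real: "(1::real) \<in> Basis" by simp

text \<open>The oscillator operator applied to a bump. This is what the adjoint Klein-Gordon
  operator becomes, at a fixed frequency and up to \<open>ep^2\<close>, on a product of a bump in
  time and a bump in space.\<close>

definition bh :: "real => real => real => real" where
 "bh r w t = partial 1 (partial 1 (bump r 0)) t + w\<^sup>2*bump r 0 t"

lemma bump_partial_tests:
 "partial 1 (bump r (0::real)) \<in> test_functions UNIV" "partial 1 (partial 1 (bump r (0::real))) \<in> test_functions UNIV"
 by (intro test_partial bump_test one_Basis_real)+

lemma bump_partial_measurable [measurable]:
 "partial 1 (partial 1 (bump r (0::real))) \<in> BM"
 by (rule test_measurable[OF bump_partial_tests(2)])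

lemma bh_measurable [measurable]: "bh r w \<in> BM"
 unfolding bh_def by measurable

lemma bounded_test:
 fixes et :: "'a::euclidean_space => real"
 assumes et: "et \<in> test_functions Oz"
 shows "\<exists>B\<ge>0. \<forall>x. \<bar>et x\<bar> <= B"
proof -
 obtain K where K: "compact K" "closed K" "K \<subseteq> Oz" "!!x. x \<notin> K ==> et x = 0" by (rule test_support[OF et], rule that)
 obtain B where "0 <= B" "!!x. \<bar>et x\<bar> <= B" by (rule compact_support_bounded[OF test_continuous[OF et] K(1,4)], assumption, rule that)
 then show ?thesis by blast
qed

lemma bh_bounded: "\<exists>H\<ge>0. \<forall>t. \<bar>bh r w t\<bar> <= H"
proof -
 obtain B0 where B0: "0 <= B0" "!!t::real. \<bar>bump r 0 t\<bar> <= B0" using bounded_test[OF bump_test] by blast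
 obtain B2 where B2: "0 <= B2" "!!t. \<bar>partial 1 (partial 1 (bump r (0::real))) t\<bar> <= B2" using bounded_test[OF bump_partial_tests(2)] by blast
 have "\<bar>bh r w t\<bar> <= B2 + w\<^sup>2*B0" for t
 proof -
  have "\<bar>bh r w t\<bar> <= \<bar>partial 1 (partial 1 (bump r (0::real))) t\<bar> + \<bar>w\<^sup>2*bump r 0 t\<bar>" unfolding bh_def by (rule abs_triangle_ineq)
  also have "... <= B2 + w\<^sup>2*B0" using B0 B2 by (intro add_mono) (auto simp: abs_mult intro!: mult_left_mono)
  finally show ?thesis .
 qed
 moreover have "0 <= B2 + w\<^sup>2*B0" using B0 B2 by simp
 ultimately show ?thesis by blast
qed

text \<open>The bump is the causal convolution of its own oscillator residual with the fundamental
 solution \<open>sin (w t) / w\<close>.\<close>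

lemma bump_duhamel:
 assumes r: "0 < r" and t: "0 <= t" and t1: "- r - 1 <= t1"
 shows "(LL s. (sin (w*(t1 - s))*bh r w (t - s))*ind {- r - 1..t1} s) = w*bump r 0 (t - t1)"
proof -
 define b0 :: "real => real" where "b0 = bump r 0"
 define b1 where "b1 = partial 1 b0"
 define b2 where "b2 = partial 1 b1"
 have T: "b0 \<in> test_functions UNIV" "b1 \<in> test_functions UNIV" "b2 \<in> test_functions UNIV"
  unfolding b2_def b1_def b0_def by (rule bump_test bump_partial_tests)+
 have d0: "(b0 has_real_derivative b1 x) (at x)" for x
  unfolding b1_def by (rule has_real_derivative_partial[OF test_differentiable[OF T(1)]])
 have d1: "(b1 has_real_derivative b2 x) (at x)" for x
  unfolding b2_def by (rule has_real_derivative_partial[OF test_differentiable[OF T(2)]])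
 define F where "F s = - sin (w*(t1 - s))*b1 (t - s) + w*cos (w*(t1 - s))*b0 (t - s)" for s
 have "(LL s. (sin (w*(t1 - s))*bh r w (t - s))*ind {- r - 1..t1} s) = F t1 - F (- r - 1)"
 proof (rule integral_FTC_Icc_real[OF t1])
  show "DERIV F s :> sin (w*(t1 - s))*bh r w (t - s)" for s
  proof -
   have e0: "((%s. b0 (t - s)) has_real_derivative - b1 (t - s)) (at s)"
   proof -
    have "((%s. b0 (t - s)) has_real_derivative b1 (t - s)*(-1)) (at s)"
     by (rule DERIV_chain2[where f=b0 and g="%s. t - s", OF d0]) (auto intro!: derivative_eq_intros)
    then show ?thesis by simp
   qed
   have e1: "((%s. b1 (t - s)) has_real_derivative - b2 (t - s)) (at s)"
   proof -
    have "((%s. b1 (t - s)) has_real_derivative b2 (t - s)*(-1)) (at s)"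
     by (rule DERIV_chain2[where f=b1 and g="%s. t - s", OF d1]) (auto intro!: derivative_eq_intros)
    then show ?thesis by simp
   qed
   have g: "((%s. - sin (w*(t1 - s))) has_real_derivative w*cos (w*(t1 - s))) (at s)"
    "((%s. w*cos (w*(t1 - s))) has_real_derivative w\<^sup>2 * sin (w*(t1 - s))) (at s)"
    by (auto intro!: derivative_eq_intros simp: power2_eq_square)
   have "w*cos (w*(t1 - s))*b1 (t - s) + - b2 (t - s) * - sin (w*(t1 - s))
     + (w\<^sup>2 * sin (w*(t1 - s))*b0 (t - s) + - b1 (t - s)*(w*cos (w*(t1 - s))))
    = sin (w*(t1 - s))*bh r w (t - s)"
    unfolding bh_def b0_def[symmetric] b1_def[symmetric] b2_def[symmetric] by (simp add: algebra_simps)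
   with DERIV_add[OF DERIV_mult[OF g(1) e1] DERIV_mult[OF g(2) e0]] show ?thesis
    unfolding F_def by (simp only:)
  qed
  show "isCont (%s. sin (w*(t1 - s))*bh r w (t - s)) s" for s
  proof -
   have "continuous_on UNIV (%s. b2 (t - s))" "continuous_on UNIV (%s. b0 (t - s))"
    by (rule continuous_on_compose2[OF test_continuous[OF T(3)]] continuous_on_compose2[OF test_continuous[OF T(1)]], auto intro!: continuous_intros)+
   then have "continuous_on UNIV (%s. sin (w*(t1 - s))*bh r w (t - s))"
    unfolding bh_def b0_def[symmetric] b1_def[symmetric] b2_def[symmetric] by (intro continuous_intros)
   then show ?thesis by (simp add: continuous_on_eq_continuous_at)
  qed
 qed
 \<comment> \<open>For \<open>t >= 0\<close> the point \<open>t - (- r - 1)\<close> is at least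
   \<open>r + 1\<close> and lies beyond the support of the bump; the extra 1 makes this
   strict.\<close>
 moreover have "F (- r - 1) = 0"
 proof -
  have z: "b0 x = 0" if "x \<notin> cball 0 r" for x using bump_support[of r 0 x] that r unfolding b0_def by (auto simp: dist_norm)
  have out: "t - (- r - 1) \<notin> cball 0 r" using t r by (simp add: dist_norm)
  have "b1 (t - (- r - 1)) = 0" unfolding b1_def by (rule partial_zero_outside[OF closed_cball z out])
  then show ?thesis using z[OF out] by (simp add: F_def)
 qed
 moreover have "F t1 = w*bump r 0 (t - t1)" by (simp add: F_def b0_def)
 ultimately show ?thesis by simp
qed

text \<open>Integrating the hypothesis over the centres \<open>s\<close> against
  \<open>sin (w*(t1 - s))\<close> reproduces a bump centred at \<open>t1\<close>, by
  \<open>bump_duhamel\<close>. Negative centres take part: such bumps may meet the initial time and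
  carry the information that the initial data vanish. Causality keeps all centres used below
  \<open>t1\<close>, hence within the range of the hypothesis.\<close>

lemma time_bump_vanish:
 fixes D :: "real => complex"
 assumes D: "LI D" and D0: "!!t. t < 0 ==> D t = 0" and w: "w ~= 0" and r: "0 < r"
  and z: "AEL s. s < T - r --> (LL t. D t*cx (bh r w (t - s))) = 0"
  and t1: "0 <= t1" "t1 <= T - r"
 shows "(LL t. D t*cx (bump r 0 (t - t1))) = 0"
proof -
 note [measurable] = borel_measurable_integrable[OF D]
 obtain h where h: "0 <= h" "!!t. \<bar>bh r w t\<bar> <= h" using bh_bounded by blast
 define S where "S s = sin (w*(t1 - s))*ind {- r - 1..t1} s" for s
 have [measurable]: "S \<in> BM" unfolding S_def by measurable
 define H where "H t s = D t*cx (S s*bh r w (t - s))" for t s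
 have Hm [measurable]: "(%(t, s). H t s) \<in> BM2" unfolding H_def by measurable
 have "(NN t. NN s. enm (H t s)) <= (NN t. NN s. enm (D t)*(ennreal h*ind {- r - 1..t1} s))"
 proof (intro nn_integral_mono)
  fix t s
  have "\<bar>S s*bh r w (t - s)\<bar> <= h*ind {- r - 1..t1} s"
   using mult_mono[OF abs_sin_le_one[of "w*(t1 - s)"] h(2)[of "t - s"]] by (auto simp: S_def abs_mult indicator_def)
  then have "norm (H t s) <= norm (D t)*(h*ind {- r - 1..t1} s)"
   unfolding H_def norm_mult norm_of_real by (rule mult_left_mono) simp
  then have "enm (H t s) <= ennreal (norm (D t)*(h*ind {- r - 1..t1} s))" by (rule ennreal_leI)
  then show "enm (H t s) <= enm (D t)*(ennreal h*ind {- r - 1..t1} s)"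
   using h(1) by (cases "s \<in> {- r - 1..t1}") (simp_all add: ennreal_mult)
 qed
 also have "... = (NN t. enm (D t))*(ennreal h*emeasure lborel {- r - 1..t1})"
  by (simp add: nn_integral_cmult nn_integral_multc)
 also have "... < \<infinity>" using D t1 r unfolding integrable_iff_bounded by (auto simp: ennreal_mult_less_top)
 finally have fin: "(NN t. NN s. enm (H t s)) < \<infinity>" .
 have i1: "(LL s. H t s) = cx w*(D t*cx (bump r 0 (t - t1)))" for t
 proof (cases "0 <= t")
  case True
  have "(LL s. H t s) = (LL s. D t*cx ((sin (w*(t1 - s))*bh r w (t - s))*ind {- r - 1..t1} s))"
   by (intro BI_LINT_cong refl) (simp add: H_def S_def)
  also have "... = D t*cx (w*bump r 0 (t - t1))"
   using bump_duhamel[OF r True, of t1 w] t1 r by (simp only: integral_mult_right_zero integral_complex_of_real)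
  finally show ?thesis by simp
 qed (simp add: H_def D0)
 have "(LL t. LL s. H t s) = (LL s. LL t. H t s)" by (rule fubini_lborel(2)[OF Hm fin])
 also have "... = 0"
 proof (rule integral_eq_zero_AE)
  show "AEL s. (LL t. H t s) = 0"
   using z AE_lborel_singleton[of "T - r"]
  proof eventually_elim
   case (elim s)
   have e: "(LL t. H t s) = cx (S s)*(LL t. D t*cx (bh r w (t - s)))"
    unfolding H_def integral_mult_right_zero[symmetric] by (intro BI_LINT_cong refl) simp
   show ?case
   proof (cases "s < T - r")
    case True then show ?thesis using elim unfolding e by simp
   next
    case False
    then have "s > t1" using elim t1 by auto
    then show ?thesis unfolding e by (simp add: S_def)
   qed
  qed
 qed
 finally have "cx w*(LL t. D t*cx (bump r 0 (t - t1))) = 0"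
  unfolding i1 integral_mult_right_zero by simp
 then show ?thesis using w by simp
qed

lemma bump_integral_pos:
 assumes r: "0 < r"
 shows "0 < (LL t. bump r (0::real) t)"
proof -
 have "ift (cr (bump r 0)) (0::real) = cx (fconst TYPE(real)*(LL t. bump r (0::real) t))"
  unfolding ift_eq by (simp add: scaleR_conv_of_real)
 then have "0 < fconst TYPE(real)*(LL t. bump r (0::real) t)" using Re_ift_bump_pos[OF r, of "0::real"] by simp
 then show ?thesis using fconst_pos[where 'a=real] by (simp add: zero_less_mult_iff)
qed

lemma L1_shift_small:
 fixes D :: "real => complex"
 assumes D: "LI D" and e: "0 < (e::real)"
 obtains rh where "0 < rh" "!!y. \<bar>y\<bar> <= rh ==> (NN t. enm (D (t + y) - D t)) <= ennreal e"
proof -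
 define I where "I y = (NN t. enm (D (t + y) - D t))" for y
 have "\<exists>rh>0. \<forall>y. \<bar>y\<bar> <= rh --> I y <= ennreal e"
 proof (rule ccontr)
  assume no: "\<not> ?thesis"
  have "\<forall>n. \<exists>y. \<bar>y\<bar> <= 1/real (Suc n) & \<not> I y <= ennreal e"
  proof
   fix n
   have "0 < 1/real (Suc n)" by simp
   then show "\<exists>y. \<bar>y\<bar> <= 1/real (Suc n) & \<not> I y <= ennreal e" using no by blast
  qed
  from choice[OF this] obtain y where y: "!!n. \<bar>y n\<bar> <= 1/real (Suc n)" "!!n. \<not> I (y n) <= ennreal e" by blast
  have "y ---> 0"
   by (rule Lim_null_comparison[OF always_eventually LIMSEQ_inverse_real_of_nat]) (use y(1) in \<open>simp add: divide_inverse\<close>)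
  from tendsto_L1_shift[OF D this] have "(%n. I (y n)) ---> 0" unfolding I_def .
  then have "eventually (%n. I (y n) < ennreal e) sequentially" by (rule order_tendstoD(2)) (use e in simp)
  then obtain n where "I (y n) < ennreal e" unfolding eventually_sequentially by blast
  then show False using y(2)[of n] by simp
 qed
 then show ?thesis using that unfolding I_def by blast
qed

text \<open>A vanishing average of \<open>D\<close> around \<open>t1\<close> means that
  \<open>m*D t1\<close> is an average of increments \<open>D t1 - D (t1 + y)\<close>. Integrating
  over \<open>t1\<close> bounds the mass of \<open>D\<close> on \<open>A\<close> by its
  \<open>L1\<close> modulus of continuity, and the total mass \<open>m\<close> of the bump
  cancels.\<close>

lemma approximate_identity_bound:
 fixes D :: "real => complex"
 assumes D: "LI D" and r: "0 < r" and [measurable]: "A \<in> sets borel"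
  and z: "!!t1. t1 \<in> A ==> (LL t. D t*cx (bump r 0 (t - t1))) = 0"
  and rh: "!!y. \<bar>y\<bar> <= r ==> (NN t. enm (D (t + y) - D t)) <= ennreal e"
 shows "(NN t. ind A t*enm (D t)) <= ennreal e"
proof -
 note [measurable] = borel_measurable_integrable[OF D]
 define b :: "real => real" where "b = bump r 0"
 have bm [measurable]: "b \<in> BM" unfolding b_def by measurable
 have b0: "0 <= b y" for y unfolding b_def by (rule bump_nonneg)
 have bi: "LI b" unfolding b_def by (rule test_integrable[OF bump_test])
 define m where "m = (LL t. b t)"
 have m: "0 < m" unfolding m_def b_def by (rule bump_integral_pos[OF r])
 obtain C where C: "!!y. \<bar>b y\<bar> <= C" unfolding b_def using bounded_test[OF bump_test] by blast
 have pt: "ennreal m*enm (D t1) <= (NN y. ennreal (b y)*enm (D (t1 + y) - D t1))" if t1: "t1 \<in> A" for t1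
 proof -
  have Ds: "LI (%y. D (y + t1))" using D by (subst lborel_shift(2)) auto
  have i1: "LI (%y. D (y + t1)*cx (b y))"
   by (rule integrable_mult_bounded[OF Ds, where C=C]) (use C in auto)
  have i2: "LI (%y. D t1*cx (b y))" by (intro integrable_mult_right integrable_of_real bi)
  have "0 = (LL t. D t*cx (b (t - t1)))" using z[OF t1] by (simp add: b_def)
  also have "... = (LL y. D (y + t1)*cx (b (y + t1 - t1)))"
   by (rule lborel_shift(1)[symmetric]) measurable
  finally have "(LL y. D (y + t1)*cx (b y) - D t1*cx (b y)) = - (D t1*cx m)"
   using i1 i2 by (simp add: m_def)
  then have "m*norm (D t1) = norm (LL y. D (y + t1)*cx (b y) - D t1*cx (b y))"
   using m by (simp add: norm_mult mult.commute)
  then have "ennreal (m*norm (D t1)) <= (NN y. enm (D (y + t1)*cx (b y) - D t1*cx (b y)))"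
   using norm_integral_le_nn by metis
  also have "... = (NN y. ennreal (b y)*enm (D (t1 + y) - D t1))"
  proof (intro nn_integral_cong)
   fix y
   have "norm (D (y + t1)*cx (b y) - D t1*cx (b y)) = b y*norm (D (t1 + y) - D t1)"
   proof -
    have "D (y + t1)*cx (b y) - D t1*cx (b y) = cx (b y)*(D (t1 + y) - D t1)"
     by (simp add: algebra_simps)
    then show ?thesis using b0[of y] by (simp add: norm_mult)
   qed
   then show "enm (D (y + t1)*cx (b y) - D t1*cx (b y)) = ennreal (b y)*enm (D (t1 + y) - D t1)"
    using b0[of y] by (simp add: ennreal_mult)
  qed
  finally show ?thesis using m by (simp add: ennreal_mult)
 qed
 have "ennreal m*(NN t. ind A t*enm (D t)) <= (NN t. NN y. ennreal (b y)*enm (D (t + y) - D t))"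
 proof -
  have "ennreal m*(NN t. ind A t*enm (D t)) <= (NN t. ennreal m*(ind A t*enm (D t)))"
   by (subst nn_integral_cmult) auto
  also have "... <= (NN t. NN y. ennreal (b y)*enm (D (t + y) - D t))"
   using pt by (intro nn_integral_mono) (auto simp: indicator_def)
  finally show ?thesis .
 qed
 also have "... = (NN y. NN t. ennreal (b y)*enm (D (t + y) - D t))"
  by (rule Fubini_lborel_nn) measurable
 also have "... = (NN y. ennreal (b y)*(NN t. enm (D (t + y) - D t)))"
  by (simp add: nn_integral_cmult)
 also have "... <= (NN y. ennreal (b y)*ennreal e)"
 proof (intro nn_integral_mono)
  fix y
  show "ennreal (b y)*(NN t. enm (D (t + y) - D t)) <= ennreal (b y)*ennreal e"
  proof (cases "b y = 0")
   case False
   then have "\<bar>y\<bar> <= r" using bump_support[of r 0 y] r unfolding b_def by simp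
   then show ?thesis by (intro mult_left_mono rh) auto
  qed simp
 qed
 also have "... = ennreal m*ennreal e"
  using nn_integral_eq_integral[OF bi] b0 by (simp add: nn_integral_multc m_def)
 finally show ?thesis using m by (subst (asm) ennreal_mult_le_mult_iff) auto
qed

lemma approximate_identity_zero:
 fixes D :: "real => complex"
 assumes D: "LI D"
  and z: "!!n t1. 0 <= t1 ==> t1 <= T - 1/real (Suc n) ==> (LL t. D t*cx (bump (1/real (Suc n)) 0 (t - t1))) = 0"
 shows "AEL t. t \<in> {0..<T} --> D t = 0"
proof -
 note [measurable] = borel_measurable_integrable[OF D]
 have "(NN t. ind {0..T - 1/real (Suc k)} t*enm (D t)) <= 0 + ennreal e" if e: "0 < e" for k and e :: real
 proof -
  obtain rh where rh: "0 < rh" "!!y. \<bar>y\<bar> <= rh ==> (NN t. enm (D (t + y) - D t)) <= ennreal e"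
   by (rule L1_shift_small[OF D e], rule that)
  obtain j where j: "1/real (Suc j) < rh" using rh(1) reals_Archimedean by (metis inverse_eq_divide)
  \<comment> \<open>\<open>k\<close> fixes the interval on which \<open>D\<close> is tested and
    \<open>j\<close> the width at which the modulus of continuity is below \<open>e\<close>; the
    bump of index \<open>n\<close> meets both demands.\<close>
  define n where "n = max j k"
  have n: "1/real (Suc n) <= 1/real (Suc j)" "1/real (Suc n) <= 1/real (Suc k)" unfolding n_def by (intro divide_left_mono; simp)+
  have "(NN t. ind {0..T - 1/real (Suc k)} t*enm (D t)) <= (NN t. ind {0..T - 1/real (Suc n)} t*enm (D t))"
   using n(2) by (intro nn_integral_mono mult_right_mono) (auto simp: indicator_def)
  also have "... <= ennreal e"
  proof (rule approximate_identity_bound[OF D, of "1/real (Suc n)"])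
   show "(NN t. enm (D (t + y) - D t)) <= ennreal e" if "\<bar>y\<bar> <= 1/real (Suc n)" for y
    using that n(1) j by (intro rh(2)) linarith
  qed (use z in auto)
  finally show ?thesis by simp
 qed
 then have "(NN t. ind {0..T - 1/real (Suc k)} t*enm (D t)) <= 0" for k
  by (rule ennreal_le_epsilon)
 then have "(NN t. ind {0..T - 1/real (Suc k)} t*enm (D t)) = 0" for k by simp
 then have "AEL t. ind {0..T - 1/real (Suc k)} t*enm (D t) = 0" for k
  by (subst (asm) nn_integral_0_iff_AE) auto
 then have "AEL t. \<forall>k. ind {0..T - 1/real (Suc k)} t*enm (D t) = 0" unfolding AE_all_countable by blast
 then show ?thesis
 proof eventually_elim
  case (elim t)
  show ?case
  proof
   assume t: "t \<in> {0..<T}"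
   then obtain k where "inverse (real (Suc k)) < T - t" using reals_Archimedean[of "T - t"] by auto
   then have "t \<in> {0..T - 1/real (Suc k)}" using t by (simp add: inverse_eq_divide)
   then show "D t = 0" using elim[rule_format, of k] by (simp add: indicator_def)
  qed
 qed
qed

lemma partial_time_product:
 fixes g :: "'a::euclidean_space => real" and f :: "real => real"
 assumes f: "!!t. f differentiable (at t)" and g: "!!x. g differentiable (at x)"
 shows "dt (%p. f (fst p)*g (snd p)) = (%p. partial 1 f (fst p)*g (snd p))"
proof
 fix p :: "real \<times> 'a"
 have df: "((%p. f (fst p)) has_derivative (%h. frechet_derivative f (at (fst p)) (fst h))) (at p)"
  by (rule has_derivative_compose[OF _ has_derivative_partial[OF f]]) (rule bounded_linear_imp_has_derivative[OF bounded_linear_fst])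
 have dg: "((%p. g (snd p)) has_derivative (%h. frechet_derivative g (at (snd p)) (snd h))) (at p)"
  by (rule has_derivative_compose[OF _ has_derivative_partial[OF g]]) (rule bounded_linear_imp_has_derivative[OF bounded_linear_snd])
 have "frechet_derivative g (at (snd p)) 0 = 0" using linear_0[OF has_derivative_linear[OF has_derivative_partial[OF g]]] .
 then show "dt (%p. f (fst p)*g (snd p)) p = partial 1 f (fst p)*g (snd p)"
  using partial_eqI[OF has_derivative_mult[OF df dg], of "(1, 0)"] by (simp add: partial_def)
qed

lemma bump_product_test:
 assumes "0 < r" "s + r < T"
 shows "(%p. bump r s (fst p)*bump r' x0 (snd p)) \<in> test_functions ({..<T} \<times> (UNIV :: 'a::euclidean_space set))"
proof (rule test_functionsI)
 show "C_k k (%p. bump r s (fst p)*bump r' x0 (snd p))" for k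
  by (intro C_k_mult C_k_bump_comp bounded_linear_fst bounded_linear_snd)
 show "compact (cball s r \<times> cball x0 \<bar>r'\<bar>)" by (intro compact_Times compact_cball)
 show "cball s r \<times> cball x0 \<bar>r'\<bar> \<subseteq> {..<T} \<times> UNIV" using assms by (auto simp: dist_real_def)
 show "bump r s (fst p)*bump r' x0 (snd p) = 0" if "p \<notin> cball s r \<times> cball x0 \<bar>r'\<bar>" for p
  using that bump_support[of r s "fst p"] bump_support[of r' x0 "snd p"] assms(1)
  by (cases p) (auto simp: dist_norm norm_minus_commute dist_real_def abs_minus_commute)
qed

lemma ift_cmult: "ift (%x. c*f x) xi = c*ift f xi"
 unfolding ift_def by (rule fourier_integral_cmult)

text \<open>Separation of variables: on the Fourier side the Laplacian is a scalar, so the adjoint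
  operator acts on the time factor alone, as the oscillator with frequency
  \<open>Om ep xi\<close>.\<close>

lemma ift_kg_adjoint_bump_product:
 fixes x0 :: "'a::euclidean_space"
 assumes r: "0 < r" "s + r < T" and e: "0 < ep"
 shows "ift (cr (%x. kg_adjoint ep (%p. bump r s (fst p)*bump r' x0 (snd p)) (t, x))) xi
  = cx (ep\<^sup>2)*(cx (bh r (Om ep xi) (t - s))*ift (cr (bump r' x0)) xi)"
proof -
 let ?Ph = "%p. bump r s (fst p)*bump r' x0 (snd p)"
 have bs: "bump r s = (%t. bump r 0 (t - s))" by (rule ext) (simp add: bump_def)
 have d0: "bump r (0::real) differentiable (at t)" "partial 1 (bump r (0::real)) differentiable (at t)" for t
  by (rule test_differentiable[OF bump_test] test_differentiable[OF bump_partial_tests(1)])+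
 have dT: "bump r s differentiable (at t)" "partial 1 (bump r s) differentiable (at t)" for t
  by (rule test_differentiable[OF bump_test] test_differentiable[OF test_partial[OF bump_test one_Basis_real]])+
 have dg: "bump r' x0 differentiable (at x)" for x by (rule test_differentiable[OF bump_test])
 have p2: "partial 1 (partial 1 (bump r s)) t = partial 1 (partial 1 (bump r 0)) (t - s)"
  unfolding bs partial_real_shift[OF d0(1)] partial_real_shift[OF d0(2)] ..
 have P: "dt (dt ?Ph) = (%p. partial 1 (partial 1 (bump r s)) (fst p)*bump r' x0 (snd p))"
  unfolding partial_time_product[OF dT(1) dg] partial_time_product[OF dT(2) dg] ..
 have "ift (cr (%x. kg_adjoint ep ?Ph (t, x))) xi = cx (ep\<^sup>2) *
   (ift (%x. cx (partial 1 (partial 1 (bump r 0)) (t - s))*cr (bump r' x0) x) xi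
    + cx ((Om ep xi)^2)*ift (%x. cx (bump r 0 (t - s))*cr (bump r' x0) x) xi)"
  unfolding ift_kg_adjoint[OF bump_product_test[OF r] e] P fst_conv snd_conv p2 of_real_mult
  by (simp add: bs)
 then show ?thesis unfolding ift_cmult bh_def by (simp add: algebra_simps)
qed

text \<open>With the bump in time fixed, the bumps in space still vary, and
  \<open>test_pairing_zero_imp_AE\<close> localises in frequency. The exceptional null set depends
  on the centre \<open>a\<close> and the radius \<open>r\<close>.\<close>

lemma weak_zero_slice:
 fixes de :: "real => 'a::euclidean_space => complex"
 assumes s: "sm > real DIM('a)/2" and e: "0 < ep" and T: "0 <= T" and d: "tb sm T de B"
  and z: "!!Ph. Ph \<in> test_functions ({..<T} \<times> UNIV) ==>
   (LL p. ind ({0<..<T} \<times> UNIV) p *R (ift (de (fst p)) (snd p)*cr (kg_adjoint ep Ph) p)) = 0"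
  and r: "0 < r" "a + r < T"
 shows "AEL xi. (LL t. (ind {0..T} t *R de t xi)*cx (bh r (Om ep xi) (t - a))) = 0"
proof -
 note dm [measurable] = tbD(1)[OF d]
 define M where "M xi = (LL t. (ind {0..T} t *R de t xi)*cx (bh r (Om ep xi) (t - a)))" for xi
 have Mm [measurable]: "M \<in> BM" unfolding M_def bh_def by measurable
 obtain B0 where B0: "0 <= B0" "!!t::real. \<bar>bump r 0 t\<bar> <= B0" using bounded_test[OF bump_test] by blast
 obtain B2 where B2: "0 <= B2" "!!t. \<bar>partial 1 (partial 1 (bump r (0::real))) t\<bar> <= B2" using bounded_test[OF bump_partial_tests(2)] by blast
 \<comment> \<open>The square of \<open>Om ep xi\<close> is at most \<open>(1 + 1/ep^2)/ep^2\<close>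
   times \<open>wgt 1\<close>, so one inverse weight makes the multiplier bounded; the dependence on
   \<open>ep\<close> is harmless here.\<close>
 define C where "C = B2 + (1 + 1/ep\<^sup>2)/ep\<^sup>2*B0"
 have C0: "0 <= C" unfolding C_def using B0 B2 by simp
 have kb: "wgt (- 1) xi*\<bar>bh r (Om ep xi) t\<bar> <= C" for xi :: 'a and t
 proof -
  have w1: "wgt (- 1) xi <= 1" using wgt_mono[of "- 1" 0 xi] by simp
  have ww: "wgt (- 1) xi*wgt 1 xi = 1" using wgt_inverse[of 1 xi] by (simp add: mult.commute)
  have "(norm xi)^2 + 1/ep\<^sup>2 <= (1 + 1/ep\<^sup>2)*wgt 1 xi" using e by (simp add: wgt_1 algebra_simps)
  then have "ep\<^sup>2*(Om ep xi)^2 <= (1 + 1/ep\<^sup>2)*wgt 1 xi" unfolding Om_square[OF e] .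
  then have "(Om ep xi)^2 <= (1 + 1/ep\<^sup>2)/ep\<^sup>2*wgt 1 xi" using e by (simp add: field_simps)
  then have "wgt (- 1) xi*(Om ep xi)^2 <= wgt (- 1) xi*((1 + 1/ep\<^sup>2)/ep\<^sup>2*wgt 1 xi)" by (intro mult_left_mono) auto
  also have "... = (1 + 1/ep\<^sup>2)/ep\<^sup>2" using ww by (metis mult.left_commute mult.right_neutral)
  finally have o: "wgt (- 1) xi*(Om ep xi)^2 <= (1 + 1/ep\<^sup>2)/ep\<^sup>2" .
  have "wgt (- 1) xi*\<bar>bh r (Om ep xi) t\<bar> <= wgt (- 1) xi*(\<bar>partial 1 (partial 1 (bump r (0::real))) t\<bar> + (Om ep xi)^2*\<bar>bump r 0 t\<bar>)"
   unfolding bh_def by (intro mult_left_mono order_trans[OF abs_triangle_ineq]) (simp_all add: abs_mult)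
  also have "... = wgt (- 1) xi*\<bar>partial 1 (partial 1 (bump r (0::real))) t\<bar> + (wgt (- 1) xi*(Om ep xi)^2)*\<bar>bump r 0 t\<bar>"
   by (simp add: algebra_simps)
  also have "... <= 1*B2 + (1 + 1/ep\<^sup>2)/ep\<^sup>2*B0"
   using B0 B2 w1 o by (intro add_mono mult_mono) auto
  finally show ?thesis by (simp add: C_def)
 qed
 have "AEL xi. M xi = 0"
 proof -
  have "hn sm (en (%xi. cx (wgt (- 1) xi)*M xi)) <= hn sm (%xi. NN t. ind {0..T} t*en (%xi. cx C*de t xi) xi)"
  proof (rule hn_mono)
   fix xi :: 'a
   have e: "cx (wgt (- 1) xi)*M xi = (LL t. cx (wgt (- 1) xi)*((ind {0..T} t *R de t xi)*cx (bh r (Om ep xi) (t - a))))"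
    unfolding M_def by (rule integral_mult_right_zero[symmetric])
   have "en (%xi. cx (wgt (- 1) xi)*M xi) xi <= (NN t. enm (cx (wgt (- 1) xi)*((ind {0..T} t *R de t xi)*cx (bh r (Om ep xi) (t - a)))))"
    unfolding e by (rule norm_integral_le_nn)
   also have "... <= (NN t. ind {0..T} t*en (%xi. cx C*de t xi) xi)"
   proof (rule nn_integral_mono)
    fix t
    have "(wgt (- 1) xi*\<bar>bh r (Om ep xi) (t - a)\<bar>)*norm (de t xi) <= C*norm (de t xi)" by (rule mult_right_mono[OF kb]) simp
    then show "enm (cx (wgt (- 1) xi)*((ind {0..T} t *R de t xi)*cx (bh r (Om ep xi) (t - a))))
      <= ind {0..T} t*en (%xi. cx C*de t xi) xi"
     using C0 by (auto simp: norm_mult indicator_def mult_ac intro!: ennreal_leI)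
   qed
   finally show "en (%xi. cx (wgt (- 1) xi)*M xi) xi <= (NN t. ind {0..T} t*en (%xi. cx C*de t xi) xi)" .
  qed
  also have "... <= ennreal T*(NN t. ind {0..T} t*hn sm (en (%xi. cx C*de t xi)))"
   by (rule hn_time_integral[OF _ T]) measurable
  also have "... <= ennreal T*(ennreal T*(ennreal (norm (cx C)*B))^2)"
  proof -
   have "hn sm (en (%xi. cx C*de t xi)) <= (ennreal (norm (cx C)*B))^2" if "0 <= t" "t <= T" for t
    by (rule hbD(3)[OF hb_cmult[OF tbD(3)[OF d that]]])
   from mult_left_mono[OF nn_integral_indicator_le[OF this T]] show ?thesis by simp
  qed
  also have "... < \<infinity>" by (simp add: ennreal_mult_less_top power2_eq_square)
  finally have fin: "hn sm (en (%xi. cx (wgt (- 1) xi)*M xi)) < \<infinity>" .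
  have m: "(%xi. cx (wgt (- 1) xi)*M xi) \<in> BM" by measurable
  obtain B' where N: "hb sm (%xi. cx (wgt (- 1) xi)*M xi) B'"
   by (rule hb_finite[OF m fin], rule that)
  show ?thesis
  proof (rule test_pairing_zero_imp_AE[OF s Mm N])
   fix r' :: real and x0 :: 'a
   let ?Ph = "%p. bump r a (fst p)*bump r' x0 (snd p)"
   note Ph = bump_product_test[OF r, of r' x0]
   obtain K where K: "compact K" "closed K" "!!p. p \<notin> K ==> ?Ph p = 0" by (rule test_support[OF Ph], rule that)
   have "0 = (LL p. ind ({0<..<T} \<times> UNIV) p *R (ift (de (fst p)) (snd p)*cr (kg_adjoint ep ?Ph) p))"
    using z[OF Ph] by simp
   also have "... = (LL xi. LL t. ind {0..T} t *R (de t xi*ift (cr (%x. kg_adjoint ep ?Ph (t, x))) xi))"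
    by (rule pairing_time(2)[OF s d T kg_adjoint_continuous[OF Ph] K(1)]) (rule kg_adjoint_outside[OF Ph K(2,3)])
   also have "... = (LL xi. cx (ep\<^sup>2)*(M xi*ift (cr (bump r' x0)) xi))"
   proof (intro BI_LINT_cong refl)
    fix xi :: 'a
    have "(LL t. ind {0..T} t *R (de t xi*ift (cr (%x. kg_adjoint ep ?Ph (t, x))) xi))
     = (LL t. (cx (ep\<^sup>2)*ift (cr (bump r' x0)) xi)*((ind {0..T} t *R de t xi)*cx (bh r (Om ep xi) (t - a))))"
     unfolding ift_kg_adjoint_bump_product[OF r e] by (intro BI_LINT_cong refl) (simp add: scaleR_conv_of_real mult_ac)
    then show "(LL t. ind {0..T} t *R (de t xi*ift (cr (%x. kg_adjoint ep ?Ph (t, x))) xi)) = cx (ep\<^sup>2)*(M xi*ift (cr (bump r' x0)) xi)"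
     unfolding integral_mult_right_zero M_def[symmetric] by simp
   qed
   finally show "(LL xi. M xi*ift (cr (bump r' x0)) xi) = 0" using e by (simp only: integral_mult_right_zero) simp
  qed
 qed
 then show ?thesis unfolding M_def .
qed

text \<open>The null sets of \<open>weak_zero_slice\<close> depend on the centre, of which there are
  uncountably many. Fubini converts the statement into one for almost every \<open>xi\<close> and
  almost every centre; this is sufficient because \<open>time_bump_vanish\<close> integrates over
  the centres. The radii are taken from a countable sequence.\<close>

theorem weak_zero_imp_AE_zero:
 fixes de :: "real => 'a::euclidean_space => complex"
 assumes s: "sm > real DIM('a)/2" and e: "0 < ep" and T: "0 <= T" and d: "tb sm T de B"
  and z: "!!Ph. Ph \<in> test_functions ({..<T} \<times> UNIV) ==>
   (LL p. ind ({0<..<T} \<times> UNIV) p *R (ift (de (fst p)) (snd p)*cr (kg_adjoint ep Ph) p)) = 0"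
 shows "AEL t. AEL xi. t \<in> {0..<T} --> de t xi = 0"
proof -
 note dm [measurable] = tbD(1)[OF d]
 define D where "D t xi = ind {0..T} t *R de t xi" for t xi
 have Dm [measurable]: "(%(t, xi). D t xi) \<in> BM2" unfolding D_def by measurable
 have "(NN t. NN xi. enm (D t xi)) <= (NN t. ind {0..T} t*ennreal (sqrt (wint TYPE('a) sm)*B))"
 proof (rule nn_integral_mono)
  fix t :: real
  show "(NN xi. enm (D t xi)) <= ind {0..T} t*ennreal (sqrt (wint TYPE('a) sm)*B)"
  proof (cases "t \<in> {0..T}")
   case True
   then have "(NN xi. enm (D t xi)) = ennreal (LL xi. norm (de t xi))"
    using tb_L1_bound(1)[OF s d, of t] by (simp add: D_def nn_integral_eq_integral)
   then show ?thesis using True tb_L1_bound(2)[OF s d, of t] by (simp add: ennreal_leI)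
  qed (simp add: D_def)
 qed
 also have "... <= ennreal T*ennreal (sqrt (wint TYPE('a) sm)*B)" using T by (intro nn_integral_indicator_le) auto
 also have "... < \<infinity>" by (simp add: ennreal_mult_less_top)
 finally have fin: "(NN t. NN xi. enm (D t xi)) < \<infinity>" .
 have Di: "AEL xi. LI (%t. D t xi)" by (rule fubini_lborel(6)[OF Dm fin])
 have "AEL xi. AEL a. a < T - 1/real (Suc n) --> (LL t. D t xi*cx (bh (1/real (Suc n)) (Om ep xi) (t - a))) = 0" for n
 proof (rule AE_lborel_commute)
  have [measurable]: "(%p. LL t. D t (snd p)*cx (bh (1/real (Suc n)) (Om ep (snd p)) (t - fst p))) \<in> BM2"
   unfolding bh_def by measurable
  show "Measurable.pred (borel \<Otimes>\<^sub>M borel) (%p. fst p < T - 1/real (Suc n) --> (LL t. D t (snd p)*cx (bh (1/real (Suc n)) (Om ep (snd p)) (t - fst p))) = 0)"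
   by measurable
  have "AEL xi. a < T - 1/real (Suc n) --> (LL t. D t xi*cx (bh (1/real (Suc n)) (Om ep xi) (t - a))) = 0" for a
  proof (cases "a < T - 1/real (Suc n)")
   case True
   then have "a + 1/real (Suc n) < T" by simp
   have "AEL xi. (LL t. (ind {0..T} t *R de t xi)*cx (bh (1/real (Suc n)) (Om ep xi) (t - a))) = 0"
    by (rule weak_zero_slice[OF s e T d _ _ \<open>a + 1 / real (Suc n) < T\<close>]) (erule z, simp)
   then show ?thesis unfolding D_def by eventually_elim blast
  qed simp
  then show "AEL a. AEL xi. a < T - 1/real (Suc n) --> (LL t. D t xi*cx (bh (1/real (Suc n)) (Om ep xi) (t - a))) = 0"
   by (rule AE_I2)
 qed
 then have "AEL xi. \<forall>n. AEL a. a < T - 1/real (Suc n) --> (LL t. D t xi*cx (bh (1/real (Suc n)) (Om ep xi) (t - a))) = 0"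
  unfolding AE_all_countable by blast
 with Di have "AEL xi. AEL t. t \<in> {0..<T} --> de t xi = 0"
 proof eventually_elim
  case (elim xi)
  have Om0: "Om ep xi ~= 0" using e by (simp add: Om_def)
  have "AEL t. t \<in> {0..<T} --> D t xi = 0"
  proof (rule approximate_identity_zero[OF elim(1)])
   fix n t1 assume t1: "0 <= t1" "t1 <= T - 1/real (Suc n)"
   show "(LL t. D t xi*cx (bump (1/real (Suc n)) 0 (t - t1))) = 0"
    by (rule time_bump_vanish[OF elim(1) _ Om0 _ elim(2)[rule_format, of n] t1]) (simp_all add: D_def)
  qed
  then show ?case by eventually_elim (auto simp: D_def)
 qed
 moreover have "Measurable.pred (borel \<Otimes>\<^sub>M borel) (%p. snd p \<in> {0..<T} --> de (snd p) (fst p) = 0)"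
  unfolding atLeastLessThan_iff by measurable
 ultimately show ?thesis using AE_lborel_commute[of "%xi t. t \<in> {0..<T} --> de t xi = 0"] by blast
qed

text \<open>The function \<open>y\<close> is merely measurable with finite integral. On a time step
  of length \<open>h\<close> with \<open>h*C <= 1/2\<close> the accumulated integral is at most half
  of itself and hence 0, by finiteness; finitely many steps exhaust the interval.\<close>

lemma gronwall_zero:
 fixes y :: "real => ennreal"
 assumes [measurable]: "y \<in> BM" and T: "0 <= T" and C: "0 <= C"
  and fin: "(NN t. ind {0..T} t*y t) < \<infinity>"
  and le: "AEL t. t \<in> {0..<T} --> y t <= ennreal C*(NN ta. ind {0..t} ta*y ta)"
 shows "(NN t. ind {0..T} t*y t) = 0"
proof -
 define Y where "Y a = (NN ta. ind {0..a} ta*y ta)" for a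
 have mono: "Y a <= Y b" if "a <= b" for a b
  unfolding Y_def using that by (intro nn_integral_mono mult_right_mono) (auto simp: indicator_def)
 \<comment> \<open>This number of steps makes the step length \<open>h = T/N\<close> satisfy
   \<open>2*(h*C) <= 1\<close>.\<close>
 obtain N where N: "2*C*T < real N" using reals_Archimedean2 by blast
 then have N0: "0 < N" using mult_nonneg_nonneg[OF C T] by (cases N) auto
 define h where "h = T/real N"
 have h: "0 <= h" "2*(h*C) <= 1" using N N0 T C by (auto simp: h_def field_simps)
 have "k <= N --> Y (real k*h) = 0" for k
 proof (induction k)
  case 0
  have "AEL t. ind {0..0} t*y t = 0" using AE_lborel_singleton[of "0::real"] by eventually_elim (auto simp: indicator_def)
  then show ?case unfolding Y_def by (subst nn_integral_0_iff_AE) auto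
 next
  case (Suc k)
  show ?case
  proof
   assume k: "Suc k <= N"
   define a where "a = real k*h"
   define b where "b = real (Suc k)*h"
   have ab: "0 <= a" "a <= b" "b - a = h" using h by (auto simp: a_def b_def algebra_simps)
   have "b <= real N*h" unfolding b_def using k h by (intro mult_right_mono) auto
   then have bT: "b <= T" using N0 by (simp add: h_def)
   have Ya: "Y a = 0" using Suc k by (simp add: a_def)
   have "Y b <= (NN t. ind {0..a} t*y t + ind {a..b} t*(ennreal C*Y b))"
    unfolding Y_def[of b]
   proof (rule nn_integral_mono_AE)
    show "AEL t. ind {0..b} t*y t <= ind {0..a} t*y t + ind {a..b} t*(ennreal C*(NN ta. ind {0..b} ta*y ta))"
     using le AE_lborel_singleton[of T]
    proof eventually_elim
     case (elim t)
     show ?case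
     proof (cases "t \<in> {a<..b}")
      case True
      then have "t \<in> {0..<T}" using elim(2) bT ab by auto
      then have "y t <= ennreal C*Y t" using elim(1) unfolding Y_def by blast
      also have "... <= ennreal C*Y b" using True by (intro mult_left_mono mono) auto
      finally show ?thesis using True ab unfolding Y_def by (simp add: indicator_def)
     next
      case False
      then have "ind {0..b} t*y t <= ind {0..a} t*y t" by (auto simp: indicator_def)
      then show ?thesis by (rule order_trans) simp
     qed
    qed
   qed
   also have "... = Y a + (NN t. ind {a..b} t*(ennreal C*Y b))"
    unfolding Y_def[of a] by (rule nn_integral_add) auto
   also have "(NN t. ind {a..b} t*(ennreal C*Y b)) = ennreal h*(ennreal C*Y b)"
    using ab by (simp add: nn_integral_multc)
   finally have "Y b <= ennreal (h*C)*Y b" using Ya h C by (simp add: ennreal_mult mult.assoc)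
   moreover have "Y b < \<infinity>" using mono[OF bT] fin unfolding Y_def by (rule le_less_trans)
   then obtain z where z: "Y b = ennreal z" "0 <= z" by (cases "Y b") auto
   ultimately have "z <= h*C*z" using h C by (simp add: ennreal_mult[symmetric])
   moreover have "2*(h*C*z) <= 1*z" using mult_right_mono[OF h(2) z(2)] by (simp only: mult.assoc)
   ultimately have "z = 0" using z(2) by linarith
   then show "Y (real (Suc k)*h) = 0" using z by (simp add: b_def)
  qed
 qed
 from this[of N] show ?thesis using N0 by (simp add: Y_def h_def)
qed

context sobolev_algebra
begin

lemma hn_cconv_le:
 fixes f g :: "'a => complex"
 assumes f: "hb sm f A" and g: "hb sm g B"
 shows "hn sm (en (%xi. c*cconv f g xi)) <= ennreal ((norm c*kappa TYPE('a) sm*A)^2)*hn sm (en g)"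
proof -
 have h: "hb sm (%xi. c*cconv f g xi) (norm c*(kappa TYPE('a) sm*(A*hnr sm g)))"
  by (intro hb_cmult hb_cconv s f hb_hnr[OF g])
 have e: "ennreal ((hnr sm g)^2) = hn sm (en g)" using hbD(4)[OF g] by (simp add: hnr_def)
 have "hn sm (en (%xi. c*cconv f g xi)) <= ennreal ((norm c*(kappa TYPE('a) sm*(A*hnr sm g)))^2)" using h by (simp add: hb_def)
 also have "(norm c*(kappa TYPE('a) sm*(A*hnr sm g)))^2 = (norm c*kappa TYPE('a) sm*A)^2*(hnr sm g)^2"
  by (simp add: power_mult_distrib)
 also have "ennreal ... = ennreal ((norm c*kappa TYPE('a) sm*A)^2)*hn sm (en g)" unfolding e[symmetric] by (rule ennreal_mult) auto
 finally show ?thesis .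
qed

text \<open>At fixed \<open>ep\<close> oscillation is irrelevant: the difference satisfies a linear
  Duhamel equation with kernel bounded by 1, and the algebra property gives Gronwall's inequality
  for its squared norm.\<close>

theorem kg_mild_unique:
 fixes U V G :: "real => 'a => complex"
 assumes T: "0 <= T" and U: "tb sm T U A" and V: "tb sm T V B"
  and eU: "AEL t. AEL xi. t \<in> {0..<T} --> U t xi = G t xi + mu*Bq ep U U t xi"
  and eV: "AEL t. AEL xi. t \<in> {0..<T} --> V t xi = G t xi + mu*Bq ep V V t xi"
 shows "AEL t. AEL xi. t \<in> {0..<T} --> U t xi = V t xi"
proof -
 note [measurable] = tbD(1)[OF U] tbD(1)[OF V]
 define d where "d t xi = U t xi - V t xi" for t xi
 define p where "p t xi = U t xi + V t xi" for t xi
 have d: "tb sm T d (A + B)" unfolding d_def by (rule tb_diff[OF U V])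
 have p: "tb sm T p (A + B)" unfolding p_def by (rule tb_add[OF U V])
 note dm [measurable] = tbD(1)[OF d] and pm [measurable] = tbD(1)[OF p]
 define K where "K = (norm mu*kappa TYPE('a) sm*(A + B))^2"
 have K0: "0 <= K" by (simp add: K_def)
 define y where "y t = hn sm (en (d t))" for t
 have ym [measurable]: "y \<in> BM" unfolding y_def hn_def by measurable
 have yb: "y t <= (ennreal (A + B))^2" if "0 <= t" "t <= T" for t unfolding y_def by (rule hbD(3)[OF tbD(3)[OF d that]])
 have "(NN t. ind {0..T} t*y t) <= ennreal T*(ennreal (A + B))^2"
  using yb T by (intro nn_integral_indicator_le) auto
 also have "... < \<infinity>" by (simp add: ennreal_mult_less_top power2_eq_square)
 finally have fin: "(NN t. ind {0..T} t*y t) < \<infinity>" .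
 have "AEL t. t \<in> {0..<T} --> y t <= ennreal (T*K)*(NN ta. ind {0..t} ta*y ta)"
  using eU eV
 proof eventually_elim
  case (elim t)
  show ?case
  proof
   assume t: "t \<in> {0..<T}"
   then have t0: "0 <= t" "t <= T" by auto
   have "AEL xi. d t xi = duh ep (%ta xi. mu*cconv (p ta) (d ta) xi) t xi"
    using elim
   proof eventually_elim
    case (elim xi)
    have "d t xi = mu*(Bq ep U U t xi - Bq ep V V t xi)" using elim t by (simp add: d_def algebra_simps)
    also have "... = mu*Bq ep p d t xi" unfolding Bq_square_diff[OF U V t0] p_def d_def ..
    finally show ?case unfolding Bq_def duh_cmult .
   qed
   then have "y t = hn sm (en (duh ep (%ta xi. mu*cconv (p ta) (d ta) xi) t))"
    unfolding y_def by (intro hn_cong_AE) (auto elim!: eventually_mono)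
   also have "... <= ennreal t*(NN ta. ind {0..t} ta*hn sm (en (%xi. mu*cconv (p ta) (d ta) xi)))"
    by (rule hn_duh[OF _ t0(1)]) measurable
   also have "... <= ennreal T*(NN ta. ennreal K*(ind {0..t} ta*y ta))"
   proof (rule mult_mono[OF _ nn_integral_mono])
    fix ta
    show "ind {0..t} ta*hn sm (en (%xi. mu*cconv (p ta) (d ta) xi)) <= ennreal K*(ind {0..t} ta*y ta)"
    proof (cases "ta \<in> {0..t}")
     case True
     then have "0 <= ta" "ta <= T" using t by auto
     from hn_cconv_le[OF tbD(3)[OF p this] tbD(3)[OF d this], of mu] show ?thesis using True by (simp add: K_def y_def)
    qed simp
   qed (use t in \<open>auto intro!: ennreal_leI\<close>)
   also have "... = ennreal (T*K)*(NN ta. ind {0..t} ta*y ta)"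
    using T K0 by (simp add: nn_integral_cmult ennreal_mult mult.assoc)
   finally show "y t <= ennreal (T*K)*(NN ta. ind {0..t} ta*y ta)" .
  qed
 qed
 from gronwall_zero[OF ym T _ fin this] have "(NN t. ind {0..T} t*y t) = 0" using T K0 by simp
 then have "AEL t. ind {0..T} t*y t = 0" by (subst (asm) nn_integral_0_iff_AE) auto
 then show ?thesis
 proof eventually_elim
  case (elim t)
  show ?case
  proof (cases "t \<in> {0..<T}")
   case True
   then have "y t = 0" using elim by simp
   moreover have [measurable]: "d t \<in> BM" using hbD(1)[OF tbD(3)[OF d, of t]] True by simp
   ultimately have "AEL xi. en (d t) xi = 0" unfolding y_def by (subst (asm) hn_zero_iff) auto
   then show ?thesis by eventually_elim (simp add: d_def)
  next
   case False
   then show ?thesis by (intro AE_I2) auto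
  qed
 qed
qed

end

section \<open>Measurable dependence of the transform on time\<close>

lemma L2_norm_le_transform:
 fixes f g :: "'a::euclidean_space => complex"
 assumes s: "sm > real DIM('a)/2" and ft: "IFT f g" and g: "hb sm g B"
 shows "hn 0 (en f) <= ennreal (B\<^sup>2)"
proof -
 have s0: "0 <= sm" using s by (meson divide_nonneg_nonneg le_less_trans less_imp_le of_nat_0_le_iff zero_le_numeral)
 have gi: "LI g" by (rule hb_integrable(1)[OF s g])
 have g0: "hb 0 g B" by (rule hb_mono_exp[OF g s0])
 note [measurable] = hbD(1)[OF g]
 have "hn 0 (en f) = hn 0 (%x. en (FI g) (- x))"
  using fourier_inversion_L2[OF ft gi] by (intro hn_cong_AE) (auto elim!: eventually_mono)
 also have "... = hn 0 (en (FI g))" by (rule hn_reflect) measurable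
 also have "... = hn 0 (en g)" by (rule plancherel[OF gi hbD(4)[OF g0]])
 also have "... <= ennreal (B\<^sup>2)" using g0 by (simp add: hb_def)
 finally show ?thesis .
qed

lemma trunc_error_le: "hn 0 (en (%x. f x - trunc R f x)) <= hn 0 (en f)"
 by (rule hn_mono) (auto simp: trunc_def indicator_def)

lemma trunc_error_tendsto:
 fixes f :: "'a::euclidean_space => complex"
 assumes [measurable]: "f \<in> BM" and fin: "hn 0 (en f) < \<infinity>"
 shows "(%n. hn 0 (en (%x. f x - trunc (real n) f x))) ---> 0"
proof -
 have [measurable]: "trunc R f \<in> BM" for R unfolding trunc_def[abs_def] indicator_def mem_cball by measurable
 have "(%n. hn 0 (en (%x. f x - trunc (real n) f x))) ---> (\<integral>\<^sup>+x. 0 \<partial>(lborel :: 'a measure))"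
  unfolding hn_def
 proof (rule nn_integral_dominated_convergence[where w="%x. ennreal (wgt 0 x)*(en f x)^2"])
  show "AEL x. ennreal (wgt 0 x)*(en (%x. f x - trunc (real n) f x) x)^2 <= ennreal (wgt 0 x)*(en f x)^2" for n
   by (intro AE_I2 mult_left_mono power_mono ennreal_leI) (auto simp: trunc_def indicator_def)
  show "(NN x. ennreal (wgt 0 x)*(en f x)^2) < \<infinity>" using fin by (simp add: hn_def)
  show "AEL x. (%n. ennreal (wgt 0 x)*(en (%x. f x - trunc (real n) f x) x)^2) ---> 0"
  proof (rule AE_I2)
   fix x :: 'a
   obtain N where N: "norm x <= real N" using real_arch_simple by blast
   have "eventually (%n. ennreal (wgt 0 x)*(en (%x. f x - trunc (real n) f x) x)^2 = 0) sequentially"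
    using eventually_ge_at_top[of N]
   proof eventually_elim
    case (elim n)
    then have "norm x <= real n" using N by linarith
    then show ?case by (simp add: trunc_def)
   qed
   then show "(%n. ennreal (wgt 0 x)*(en (%x. f x - trunc (real n) f x) x)^2) ---> 0" by (rule tendsto_eventually)
  qed
 qed measurable
 then show ?thesis by simp
qed

text \<open>Summable squared distances force pointwise convergence almost everywhere, so the
  pointwise \<open>lim\<close> of the sequence is a measurable representative of its
  \<open>L2\<close> limit.\<close>

lemma summable_hn_imp_AE_tendsto:
 fixes F :: "nat => 'a::euclidean_space => complex"
 assumes [measurable]: "!!k. F k \<in> BM" "g \<in> BM"
  and fin: "(\<Sum>k. hn 0 (en (%xi. g xi - F k xi))) ~= \<infinity>"
 shows "AEL xi. (%k. F k xi) ---> g xi"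
proof -
 have "(NN xi. (\<Sum>k. ennreal ((norm (g xi - F k xi))^2))) = (\<Sum>k. hn 0 (en (%xi. g xi - F k xi)))"
  unfolding hn_0_nn by (rule nn_integral_suminf) measurable
 then have "(NN xi. (\<Sum>k. ennreal ((norm (g xi - F k xi))^2))) ~= \<infinity>" using fin by simp
 then have "AEL xi. (\<Sum>k. ennreal ((norm (g xi - F k xi))^2)) ~= \<infinity>" by (intro nn_integral_PInf_AE) measurable
 then show ?thesis
 proof eventually_elim
  case (elim xi)
  then have "summable (%k. (norm (g xi - F k xi))^2)" by (intro summable_suminf_not_top) auto
  then have "(%k. (norm (g xi - F k xi))^2) ---> 0" by (rule summable_LIMSEQ_zero)
  then have "(%k. sqrt ((norm (g xi - F k xi))^2)) ---> sqrt 0" by (rule tendsto_real_sqrt)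
  then have "(%k. norm (F k xi - g xi)) ---> 0" by (simp add: norm_minus_commute)
  then show ?case using LIM_zero_cancel tendsto_norm_zero_iff by blast
 qed
qed

text \<open>The transform at a fixed time is an \<open>L\<^sup>2\<close> limit only; a subsequence along which the
 truncation errors are summable in time gives a jointly measurable choice.\<close>

theorem jointly_measurable_transform:
 fixes w :: "real => 'a::euclidean_space => complex"
 assumes s: "sm > real DIM('a)/2" and wm [measurable]: "(%(t, x). w t x) \<in> BM2"
  and w0: "!!t x. t \<notin> {0<..<T} ==> w t x = 0"
  and ae: "AEL t. t \<in> {0<..<T} --> sobolev_le sm (w t) B" and T: "0 <= T"
 obtains V where "tb sm T V \<bar>B\<bar>" "AEL t. t \<in> {0<..<T} --> IFT (w t) (V t)"
proof -
 have [measurable]: "(%(t, x). trunc R (w t) x) \<in> BM2" for R unfolding trunc_def indicator_def mem_cball by measurable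
 have wt [measurable]: "w t \<in> BM" for t by measurable
 define e where "e n t = hn 0 (en (%x. w t x - trunc (real n) (w t) x))" for n t
 have em [measurable]: "e n \<in> BM" for n unfolding e_def hn_def by measurable
 have good: "AEL t. t \<in> {0<..<T} --> (\<exists>g. IFT (w t) g & hb sm g B)"
  using ae by eventually_elim (auto elim: sobolev_leD)
 have wb: "AEL t. hn 0 (en (w t)) <= ind {0..T} t*ennreal (B\<^sup>2)"
  using good
 proof eventually_elim
  case (elim t)
  show ?case
  proof (cases "t \<in> {0<..<T}")
   case True
   then obtain g where "IFT (w t) g" "hb sm g B" using elim by blast
   from L2_norm_le_transform[OF s this] show ?thesis using True by simp
  next
   case False
   then show ?thesis using w0 by (simp add: hn_def)
  qed
 qed
 have "(%n. NN t. e n t) ---> (\<integral>\<^sup>+t. 0 \<partial>(lborel :: real measure))"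
 proof (rule nn_integral_dominated_convergence[where w="%t. ind {0..T} t*ennreal (B\<^sup>2)"])
  show "AEL t. e n t <= ind {0..T} t*ennreal (B\<^sup>2)" for n
   using wb by eventually_elim (auto simp: e_def intro: order_trans[OF trunc_error_le])
  have "(NN t. ind {0..T} t*ennreal (B\<^sup>2)) <= ennreal T*ennreal (B\<^sup>2)" using T by (intro nn_integral_indicator_le) auto
  also have "... < \<infinity>" by (simp add: ennreal_mult_less_top)
  finally show "(NN t. ind {0..T} t*ennreal (B\<^sup>2)) < \<infinity>" .
  show "AEL t. (%n. e n t) ---> 0"
   using wb
  proof eventually_elim
   case (elim t)
   have "ind {0..T} t*ennreal (B\<^sup>2) < (\<infinity>::ennreal)" by (auto simp: indicator_def)
   then show ?case unfolding e_def by (intro trunc_error_tendsto wt le_less_trans[OF elim])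
  qed
 qed measurable
 then have lim: "(%n. NN t. e n t) ---> 0" by simp
 have "\<exists>n. (NN t. e n t) < ennreal ((1/2)^k)" for k :: nat
  using order_tendstoD(2)[OF lim, of "ennreal ((1/2)^k)"] by (auto simp: eventually_sequentially)
 then obtain n where n: "!!k::nat. (NN t. e (n k) t) < ennreal ((1/2)^k)" by metis
 have "(NN t. (\<Sum>k. e (n k) t)) = (\<Sum>k. NN t. e (n k) t)" by (rule nn_integral_suminf) measurable
 also have "... <= (\<Sum>k. ennreal ((1/2)^k))" using n by (intro suminf_le summableI less_imp_le) auto
 also have "... = ennreal (\<Sum>k. (1/2)^k)" by (rule suminf_ennreal2) (auto intro!: summable_geometric)
 also have "... < \<infinity>" by simp
 finally have "(NN t. (\<Sum>k. e (n k) t)) ~= \<infinity>" by simp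
 then have sume: "AEL t. (\<Sum>k. e (n k) t) ~= \<infinity>" by (intro nn_integral_PInf_AE) measurable
 define F where "F k t xi = FI (trunc (real (n k)) (w t)) xi" for k t xi
 have Fm [measurable]: "(%(t, xi). F k t xi) \<in> BM2" for k unfolding F_def by measurable
 define V0 where "V0 t xi = lim (%k. F k t xi)" for t xi
 have V0m [measurable]: "(%(t, xi). V0 t xi) \<in> BM2" unfolding V0_def by measurable
 have V0t [measurable]: "V0 t \<in> BM" for t by measurable
 define Q where "Q t \<longleftrightarrow> (t \<in> {0<..<T} --> IFT (w t) (V0 t) & hb sm (V0 t) \<bar>B\<bar>)" for t
 have "AEL t. Q t"
  using good sume
 proof eventually_elim
  case (elim t)
  show ?case unfolding Q_def
  proof
   assume "t \<in> {0<..<T}"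
   then obtain g where g: "IFT (w t) g" "hb sm g B" using elim by blast
   note [measurable] = hbD(1)[OF g(2)]
   have [measurable]: "F k t \<in> BM" for k by measurable
   have "(\<Sum>k. hn 0 (en (%xi. g xi - F k t xi))) <= (\<Sum>k. 2*e (n k) t)"
    unfolding F_def e_def by (intro suminf_le summableI is_fourier_transform_trunc_error[OF g(1)])
   also have "... = 2*(\<Sum>k. e (n k) t)" by (rule ennreal_suminf_cmult)
   also have "... < \<infinity>" using elim(2) by (simp add: ennreal_mult_less_top less_top)
   finally have "(\<Sum>k. hn 0 (en (%xi. g xi - F k t xi))) ~= \<infinity>" by simp
   then have "AEL xi. (%k. F k t xi) ---> g xi" by (intro summable_hn_imp_AE_tendsto) measurable
   then have gV: "AEL xi. g xi = V0 t xi" by eventually_elim (simp add: V0_def limI)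
   have "IFT (w t) (V0 t)" by (rule is_fourier_transform_cong_AE[OF g(1) _ gV]) auto
   moreover have "hn sm (en (V0 t)) = hn sm (en g)" using gV by (intro hn_cong_AE) (auto elim!: eventually_mono)
   then have "hb sm (V0 t) \<bar>B\<bar>" using g(2) by (simp add: hb_def)
   ultimately show "IFT (w t) (V0 t) & hb sm (V0 t) \<bar>B\<bar>" ..
  qed
 qed
 \<comment> \<open>The choice is correct for almost every time only, while \<open>tb\<close> asks
   for every time. Setting it to 0 on a measurable null set of bad times repairs this and preserves
   joint measurability.\<close>
 then obtain N where N: "N \<in> null_sets lborel" "{t. \<not> Q t} \<subseteq> N" unfolding eventually_ae_filter by auto
 have Nm [measurable]: "N \<in> sets borel" using N(1) by auto
 define V where "V t xi = (if t \<in> N \<or> t \<notin> {0<..<T} then 0 else V0 t xi)" for t xi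
 have "(%(t, xi). V t xi) \<in> BM2" unfolding V_def by measurable
 moreover have "hb sm (V t) \<bar>B\<bar>" for t
 proof (cases "t \<in> N \<or> t \<notin> {0<..<T}")
  case True
  then show ?thesis using hb_mono_B[OF hb_zero, of "\<bar>B\<bar>"] by (simp add: V_def[abs_def])
 next
  case False
  then have "Q t" using N(2) by auto
  then show ?thesis using False by (simp add: V_def[abs_def] Q_def)
 qed
 ultimately have "tb sm T V \<bar>B\<bar>" by (simp add: tb_def)
 moreover have "AEL t. t \<in> {0<..<T} --> IFT (w t) (V t)"
  using AE_not_in[OF N(1)]
 proof eventually_elim
  case (elim t)
  then have "Q t" using N(2) by auto
  then show ?case using elim by (auto simp: V_def[abs_def] Q_def)
 qed
 ultimately show ?thesis by (rule that)
qed

lemma joint_slice: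
 assumes "(%(t, xi). f t xi) \<in> BM2"
 shows "f t \<in> borel_measurable (borel :: 'a::euclidean_space measure)"
proof -
 note [measurable] = assms
 show ?thesis by measurable
qed

section \<open>Real-valued solutions and the Fourier form of the weak equation\<close>

lemma cnj_ift:
 assumes [measurable]: "G \<in> BM"
 shows "cnj (ift G x) = ift (%xi. cnj (G (- xi))) x"
proof -
 have "ift (%xi. cnj (G (- xi))) x = FI (%xi. cnj (G xi)) (- (- x))"
  unfolding ift_def by (rule fourier_integral_reflect) measurable
 then show ?thesis unfolding ift_def cnj_fourier_integral by simp
qed

lemma ift_hermitian:
 assumes "G \<in> BM" "hermitian G"
 shows "cx (Re (ift G x)) = ift G x"
proof -
 have "(%xi. cnj (G (- xi))) = G" using assms(2) by (simp add: hermitian_def)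
 then have "cnj (ift G x) = ift G x" using cnj_ift[OF assms(1), of x] by simp
 then show ?thesis by (simp add: complex_eq_iff)
qed

text \<open>Symmetrising a transform of a real function changes it on a null set only and makes the
  symmetry hold everywhere.\<close>

lemma hermitian_transform:
 fixes f :: "'a::euclidean_space => real"
 assumes f: "IFT (cr f) g" and g: "hb sm g B"
 obtains p where "IFT (cr f) p" "hb sm p B" "hermitian p"
proof -
 note [measurable] = hbD(1)[OF g]
 define p where "p xi = (g xi + cnj (g (- xi)))/2" for xi
 have [measurable]: "p \<in> BM" unfolding p_def by measurable
 have ae: "AEL xi. g xi = p xi"
  using is_fourier_transform_real[OF f] by (auto simp: p_def elim!: eventually_mono)
 have "IFT (cr f) p"
  by (rule is_fourier_transform_cong_AE[OF f _ ae]) (use is_fourier_transform_measurable(1)[OF f] in auto)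
 moreover have "hn sm (en p) = hn sm (en g)" using ae by (intro hn_cong_AE) (auto elim!: eventually_mono)
 then have "hb sm p B" using g by (simp add: hb_def)
 moreover have "hermitian p" by (simp add: hermitian_def p_def add.commute)
 ultimately show ?thesis by (rule that)
qed

lemma ift_cong_AE:
 assumes "AEL xi. F xi = G xi" "F \<in> BM" "G \<in> BM"
 shows "ift F x = ift G x"
 unfolding ift_def by (rule fourier_integral_cong_AE[OF assms])

lemma Linf_sobolev_le_cong:
 assumes "!!t x. t \<in> {0<..<T} ==> w t x = w' t x"
 shows "Linf_sobolev_le T sm w B \<longleftrightarrow> Linf_sobolev_le T sm w' B"
proof -
 have "(%p. ind ({0<..<T} \<times> UNIV) p *R (%(t, x). w t x) p) = (%p. ind ({0<..<T} \<times> UNIV) p *R (%(t, x). w' t x) p)"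
  using assms by (auto simp: indicator_def fun_eq_iff)
 moreover have "w t = w' t" if "t \<in> {0<..<T}" for t using assms[OF that] by (rule ext)
 then have "(t \<in> {0<..<T} --> sobolev_le sm (w t) B) = (t \<in> {0<..<T} --> sobolev_le sm (w' t) B)" for t by auto
 ultimately show ?thesis unfolding Linf_sobolev_le_def set_borel_measurable_def by simp
qed

lemma slab_measurable: "({0<..<T} \<times> (UNIV :: 'a::euclidean_space set)) \<in> sets (borel :: (real \<times> 'a) measure)"
 by (intro borel_open open_Times) auto

lemma Linf_sobolev_le_ift:
 fixes G :: "real => 'a::euclidean_space => complex"
 assumes s: "sm > real DIM('a)/2" and G: "tb sm T G B"
 shows "Linf_sobolev_le T sm (%t. ift (G t)) B"
 unfolding Linf_sobolev_le_def
proof (intro conjI AE_I2 impI)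
 note [measurable] = tbD(1)[OF G]
 have m: "(%(t, x). ift (G t) x) \<in> BM2" by measurable
 show "set_borel_measurable lborel ({0<..<T} \<times> UNIV) (%(t, x). ift (G t) x)"
  unfolding set_borel_measurable_def using m slab_measurable[of T, where 'a='a] unfolding borel_prod
  by (intro borel_measurable_scaleR borel_measurable_indicator) auto
 fix t assume "t \<in> {0<..<T}"
 then have "hb sm (G t) B" using tbD(3)[OF G] by simp
 then show "sobolev_le sm (ift (G t)) B" by (intro sobolev_leI[of _ "G t"] hb_is_fourier_transform_ift[OF s])
qed

text \<open>With \<open>te\<close> the total phase, \<open>cos te*p + sin te*q\<close> is the sum of
  \<open>(p + \<i>*q)/2\<close> rotated by \<open>- te\<close> and \<open>(p - \<i>*q)/2\<close>
  rotated by \<open>te\<close>. Since \<open>p\<close> and \<open>q\<close> are hermitian, the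
  second summand is the reflected conjugate of the first, that is, the transform of the conjugate
  function. Splitting \<open>1/ep^2\<close> off \<open>te\<close> leaves the Schroedinger
  phase.\<close>

lemma trig_schroedinger:
 fixes p q :: "'a::euclidean_space => complex"
 assumes p: "hermitian p" and q: "hermitian q" and i: "LI p" "LI q"
 shows "ift (trig (th ep) p q t) x = cis (- t/ep\<^sup>2)*ift (sv (%xi. (1/2)*(p xi + \<i>*q xi)) t) x
  + cis (t/ep\<^sup>2)*cnj (ift (sv (%xi. (1/2)*(p xi + \<i>*q xi)) t) x)"
proof -
 let ?a = "%xi. (1/2)*(p xi + \<i>*q xi)"
 note [measurable] = borel_measurable_integrable[OF i(1)] borel_measurable_integrable[OF i(2)]
 have ia: "LI ?a" by (intro integrable_mult_right BI_int_add i)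
 have isv: "LI (sv ?a t)" unfolding sv_def[abs_def] by (rule integrable_cis_mult[OF ia]) measurable
 have svm [measurable]: "sv ?a t \<in> BM" by measurable
 have icn: "LI (%xi. cnj (sv ?a t (- xi)))"
 proof -
  have "LI (%xi. sv ?a t (0 - xi))" using isv by (subst lborel_reflect(2)) auto
  then show ?thesis by simp
 qed
 have e: "trig (th ep) p q t xi = cis (- t/ep\<^sup>2) * sv ?a t xi + cis (t/ep\<^sup>2)*cnj (sv ?a t (- xi))" for xi
 proof -
  define te where "te = th ep xi*t"
  have h: "cnj (p (- xi)) = p xi" "cnj (q (- xi)) = q xi" using p q by (simp_all add: hermitian_def)
  have 1: "cis (- t/ep\<^sup>2)*cis (- ((norm xi)^2/2)*t) = cis (- te)" "cis (t/ep\<^sup>2)*cis ((norm xi)^2/2*t) = cis te"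
   by (simp_all add: cis_mult te_def th_def algebra_simps)
  have 2: "cnj (sv ?a t (- xi)) = cis ((norm xi)^2/2*t)*((1/2)*(p xi - \<i>*q xi))"
   using h by (simp add: sv_def cis_cnj)
  have "cis (- t/ep\<^sup>2) * sv ?a t xi + cis (t/ep\<^sup>2)*cnj (sv ?a t (- xi))
   = cis (- te)*((1/2)*(p xi + \<i>*q xi)) + cis te*((1/2)*(p xi - \<i>*q xi))"
   unfolding 2 unfolding sv_def 1[symmetric] by (simp only: mult.assoc)
  also have "... = cx (cos te)*p xi + cx (sin te)*q xi"
   by (simp add: complex_eq_iff field_simps)
  finally show ?thesis by (simp add: trig_def te_def)
 qed
 show ?thesis unfolding cnj_ift[OF svm] ift_linear[OF isv icn, symmetric] e[abs_def] ..
qed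

lemma ift_cconv:
 assumes "LI f" "LI (g :: 'a::euclidean_space => complex)"
 shows "ift (cconv f g) x = ift f x*ift g x/cx (fconst TYPE('a))"
 unfolding ift_def using fourier_integral_cconv(2)[OF assms] by simp

text \<open>The real weak formulation becomes a complex identity between pairings of inverse
  transforms. The square becomes a convolution divided by \<open>fconst\<close>, whence
  \<open>mu\<close>. The velocity enters multiplied by \<open>ep^2\<close>, so \<open>Q\<close> is
  the transform of \<open>ep^2*b\<close>.\<close>

lemma klein_gordon_solution_iff:
 fixes u :: "real => 'a::euclidean_space => real" and V :: "real => 'a => complex"
 assumes s: "sm > real DIM('a)/2" and e: "0 < ep" and T: "0 <= T" and V: "tb sm T V B"
  and P: "hb sm P A" and Q: "hb sm Q A"
  and um: "(%p. ind ({0<..<T} \<times> UNIV) p *R u (fst p) (snd p)) \<in> BM"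
  and ae: "AEL p. p \<in> {0<..<T} \<times> UNIV --> cx (u (fst p) (snd p)) = ift (V (fst p)) (snd p)"
  and a: "AEL x. cx (a x) = ift P x" "a \<in> BM"
  and b: "AEL x. cx (ep\<^sup>2*b x) = ift Q x" "b \<in> BM"
  and mu: "mu = lam*fconst TYPE('a)"
 shows "klein_gordon_solution lam ep T a b u \<longleftrightarrow> (\<forall>Ph\<in>test_functions ({..<T} \<times> UNIV).
   (LL p. ind ({0<..<T} \<times> UNIV) p *R (ift (V (fst p)) (snd p)*cr (kg_adjoint ep Ph) p))
   + cx (ep\<^sup>2)*(LL x. ift P x*cr (%x. dt Ph (0, x)) x)
   - (LL x. ift Q x*cr (%x. Ph (0, x)) x)
  = (LL p. ind ({0<..<T} \<times> UNIV) p *R (ift (%xi. cx mu*cconv (V (fst p)) (V (fst p)) xi) (snd p)*cr Ph p)))"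
 unfolding klein_gordon_solution_def
proof (intro ball_cong refl)
 interpret sobolev_algebra sm "TYPE('a)" by unfold_locales (rule s)
 fix Ph :: "real \<times> 'a => real" assume Ph: "Ph \<in> test_functions ({..<T} \<times> UNIV)"
 note P1 = test_partial[OF Ph Basis_prod_time]
 obtain K where K: "compact K" "closed K" "!!p. p \<notin> K ==> Ph p = 0" by (rule test_support[OF Ph], rule that)
 have ko: "kg_adjoint ep Ph p = 0" if "p \<notin> K" for p
  by (rule kg_adjoint_outside[OF Ph K(2) _ that]) (rule K(3))
 let ?S = "{0<..<T} \<times> (UNIV :: 'a set)"
 let ?f = "%t xi. cx mu*cconv (V t) (V t) xi"
 have f: "tb sm T ?f (norm (cx mu)*(kappa TYPE('a) sm*(B*B)))" by (intro tb_cmult tb_cconv V)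
 note [measurable] = hbD(1)[OF P] hbD(1)[OF Q] a(2) b(2) test_measurable[OF test_slice[OF P1]] test_measurable[OF test_slice[OF Ph]]
 note km = borel_measurable_continuous_onI[OF kg_adjoint_continuous[OF Ph, of ep]] and Phm = test_measurable[OF Ph]
 have m1: "(%p. ind ?S p *R (ift (V (fst p)) (snd p)*cr (kg_adjoint ep Ph) p)) \<in> borel_measurable lborel"
  by (rule borel_measurable_integrable, rule pairing_time(1)[OF s V T kg_adjoint_continuous[OF Ph] K(1)], erule ko)
 have m2: "(%p. ind ?S p *R (ift (?f (fst p)) (snd p)*cr Ph p)) \<in> borel_measurable lborel"
  by (rule borel_measurable_integrable, rule pairing_time(1)[OF s f T test_continuous[OF Ph] K(1)], erule K(3))
 have uml: "(%p. ind ?S p *R u (fst p) (snd p)) \<in> borel_measurable lborel" using um by simp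
 have n1: "(%p. cx ((ind ?S p *R u (fst p) (snd p))*kg_adjoint ep Ph p)) \<in> borel_measurable lborel"
  by (rule measurable_compose[OF _ borel_measurable_of_real], intro borel_measurable_times uml) (use km in simp)
 have n2: "(%p. cx (lam*(ind ?S p *R u (fst p) (snd p))^2*Ph p)) \<in> borel_measurable lborel"
  by (rule measurable_compose[OF _ borel_measurable_of_real], intro borel_measurable_times borel_measurable_power borel_measurable_const uml) (use Phm in simp)
 have 1: "cx (LINT p:?S|lborel. u (fst p) (snd p)*(ep\<^sup>2*dt (dt Ph) p - laplacian (%x. Ph (fst p, x)) (snd p) + Ph p/ep\<^sup>2))
  = (LL p. ind ?S p *R (ift (V (fst p)) (snd p)*cr (kg_adjoint ep Ph) p))"
 proof -
  have "cx (LINT p:?S|lborel. u (fst p) (snd p)*(ep\<^sup>2*dt (dt Ph) p - laplacian (%x. Ph (fst p, x)) (snd p) + Ph p/ep\<^sup>2))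
   = (LL p. cx ((ind ?S p *R u (fst p) (snd p))*kg_adjoint ep Ph p))"
   unfolding set_lebesgue_integral_def integral_complex_of_real kg_adjoint_def by (simp add: mult.assoc)
  also have "... = (LL p. ind ?S p *R (ift (V (fst p)) (snd p)*cr (kg_adjoint ep Ph) p))"
  proof (rule integral_cong_AE[OF n1 m1])
   show "AEL p. cx ((ind ?S p *R u (fst p) (snd p))*kg_adjoint ep Ph p) = ind ?S p *R (ift (V (fst p)) (snd p)*cr (kg_adjoint ep Ph) p)"
    using ae by eventually_elim (auto simp: indicator_def)
  qed
  finally show ?thesis .
 qed
 have 2: "cx (LINT p:?S|lborel. lam*(u (fst p) (snd p))^2*Ph p) = (LL p. ind ?S p *R (ift (?f (fst p)) (snd p)*cr Ph p))"
 proof -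
  have i2: "ind ?S p *R (lam*(u (fst p) (snd p))^2*Ph p) = lam*(ind ?S p *R u (fst p) (snd p))^2*Ph p" for p
   by (simp add: indicator_def)
  have "cx (LINT p:?S|lborel. lam*(u (fst p) (snd p))^2*Ph p) = (LL p. cx (lam*(ind ?S p *R u (fst p) (snd p))^2*Ph p))"
   unfolding set_lebesgue_integral_def integral_complex_of_real i2 ..
  also have "... = (LL p. ind ?S p *R (ift (?f (fst p)) (snd p)*cr Ph p))"
  proof (rule integral_cong_AE[OF n2 m2])
   show "AEL p. cx (lam*(ind ?S p *R u (fst p) (snd p))^2*Ph p) = ind ?S p *R (ift (?f (fst p)) (snd p)*cr Ph p)"
    using ae
   proof eventually_elim
    case (elim p)
    show ?case
    proof (cases "p \<in> ?S")
     case True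
     then have t: "0 <= fst p" "fst p <= T" by auto
     have i: "LI (V (fst p))" by (rule tb_L1_bound(1)[OF s V t])
     have "ift (?f (fst p)) (snd p) = cx lam*(ift (V (fst p)) (snd p))^2"
      unfolding ift_cmult ift_cconv[OF i i] mu using fconst_pos[where 'a='a] by (simp add: power2_eq_square)
     moreover have "cx (u (fst p) (snd p)) = ift (V (fst p)) (snd p)" using elim True by blast
     ultimately show ?thesis using True by (simp add: of_real_power)
    qed simp
   qed
  qed
  finally show ?thesis .
 qed
 have 3: "cx (LL x. a x*dt Ph (0, x)) = (LL x. ift P x*cr (%x. dt Ph (0, x)) x)"
  unfolding integral_complex_of_real[symmetric]
 proof (rule integral_cong_AE)
  show "AEL x. cx (a x*dt Ph (0, x)) = ift P x*cr (%x. dt Ph (0, x)) x"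
   using a(1) by eventually_elim simp
 qed measurable
 have 4: "cx (ep\<^sup>2*(LL x. b x*Ph (0, x))) = (LL x. ift Q x*cr (%x. Ph (0, x)) x)"
  unfolding integral_complex_of_real[symmetric] integral_mult_right_zero[symmetric]
 proof (rule integral_cong_AE)
  show "AEL x. cx (ep\<^sup>2*(b x*Ph (0, x))) = ift Q x*cr (%x. Ph (0, x)) x"
   using b(1) by eventually_elim simp
 qed measurable
 show "((LINT p:?S|lborel. u (fst p) (snd p)*(ep\<^sup>2*dt (dt Ph) p - laplacian (%x. Ph (fst p, x)) (snd p) + Ph p/ep\<^sup>2))
    + ep\<^sup>2*(LL x. a x*dt Ph (0, x)) - ep\<^sup>2*(LL x. b x*Ph (0, x))
    = (LINT p:?S|lborel. lam*(u (fst p) (snd p))^2*Ph p)) \<longleftrightarrow>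
  ((LL p. ind ?S p *R (ift (V (fst p)) (snd p)*cr (kg_adjoint ep Ph) p))
   + cx (ep\<^sup>2)*(LL x. ift P x*cr (%x. dt Ph (0, x)) x)
   - (LL x. ift Q x*cr (%x. Ph (0, x)) x)
  = (LL p. ind ?S p *R (ift (?f (fst p)) (snd p)*cr Ph p)))"
  unfolding 1[symmetric] 2[symmetric] 3[symmetric] 4[symmetric] of_real_mult[symmetric] of_real_add[symmetric] of_real_diff[symmetric] of_real_eq_iff ..
qed

context sobolev_algebra
begin

lemma duhamel_weak_form:
 fixes V :: "real => 'a => complex"
 assumes e: "0 < ep" and T: "0 <= T" and V: "tb sm T V B" and P: "hb sm P A" and Q: "hb sm Q A"
  and Ph: "Ph \<in> test_functions ({..<T} \<times> UNIV)"
 shows "(LL p. ind ({0<..<T} \<times> UNIV) p *R (ift (%xi. free ep P Q (fst p) xi + mu*Bq ep V V (fst p) xi) (snd p)*cr (kg_adjoint ep Ph) p))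
   + cx (ep\<^sup>2)*(LL x. ift P x*cr (%x. dt Ph (0, x)) x)
   - (LL x. ift Q x*cr (%x. Ph (0, x)) x)
  = (LL p. ind ({0<..<T} \<times> UNIV) p *R (ift (%xi. mu*cconv (V (fst p)) (V (fst p)) xi) (snd p)*cr Ph p))"
proof -
 have f: "tb sm T (%t xi. mu*cconv (V t) (V t) xi) (norm mu*(kappa TYPE('a) sm*(B*B)))" by (intro tb_cmult tb_cconv V)
 have fb: "norm (mu*cconv (V ta) (V ta) xi) <= norm mu*(B*B)" if "0 <= ta" "ta <= T" for ta xi
  unfolding norm_mult by (intro mult_left_mono cconv_tb_bound[OF V V that]) simp
 show ?thesis using weak_form_duhamel[OF s e T P Q f fb Ph] unfolding duh_cmult Bq_def by simp
qed

theorem klein_gordon_solution_of_mild: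
 fixes uh :: "real => 'a => complex"
 assumes e: "0 < ep" and T: "0 <= T" and U: "tb sm T uh B" and h: "!!t. hermitian (uh t)"
  and P: "hb sm P A" and Q: "hb sm Q A"
  and mild: "!!t. 0 <= t ==> t <= T ==> AEL xi. uh t xi = free ep P Q t xi + cx mu*Bq ep uh uh t xi"
  and a: "AEL x. cx (a x) = ift P x" "a \<in> BM"
  and b: "AEL x. cx (ep\<^sup>2*b x) = ift Q x" "b \<in> BM"
  and mu: "mu = lam*fconst TYPE('a)"
 shows "klein_gordon_solution lam ep T a b (%t x. Re (ift (uh t) x))"
proof -
 note [measurable] = tbD(1)[OF U] hbD(1)[OF P] hbD(1)[OF Q]
 have ut [measurable]: "uh t \<in> BM" for t by measurable
 have "(%p. ift (uh (fst p)) (snd p)) \<in> BM2" by measurable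
 then have m: "(%p. ift (uh (fst p)) (snd p)) \<in> BM" by (simp only: borel_prod)
 have um: "(%p. ind ({0<..<T} \<times> UNIV) p *R Re (ift (uh (fst p)) (snd p))) \<in> BM"
  using m slab_measurable[of T, where 'a='a] by (intro borel_measurable_scaleR borel_measurable_indicator borel_measurable_Re) auto
 have ae: "AEL p. p \<in> {0<..<T} \<times> UNIV --> cx (Re (ift (uh (fst p)) (snd p))) = ift (uh (fst p)) (snd p)"
  using ift_hermitian[OF ut h] by simp
 show ?thesis
  unfolding klein_gordon_solution_iff[OF s e T U P Q um ae a b mu]
 proof
  fix Ph :: "real \<times> 'a => real" assume Ph: "Ph \<in> test_functions ({..<T} \<times> UNIV)"
  have "ift (uh t) x = ift (%xi. free ep P Q t xi + cx mu*Bq ep uh uh t xi) x" if "0 <= t" "t <= T" for t x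
   by (rule ift_cong_AE[OF mild[OF that]]) (unfold free_def Bq_def, measurable)
  then have "ind ({0<..<T} \<times> UNIV) p *R (ift (uh (fst p)) (snd p)*c) = ind ({0<..<T} \<times> UNIV) p *R (ift (%xi. free ep P Q (fst p) xi + cx mu*Bq ep uh uh (fst p) xi) (snd p)*c)" for p c
   by (auto simp: indicator_def)
  then show "(LL p. ind ({0<..<T} \<times> UNIV) p *R (ift (uh (fst p)) (snd p)*cr (kg_adjoint ep Ph) p))
   + cx (ep\<^sup>2)*(LL x. ift P x*cr (%x. dt Ph (0, x)) x)
   - (LL x. ift Q x*cr (%x. Ph (0, x)) x)
  = (LL p. ind ({0<..<T} \<times> UNIV) p *R (ift (%xi. cx mu*cconv (uh (fst p)) (uh (fst p)) xi) (snd p)*cr Ph p))"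
   using duhamel_weak_form[OF e T U P Q Ph, of "cx mu"] by (simp only:)
 qed
qed

text \<open>The competitor has no continuity in time. The comparison function \<open>?Z\<close> is
  built from the transform \<open>V\<close> of the competitor itself, so both satisfy weak forms
  with the same quadratic right side and the same data; their difference solves a linear homogeneous
  problem. Once \<open>V\<close> satisfies its own Duhamel formula, it can be compared with
  \<open>uh\<close>.\<close>

theorem klein_gordon_solution_unique:
 fixes uh :: "real => 'a => complex" and u :: "real => 'a => real"
 assumes e: "0 < ep" and T: "0 <= T" and U: "tb sm T uh B"
  and P: "hb sm P A" and Q: "hb sm Q A"
  and mild: "!!t. 0 <= t ==> t <= T ==> AEL xi. uh t xi = free ep P Q t xi + cx mu*Bq ep uh uh t xi"
  and a: "AEL x. cx (a x) = ift P x" "a \<in> BM"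
  and b: "AEL x. cx (ep\<^sup>2*b x) = ift Q x" "b \<in> BM"
  and mu: "mu = lam*fconst TYPE('a)"
  and u: "(%t x. cx (u t x)) \<in> Linf_sobolev T sm" and sol: "klein_gordon_solution lam ep T a b u"
 shows "AEL t. t \<in> {0<..<T} --> (AEL x. u t x = Re (ift (uh t) x))"
proof -
 let ?S = "{0<..<T} \<times> (UNIV :: 'a set)"
 obtain B' where B': "Linf_sobolev_le T sm (%t x. cx (u t x)) B'" using u unfolding Linf_sobolev_def by blast
 define w where "w t x = ind {0<..<T} t *R cx (u t x)" for t x
 have wS: "(%p. w (fst p) (snd p)) = (%p. ind ?S p *R (%(t, x). cx (u t x)) p)"
  by (auto simp: w_def indicator_def fun_eq_iff)
 have wb: "(%p. w (fst p) (snd p)) \<in> BM"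
  using B' unfolding wS Linf_sobolev_le_def set_borel_measurable_def by simp
 then have wm [measurable]: "(%(t, x). w t x) \<in> BM2"
  by (simp only: borel_prod case_prod_unfold)
 have win: "w t = cr (u t)" if "t \<in> {0<..<T}" for t using that by (simp add: w_def fun_eq_iff)
 have ae: "AEL t. t \<in> {0<..<T} --> sobolev_le sm (w t) B'"
  using B' unfolding Linf_sobolev_le_def by (auto simp: win elim!: eventually_mono)
 obtain V where V: "tb sm T V \<bar>B'\<bar>" and ft: "AEL t. t \<in> {0<..<T} --> IFT (w t) (V t)"
  by (rule jointly_measurable_transform[OF s wm _ ae T]) (auto simp: w_def)
 note [measurable] = tbD(1)[OF V] tbD(1)[OF U] hbD(1)[OF P] hbD(1)[OF Q]
 have wV: "AEL t. AEL x. t \<in> {0<..<T} --> w t x = ift (V t) x"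
  using ft
 proof eventually_elim
  case (elim t)
  show ?case
  proof (cases "t \<in> {0<..<T}")
   case True
   then have "hb sm (V t) \<bar>B'\<bar>" using tbD(3)[OF V] by simp
   from ift_inversion_AE[OF s _ this] elim True show ?thesis by (auto elim!: eventually_mono)
  next
   case False
   then show ?thesis by (intro AE_I2) auto
  qed
 qed
 have "AE p in lborel \<Otimes>\<^sub>M lborel. fst p \<in> {0<..<T} --> w (fst p) (snd p) = ift (V (fst p)) (snd p)"
 proof (rule lborel_pair.AE_pair_measure)
  have "Measurable.pred (borel \<Otimes>\<^sub>M borel) (%p. fst p \<in> {0<..<T} --> w (fst p) (snd p) = ift (V (fst p)) (snd p))"
   unfolding greaterThanLessThan_iff by measurable
  moreover have "sets (lborel \<Otimes>\<^sub>M lborel :: (real \<times> 'a) measure) = sets (borel \<Otimes>\<^sub>M borel)"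
   by (intro sets_pair_measure_cong sets_lborel)
  ultimately have "Measurable.pred (lborel \<Otimes>\<^sub>M lborel) (%p. fst p \<in> {0<..<T} --> w (fst p) (snd p) = ift (V (fst p)) (snd p))"
   using measurable_cong_sets[of "lborel \<Otimes>\<^sub>M lborel" "borel \<Otimes>\<^sub>M borel"] by blast
  then show "{p \<in> space (lborel \<Otimes>\<^sub>M lborel). fst p \<in> {0<..<T} --> w (fst p) (snd p) = ift (V (fst p)) (snd p)} \<in> sets (lborel \<Otimes>\<^sub>M lborel)"
   by (rule predE)
  show "AEL t. AEL x. fst (t, x) \<in> {0<..<T} --> w (fst (t, x)) (snd (t, x)) = ift (V (fst (t, x))) (snd (t, x))"
   using wV by simp
 qed
 then have aeS: "AEL p. p \<in> ?S --> cx (u (fst p) (snd p)) = ift (V (fst p)) (snd p)"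
  unfolding lborel_prod by eventually_elim (auto simp: win)
 have um: "(%p. ind ?S p *R u (fst p) (snd p)) \<in> BM"
 proof -
  have "(%p. ind ?S p *R u (fst p) (snd p)) = (%p. Re (w (fst p) (snd p)))" by (auto simp: w_def indicator_def fun_eq_iff)
  then show ?thesis using wb by simp
 qed
 let ?Z = "%t xi. free ep P Q t xi + cx mu*Bq ep V V t xi"
 have Z: "tb sm T ?Z (2*A + norm (cx mu)*(T*(kappa TYPE('a) sm*(\<bar>B'\<bar>*\<bar>B'\<bar>))))"
  by (intro tb_add tb_free P Q tb_cmult tb_Bq V T)
 have d: "tb sm T (%t xi. V t xi - ?Z t xi) (\<bar>B'\<bar> + (2*A + norm (cx mu)*(T*(kappa TYPE('a) sm*(\<bar>B'\<bar>*\<bar>B'\<bar>)))))"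
  by (rule tb_diff[OF V Z])
 have "AEL t. AEL xi. t \<in> {0..<T} --> V t xi - ?Z t xi = 0"
 proof (rule weak_zero_imp_AE_zero[OF s e T d])
  fix Ph :: "real \<times> 'a => real" assume Ph: "Ph \<in> test_functions ({..<T} \<times> UNIV)"
  obtain K where K: "compact K" "closed K" "!!p. p \<notin> K ==> Ph p = 0" by (rule test_support[OF Ph], rule that)
  have ko: "kg_adjoint ep Ph p = 0" if "p \<notin> K" for p
   by (rule kg_adjoint_outside[OF Ph K(2) _ that]) (rule K(3))
  have iV: "LI (%p. ind ?S p *R (ift (V (fst p)) (snd p)*cr (kg_adjoint ep Ph) p))"
   by (rule pairing_time(1)[OF s V T kg_adjoint_continuous[OF Ph] K(1)], erule ko)
  have iZ: "LI (%p. ind ?S p *R (ift (?Z (fst p)) (snd p)*cr (kg_adjoint ep Ph) p))"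
   by (rule pairing_time(1)[OF s Z T kg_adjoint_continuous[OF Ph] K(1)], erule ko)
  have "(LL p. ind ?S p *R (ift (%xi. V (fst p) xi - ?Z (fst p) xi) (snd p)*cr (kg_adjoint ep Ph) p))
   = (LL p. ind ?S p *R (ift (V (fst p)) (snd p)*cr (kg_adjoint ep Ph) p) - ind ?S p *R (ift (?Z (fst p)) (snd p)*cr (kg_adjoint ep Ph) p))"
  proof (intro BI_LINT_cong refl)
   fix p :: "real \<times> 'a"
   show "ind ?S p *R (ift (%xi. V (fst p) xi - ?Z (fst p) xi) (snd p)*cr (kg_adjoint ep Ph) p)
    = ind ?S p *R (ift (V (fst p)) (snd p)*cr (kg_adjoint ep Ph) p) - ind ?S p *R (ift (?Z (fst p)) (snd p)*cr (kg_adjoint ep Ph) p)"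
   proof (cases "p \<in> ?S")
    case True
    then have t: "0 <= fst p" "fst p <= T" by auto
    show ?thesis unfolding ift_diff[OF tb_L1_bound(1)[OF s V t] tb_L1_bound(1)[OF s Z t]]
     by (simp only: left_diff_distrib scaleR_diff_right)
   qed simp
  qed
  also have "... = (LL p. ind ?S p *R (ift (V (fst p)) (snd p)*cr (kg_adjoint ep Ph) p)) - (LL p. ind ?S p *R (ift (?Z (fst p)) (snd p)*cr (kg_adjoint ep Ph) p))"
   by (rule BI_LINT_diff[OF iV iZ])
  also have "... = 0"
   using sol[unfolded klein_gordon_solution_iff[OF s e T V P Q um aeS a b mu], rule_format, OF Ph]
    duhamel_weak_form[OF e T V P Q Ph, of "cx mu"]
   by (simp only: diff_eq_eq add_0) (metis (no_types, lifting) add_right_cancel diff_add_cancel)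
  finally show "(LL p. ind ?S p *R (ift (%xi. V (fst p) xi - ?Z (fst p) xi) (snd p)*cr (kg_adjoint ep Ph) p)) = 0" .
 qed
 then have eV: "AEL t. AEL xi. t \<in> {0..<T} --> V t xi = ?Z t xi" by simp
 have eU: "AEL t. AEL xi. t \<in> {0..<T} --> uh t xi = free ep P Q t xi + cx mu*Bq ep uh uh t xi"
 proof (rule AE_I2)
  fix t :: real
  show "AEL xi. t \<in> {0..<T} --> uh t xi = free ep P Q t xi + cx mu*Bq ep uh uh t xi"
   using mild[of t] by (cases "t \<in> {0..<T}") auto
 qed
 have ut: "uh t \<in> BM" "V t \<in> BM" for t by measurable
 show ?thesis using kg_mild_unique[OF T V U eV eU] wV
 proof eventually_elim
  case (elim t)
  show ?case
  proof
   assume t: "t \<in> {0<..<T}"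
   then have "AEL xi. V t xi = uh t xi" using elim(1) by (auto elim!: eventually_mono)
   then have "ift (V t) x = ift (uh t) x" for x by (rule ift_cong_AE[OF _ ut(2) ut(1)])
   then show "AEL x. u t x = Re (ift (uh t) x)"
    using elim(2) t by (auto simp: win[OF t] elim!: eventually_mono) (metis Re_complex_of_real)
  qed
 qed
qed

end

theorem theorem7p1:
  fixes lam s :: real
    and phi0 psi0 :: "real ^ 'd \<Rightarrow> real"
    and phi psi :: "real \<Rightarrow> real ^ 'd \<Rightarrow> real"
    and u0 u1 :: "real \<Rightarrow> real ^ 'd \<Rightarrow> real"
  assumes s: "s > real CARD('d) / 2 + 4"
    and u0: "\<And>\<epsilon> x. u0 \<epsilon> x = phi0 x + \<epsilon> * phi \<epsilon> x"
    and u1: "\<And>\<epsilon> x. u1 \<epsilon> x = psi0 x + \<epsilon> * psi \<epsilon> x"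
    and phi0: "(\<lambda>x. complex_of_real (phi0 x)) \<in> sobolev s"
    and psi0: "(\<lambda>x. complex_of_real (psi0 x)) \<in> sobolev s"
    and bounded_family: "\<exists>M. \<forall>\<epsilon>. 0 < \<epsilon> \<and> \<epsilon> < 1 \<longrightarrow>
          sobolev_le (s - 4) (\<lambda>x. complex_of_real (phi \<epsilon> x)) M \<and>
          sobolev_le (s - 4) (\<lambda>x. complex_of_real (psi \<epsilon> x)) M \<and>
          (\<forall>b\<in>Basis. \<exists>g. weak_partial b (phi \<epsilon>) g \<and>
             sobolev_le (s - 4) (\<lambda>x. complex_of_real (\<epsilon> * g x)) M)"
  shows "\<exists>v.
     schroedinger_solution s (\<lambda>x. (complex_of_real (phi0 x) + \<i> * complex_of_real (psi0 x)) / 2) v \<and>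
     (\<forall>v'. schroedinger_solution s
             (\<lambda>x. (complex_of_real (phi0 x) + \<i> * complex_of_real (psi0 x)) / 2) v'
           \<longrightarrow> (\<forall>t\<ge>0. AE x in lborel. v' t x = v t x)) \<and>
     (\<exists>\<epsilon>0>0. \<exists>T>0. \<exists>C. \<forall>\<epsilon>. 0 < \<epsilon> \<and> \<epsilon> < \<epsilon>0 \<longrightarrow>
        (\<exists>u. (\<lambda>t x. complex_of_real (u t x)) \<in> Linf_sobolev (T / \<epsilon>) (s - 4) \<and>
             klein_gordon_solution lam \<epsilon> (T / \<epsilon>) (u0 \<epsilon>) (\<lambda>x. u1 \<epsilon> x / \<epsilon>\<^sup>2) u \<and>
             (\<forall>u'. (\<lambda>t x. complex_of_real (u' t x)) \<in> Linf_sobolev (T / \<epsilon>) (s - 4) \<and>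
                   klein_gordon_solution lam \<epsilon> (T / \<epsilon>) (u0 \<epsilon>) (\<lambda>x. u1 \<epsilon> x / \<epsilon>\<^sup>2) u'
                   \<longrightarrow> (AE t in lborel. t \<in> {0<..<T / \<epsilon>} \<longrightarrow> (AE x in lborel. u' t x = u t x))) \<and>
             Linf_sobolev_le (T / \<epsilon>) (s - 4)
               (\<lambda>t x. complex_of_real (u t x)
                  - (cis (- t / \<epsilon>\<^sup>2) * v t x + cis (t / \<epsilon>\<^sup>2) * cnj (v t x)))
               (C * \<epsilon>)))"
proof -
 define sm where "sm = s - 4"
 have ssm: "sm > real DIM(real ^ 'd)/2" and s2: "s > real DIM(real ^ 'd)/2 + 2" and s1: "s > real DIM(real ^ 'd)/2"
  using s by (simp_all add: sm_def)
 have sm4: "sm + 4 = s" by (simp add: sm_def)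
 interpret sobolev_algebra sm "TYPE(real ^ 'd)" by unfold_locales (rule ssm)
 obtain p0 where "IFT (cr phi0) p0" "hb s p0 (sobolev_norm s (cr phi0))" using sobolevD[OF phi0] .
 then obtain p where p: "IFT (cr phi0) p" "hb s p (sobolev_norm s (cr phi0))" "hermitian p"
  using hermitian_transform by blast
 obtain q0 where "IFT (cr psi0) q0" "hb s q0 (sobolev_norm s (cr psi0))" using sobolevD[OF psi0] .
 then obtain q where q: "IFT (cr psi0) q" "hb s q (sobolev_norm s (cr psi0))" "hermitian q"
  using hermitian_transform by blast
 obtain M where M: "!!ep. 0 < ep ==> ep < 1 ==> sobolev_le sm (cr (phi ep)) M & sobolev_le sm (cr (psi ep)) M"
  using bounded_family unfolding sm_def by blast
 \<comment> \<open>One bound for all transformed data. It depends on the perturbations only through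
   the uniform \<open>M\<close>, so the \<open>T\<close> and \<open>R\<close> obtained from it do
   not depend on \<open>ep\<close>.\<close>
 define A where "A = max M (max (sobolev_norm s (cr phi0)) (sobolev_norm s (cr psi0)))"
 have pA: "hb s p A" and qA: "hb s q A" using p(2) q(2) by (auto intro: hb_mono_B simp: A_def)
 have p4: "hb (sm + 4) p A" and q4: "hb (sm + 4) q A" unfolding sm4 by (rule pA qA)+
 define mu where "mu = lam*fconst TYPE(real ^ 'd)"
 obtain T R where T: "0 < T" "T <= 1" "0 <= R" and sol:
  "!!ep p1 q1. 0 < ep ==> ep <= 1 ==> hb sm p1 A ==> hermitian p1 ==> hb sm q1 A ==> hermitian q1 ==>
   \<exists>uh. (%(t, xi). uh t xi) \<in> BM2 & (\<forall>t. hermitian (uh t)) &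
    tb sm (T/ep) uh (2*A + R*ep) & tb sm (T/ep) (%t xi. uh t xi - trig (th ep) p q t xi) (R*ep) &
    (\<forall>t. 0 <= t --> t <= T/ep --> (AEL xi. uh t xi =
     free ep (%xi. p xi + ep*p1 xi) (%xi. q xi + ep*q1 xi) t xi + mu*Bq ep uh uh t xi))"
  by (rule kg_long_time_solution[OF p4 p(3) q4 q(3), where mu=mu]) (rule that)
 \<comment> \<open>The initial amplitude of the Schroedinger equation on the Fourier side, in the
   form in which \<open>trig_schroedinger\<close> produces it.\<close>
 define a where "a xi = (1/2)*(p xi + \<i>*q xi)" for xi
 have ha: "hb s a (norm (1/2 :: complex)*(A + norm \<i>*A))" unfolding a_def by (intro hb_cmult hb_add pA qA)
 have ip: "LI p" and iq: "LI q" using hb_integrable(1)[OF s1] pA qA by auto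
 let ?f = "%x. (cx (phi0 x) + \<i>*cx (psi0 x))/2"
 have fa: "AEL x. ift a x = ?f x"
  using ift_inversion_AE[OF s1 p(1,2)] ift_inversion_AE[OF s1 q(1,2)]
 proof eventually_elim
  case (elim x)
  have "a = (%xi. (1/2)*p xi + (\<i>/2)*q xi)" by (rule ext) (simp add: a_def algebra_simps)
  then have "ift a x = (1/2)*ift p x + (\<i>/2)*ift q x" by (simp only: ift_linear[OF ip iq])
  then show ?case using elim by (simp add: algebra_simps)
 qed
 define v where "v t = ift (sv a t)" for t
 have v1: "schroedinger_solution s ?f v" unfolding v_def by (rule schroedinger_solution_ift_sv[OF s2 ha fa])
 have v2: "\<forall>v'. schroedinger_solution s ?f v' --> (\<forall>t\<ge>0. AEL x. v' t x = v t x)"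
  unfolding v_def using schroedinger_solution_unique[OF s2 ha fa] by blast
 have main: "\<exists>u. (%t x. cx (u t x)) \<in> Linf_sobolev (T/ep) sm &
      klein_gordon_solution lam ep (T/ep) (u0 ep) (%x. u1 ep x/ep\<^sup>2) u &
      (\<forall>u'. (%t x. cx (u' t x)) \<in> Linf_sobolev (T/ep) sm &
         klein_gordon_solution lam ep (T/ep) (u0 ep) (%x. u1 ep x/ep\<^sup>2) u'
         --> (AEL t. t \<in> {0<..<T/ep} --> (AEL x. u' t x = u t x))) &
      Linf_sobolev_le (T/ep) sm
       (%t x. cx (u t x)
         - (cis (- t/ep\<^sup>2) * v t x + cis (t/ep\<^sup>2)*cnj (v t x))) (R*ep)"
  if e: "0 < ep" "ep < 1" for ep
 proof -
  obtain g1 where "IFT (cr (phi ep)) g1" "hb sm g1 M" using sobolev_leD M[OF e] by blast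
  then obtain p1 where p1: "IFT (cr (phi ep)) p1" "hb sm p1 M" "hermitian p1" using hermitian_transform by blast
  obtain g2 where "IFT (cr (psi ep)) g2" "hb sm g2 M" using sobolev_leD M[OF e] by blast
  then obtain q1 where q1: "IFT (cr (psi ep)) q1" "hb sm q1 M" "hermitian q1" using hermitian_transform by blast
  have p1A: "hb sm p1 A" and q1A: "hb sm q1 A" using p1(2) q1(2) by (auto intro: hb_mono_B simp: A_def)
  let ?P = "%xi. p xi + cx ep*p1 xi" and ?Q = "%xi. q xi + cx ep*q1 xi"
  obtain uh where um: "(%(t, xi). uh t xi) \<in> BM2" and uherm: "!!t. hermitian (uh t)"
   and utb: "tb sm (T/ep) uh (2*A + R*ep)" and uerr: "tb sm (T/ep) (%t xi. uh t xi - trig (th ep) p q t xi) (R*ep)"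
   and mild: "!!t. 0 <= t ==> t <= T/ep ==> AEL xi. uh t xi = free ep ?P ?Q t xi + cx mu*Bq ep uh uh t xi"
   using sol[OF e(1) less_imp_le[OF e(2)] p1A p1(3) q1A q1(3)] by blast
  have Tep: "0 <= T/ep" using T e by simp
  have psm: "hb sm p A" and qsm: "hb sm q A" using hb_mono_exp[OF p4] hb_mono_exp[OF q4] by simp_all
  have P: "hb sm ?P (A + norm (cx ep)*A)" and Q: "hb sm ?Q (A + norm (cx ep)*A)"
   by (intro hb_add hb_cmult psm qsm p1A q1A)+
  have ip1: "LI p1" and iq1: "LI q1" using hb_integrable(1)[OF ssm] p1A q1A by auto
  have rm: "f \<in> BM" if "IFT (cr f) g" for f :: "real ^ 'd => real" and g
   using measurable_compose[OF is_fourier_transform_measurable(1)[OF that] borel_measurable_Re] by simp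
  have m: "u0 ep \<in> BM" "(%x. u1 ep x/ep\<^sup>2) \<in> BM"
   unfolding u0[abs_def] u1[abs_def] using rm[OF p(1)] rm[OF q(1)] rm[OF p1(1)] rm[OF q1(1)] by auto
  have a0: "AEL x. cx (u0 ep x) = ift ?P x"
   using ift_inversion_AE[OF s1 p(1,2)] ift_inversion_AE[OF ssm p1(1,2)]
  proof eventually_elim
   case (elim x)
   then show ?case using ift_linear[OF ip ip1, of 1 "cx ep" x] by (simp add: u0)
  qed
  \<comment> \<open>The prescribed velocity is \<open>u1 ep x/ep^2\<close>; the factor
    \<open>ep^2\<close> restores \<open>u1 ep\<close>, so the coefficient \<open>Q\<close> of the
    sine has size 1.\<close>
  have b0: "AEL x. cx (ep\<^sup>2*(u1 ep x/ep\<^sup>2)) = ift ?Q x"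
   using ift_inversion_AE[OF s1 q(1,2)] ift_inversion_AE[OF ssm q1(1,2)]
  proof eventually_elim
   case (elim x)
   then show ?case using e ift_linear[OF iq iq1, of 1 "cx ep" x] by (simp add: u1)
  qed
  have ut: "uh t \<in> BM" for t using um by (rule joint_slice)
  have re: "cx (Re (ift (uh t) x)) = ift (uh t) x" for t x by (rule ift_hermitian[OF ut uherm])
  show ?thesis
  proof (intro exI[of _ "%t x. Re (ift (uh t) x)"] conjI allI impI)
   show "(%t x. cx (Re (ift (uh t) x))) \<in> Linf_sobolev (T/ep) sm"
    unfolding re Linf_sobolev_def using Linf_sobolev_le_ift[OF ssm utb] by blast
   show "klein_gordon_solution lam ep (T/ep) (u0 ep) (%x. u1 ep x/ep\<^sup>2) (%t x. Re (ift (uh t) x))"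
    by (rule klein_gordon_solution_of_mild[OF e(1) Tep utb uherm P Q mild a0 m(1) b0 m(2) mu_def])
   show "AEL t. t \<in> {0<..<T/ep} --> (AEL x. u' t x = Re (ift (uh t) x))"
    if "(%t x. cx (u' t x)) \<in> Linf_sobolev (T/ep) sm &
     klein_gordon_solution lam ep (T/ep) (u0 ep) (%x. u1 ep x/ep\<^sup>2) u'" for u'
    by (rule klein_gordon_solution_unique[OF e(1) Tep utb P Q mild a0 m(1) b0 m(2) mu_def conjunct1[OF that] conjunct2[OF that]])
   have eqf: "cx (Re (ift (uh t) x)) - (cis (- t/ep\<^sup>2) * v t x + cis (t/ep\<^sup>2)*cnj (v t x))
     = ift (%xi. uh t xi - trig (th ep) p q t xi) x" if t: "t \<in> {0<..<T/ep}" for t x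
   proof -
    have i1: "LI (uh t)" using tb_L1_bound(1)[OF ssm utb] t by simp
    have i2: "LI (trig (th ep) p q t)"
     by (rule tb_L1_bound(1)[OF ssm tb_trig[OF om_th_measurable(3) psm qsm], of t t]) (use t in auto)
    show ?thesis
     unfolding re ift_diff[OF i1 i2] trig_schroedinger[OF p(3) q(3) ip iq] v_def a_def[abs_def] ..
   qed
   show "Linf_sobolev_le (T/ep) sm (%t x. cx (Re (ift (uh t) x))
         - (cis (- t/ep\<^sup>2) * v t x + cis (t/ep\<^sup>2)*cnj (v t x))) (R*ep)"
    by (rule iffD2[OF Linf_sobolev_le_cong[where w'="%t. ift (%xi. uh t xi - trig (th ep) p q t xi)"]])
     (erule eqf, rule Linf_sobolev_le_ift[OF ssm uerr])
  qed
 qed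
 show ?thesis
 proof (intro exI[of _ v] conjI)
  show "schroedinger_solution s ?f v" by (rule v1)
  show "\<forall>v'. schroedinger_solution s ?f v' --> (\<forall>t\<ge>0. AEL x. v' t x = v t x)" by (rule v2)
  show "\<exists>ep0>0. \<exists>T>0. \<exists>C. \<forall>ep. 0 < ep & ep < ep0 -->
    (\<exists>u. (%t x. cx (u t x)) \<in> Linf_sobolev (T/ep) (s - 4) &
      klein_gordon_solution lam ep (T/ep) (u0 ep) (%x. u1 ep x/ep\<^sup>2) u &
      (\<forall>u'. (%t x. cx (u' t x)) \<in> Linf_sobolev (T/ep) (s - 4) &
         klein_gordon_solution lam ep (T/ep) (u0 ep) (%x. u1 ep x/ep\<^sup>2) u'
         --> (AEL t. t \<in> {0<..<T/ep} --> (AEL x. u' t x = u t x))) &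
      Linf_sobolev_le (T/ep) (s - 4)
       (%t x. cx (u t x)
         - (cis (- t/ep\<^sup>2) * v t x + cis (t/ep\<^sup>2)*cnj (v t x)))
       (C*ep))"
   \<comment> \<open>The threshold for \<open>ep\<close> is 1, as smallness is required of
     \<open>T\<close> alone, and the constant \<open>C\<close> is the bound \<open>R\<close> of the
     remainder in units of \<open>ep\<close>.\<close>
   unfolding sm_def[symmetric]
   by (rule exI[of _ 1], rule conjI[OF zero_less_one], rule exI[of _ T], rule conjI[OF T(1)], rule exI[of _ R]) (use main in blast)
 qed
qed

end
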